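(* For any $i,j\in I$, write $\widetilde C_{ij}(q)=\sum_{u\ge 0}\widetilde c_{ij}(u)q^u\in\mathbb Z[\![q]\!]$ for the formal Taylor expansion at $q=0$ of the $(i,j)$-entry of the inverse $\widetilde C(q)$ of the quantum Cartan matrix $C(q)$. Then $$\dim_q e_i\bar I_j = q^{-d_j}\sum_{u=0}^{rh^\vee}\widetilde c_{ij}(u)\,q^u,\qquad \widetilde C_{ij}(q)=\frac{q^{d_j}}{1-q^{2rh^\vee}}\left(\dim_q e_i\bar I_j-q^{rh^\vee}\dim_q e_i\bar I_{j^*}\right).$$
   Context: Lie data: $\mathfrak g$ is a complex finite-dimensional simple Lie algebra with Cartan matrix $C=(c_{ij})_{i,j\in I}$. Write $i\sim j$ if $i\neq j$ and $c_{ij}<0$. $r\in\{1,2,3\}$ is the lacing number ($1$ for types ADE, $2$ for B, C, F$_4$, $3$ for G$_2$). $(d_i)_{i\in I}$ is the unique tuple of mutually coprime positive integers with $d_ic_{ij}=d_jc_{ji}$ (so $d_i\in\{1,r\}$ and $c_{ij}=-\lceil d_j/d_i\rceil$ if $i\sim j$). $h^\vee$ is the dual Coxeter number, and $i\mapsto i^*$ is the involution of $I$ with $w_0(\alpha_i)=-\alpha_{i^*}$, where $w_0$ is the longest element of the Weyl group. Quantum Cartan matrix: $[k]_q=(q^k-q^{-k})/(q-q^{-1})$; $C(q)=(C_{ij}(q))_{i,j\in I}$ with $C_{ii}(q)=q^{d_i}+q^{-d_i}$ and $C_{ij}(q)=[c_{ij}]_q$ for $i\ne j$; $\widetilde C(q)=C(q)^{-1}$,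 whose entries expand in $\mathbb Z[\![q]\!]$. Algebra: $\Bbbk$ is an arbitrary field. $\widetilde Q$ is the quiver with vertex set $I$, arrows $\alpha_{ij}\colon j\to i$ for each $(i,j)$ with $i\sim j$, and loops $\varepsilon_i\colon i\to i$ for $i\in I$; $e_i$ denotes the idempotent of the path algebra $\Bbbk\widetilde Q$ at $i$, and $\alpha=e_{t(\alpha)}\alpha e_{s(\alpha)}$ for an arrow $\alpha$ with source $s(\alpha)$ and target $t(\alpha)$. It is graded by $\deg\alpha_{ij}=-\max(d_i,d_j)$, $\deg\varepsilon_i=2d_i$. Fix signs $\omega_{ij}\in\{\pm1\}$ for $i\sim j$ with $\omega_{ij}=-\omega_{ji}$. $\widetilde\Pi$ is the graded quotient of $\Bbbk\widetilde Q$ by the relations (R1) $\varepsilon_i^{-c_{ij}}\alpha_{ij}=\alpha_{ij}\varepsilon_j^{-c_{ji}}$ for $i\sim j$, and (R2) $\sum_{j\sim i}\sum_{k=0}^{-c_{ij}-1}\omega_{ij}\varepsilon_i^k\alpha_{ij}\alpha_{ji}\varepsilon_i^{-c_{ij}-1-k}=0$ for each $i\in I$. Modules: modules are left modules. For a graded vector space $V$, $\mathbb D(V)$ is the restricted dual, $\mathbb D(V)_u=\mathrm{Hom}_\Bbbk(V_{-u},\Bbbk)$, and $\dim_qV=\sum_u(\dim V_u)q^u$. The dual of a left $\widetilde\Pi$-module is regarded as a left $\widetilde\Pi$-module via the anti-involution $e_i\mapsto e_i$, $\alpha_{ij}\mapsto\alpha_{ji}$, $\varepsilon_i\mapsto\varepsilon_i$.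 Put $\bar I_i=\mathbb D((\widetilde\Pi/\widetilde\Pi\varepsilon_i)e_i)$, a finite-dimensional graded $\widetilde\Pi$-module. *)

theory Defs
  imports
    "HOL-Analysis.Determinants"
    "HOL-Computational_Algebra.Formal_Laurent_Series"
    "HOL-Algebra.QuotRing"
    "HOL-Algebra.Module"
    "HOL-Library.Poly_Mapping"
    "HOL-Library.Function_Algebras"
begin

locale complex_lie_algebra = vector_space scale
  for scale :: "complex \<Rightarrow> 'g::ab_group_add \<Rightarrow> 'g" +
  fixes bracket :: "'g \<Rightarrow> 'g \<Rightarrow> 'g"
  assumes linear_left: "Vector_Spaces.linear scale scale (\<lambda>x. bracket x y)"
    and linear_right: "Vector_Spaces.linear scale scale (\<lambda>y. bracket x y)"
    and alternating: "bracket x x = 0"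
    and jacobi: "bracket x (bracket y z) + bracket y (bracket z x) + bracket z (bracket x y) = 0"
begin

definition lie_ideal :: "'g set \<Rightarrow> bool" where
  "lie_ideal J \<longleftrightarrow> subspace J \<and> (\<forall>x. \<forall>y\<in>J. bracket x y \<in> J)"

definition toral :: "'g set \<Rightarrow> bool" where
  "toral K \<longleftrightarrow> subspace K \<and> (\<forall>x\<in>K. \<forall>y\<in>K. bracket x y = 0) \<and>
     (\<forall>x\<in>K. span {v. \<exists>c. bracket x v = scale c v} = UNIV)"

text \<open>Used for simple (hence semisimple) algebras only, where the Cartan subalgebras are exactly
  the maximal subalgebras that are abelian and act diagonalizably.\<close>

definition cartan_subalgebra :: "'g set \<Rightarrow> bool" where
  "cartan_subalgebra H \<longleftrightarrow> toral H \<and> (\<forall>K. toral K \<and> H \<subseteq> K \<longrightarrow> K = H)"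

definition root_space :: "'g set \<Rightarrow> ('g \<Rightarrow> complex) \<Rightarrow> 'g set" where
  "root_space H a = {v. \<forall>h\<in>H. bracket h v = scale (a h) v}"

text \<open>A functional on \<open>H\<close> is represented by a function on the whole algebra that vanishes outside
  \<open>H\<close>.  Linearity on \<open>H\<close> is automatic when the root space is nonzero.\<close>

definition root :: "'g set \<Rightarrow> ('g \<Rightarrow> complex) \<Rightarrow> bool" where
  "root H a \<longleftrightarrow> (\<forall>x. x \<notin> H \<longrightarrow> a x = 0) \<and> (\<exists>x. a x \<noteq> 0) \<and> root_space H a \<noteq> {0}"

definition root_basis :: "'g set \<Rightarrow> ('i::finite \<Rightarrow> 'g \<Rightarrow> complex) \<Rightarrow> bool" where
  "root_basis H \<alpha> \<longleftrightarrow>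
     (\<forall>i. root H (\<alpha> i)) \<and>
     (\<forall>c. (\<forall>x. (\<Sum>i\<in>UNIV. c i * \<alpha> i x) = 0) \<longrightarrow> (\<forall>i. c i = 0)) \<and>
     (\<forall>b. root H b \<longrightarrow> (\<exists>n :: 'i \<Rightarrow> nat.
        (\<forall>x. b x = (\<Sum>i\<in>UNIV. of_nat (n i) * \<alpha> i x)) \<or>
        (\<forall>x. b x = - (\<Sum>i\<in>UNIV. of_nat (n i) * \<alpha> i x))))"

definition coroot :: "'g set \<Rightarrow> ('g \<Rightarrow> complex) \<Rightarrow> 'g \<Rightarrow> bool" where
  "coroot H a h \<longleftrightarrow> h \<in> H \<and> a h = 2 \<and>
     (\<exists>e\<in>root_space H a. \<exists>f\<in>root_space H (\<lambda>x. - a x). bracket e f = h)"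

text \<open>The convention is that the \<open>(i,j)\<close> entry is the value of the \<open>j\<close>-th simple root on the
  \<open>i\<close>-th simple coroot.\<close>

definition is_cartan_matrix :: "int ^ 'i::finite ^ 'i \<Rightarrow> bool" where
  "is_cartan_matrix C \<longleftrightarrow> (\<exists>H \<alpha>. cartan_subalgebra H \<and> root_basis H \<alpha> \<and>
     (\<forall>i. \<exists>h. coroot H (\<alpha> i) h \<and> (\<forall>j. of_int (C $ i $ j) = \<alpha> j h)))"

end

locale simple_lie_algebra = complex_lie_algebra +
  assumes finite_dimensional: "\<exists>B. finite B \<and> span B = UNIV"
    and non_abelian: "\<exists>x y. bracket x y \<noteq> 0"
    and no_proper_ideal: "lie_ideal J \<Longrightarrow> J = {0} \<or> J = UNIV"


definition adj :: "int ^ 'i::finite ^ 'i \<Rightarrow> 'i \<Rightarrow> 'i \<Rightarrow> bool" where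
  "adj C i j \<longleftrightarrow> i \<noteq> j \<and> C $ i $ j < 0"

text \<open>\<open>Mutually coprime\<close> means that the greatest common divisor of the whole tuple is \<open>1\<close>;
  pairwise coprimality would already exclude type \<open>B\<^sub>3\<close>, where the tuple is \<open>(2,2,1)\<close>.\<close>

definition symmetrizer :: "int ^ 'i::finite ^ 'i \<Rightarrow> ('i \<Rightarrow> int) \<Rightarrow> bool" where
  "symmetrizer C d \<longleftrightarrow> (\<forall>i. 0 < d i) \<and> Gcd (range d) = 1 \<and>
     (\<forall>i j. d i * C $ i $ j = d j * C $ j $ i)"

text \<open>Two adjacent vertices of the Dynkin diagram are joined by \<open>c\<^sub>i\<^sub>j c\<^sub>j\<^sub>i\<close> edges.\<close>

definition lacing_number :: "int ^ 'i::finite ^ 'i \<Rightarrow> nat" where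
  "lacing_number C = Max (insert 1 {nat (C $ i $ j * C $ j $ i) | i j. adj C i j})"

text \<open>The root lattice is identified with \<open>\<int>\<^sup>I\<close> so that \<open>axis i 1\<close> is the \<open>i\<close>-th simple root, and
  likewise the coroot lattice, on which the Weyl group acts by the transposed matrix.\<close>

definition simple_reflection :: "int ^ 'i::finite ^ 'i \<Rightarrow> 'i \<Rightarrow> int ^ 'i \<Rightarrow> int ^ 'i" where
  "simple_reflection C i v = v - axis i ((C *v v) $ i)"

definition weyl_word :: "int ^ 'i::finite ^ 'i \<Rightarrow> 'i list \<Rightarrow> int ^ 'i \<Rightarrow> int ^ 'i" where
  "weyl_word C w = foldr (\<lambda>i g. simple_reflection C i \<circ> g) w id"

definition weyl_length :: "int ^ 'i::finite ^ 'i \<Rightarrow> (int ^ 'i \<Rightarrow> int ^ 'i) \<Rightarrow> nat" where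
  "weyl_length C g = (LEAST n. \<exists>w. length w = n \<and> weyl_word C w = g)"

definition longest_element :: "int ^ 'i::finite ^ 'i \<Rightarrow> int ^ 'i \<Rightarrow> int ^ 'i" where
  "longest_element C =
     (THE g. g \<in> range (weyl_word C) \<and> (\<forall>g'\<in>range (weyl_word C). weyl_length C g' \<le> weyl_length C g))"

definition star :: "int ^ 'i::finite ^ 'i \<Rightarrow> 'i \<Rightarrow> 'i" where
  "star C i = (THE j. longest_element C (axis i 1) = - axis j 1)"

text \<open>\<open>root_coroot C \<beta> \<gamma>\<close>: \<open>\<beta>\<close> is a root and \<open>\<gamma>\<close> is its coroot.\<close>

inductive root_coroot :: "int ^ 'i::finite ^ 'i \<Rightarrow> int ^ 'i \<Rightarrow> int ^ 'i \<Rightarrow> bool"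
  for C where
  simple: "root_coroot C (axis i 1) (axis i 1)"
| reflect: "root_coroot C \<beta> \<gamma> \<Longrightarrow>
    root_coroot C (simple_reflection C i \<beta>) (simple_reflection (transpose C) i \<gamma>)"

definition highest_root :: "int ^ 'i::finite ^ 'i \<Rightarrow> int ^ 'i \<Rightarrow> bool" where
  "highest_root C \<theta> \<longleftrightarrow> (\<exists>\<gamma>. root_coroot C \<theta> \<gamma>) \<and>
     (\<forall>\<beta> \<gamma>. root_coroot C \<beta> \<gamma> \<longrightarrow> (\<forall>i. \<beta> $ i \<le> \<theta> $ i))"

text \<open>\<open>h\<^sup>\<or> = 1 + \<langle>\<rho>, \<theta>\<^sup>\<or>\<rangle>\<close>, where the pairing with \<open>\<rho>\<close> sums the coefficients of the coroot
  \<open>\<theta>\<^sup>\<or>\<close> of the highest root in terms of the simple coroots.\<close>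

definition dual_coxeter_number :: "int ^ 'i::finite ^ 'i \<Rightarrow> nat" where
  "dual_coxeter_number C =
     (THE h. \<exists>\<theta> \<gamma>. highest_root C \<theta> \<and> root_coroot C \<theta> \<gamma> \<and> int h = 1 + (\<Sum>i\<in>UNIV. \<gamma> $ i))"


text \<open>All rational functions in \<open>q\<close> are replaced by their Laurent expansions at \<open>q = 0\<close>, that is,
  by their images in the field \<open>rat fls\<close>; the variable \<open>q\<close> is \<open>fls_X\<close>.\<close>

definition qint :: "int \<Rightarrow> rat fls" where
  "qint k = (fls_X powi k - fls_X powi (- k)) / (fls_X - inverse fls_X)"

definition quantum_cartan :: "int ^ 'i::finite ^ 'i \<Rightarrow> ('i \<Rightarrow> int) \<Rightarrow> rat fls ^ 'i ^ 'i" where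
  "quantum_cartan C d =
     (\<chi> i j. if i = j then fls_X powi d i + fls_X powi (- d i) else qint (C $ i $ j))"

definition quantum_cartan_inv :: "int ^ 'i::finite ^ 'i \<Rightarrow> ('i \<Rightarrow> int) \<Rightarrow> rat fls ^ 'i ^ 'i" where
  "quantum_cartan_inv C d = matrix_inv (quantum_cartan C d)"


text \<open>\<open>Arr i j\<close> is the arrow \<open>\<alpha>\<^sub>i\<^sub>j : j \<rightarrow> i\<close>, and \<open>Loop i\<close> is \<open>\<epsilon>\<^sub>i\<close>.\<close>

datatype 'i arrow = Arr 'i 'i | Loop 'i

fun arrow_in :: "int ^ 'i::finite ^ 'i \<Rightarrow> 'i arrow \<Rightarrow> bool" where
  "arrow_in C (Arr i j) = adj C i j"
| "arrow_in C (Loop i) = True"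

fun tgt :: "'i arrow \<Rightarrow> 'i" where
  "tgt (Arr i j) = i"
| "tgt (Loop i) = i"

fun src :: "'i arrow \<Rightarrow> 'i" where
  "src (Arr i j) = j"
| "src (Loop i) = i"

fun arrow_deg :: "('i \<Rightarrow> int) \<Rightarrow> 'i arrow \<Rightarrow> int" where
  "arrow_deg d (Arr i j) = - max (d i) (d j)"
| "arrow_deg d (Loop i) = 2 * d i"

fun arrow_op :: "'i arrow \<Rightarrow> 'i arrow" where
  "arrow_op (Arr i j) = Arr j i"
| "arrow_op (Loop i) = Loop i"

text \<open>A path is a triple (target, arrows, source).  Arrows are composed like functions, so the
  rightmost arrow of the list comes first and starts at the source.\<close>

type_synonym 'i path = "'i \<times> 'i arrow list \<times> 'i"

fun walk :: "int ^ 'i::finite ^ 'i \<Rightarrow> 'i \<Rightarrow> 'i arrow list \<Rightarrow> 'i \<Rightarrow> bool" where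
  "walk C t [] s = (t = s)"
| "walk C t (a # as) s = (arrow_in C a \<and> tgt a = t \<and> walk C (src a) as s)"

definition paths :: "int ^ 'i::finite ^ 'i \<Rightarrow> 'i path set" where
  "paths C = {(t, as, s). walk C t as s}"

fun path_deg :: "('i \<Rightarrow> int) \<Rightarrow> 'i path \<Rightarrow> int" where
  "path_deg d (t, as, s) = sum_list (map (arrow_deg d) as)"

fun path_op :: "'i path \<Rightarrow> 'i path" where
  "path_op (t, as, s) = (s, rev (map arrow_op as), t)"

type_synonym ('i, 'k) path_comb = "'i path \<Rightarrow>\<^sub>0 'k"

fun path_comp :: "'i path \<Rightarrow> 'i path \<Rightarrow> 'k \<Rightarrow> ('i, 'k::field) path_comb" where
  "path_comp (t, as, s) (t', as', s') c =
     (if s = t' then Poly_Mapping.single (t, as @ as', s') c else 0)"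

definition path_mult ::
    "('i, 'k::field) path_comb \<Rightarrow> ('i, 'k) path_comb \<Rightarrow> ('i, 'k) path_comb" where
  "path_mult x y = (\<Sum>p\<in>Poly_Mapping.keys x. \<Sum>p'\<in>Poly_Mapping.keys y.
     path_comp p p' (Poly_Mapping.lookup x p * Poly_Mapping.lookup y p'))"

definition PA_scalar :: "'k::field \<Rightarrow> ('i::finite, 'k) path_comb" where
  "PA_scalar c = (\<Sum>i\<in>UNIV. Poly_Mapping.single (i, [], i) c)"

definition PA :: "int ^ 'i::finite ^ 'i \<Rightarrow> ('i, 'k::field) path_comb ring" where
  "PA C = \<lparr>carrier = {x. Poly_Mapping.keys x \<subseteq> paths C}, mult = path_mult, one = PA_scalar 1,
           zero = 0, add = (+)\<rparr>"

definition PA_comp :: "int ^ 'i::finite ^ 'i \<Rightarrow> ('i \<Rightarrow> int) \<Rightarrow> int \<Rightarrow> ('i, 'k::field) path_comb set"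
  where "PA_comp C d u = {x \<in> carrier (PA C). \<forall>p\<in>Poly_Mapping.keys x. path_deg d p = u}"

definition PA_op :: "('i, 'k::field) path_comb \<Rightarrow> ('i, 'k) path_comb" where
  "PA_op x = (\<Sum>p\<in>Poly_Mapping.keys x. Poly_Mapping.single (path_op p) (Poly_Mapping.lookup x p))"

definition idem :: "'i \<Rightarrow> ('i, 'k::field) path_comb" where
  "idem i = Poly_Mapping.single (i, [], i) 1"

definition alpha :: "'i \<Rightarrow> 'i \<Rightarrow> ('i, 'k::field) path_comb" where
  "alpha i j = Poly_Mapping.single (i, [Arr i j], j) 1"

definition eps :: "'i \<Rightarrow> ('i, 'k::field) path_comb" where
  "eps i = Poly_Mapping.single (i, [Loop i], i) 1"


definition sign_choice :: "int ^ 'i::finite ^ 'i \<Rightarrow> ('i \<Rightarrow> 'i \<Rightarrow> int) \<Rightarrow> bool" where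
  "sign_choice C \<omega> \<longleftrightarrow> (\<forall>i j. adj C i j \<longrightarrow> \<omega> i j \<in> {1, -1} \<and> \<omega> i j = - \<omega> j i)"

definition rel1 :: "int ^ 'i::finite ^ 'i \<Rightarrow> 'i \<Rightarrow> 'i \<Rightarrow> ('i, 'k::field) path_comb" where
  "rel1 C i j =
     (eps i [^]\<^bsub>PA C\<^esub> nat (- C $ i $ j)) \<otimes>\<^bsub>PA C\<^esub> alpha i j
     - alpha i j \<otimes>\<^bsub>PA C\<^esub> (eps j [^]\<^bsub>PA C\<^esub> nat (- C $ j $ i))"

definition rel2 ::
    "int ^ 'i::finite ^ 'i \<Rightarrow> ('i \<Rightarrow> 'i \<Rightarrow> int) \<Rightarrow> 'i \<Rightarrow> ('i, 'k::field) path_comb" where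
  "rel2 C \<omega> i = (\<Sum>j | adj C j i. \<Sum>k = 0..<nat (- C $ i $ j).
     PA_scalar (of_int (\<omega> i j)) \<otimes>\<^bsub>PA C\<^esub> (eps i [^]\<^bsub>PA C\<^esub> k) \<otimes>\<^bsub>PA C\<^esub> alpha i j \<otimes>\<^bsub>PA C\<^esub> alpha j i
       \<otimes>\<^bsub>PA C\<^esub> (eps i [^]\<^bsub>PA C\<^esub> (nat (- C $ i $ j) - 1 - k)))"

definition GPA_ideal ::
    "int ^ 'i::finite ^ 'i \<Rightarrow> ('i \<Rightarrow> 'i \<Rightarrow> int) \<Rightarrow> ('i, 'k::field) path_comb set" where
  "GPA_ideal C \<omega> = Idl\<^bsub>PA C\<^esub> ({rel1 C i j | i j. adj C i j} \<union> range (rel2 C \<omega>))"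

type_synonym ('i, 'k) gpa = "('i, 'k) path_comb set"

definition GPA :: "int ^ 'i::finite ^ 'i \<Rightarrow> ('i \<Rightarrow> 'i \<Rightarrow> int) \<Rightarrow> ('i, 'k::field) gpa ring" where
  "GPA C \<omega> = PA C Quot GPA_ideal C \<omega>"

definition GPA_class :: "int ^ 'i::finite ^ 'i \<Rightarrow> ('i \<Rightarrow> 'i \<Rightarrow> int) \<Rightarrow>
    ('i, 'k::field) path_comb \<Rightarrow> ('i, 'k) gpa" where
  "GPA_class C \<omega> x = GPA_ideal C \<omega> +>\<^bsub>PA C\<^esub> x"

definition GPA_comp :: "int ^ 'i::finite ^ 'i \<Rightarrow> ('i \<Rightarrow> int) \<Rightarrow> ('i \<Rightarrow> 'i \<Rightarrow> int) \<Rightarrow> int \<Rightarrow>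
    ('i, 'k::field) gpa set" where
  "GPA_comp C d \<omega> u = GPA_class C \<omega> ` PA_comp C d u"

definition GPA_idem :: "int ^ 'i::finite ^ 'i \<Rightarrow> ('i \<Rightarrow> 'i \<Rightarrow> int) \<Rightarrow> 'i \<Rightarrow> ('i, 'k::field) gpa" where
  "GPA_idem C \<omega> i = GPA_class C \<omega> (idem i)"

definition GPA_eps :: "int ^ 'i::finite ^ 'i \<Rightarrow> ('i \<Rightarrow> 'i \<Rightarrow> int) \<Rightarrow> 'i \<Rightarrow> ('i, 'k::field) gpa" where
  "GPA_eps C \<omega> i = GPA_class C \<omega> (eps i)"

text \<open>The anti-involution of the path algebra preserves the ideal, so on cosets it is the image.\<close>

definition GPA_op :: "('i, 'k::field) gpa \<Rightarrow> ('i, 'k) gpa" where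
  "GPA_op X = PA_op ` X"


text \<open>The record type \<open>module\<close> extends \<open>ring\<close>; its multiplicative fields play no role for
  modules over a noncommutative ring and are left unspecified.\<close>

record ('r, 'v) graded_module = "('r, 'v) module" +
  comp :: "int \<Rightarrow> 'v set"

text \<open>The left module \<open>(R/Re)f\<close> for a graded ring \<open>R\<close>, where \<open>e = ef\<close>, so that right multiplication
  by \<open>f\<close> is well defined on cosets of \<open>Re\<close>.\<close>

definition left_ideal :: "'r ring \<Rightarrow> 'r \<Rightarrow> 'r set" where
  "left_ideal R e = {x \<otimes>\<^bsub>R\<^esub> e | x. x \<in> carrier R}"

definition quot_mod :: "'r ring \<Rightarrow> (int \<Rightarrow> 'r set) \<Rightarrow> 'r \<Rightarrow> 'r \<Rightarrow> ('r, 'r set) graded_module" where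
  "quot_mod R Rcomp e f = \<lparr>
     carrier = {left_ideal R e +>\<^bsub>R\<^esub> (x \<otimes>\<^bsub>R\<^esub> f) | x. x \<in> carrier R},
     mult = undefined, one = undefined,
     zero = left_ideal R e,
     add = set_add R,
     smult = (\<lambda>r m. \<Union>x\<in>m. left_ideal R e +>\<^bsub>R\<^esub> (r \<otimes>\<^bsub>R\<^esub> x)),
     comp = (\<lambda>u. {left_ideal R e +>\<^bsub>R\<^esub> (x \<otimes>\<^bsub>R\<^esub> f) | x. x \<in> Rcomp u})\<rparr>"

text \<open>The restricted dual of a graded left module over a \<open>'k\<close>-algebra with structure map \<open>\<iota>\<close>,
  made into a left module by means of the anti-involution \<open>\<tau>\<close>.  A functional on the module is
  extended by zero outside its carrier; a functional on the component of degree \<open>-u\<close> is extended by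
  zero to the other components.\<close>

definition restricted_dual :: "('k::field \<Rightarrow> 'r) \<Rightarrow> ('r \<Rightarrow> 'r) \<Rightarrow> ('r, 'v) graded_module \<Rightarrow>
    ('r, 'v \<Rightarrow> 'k) graded_module" where
  "restricted_dual \<iota> \<tau> M = (let
     D = {\<phi>. (\<forall>m. m \<notin> carrier M \<longrightarrow> \<phi> m = 0) \<and>
             (\<forall>m\<in>carrier M. \<forall>n\<in>carrier M. \<phi> (m \<oplus>\<^bsub>M\<^esub> n) = \<phi> m + \<phi> n) \<and>
             (\<forall>c. \<forall>m\<in>carrier M. \<phi> (\<iota> c \<odot>\<^bsub>M\<^esub> m) = c * \<phi> m) \<and>
             finite {u. \<exists>m\<in>comp M u. \<phi> m \<noteq> 0}}
   in \<lparr>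
     carrier = D,
     mult = undefined, one = undefined,
     zero = 0,
     add = (+),
     smult = (\<lambda>r \<phi> m. if m \<in> carrier M then \<phi> (\<tau> r \<odot>\<^bsub>M\<^esub> m) else 0),
     comp = (\<lambda>u. {\<phi> \<in> D. \<forall>v. v \<noteq> - u \<longrightarrow> (\<forall>m\<in>comp M v. \<phi> m = 0)})\<rparr>)"

definition Ibar :: "int ^ 'i::finite ^ 'i \<Rightarrow> ('i \<Rightarrow> int) \<Rightarrow> ('i \<Rightarrow> 'i \<Rightarrow> int) \<Rightarrow> 'i \<Rightarrow>
    (('i, 'k::field) gpa, ('i, 'k) gpa set \<Rightarrow> 'k) graded_module" where
  "Ibar C d \<omega> i = restricted_dual (\<lambda>c. GPA_class C \<omega> (PA_scalar c)) GPA_op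
     (quot_mod (GPA C \<omega>) (GPA_comp C d \<omega>) (GPA_eps C \<omega> i) (GPA_idem C \<omega> i))"

text \<open>The graded subspace \<open>eV\<close> of a graded module, for \<open>e\<close> homogeneous of degree \<open>0\<close>.\<close>

definition act_image :: "'r \<Rightarrow> ('r, 'v) graded_module \<Rightarrow> int \<Rightarrow> 'v set" where
  "act_image e V u = (\<lambda>v. e \<odot>\<^bsub>V\<^esub> v) ` comp V u"

text \<open>Graded dimension of a graded space of \<open>'k\<close>-valued functions with finite-dimensional
  components that vanish in all sufficiently negative degrees.\<close>

definition dim_q :: "(int \<Rightarrow> ('v \<Rightarrow> 'k::field) set) \<Rightarrow> rat fls" where
  "dim_q W = Abs_fls (\<lambda>u. of_nat (vector_space.dim (\<lambda>c \<phi> x. c * \<phi> x) (W u)))"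

end

theory Submission
  imports Defs
begin

text \<open>
  Let \<open>V\<^sub>i\<close> be the space of functions on the words from \<open>j\<close> to \<open>i\<close> that kill the relations; it is the
  component of the dual module at \<open>i\<close>.  For a graded submodule \<open>N\<close> of \<open>V\<close> let \<open>N\<^sub>i\<^sup>+\<close> and \<open>N\<^sub>i\<^sup>-\<close> be the largest and
  the smallest component at \<open>i\<close> compatible with the other components.  With \<open>a\<^sub>i\<^sub>k = -c\<^sub>i\<^sub>k\<close> the sequence
  \<open>0 \<rightarrow> [i = j] \<rightarrow> N\<^sub>i\<^sup>+ \<rightarrow> \<Oplus>\<^sub>k N\<^sub>k\<^bsup>a\<^sub>i\<^sub>k\<^esup> \<rightarrow> N\<^sub>i\<^sup>- \<rightarrow> 0\<close> is exact, so replacing \<open>N\<^sub>i = N\<^sub>i\<^sup>-\<close> by \<open>N\<^sub>i\<^sup>+\<close>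
  reflects the weight \<open>\<lambda> = \<omega>\<^sub>j - \<Sum>\<^sub>k dim N\<^sub>k \<alpha>\<^sub>k\<close>.  Starting from \<open>0\<close> and reflecting whenever \<open>\<lambda>\<^sub>i > 0\<close>, a rank
  two argument shows that every \<open>N\<^sub>i\<close> stays equal to \<open>N\<^sub>i\<^sup>-\<close> or \<open>N\<^sub>i\<^sup>+\<close>.  The orbit of \<open>\<omega>\<^sub>j\<close> is finite, so the process
  ends with \<open>\<lambda> = -\<omega>\<^sub>j\<^sub>*\<close>, all \<open>N\<^sub>i = N\<^sub>i\<^sup>+\<close>, and therefore \<open>N = V\<close>.

  Consequently \<open>V\<^sub>i\<^sup>- = V\<^sub>i\<close> except for one missing dimension at \<open>j\<^sup>*\<close>.  Its degree follows from the first
  moments of the dimensions, which are expressed through positive roots along the process, and the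
  identity \<open>\<Sum>\<^sub>\<gamma> d\<^sub>i (C \<gamma>)\<^sub>i \<gamma>\<^sub>k = r h\<^sup>\<or> \<delta>\<^sub>i\<^sub>k\<close> over the positive roots.  In each degree the exact sequences now
  say \<open>C(q) X = 1 + q\<^bsup>N\<^esup> P\<close>, where \<open>N = r h\<^sup>\<or>\<close>, \<open>X\<^sub>i\<^sub>j = q\<^bsup>d\<^sub>j\<^esup> dim\<^sub>q\<close> and \<open>P\<close> is the permutation matrix of the
  involution, so that \<open>C(q)\<^sup>-\<^sup>1 = X (1 - q\<^bsup>N\<^esup> P) / (1 - q\<^bsup>2N\<^esup>)\<close>.  Since \<open>X\<close> lives in the degrees strictly
  between \<open>0\<close> and \<open>N\<close>, both formulas follow.
\<close>

text \<open>At the outset nothing is known about the size of \<open>V\<close>, and the field is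
  arbitrary, so \<open>V\<close> is exhausted from below by submodules of controlled size; that it
  is finite-dimensional is an outcome of the exhaustion. The obstacle is that a reflection at one
  vertex changes the largest and smallest components at its neighbours, so a neighbour might end up
  strictly between its extremes. The weight only controls the difference dim(N+/N) - dim(N/N-); that
  one of the two terms vanishes at every vertex has to be carried along as an invariant. Its
  preservation can be tested on two vertices at a time, which is why only the Coxeter numbers 2, 3,
  4 and 6 occur.

  Knowing all total dimensions leaves a single unknown, the degree of the one missing dimension. One
  more linear equation locates it, so first moments are enough. The constant r h^\<or> enters there
  as half the eigenvalue of the Weyl-invariant operator that sends x to the sum of (x,\<beta>)
  \<beta> over all roots.\<close>

no_notation fps_nth (infixl "$" 75)

section \<open>Spaces of functions\<close>

text \<open>A separate locale, because the global interpretation of \<open>vector_space\<close> for real vector spaces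
  would capture the name of a new constant defined in that locale.\<close>

locale fdim_space = vector_space
begin

text \<open>The ambient spaces consist of all functions on infinite sets of words, so finite
  dimension is a property of subsets, and \<open>dim\<close> is informative only together with
  it.\<close>

definition fin_dim :: "'b set \<Rightarrow> bool" where
  "fin_dim W \<longleftrightarrow> (\<exists>B. finite B \<and> W \<subseteq> span B)"

lemma fin_dim_mono: "fin_dim W \<Longrightarrow> V \<subseteq> W \<Longrightarrow> fin_dim V"
  unfolding fin_dim_def by blast

lemma fin_dim_zero: "fin_dim {0}"
  unfolding fin_dim_def by (rule exI[of _ "{}"]) simp

lemma fin_dim_span_singleton: "fin_dim (span {x})"
  unfolding fin_dim_def by blast

lemma finite_if_independent_fin_dim:
  assumes "fin_dim W" "independent B" "B \<subseteq> W"
  shows "finite B"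
proof -
  from assms(1) obtain T where "finite T" "W \<subseteq> span T" unfolding fin_dim_def by blast
  then show ?thesis using independent_span_bound[of T B] assms by auto
qed

lemma fin_dim_basis_extend:
  assumes "fin_dim W" "S \<subseteq> W" "independent S"
  shows "\<exists>B. S \<subseteq> B \<and> B \<subseteq> W \<and> independent B \<and> finite B \<and> W \<subseteq> span B \<and> card B = dim W"
proof -
  obtain B where B: "S \<subseteq> B" "B \<subseteq> W" "independent B" "W \<subseteq> span B"
    by (rule maximal_independent_subset_extend[OF assms(2,3)])
  have "finite B" by (rule finite_if_independent_fin_dim[OF assms(1) B(3,2)])
  moreover have "card B = dim W" by (rule basis_card_eq_dim[OF B(2,4,3)])
  ultimately show ?thesis using B by (intro exI[of _ B] conjI)
qed

lemma fin_dim_basis: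
  assumes "fin_dim W"
  shows "\<exists>B. B \<subseteq> W \<and> independent B \<and> finite B \<and> W \<subseteq> span B \<and> card B = dim W"
  using fin_dim_basis_extend[OF assms, of "{}"] independent_empty by simp

lemma dim_mono_fin:
  assumes "fin_dim W" "V \<subseteq> W"
  shows "dim V \<le> dim W"
proof -
  obtain B where B: "finite B" "W \<subseteq> span B" "card B = dim W"
    using fin_dim_basis[OF assms(1)] by (elim exE conjE)
  have "V \<subseteq> span B" using B(2) assms(2) by (rule subset_trans[rotated])
  then show ?thesis using dim_le_card[of V B] B(1,3) by simp
qed

lemma subspace_eq_if_dim_le:
  assumes "fin_dim W" "V \<subseteq> W" "subspace V" "dim W \<le> dim V"
  shows "V = W"
proof -
  obtain S where S: "S \<subseteq> V" "independent S" "finite S" "V \<subseteq> span S" "card S = dim V"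
    using fin_dim_basis[OF fin_dim_mono[OF assms(1,2)]] by (elim exE conjE)
  obtain B where B: "S \<subseteq> B" "B \<subseteq> W" "finite B" "W \<subseteq> span B" "card B = dim W"
    using fin_dim_basis_extend[OF assms(1) subset_trans[OF S(1) assms(2)] S(2)] by (elim exE conjE)
  have "S = B" using card_seteq[OF B(3) B(1)] B(5) S(5) assms(4) by simp
  then have "W \<subseteq> span V" using subset_trans[OF B(4)] span_mono[OF S(1)] by simp
  moreover have "span V = V" using assms(3) by simp
  ultimately show ?thesis using assms(2) by simp
qed

lemma dim_zero_space: "dim {0} = 0"
  using dim_span_eq_card_independent[OF independent_empty] by simp

lemma dim_eq_zero_fin:
  assumes "fin_dim W" "dim W = 0" "subspace W"
  shows "W = {0}"
  using subspace_eq_if_dim_le[of W "{0}"] assms subspace_0[OF assms(3)] by (simp add: dim_zero_space)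

lemma dim_span_singleton_nonzero: "x \<noteq> 0 \<Longrightarrow> dim (span {x}) = 1"
  using dim_span_eq_card_independent[of "{x}"] by simp

end

lemma linear_imp_mh: "Vector_Spaces.linear s1 s2 f \<Longrightarrow> module_hom s1 s2 f"
  unfolding module_hom_iff_linear .

locale fdim_pair = vs1: fdim_space s1 + vs2: fdim_space s2
  for s1 :: "'k::field \<Rightarrow> 'b::ab_group_add \<Rightarrow> 'b" and s2 :: "'k \<Rightarrow> 'c::ab_group_add \<Rightarrow> 'c"
begin

lemma fin_dim_image:
  assumes "Vector_Spaces.linear s1 s2 f" "vs1.fin_dim W"
  shows "vs2.fin_dim (f ` W)"
proof -
  interpret f: module_hom s1 s2 f using assms(1) by (rule linear_imp_mh)
  show ?thesis using assms(2) unfolding vs1.fin_dim_def vs2.fin_dim_def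
    using f.span_image by (metis finite_imageI image_mono)
qed

text \<open>A basis \<open>S\<close> of the kernel is extended to a basis \<open>B\<close> of
  \<open>W\<close>; the images of \<open>B - S\<close> form a basis of the image.\<close>

lemma rank_nullity:
  assumes lin: "Vector_Spaces.linear s1 s2 f" and W: "vs1.subspace W" "vs1.fin_dim W"
  shows "vs1.dim W = vs1.dim {x \<in> W. f x = 0} + vs2.dim (f ` W)"
proof -
  interpret f: module_hom s1 s2 f using lin by (rule linear_imp_mh)
  let ?K = "{x \<in> W. f x = 0}"
  have KW: "?K \<subseteq> W" by auto
  obtain S where S: "S \<subseteq> ?K" "vs1.independent S" "finite S" "?K \<subseteq> vs1.span S" "card S = vs1.dim ?K"
    using vs1.fin_dim_basis[OF vs1.fin_dim_mono[OF W(2) KW]] by (elim exE conjE)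
  obtain B where B: "S \<subseteq> B" "B \<subseteq> W" "vs1.independent B" "finite B" "W \<subseteq> vs1.span B" "card B = vs1.dim W"
    using vs1.fin_dim_basis_extend[OF W(2) subset_trans[OF S(1) KW] S(2)] by (elim exE conjE)
  let ?D = "B - S"
  have spanBW: "vs1.span B = W" using B W(1) using vs1.span_minimal by blast
  have inj: "inj_on f (vs1.span ?D)"
  proof (subst f.inj_on_iff_eq_0)
    show "vs1.subspace (vs1.span ?D)" by simp
    show "\<forall>x\<in>vs1.span ?D. f x = 0 \<longrightarrow> x = 0"
    proof (intro ballI impI)
      fix x assume x: "x \<in> vs1.span ?D" "f x = 0"
      have "x \<in> W" using x(1) vs1.span_mono[of ?D B] spanBW by auto
      then have xS: "x \<in> vs1.span S" using x(2) S(4) by auto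
      obtain a where a: "x = (\<Sum>v\<in>?D. s1 (a v) v)"
        using x(1) B(4) by (auto simp: vs1.span_finite)
      obtain b where b: "x = (\<Sum>v\<in>S. s1 (b v) v)"
        using xS S(3) by (auto simp: vs1.span_finite)
      \<comment> \<open>Two expansions of the same vector, over \<open>S\<close> and over
        \<open>B - S\<close>, combine to a linear relation on the basis \<open>B\<close>.\<close>
      define c where "c v = (if v \<in> S then - b v else a v)" for v
      have "(\<Sum>v\<in>B. s1 (c v) v) = (\<Sum>v\<in>?D. s1 (c v) v) + (\<Sum>v\<in>S. s1 (c v) v)"
        using sum.subset_diff[OF B(1) B(4)] by blast
      also have "\<dots> = x - x"
        unfolding c_def using a b by (simp add: sum_negf vs1.scale_minus_left)
      finally have "(\<Sum>v\<in>B. s1 (c v) v) = 0" by simp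
      then have "c v = 0" if "v \<in> B" for v
        by (rule vs1.independentD[OF B(3) B(4) subset_refl _ that, where u = c])
      then have "a v = 0" if "v \<in> ?D" for v using that unfolding c_def by force
      then show "x = 0" using a by simp
    qed
  qed
  have indD: "vs1.independent ?D" using B(3) vs1.independent_mono by blast
  have ind: "vs2.independent (f ` ?D)" using f.independent_injective_image[OF indD inj] .
  have cardD: "card (f ` ?D) = card ?D"
    using inj vs1.span_superset[of ?D] by (meson card_image inj_on_subset)
  have "f ` W \<subseteq> vs2.span (f ` ?D)"
  proof
    fix y assume "y \<in> f ` W"
    then obtain x where x: "x \<in> vs1.span B" "y = f x" using spanBW by blast
    have "B = S \<union> ?D" using B(1) by blast
    then obtain u v where uv: "x = u + v" "u \<in> vs1.span S" "v \<in> vs1.span ?D"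
      using x(1) vs1.span_Un[of S ?D] by auto
    have "f u = 0" using uv(2) S(1) f.eq_0_on_span[of S u] by blast
    then have "y = f v" using x uv f.add by simp
    then show "y \<in> vs2.span (f ` ?D)" using uv(3) f.span_image by auto
  qed
  then have "vs2.dim (f ` W) = card (f ` ?D)"
    using vs2.basis_card_eq_dim[of "f ` ?D" "f ` W"] ind B(2) by force
  then show ?thesis using cardD S(5) B(6) B(1,4) S(3)
  card_mono[OF B(4,1)] by (simp add: card_Diff_subset)
qed

lemma dim_inj_image:
  assumes lin: "Vector_Spaces.linear s1 s2 f" and W: "vs1.subspace W" and inj: "\<And>x. x \<in> W \<Longrightarrow> f x = 0 \<Longrightarrow> x = 0"
  shows "vs2.dim (f ` W) = vs1.dim W"
proof -
  interpret f: module_hom s1 s2 f using lin by (rule linear_imp_mh)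
  obtain B where B: "B \<subseteq> W" "vs1.independent B" "W \<subseteq> vs1.span B" "card B = vs1.dim W"
    by (rule vs1.basis_exists)
  have BW: "vs1.span B = W" using B W using vs1.span_minimal by blast
  have injW: "inj_on f (vs1.span B)" using f.inj_on_iff_eq_0[of W] W inj BW by auto
  have "vs2.independent (f ` B)" using f.independent_injective_image[OF B(2) injW] .
  moreover have "f ` W \<subseteq> vs2.span (f ` B)" using B(3) f.span_image by auto
  ultimately have "card (f ` B) = vs2.dim (f ` W)"
    using vs2.basis_card_eq_dim[of "f ` B" "f ` W"] B(1) by blast
  moreover have "card (f ` B) = card B" using injW vs1.span_superset[of B] by (meson card_image inj_on_subset)
  ultimately show ?thesis using B by simp
qed

text \<open>This is how the largest component at a vertex is seen to be finite-dimensional, although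
  it is cut out of a space whose dimension is still unknown.\<close>

lemma fin_dim_if_kernel_image:
  assumes lin: "Vector_Spaces.linear s1 s2 f" and W: "vs1.subspace W"
    and K: "vs1.fin_dim {x \<in> W. f x = 0}" and I: "vs2.fin_dim (f ` W)"
  shows "vs1.fin_dim W"
proof -
  interpret f: module_hom s1 s2 f using lin by (rule linear_imp_mh)
  obtain S where S: "finite S" "{x \<in> W. f x = 0} \<subseteq> vs1.span S" using K unfolding vs1.fin_dim_def by blast
  obtain T where T: "T \<subseteq> f ` W" "finite T" "f ` W \<subseteq> vs2.span T"
    using vs2.fin_dim_basis[OF I] by (elim exE conjE)
  obtain T' where T': "T' \<subseteq> W" "finite T'" "T = f ` T'" using T(1,2) finite_subset_image[of T f W] by blast
  have "W \<subseteq> vs1.span (S \<union> T')"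
  proof
    fix x assume x: "x \<in> W"
    then have "f x \<in> f ` vs1.span T'" using T T' f.span_image by auto
    then obtain y where y: "y \<in> vs1.span T'" "f x = f y" by blast
    have "y \<in> W" using y T' W vs1.span_minimal by blast
    then have "x - y \<in> {x \<in> W. f x = 0}" using x y W f.diff vs1.subspace_diff by auto
    then have "x - y \<in> vs1.span S" using S by blast
    then have "(x - y) + y \<in> vs1.span (S \<union> T')"
      using y(1) vs1.span_mono[of S "S \<union> T'"] vs1.span_mono[of T' "S \<union> T'"] vs1.span_add by blast
    then show "x \<in> vs1.span (S \<union> T')" by simp
  qed
  then show ?thesis unfolding vs1.fin_dim_def using S T' by blast
qed

end

global_interpretation fs: fdim_space "\<lambda>c (\<phi> :: 'x \<Rightarrow> 'k::field) x. c * \<phi> x"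
  by unfold_locales (simp_all add: fun_eq_iff distrib_left distrib_right mult.assoc)

global_interpretation fsp: fdim_pair
  "\<lambda>c (\<phi> :: 'x \<Rightarrow> 'k::field) x. c * \<phi> x" "\<lambda>c (\<phi> :: 'y \<Rightarrow> 'k::field) x. c * \<phi> x"
  by unfold_locales

lemma fs_subspaceI:
  assumes "0 \<in> W" "\<And>x y. x \<in> W \<Longrightarrow> y \<in> W \<Longrightarrow> x + y \<in> W"
    "\<And>c x. x \<in> W \<Longrightarrow> (\<lambda>p. c * x p) \<in> W"
  shows "fs.subspace W"
  using assms unfolding fs.subspace_def by auto

lemma fs_linearI:
  fixes f :: "('x \<Rightarrow> 'k::field) \<Rightarrow> ('y \<Rightarrow> 'k)"
  assumes "\<And>x y. f (x + y) = f x + f y" "\<And>c x. f (\<lambda>p. c * x p) = (\<lambda>p. c * f x p)"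
  shows "Vector_Spaces.linear (\<lambda>c \<phi> x. c * \<phi> x) (\<lambda>c \<phi> x. c * \<phi> x) f"
  unfolding Vector_Spaces.linear_iff by (intro conjI fs.vector_space_axioms allI assms)

text \<open>The direct sum of the \<open>N a\<close>, encoded as functions on pairs so that it is
  again a space of functions with the same scalar multiplication; vanishing outside \<open>A\<close>
  makes the encoding faithful.\<close>

definition prod_space :: "'a set \<Rightarrow> ('a \<Rightarrow> ('b \<Rightarrow> 'k::field) set) \<Rightarrow> ('a \<times> 'b \<Rightarrow> 'k) set" where
  "prod_space A N = {\<Psi>. (\<forall>a\<in>A. (\<lambda>b. \<Psi> (a, b)) \<in> N a) \<and> (\<forall>a b. a \<notin> A \<longrightarrow> \<Psi> (a, b) = 0)}"

lemma prod_space_subspace: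
  assumes "\<And>a. a \<in> A \<Longrightarrow> fs.subspace (N a)"
  shows "fs.subspace (prod_space A N)"
proof (rule fs_subspaceI)
  show "0 \<in> prod_space A N"
    using fs.subspace_0[OF assms] by (simp add: prod_space_def zero_fun_def)
next
  fix x y assume "x \<in> prod_space A N" "y \<in> prod_space A N"
  then show "x + y \<in> prod_space A N"
    using fs.subspace_add[OF assms] by (auto simp: prod_space_def plus_fun_def)
next
  fix c x assume "x \<in> prod_space A N"
  then show "(\<lambda>p. c * x p) \<in> prod_space A N"
    using fs.subspace_scale[OF assms] by (auto simp: prod_space_def)
qed

lemma prod_space_dim:
  fixes N :: "'a \<Rightarrow> ('b \<Rightarrow> 'k::field) set"
  assumes "finite A" "\<And>a. a \<in> A \<Longrightarrow> fs.subspace (N a)" "\<And>a. a \<in> A \<Longrightarrow> fs.fin_dim (N a)"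
  shows "fs.fin_dim (prod_space A N) \<and> fs.dim (prod_space A N) = (\<Sum>a\<in>A. fs.dim (N a))"
  using assms
proof (induction A rule: finite_induct)
  case empty
  have "prod_space {} N = {0}" by (auto simp: prod_space_def fun_eq_iff)
  then show ?case by (simp add: fs.fin_dim_zero fs.dim_zero_space)
next
  case (insert a A)
  let ?P = "prod_space (insert a A) N"
  let ?f = "\<lambda>\<Psi> :: 'a \<times> 'b \<Rightarrow> 'k. (\<lambda>b. \<Psi> (a, b))"
  have lin: "Vector_Spaces.linear (\<lambda>c \<phi> x. c * \<phi> x) (\<lambda>c \<phi> x. c * \<phi> x) ?f"
    by (rule fs_linearI) (auto simp: fun_eq_iff)
  have sub: "fs.subspace ?P" using prod_space_subspace insert.prems(1) by metis
  have 0: "(\<lambda>b. 0) \<in> N c" if "c \<in> insert a A" for c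
    using fs.subspace_0[OF insert.prems(1)[OF that]] by (simp add: zero_fun_def)
  have ker: "{x \<in> ?P. ?f x = 0} = prod_space A N"
    using insert.hyps 0[of a] by (auto simp: prod_space_def fun_eq_iff)
  have im: "?f ` ?P = N a"
  proof
    show "?f ` ?P \<subseteq> N a" by (auto simp: prod_space_def)
    show "N a \<subseteq> ?f ` ?P"
    proof
      fix \<phi> assume \<phi>: "\<phi> \<in> N a"
      let ?\<Psi> = "\<lambda>(a', b). if a' = a then \<phi> b else 0"
      have "(\<lambda>b. ?\<Psi> (c, b)) \<in> N c" if "c \<in> insert a A" for c
        using 0[OF that] \<phi> by (cases "c = a") simp_all
      then have "?\<Psi> \<in> ?P" using \<phi> by (auto simp: prod_space_def)
      then show "\<phi> \<in> ?f ` ?P" by (rule rev_image_eqI) auto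
    qed
  qed
  have fd: "fs.fin_dim ?P"
    by (rule fsp.fin_dim_if_kernel_image[OF lin sub]) (use ker im insert in auto)
  then show ?case using fsp.rank_nullity[OF lin sub fd] ker im insert by auto
qed

section \<open>Finite root systems\<close>

lemma axis_nth: "axis i c $ k = (if k = i then c else 0)"
  by (simp add: axis_def)

lemma sum_axis_mult: "(\<Sum>k\<in>UNIV. (f k :: int) * axis i c $ k) = f i * c"
proof -
  have "(\<Sum>k\<in>UNIV. f k * axis i c $ k) = (\<Sum>k\<in>UNIV. if k = i then f i * c else 0)"
    by (rule sum.cong) (auto simp: axis_nth)
  then show ?thesis by simp
qed

lemma mat_vec_nth: "((A :: int ^ 'n::finite ^ 'm::finite) *v x) $ i = (\<Sum>j\<in>UNIV. A $ i $ j * x $ j)"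
  by (simp add: matrix_vector_mult_def)

lemma mat_vec_axis: "((A :: int ^ 'n::finite ^ 'm::finite) *v axis i c) $ k = A $ k $ i * c"
  unfolding mat_vec_nth by (rule sum_axis_mult)

lemma refl_nth: "simple_reflection C i v $ k = v $ k - (if k = i then (C *v v) $ i else 0)"
  by (simp add: simple_reflection_def axis_nth)

lemma refl_add: "simple_reflection C i (v + w) = simple_reflection C i v + simple_reflection C i w"
  by (simp add: simple_reflection_def vec_eq_iff axis_nth matrix_vector_right_distrib)

lemma mat_vec_neg: "(A :: int ^ 'n::finite ^ 'm::finite) *v (- x) = - (A *v x)"
  by (simp add: vec_eq_iff mat_vec_nth sum_negf)

lemma refl_neg: "simple_reflection C i (- v) = - simple_reflection C i v"
  by (simp add: simple_reflection_def vec_eq_iff axis_nth mat_vec_neg)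

lemma refl_smult: "simple_reflection C i (c *s v) = c *s simple_reflection C i v"
  by (simp add: simple_reflection_def vec_eq_iff axis_nth mat_vec_nth sum_distrib_left algebra_simps)

lemma weyl_word_Nil [simp]: "weyl_word C [] = id"
  by (simp add: weyl_word_def)

lemma weyl_word_Cons: "weyl_word C (i # w) = simple_reflection C i \<circ> weyl_word C w"
  by (simp add: weyl_word_def)

lemma weyl_word_append: "weyl_word C (v @ w) = weyl_word C v \<circ> weyl_word C w"
  by (induction v) (simp_all add: weyl_word_Cons comp_assoc)

lemma weyl_word_add: "weyl_word C w (x + y) = weyl_word C w x + weyl_word C w y"
  by (induction w) (simp_all add: weyl_word_Cons refl_add)

lemma weyl_word_neg: "weyl_word C w (- x) = - weyl_word C w x"
  by (induction w) (simp_all add: weyl_word_Cons refl_neg)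

lemma weyl_word_smult: "weyl_word C w (c *s x) = c *s weyl_word C w x"
  by (induction w) (simp_all add: weyl_word_Cons refl_smult)

lemma weyl_word_zero: "weyl_word C w 0 = 0"
  using weyl_word_add[of C w 0 0] by simp

lemma weyl_word_sum: "finite A \<Longrightarrow> weyl_word C w (\<Sum>a\<in>A. f a) = (\<Sum>a\<in>A. weyl_word C w (f a))"
  by (induction A rule: finite_induct) (simp_all add: weyl_word_zero weyl_word_add)

lemma vec_axis_expand: "(v :: int ^ 'n::finite) = (\<Sum>i\<in>UNIV. v $ i *s axis i 1)"
proof -
  have "(\<Sum>i\<in>UNIV. v $ i *s axis i 1) $ k = v $ k" for k
  proof -
    have "(\<Sum>i\<in>UNIV. v $ i *s axis i 1) $ k = (\<Sum>i\<in>UNIV. if i = k then v $ k else 0)"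
      unfolding sum_component by (rule sum.cong) (auto simp: axis_nth)
    then show ?thesis by simp
  qed
  then show ?thesis by (simp add: vec_eq_iff)
qed

section \<open>Roots, positive roots and the invariant form\<close>

definition roots :: "int ^ 'i::finite ^ 'i \<Rightarrow> (int ^ 'i) set" where
  "roots C = {\<beta>. \<exists>\<gamma>. root_coroot C \<beta> \<gamma>}"

definition pos_roots :: "int ^ 'i::finite ^ 'i \<Rightarrow> (int ^ 'i) set" where
  "pos_roots C = {\<beta> \<in> roots C. \<forall>i. 0 \<le> \<beta> $ i}"

lemma axis_root: "axis i 1 \<in> roots C"
  unfolding roots_def using root_coroot.simple by blast

lemma refl_root: "\<beta> \<in> roots C \<Longrightarrow> simple_reflection C i \<beta> \<in> roots C"
  unfolding roots_def using root_coroot.reflect by blast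

lemma weyl_word_root: "\<beta> \<in> roots C \<Longrightarrow> weyl_word C w \<beta> \<in> roots C"
  by (induction w) (simp_all add: weyl_word_Cons refl_root)

lemma root_eq_weyl_word: "\<beta> \<in> roots C \<Longrightarrow> \<exists>w i. \<beta> = weyl_word C w (axis i 1)"
proof -
  assume "\<beta> \<in> roots C"
  then obtain \<gamma> where "root_coroot C \<beta> \<gamma>" unfolding roots_def by blast
  then show ?thesis
  proof induction
    case (simple i)
    show ?case by (intro exI[of _ "[]"] exI[of _ i]) simp
  next
    case (reflect \<beta> \<gamma> i)
    then obtain w j where "\<beta> = weyl_word C w (axis j 1)" by blast
    then show ?case by (intro exI[of _ "i # w"] exI[of _ j]) (simp add: weyl_word_Cons)
  qed
qed

text \<open>Finite type is expressed by finiteness and sign coherence of the roots, the two facts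
  that a Lie algebra supplies directly; positive definiteness is then a consequence,
  \<open>form_pos\<close>.\<close>

locale finite_cartan =
  fixes C :: "int ^ 'i::finite ^ 'i" and d :: "'i \<Rightarrow> int"
  assumes diag: "C $ i $ i = 2"
    and offdiag: "i \<noteq> j \<Longrightarrow> C $ i $ j \<le> 0"
    and symm: "symmetrizer C d"
    and finite_roots: "finite (roots C)"
    and sign_coherent: "\<beta> \<in> roots C \<Longrightarrow> (\<forall>i. 0 \<le> \<beta> $ i) \<or> (\<forall>i. \<beta> $ i \<le> 0)"
begin

lemma d_pos: "0 < d i" and d_Gcd: "Gcd (range d) = 1" and d_sym: "d i * C $ i $ j = d j * C $ j $ i"
  using symm by (simp_all add: symmetrizer_def)

lemma refl_axis_self: "simple_reflection C i (axis i 1) = - axis i 1"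
  by (simp add: simple_reflection_def vec_eq_iff axis_nth mat_vec_axis diag)

lemma refl_axis: "simple_reflection C i (axis i c) = - axis i c"
  by (simp add: simple_reflection_def vec_eq_iff axis_nth mat_vec_axis diag)

lemma refl_refl [simp]: "simple_reflection C i (simple_reflection C i v) = v"
proof -
  have "simple_reflection C i (v + - axis i ((C *v v) $ i)) = simple_reflection C i v + axis i ((C *v v) $ i)"
    unfolding refl_add refl_neg refl_axis by simp
  then show ?thesis by (simp add: simple_reflection_def)
qed

lemma weyl_word_rev: "weyl_word C (rev w) (weyl_word C w x) = x"
  by (induction w arbitrary: x) (simp_all add: weyl_word_Cons weyl_word_append)

lemma weyl_word_rev': "weyl_word C w (weyl_word C (rev w) x) = x"
  using weyl_word_rev[of "rev w"] by simp

text \<open>The symmetric form with (\<alpha>_k, \<alpha>_l) = \<open>d k * C $ k $ l\<close>, so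
  that simple roots have norm \<open>2 * d k\<close>.\<close>

definition form :: "int ^ 'i \<Rightarrow> int ^ 'i \<Rightarrow> int" where
  "form x y = (\<Sum>k\<in>UNIV. d k * x $ k * (C *v y) $ k)"

lemma form_expand: "form x y = (\<Sum>k\<in>UNIV. \<Sum>l\<in>UNIV. d k * C $ k $ l * x $ k * y $ l)"
  unfolding form_def mat_vec_nth sum_distrib_left by (simp add: mult_ac)

lemma form_sym: "form x y = form y x"
proof -
  have "form x y = (\<Sum>l\<in>UNIV. \<Sum>k\<in>UNIV. d k * C $ k $ l * x $ k * y $ l)"
    unfolding form_expand by (rule sum.swap)
  also have "\<dots> = form y x"
    unfolding form_expand by (intro sum.cong refl) (simp add: d_sym mult_ac)
  finally show ?thesis .
qed

lemma form_add_left: "form (x + y) z = form x z + form y z"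
  unfolding form_def by (simp add: algebra_simps sum.distrib)

lemma form_smult_left: "form (c *s x) z = c * form x z"
  unfolding form_def by (simp add: sum_distrib_left mult_ac)

lemma form_smult_right: "form z (c *s x) = c * form z x"
  using form_smult_left form_sym by metis

lemma form_neg_left: "form (- x) z = - form x z"
  unfolding form_def by (simp add: sum_negf)

lemma form_neg_right: "form z (- x) = - form z x"
  using form_neg_left form_sym by metis

lemma form_diff_left: "form (x - y) z = form x z - form y z"
  using form_add_left[of x "- y" z] form_neg_left[of y z] by simp

lemma form_diff_right: "form z (x - y) = form z x - form z y"
  using form_diff_left form_sym by metis

lemma form_zero_left [simp]: "form 0 z = 0"
  unfolding form_def by simp

lemma form_sum_left: "finite A \<Longrightarrow> form (\<Sum>a\<in>A. f a) z = (\<Sum>a\<in>A. form (f a) z)"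
  by (induction A rule: finite_induct) (simp_all add: form_add_left)

lemma form_axis_left: "form (axis i c) y = c * d i * (C *v y) $ i"
proof -
  have "form (axis i c) y = (\<Sum>k\<in>UNIV. (d k * (C *v y) $ k) * axis i c $ k)"
    unfolding form_def by (simp add: mult_ac)
  then show ?thesis unfolding sum_axis_mult by (simp add: mult_ac)
qed

lemma form_refl: "form (simple_reflection C i x) (simple_reflection C i y) = form x y"
proof -
  have 1: "form (axis i a) (axis i b) = 2 * a * b * d i" for a b
    by (simp add: form_axis_left mat_vec_axis diag)
  have 2: "form x (axis i b) = b * d i * (C *v x) $ i" for x b
    using form_sym form_axis_left by metis
  show ?thesis
    unfolding simple_reflection_def form_diff_left form_diff_right form_axis_left 2
    by (simp add: mat_vec_axis diag algebra_simps)
qed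

lemma form_weyl: "form (weyl_word C w x) (weyl_word C w y) = form x y"
  by (induction w) (simp_all add: weyl_word_Cons form_refl)

lemma neg_root: "\<beta> \<in> roots C \<Longrightarrow> - \<beta> \<in> roots C"
proof -
  assume "\<beta> \<in> roots C"
  then obtain w i where "\<beta> = weyl_word C w (axis i 1)" using root_eq_weyl_word by blast
  then have "- \<beta> = weyl_word C w (simple_reflection C i (axis i 1))"
    by (simp add: refl_axis_self weyl_word_neg)
  then show ?thesis by (simp add: weyl_word_root refl_root axis_root)
qed

lemma root_norm: "\<beta> \<in> roots C \<Longrightarrow> \<exists>i. form \<beta> \<beta> = 2 * d i"
  using root_eq_weyl_word[of \<beta> C] by (auto simp: form_weyl form_axis_left mat_vec_axis diag)

lemma root_norm_pos: "\<beta> \<in> roots C \<Longrightarrow> 0 < form \<beta> \<beta>"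
  using root_norm d_pos by fastforce

lemma root_nonzero: "\<beta> \<in> roots C \<Longrightarrow> \<beta> \<noteq> 0"
  using root_norm_pos by fastforce

text \<open>This is \<beta>^\<or> = 2 \<beta> / (\<beta>,\<beta>) in coordinates, with \<alpha>_k =
  d_k \<alpha>_k^\<or>; clearing the denominator keeps it in the integers.\<close>

lemma coroot_eq: "root_coroot C \<beta> \<gamma> \<Longrightarrow> form \<beta> \<beta> * \<gamma> $ k = 2 * d k * \<beta> $ k"
proof (induction arbitrary: k rule: root_coroot.induct)
  case (simple i)
  show ?case by (auto simp: form_axis_left mat_vec_axis diag axis_nth)
next
  case (reflect \<beta> \<gamma> i)
  have "form \<beta> \<beta> * (transpose C *v \<gamma>) $ i = (\<Sum>k\<in>UNIV. C $ k $ i * (form \<beta> \<beta> * \<gamma> $ k))"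
    unfolding mat_vec_nth sum_distrib_left by (simp add: transpose_def mult_ac)
  also have "\<dots> = (\<Sum>k\<in>UNIV. 2 * (d k * C $ k $ i) * \<beta> $ k)"
    using reflect.IH by (simp add: mult_ac)
  also have "\<dots> = 2 * d i * (C *v \<beta>) $ i"
    unfolding d_sym[of _ i] mat_vec_nth sum_distrib_left by (simp add: mult_ac)
  finally show ?case
    unfolding form_refl refl_nth using reflect.IH[of k] by (simp add: right_diff_distrib)
qed

definition pairing :: "int ^ 'i \<Rightarrow> int ^ 'i \<Rightarrow> int" where
  "pairing \<gamma> x = (\<Sum>k\<in>UNIV. \<gamma> $ k * (C *v x) $ k)"

lemma pairing_eq:
  assumes "root_coroot C \<beta> \<gamma>"
  shows "form \<beta> \<beta> * pairing \<gamma> x = 2 * form \<beta> x"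
  unfolding pairing_def form_def[of \<beta> x] sum_distrib_left
  by (intro sum.cong refl) (metis coroot_eq[OF assms] mult.assoc)

lemma root_coroot_root: "root_coroot C \<beta> \<gamma> \<Longrightarrow> \<beta> \<in> roots C"
  unfolding roots_def by blast

text \<open>Reflections in arbitrary roots are conjugates of simple ones: passing from \<beta> to
  s_i \<beta> conjugates the reflection by s_i.\<close>

lemma root_reflection:
  assumes "root_coroot C \<beta> \<gamma>" "\<alpha> \<in> roots C"
  shows "\<alpha> - pairing \<gamma> \<alpha> *s \<beta> \<in> roots C"
  using assms
proof (induction arbitrary: \<alpha> rule: root_coroot.induct)
  case (simple i)
  have "pairing (axis i 1) \<alpha> = (C *v \<alpha>) $ i"
    unfolding pairing_def using sum_axis_mult[of "\<lambda>k. (C *v \<alpha>) $ k" i 1] by (simp add: mult.commute)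
  then have "\<alpha> - pairing (axis i 1) \<alpha> *s axis i 1 = simple_reflection C i \<alpha>"
    by (simp add: simple_reflection_def vec_eq_iff axis_nth)
  then show ?case using refl_root[OF simple] by simp
next
  case (reflect \<beta> \<gamma> i)
  let ?s = "simple_reflection C i"
  let ?\<gamma> = "simple_reflection (transpose C) i \<gamma>"
  have rc: "root_coroot C (?s \<beta>) ?\<gamma>" using reflect.hyps by (rule root_coroot.reflect)
  have "form \<beta> \<beta> * pairing ?\<gamma> \<alpha> = 2 * form (?s \<beta>) (?s (?s \<alpha>))"
    using pairing_eq[OF rc, of \<alpha>] by (simp add: form_refl)
  also have "\<dots> = form \<beta> \<beta> * pairing \<gamma> (?s \<alpha>)"
    unfolding form_refl pairing_eq[OF reflect.hyps] ..
  finally have "pairing ?\<gamma> \<alpha> = pairing \<gamma> (?s \<alpha>)"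
    using root_norm_pos[OF root_coroot_root[OF reflect.hyps]] by simp
  then have "\<alpha> - pairing ?\<gamma> \<alpha> *s ?s \<beta> = ?s (?s \<alpha> + - (pairing \<gamma> (?s \<alpha>) *s \<beta>))"
    unfolding refl_add refl_neg refl_smult by simp
  then show ?case using refl_root[OF reflect.IH[OF refl_root[OF reflect.prems, of i]], of i] by simp
qed

text \<open>The coroot of c \<alpha>_i has the integer coordinate 1/c at i.\<close>

lemma axis_multiple_root:
  assumes "axis i c \<in> roots C"
  shows "c = 1 \<or> c = - 1"
proof -
  obtain \<gamma> where "root_coroot C (axis i c) \<gamma>" using assms unfolding roots_def by blast
  from coroot_eq[OF this, of i] have "c * (2 * d i) * (c * \<gamma> $ i) = c * (2 * d i) * 1"
    by (simp add: form_axis_left mat_vec_axis diag axis_nth mult_ac)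
  moreover have "c \<noteq> 0" using root_nonzero[OF assms] by (auto simp: vec_eq_iff axis_nth)
  ultimately have "c * \<gamma> $ i = 1" using d_pos[of i] by (metis mult_cancel_left mult_eq_0_iff less_irrefl zero_neq_numeral)
  then show ?thesis using zmult_eq_1_iff by blast
qed

lemma axis_pos_root: "axis i 1 \<in> pos_roots C"
  by (simp add: pos_roots_def axis_root axis_nth)

lemma root_pos_or_neg: "\<beta> \<in> roots C \<Longrightarrow> \<beta> \<in> pos_roots C \<or> - \<beta> \<in> pos_roots C"
  using sign_coherent[of \<beta>] neg_root[of \<beta>] by (auto simp: pos_roots_def)

lemma not_pos_neg: "\<beta> \<in> pos_roots C \<Longrightarrow> - \<beta> \<notin> pos_roots C"
proof
  assume a: "\<beta> \<in> pos_roots C" "- \<beta> \<in> pos_roots C"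
  then have "\<beta> $ i = 0" for i by (auto simp: pos_roots_def intro: antisym)
  then show False using root_nonzero[of \<beta>] a by (simp add: pos_roots_def vec_eq_iff)
qed

text \<open>A positive root other than \<alpha>_i has a positive coordinate at some k different from
  i; s_i leaves it unchanged, and sign coherence does the rest.\<close>

lemma pos_root_refl:
  assumes \<beta>: "\<beta> \<in> pos_roots C" "\<beta> \<noteq> axis i 1"
  shows "simple_reflection C i \<beta> \<in> pos_roots C" "simple_reflection C i \<beta> \<noteq> axis i 1"
proof -
  have "\<exists>k. k \<noteq> i \<and> \<beta> $ k \<noteq> 0"
  proof (rule ccontr)
    assume *: "\<not> ?thesis"
    then have eq: "\<beta> = axis i (\<beta> $ i)" by (auto simp: vec_eq_iff axis_nth)
    have "\<beta> \<in> roots C" using \<beta>(1) by (simp add: pos_roots_def)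
    then have "\<beta> $ i = 1 \<or> \<beta> $ i = - 1" using axis_multiple_root[of i "\<beta> $ i"] eq by simp
    then have "\<beta> $ i = 1" using \<beta>(1) by (auto simp: pos_roots_def dest: spec[of _ i])
    then show False using eq \<beta>(2) by simp
  qed
  then obtain k where k: "k \<noteq> i" "\<beta> $ k > 0" using \<beta>(1) by (auto simp: pos_roots_def less_le)
  have r: "simple_reflection C i \<beta> \<in> roots C" using \<beta>(1) refl_root[of \<beta> C i] by (auto simp: pos_roots_def)
  have p: "simple_reflection C i \<beta> $ k > 0" using k by (simp add: refl_nth)
  then have "\<not> (\<forall>l. simple_reflection C i \<beta> $ l \<le> 0)" by (meson not_less)
  then show "simple_reflection C i \<beta> \<in> pos_roots C"
    using sign_coherent[OF r] r by (auto simp: pos_roots_def)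
  show "simple_reflection C i \<beta> \<noteq> axis i 1"
    using k p by (metis axis_nth less_irrefl)
qed

lemma refl_bij_pos: "bij_betw (simple_reflection C i) (pos_roots C - {axis i 1}) (pos_roots C - {axis i 1})"
  by (rule bij_betw_byWitness[where f' = "simple_reflection C i"]) (use pos_root_refl in auto)

lemma finite_pos_roots: "finite (pos_roots C)"
  using finite_roots by (simp add: pos_roots_def)

definition two_rho :: "int ^ 'i" where
  "two_rho = (\<Sum>\<beta>\<in>pos_roots C. \<beta>)"

text \<open>s_i permutes the positive roots other than \<alpha>_i and negates \<alpha>_i, hence
  s_i(2\<rho>) = 2\<rho> - 2\<alpha>_i.\<close>

lemma two_rho_pairing: "(C *v two_rho) $ i = 2"
proof -
  let ?P = "pos_roots C - {axis i 1}"
  have split: "two_rho = axis i 1 + (\<Sum>\<beta>\<in>?P. \<beta>)"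
    unfolding two_rho_def using finite_pos_roots axis_pos_root by (rule sum.remove)
  have "simple_reflection C i (\<Sum>\<beta>\<in>?P. \<beta>) = (\<Sum>\<beta>\<in>?P. simple_reflection C i \<beta>)"
    using weyl_word_sum[of ?P C "[i]" "\<lambda>\<beta>. \<beta>"] finite_pos_roots by (simp add: weyl_word_Cons)
  also have "\<dots> = (\<Sum>\<beta>\<in>?P. \<beta>)" using sum.reindex_bij_betw[OF refl_bij_pos, of "\<lambda>\<beta>. \<beta>" i] .
  finally have "simple_reflection C i two_rho = two_rho - axis i 2"
    unfolding split refl_add refl_axis_self by (simp add: vec_eq_iff axis_nth)
  then have "simple_reflection C i two_rho $ i = (two_rho - axis i 2) $ i" by simp
  then show ?thesis by (simp add: refl_nth axis_nth)
qed

lemma two_rho_pos: "0 < two_rho $ i"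
proof -
  have "axis i 1 $ i \<le> two_rho $ i"
    unfolding two_rho_def sum_component
    by (rule member_le_sum[OF axis_pos_root _ finite_pos_roots]) (simp add: pos_roots_def)
  then show ?thesis by (simp add: axis_nth)
qed

text \<open>Rescaling the coordinates by \<open>2\<rho>\<close> makes the Gram matrix diagonally dominant.\<close>

lemma form_pos:
  assumes "x \<noteq> 0"
  shows "0 < form x x"
proof -
  define \<sigma> where "\<sigma> k = real_of_int (two_rho $ k)" for k
  have \<sigma>: "\<sigma> k > 0" for k using two_rho_pos by (simp add: \<sigma>_def)
  define z where "z k = real_of_int (x $ k) / \<sigma> k" for k
  have x: "real_of_int (x $ k) = \<sigma> k * z k" for k using \<sigma>[of k] by (simp add: z_def)
  define M where "M k l = real_of_int (d k * C $ k $ l) * \<sigma> k * \<sigma> l" for k l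
  have Msym: "M k l = M l k" for k l unfolding M_def by (subst d_sym) (simp add: mult_ac)
  have row: "(\<Sum>l\<in>UNIV. M k l) = 2 * real_of_int (d k) * \<sigma> k" for k
  proof -
    have "(\<Sum>l\<in>UNIV. M k l) = real_of_int (d k) * \<sigma> k * real_of_int (\<Sum>l\<in>UNIV. C $ k $ l * two_rho $ l)"
      unfolding M_def \<sigma>_def of_int_sum sum_distrib_left by (simp add: mult_ac)
    also have "\<dots> = real_of_int (d k) * \<sigma> k * 2"
      using two_rho_pairing[of k] unfolding mat_vec_nth by simp
    finally show ?thesis by simp
  qed
  have col: "(\<Sum>k\<in>UNIV. \<Sum>l\<in>UNIV. M k l * z l * z l) = (\<Sum>k\<in>UNIV. \<Sum>l\<in>UNIV. M k l * z k * z k)"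
    by (subst sum.swap) (simp add: Msym)
  have "2 * real_of_int (form x x) = (\<Sum>k\<in>UNIV. \<Sum>l\<in>UNIV. 2 * M k l * z k * z l)"
    unfolding form_expand of_int_sum sum_distrib_left of_int_mult x M_def by (simp add: mult_ac)
  also have "\<dots> = (\<Sum>k\<in>UNIV. \<Sum>l\<in>UNIV. M k l * z k * z k + M k l * z l * z l - M k l * (z k - z l)\<^sup>2)"
    by (simp add: power2_eq_square algebra_simps)
  also have "\<dots> = 2 * (\<Sum>k\<in>UNIV. \<Sum>l\<in>UNIV. M k l * z k * z k) - (\<Sum>k\<in>UNIV. \<Sum>l\<in>UNIV. M k l * (z k - z l)\<^sup>2)"
    unfolding sum_subtractf sum.distrib col by simp
  also have "(\<Sum>k\<in>UNIV. \<Sum>l\<in>UNIV. M k l * z k * z k) = (\<Sum>k\<in>UNIV. 2 * real_of_int (d k) * \<sigma> k * (z k)\<^sup>2)"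
    unfolding sum_distrib_right[symmetric] row by (simp add: power2_eq_square mult_ac)
  finally have eq: "2 * real_of_int (form x x) = 2 * (\<Sum>k\<in>UNIV. 2 * real_of_int (d k) * \<sigma> k * (z k)\<^sup>2)
      - (\<Sum>k\<in>UNIV. \<Sum>l\<in>UNIV. M k l * (z k - z l)\<^sup>2)" .
  have "M k l * (z k - z l)\<^sup>2 \<le> 0" for k l
  proof (cases "k = l")
    case False
    then have "d k * C $ k $ l \<le> 0" using offdiag d_pos[of k] by (simp add: mult_le_0_iff less_imp_le)
    then have "M k l \<le> 0" unfolding M_def using \<sigma>
      by (smt (verit) mult_nonneg_nonneg mult_nonpos_nonneg of_int_le_0_iff)
    then show ?thesis by (simp add: mult_nonpos_nonneg)
  qed simp
  then have "(\<Sum>k\<in>UNIV. \<Sum>l\<in>UNIV. M k l * (z k - z l)\<^sup>2) \<le> 0" by (intro sum_nonpos) auto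
  moreover have "(\<Sum>k\<in>UNIV. 2 * real_of_int (d k) * \<sigma> k * (z k)\<^sup>2) > 0"
  proof -
    obtain k where "x $ k \<noteq> 0" using assms by (auto simp: vec_eq_iff)
    then have "z k \<noteq> 0" using \<sigma>[of k] by (simp add: z_def)
    then have "0 < 2 * real_of_int (d k) * \<sigma> k * (z k)\<^sup>2" using \<sigma>[of k] d_pos[of k] by simp
    moreover have "0 \<le> 2 * real_of_int (d k) * \<sigma> k * (z k)\<^sup>2" for k
      using \<sigma>[of k] d_pos[of k] by (simp add: less_imp_le)
    ultimately show ?thesis by (intro sum_pos2[of _ k]) auto
  qed
  ultimately show ?thesis using eq by linarith
qed

lemma cartan_injective: "C *v x = 0 \<Longrightarrow> x = 0"
  using form_pos[of x] by (auto simp: form_def)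

end

section \<open>Weyl group: inversions, longest element and the induced involution\<close>

context finite_cartan
begin

abbreviation W :: "(int ^ 'i \<Rightarrow> int ^ 'i) set" where
  "W \<equiv> range (weyl_word C)"

abbreviation srefl :: "'i \<Rightarrow> int ^ 'i \<Rightarrow> int ^ 'i" where
  "srefl \<equiv> simple_reflection C"

lemma pos_combination:
  assumes "\<beta> \<in> pos_roots C" "\<And>k. \<beta> $ k \<noteq> 0 \<Longrightarrow> 0 \<le> (f k :: int)"
  shows "0 \<le> (\<Sum>k\<in>UNIV. \<beta> $ k * f k)"
proof (rule sum_nonneg)
  fix k show "0 \<le> \<beta> $ k * f k"
    using assms by (cases "\<beta> $ k = 0") (auto simp: pos_roots_def)
qed

lemma weyl_word_nth_expand: "weyl_word C w \<beta> $ j = (\<Sum>k\<in>UNIV. \<beta> $ k * weyl_word C w (axis k 1) $ j)"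
proof -
  have "weyl_word C w \<beta> = (\<Sum>k\<in>UNIV. weyl_word C w (\<beta> $ k *s axis k 1))"
    using weyl_word_sum[of UNIV C w "\<lambda>k. \<beta> $ k *s axis k 1"] vec_axis_expand[of \<beta>] by simp
  then show ?thesis by (simp add: weyl_word_smult sum_component)
qed

lemma root_posI: "\<beta> \<in> roots C \<Longrightarrow> (\<And>k. 0 \<le> \<beta> $ k) \<Longrightarrow> \<beta> \<in> pos_roots C"
  by (simp add: pos_roots_def)

lemma weyl_pos_if_simple_pos:
  assumes "\<And>i. weyl_word C w (axis i 1) \<in> pos_roots C" "\<beta> \<in> pos_roots C"
  shows "weyl_word C w \<beta> \<in> pos_roots C"
proof (rule root_posI)
  show "weyl_word C w \<beta> \<in> roots C" using assms(2) weyl_word_root by (auto simp: pos_roots_def)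
  show "0 \<le> weyl_word C w \<beta> $ j" for j
    unfolding weyl_word_nth_expand[of w \<beta> j]
    by (rule pos_combination[OF assms(2)]) (use assms(1) in \<open>auto simp: pos_roots_def\<close>)
qed

lemma weyl_neg_if_simple_neg:
  assumes "\<And>i. - weyl_word C w (axis i 1) \<in> pos_roots C" "\<beta> \<in> pos_roots C"
  shows "- weyl_word C w \<beta> \<in> pos_roots C"
proof (rule root_posI)
  show "- weyl_word C w \<beta> \<in> roots C" using assms(2) weyl_word_root neg_root by (auto simp: pos_roots_def)
  fix j
  have "0 \<le> (\<Sum>k\<in>UNIV. \<beta> $ k * (- weyl_word C w (axis k 1) $ j))"
    by (rule pos_combination[OF assms(2)]) (use assms(1) in \<open>auto simp: pos_roots_def\<close>)
  then show "0 \<le> (- weyl_word C w \<beta>) $ j"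
    by (simp add: weyl_word_nth_expand[of w \<beta> j] sum_negf)
qed

lemma weyl_intertwine:
  assumes "weyl_word C w (axis i 1) = axis k 1"
  shows "srefl k (weyl_word C w x) = weyl_word C w (srefl i x)"
proof -
  have "form (axis k 1) (axis k 1) = form (axis i 1) (axis i 1)"
    unfolding assms[symmetric] form_weyl ..
  then have dk: "d k = d i" by (simp add: form_axis_left mat_vec_axis diag)
  have "form (axis k 1) (weyl_word C w x) = form (axis i 1) x"
    unfolding assms[symmetric] form_weyl ..
  then have "(C *v weyl_word C w x) $ k = (C *v x) $ i"
    using dk d_pos[of i] by (simp add: form_axis_left)
  then have "srefl k (weyl_word C w x) = weyl_word C w x + - weyl_word C w ((C *v x) $ i *s axis i 1)"
    unfolding weyl_word_smult assms by (simp add: vec_eq_iff refl_nth axis_nth)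
  also have "\<dots> = weyl_word C w (x + - ((C *v x) $ i *s axis i 1))"
    by (simp only: weyl_word_add weyl_word_neg)
  also have "x + - ((C *v x) $ i *s axis i 1) = srefl i x"
    by (simp add: simple_reflection_def vec_eq_iff axis_nth)
  finally show ?thesis .
qed

text \<open>Apply the letters from right to left to \<alpha>_i. At some letter k a positive root
  turns negative, so it was \<alpha>_k just before. For the part v to the right of that letter s_k v
  = v s_i, hence multiplying by s_i on the right deletes the letter.\<close>

lemma exchange:
  assumes "- weyl_word C w (axis i 1) \<in> pos_roots C"
  shows "\<exists>w'. length w' + 1 = length w \<and> weyl_word C w' = weyl_word C w \<circ> srefl i"
  using assms
proof (induction w)
  case Nil
  then show ?case using axis_pos_root[of i] not_pos_neg by auto
next
  case (Cons k w)
  let ?b = "weyl_word C w (axis i 1)"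
  show ?case
  proof (cases "- ?b \<in> pos_roots C")
    case True
    then obtain w' where "length w' + 1 = length w" "weyl_word C w' = weyl_word C w \<circ> srefl i"
      using Cons.IH by blast
    then show ?thesis by (intro exI[of _ "k # w'"]) (simp add: weyl_word_Cons comp_assoc)
  next
    case False
    then have b: "?b \<in> pos_roots C" using root_pos_or_neg weyl_word_root axis_root by blast
    have "?b = axis k 1"
    proof (rule ccontr)
      assume "?b \<noteq> axis k 1"
      then have "srefl k ?b \<in> pos_roots C" using pos_root_refl(1)[OF b] by blast
      then show False using Cons.prems not_pos_neg by (auto simp: weyl_word_Cons)
    qed
    then have "weyl_word C (k # w) \<circ> srefl i = weyl_word C w"
      using weyl_intertwine by (auto simp: weyl_word_Cons fun_eq_iff)
    then show ?thesis by (intro exI[of _ w]) simp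
  qed
qed

definition inv_count :: "(int ^ 'i \<Rightarrow> int ^ 'i) \<Rightarrow> nat" where
  "inv_count g = card {\<beta> \<in> pos_roots C. g \<beta> \<notin> pos_roots C}"

lemma inv_count_step:
  assumes "g \<in> W" "g (axis i 1) \<in> pos_roots C"
  shows "inv_count (g \<circ> srefl i) = inv_count g + 1"
proof -
  let ?A = "\<lambda>g. {\<beta> \<in> pos_roots C - {axis i 1}. g \<beta> \<notin> pos_roots C}"
  have gn: "g (- x) = - g x" for x using assms(1) weyl_word_neg by auto
  have "bij_betw (srefl i) (?A (g \<circ> srefl i)) (?A g)"
    by (rule bij_betw_byWitness[where f' = "srefl i"]) (use pos_root_refl in auto)
  then have 1: "card (?A (g \<circ> srefl i)) = card (?A g)" by (rule bij_betw_same_card)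
  have 2: "{\<beta> \<in> pos_roots C. g \<beta> \<notin> pos_roots C} = ?A g" using assms(2) by auto
  have "(g \<circ> srefl i) (axis i 1) \<notin> pos_roots C"
    using not_pos_neg[OF assms(2)] by (simp add: refl_axis_self gn)
  then have 3: "{\<beta> \<in> pos_roots C. (g \<circ> srefl i) \<beta> \<notin> pos_roots C} = insert (axis i 1) (?A (g \<circ> srefl i))"
    using axis_pos_root by auto
  have "finite (?A (g \<circ> srefl i))" using finite_pos_roots by auto
  then show ?thesis unfolding inv_count_def 2 3 1[symmetric] by (subst card_insert_disjoint) auto
qed

lemma W_comp: "g \<in> W \<Longrightarrow> h \<in> W \<Longrightarrow> g \<circ> h \<in> W"
  by (elim rangeE) (simp add: weyl_word_append[symmetric])

lemma refl_W: "srefl i \<in> W"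
  by (rule range_eqI[of _ _ "[i]"]) (simp add: weyl_word_Cons)

lemma id_W: "id \<in> W"
  by (rule range_eqI[of _ _ "[]"]) simp

lemma W_root: "g \<in> W \<Longrightarrow> \<beta> \<in> roots C \<Longrightarrow> g \<beta> \<in> roots C"
  using weyl_word_root by auto

lemma W_neg: "g \<in> W \<Longrightarrow> g (- x) = - g x"
  using weyl_word_neg by auto

lemma W_inverse: "g \<in> W \<Longrightarrow> \<exists>h\<in>W. h \<circ> g = id \<and> g \<circ> h = id"
proof -
  assume "g \<in> W"
  then obtain w where "g = weyl_word C w" by blast
  then show ?thesis
    by (intro bexI[of _ "weyl_word C (rev w)"]) (auto simp: fun_eq_iff weyl_word_rev weyl_word_rev')
qed

lemma inv_count_step':
  assumes "g \<in> W" "- g (axis i 1) \<in> pos_roots C"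
  shows "inv_count g = inv_count (g \<circ> srefl i) + 1"
proof -
  have "g \<circ> srefl i \<in> W" using W_comp assms(1) refl_W by blast
  moreover have "(g \<circ> srefl i) (axis i 1) \<in> pos_roots C" using assms by (simp add: refl_axis_self W_neg)
  ultimately have "inv_count (g \<circ> srefl i \<circ> srefl i) = inv_count (g \<circ> srefl i) + 1" by (rule inv_count_step)
  moreover have "g \<circ> srefl i \<circ> srefl i = g" by (simp add: fun_eq_iff)
  ultimately show ?thesis by simp
qed

lemma weyl_length_le: "weyl_length C (weyl_word C w) \<le> length w"
  unfolding weyl_length_def by (rule Least_le) blast

lemma weyl_length_word: "g \<in> W \<Longrightarrow> \<exists>w. length w = weyl_length C g \<and> weyl_word C w = g"
  unfolding weyl_length_def by (rule LeastI_ex) auto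

text \<open>Each letter changes the inversion number by one. In a shortest word the last letter must
  raise it, since otherwise \<open>exchange\<close> would produce a shorter word.\<close>

lemma weyl_length_eq_inv_count:
  assumes "g \<in> W"
  shows "weyl_length C g = inv_count g"
  using assms
proof (induction "weyl_length C g" arbitrary: g)
  case 0
  then have "g = id" using weyl_length_word[OF 0(2)] by auto
  then show ?case using 0 by (simp add: inv_count_def)
next
  case (Suc n)
  obtain w where w: "length w = Suc n" "weyl_word C w = g" using weyl_length_word[OF Suc(3)] Suc(2) by auto
  then obtain u i where u: "w = u @ [i]" by (metis length_0_conv nat.distinct(1) rev_exhaust)
  define h where "h = weyl_word C u"
  have g: "g = h \<circ> srefl i" using w(2) u by (simp add: weyl_word_append weyl_word_Cons h_def)
  have hW: "h \<in> W" by (simp add: h_def)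
  have min: "Suc n \<le> length v" if "weyl_word C v = g" for v
    using weyl_length_le[of v] that Suc(2) by simp
  have "weyl_length C h = n"
  proof (rule antisym)
    show "weyl_length C h \<le> n" using weyl_length_le[of u] w u by (simp add: h_def)
    obtain v where v: "length v = weyl_length C h" "weyl_word C v = h" using weyl_length_word[OF hW] by blast
    then have "weyl_word C (v @ [i]) = g" using g by (simp add: weyl_word_append weyl_word_Cons)
    then show "n \<le> weyl_length C h" using min v by fastforce
  qed
  then have IH: "n = inv_count h" using Suc(1)[of h] hW by simp
  have "- h (axis i 1) \<notin> pos_roots C"
  proof
    assume "- h (axis i 1) \<in> pos_roots C"
    then obtain v where "length v + 1 = length u" "weyl_word C v = h \<circ> srefl i"
      using exchange unfolding h_def by blast
    then show False using min[of v] g w u by simp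
  qed
  then have "h (axis i 1) \<in> pos_roots C" using root_pos_or_neg W_root[OF hW axis_root] by blast
  then show ?case using inv_count_step[OF hW] IH g Suc(2) by simp
qed

lemma inv_count_zero:
  assumes "g \<in> W" "inv_count g = 0"
  shows "g = id"
  using weyl_length_word[OF assms(1)] weyl_length_eq_inv_count[OF assms(1)] assms(2) by auto

lemma inv_count_le: "inv_count g \<le> card (pos_roots C)"
  unfolding inv_count_def by (rule card_mono) (use finite_pos_roots in auto)

lemma all_negative_if_inv_count_max:
  assumes "g \<in> W" "inv_count g = card (pos_roots C)" "\<beta> \<in> pos_roots C"
  shows "- g \<beta> \<in> pos_roots C"
proof -
  have "{\<beta> \<in> pos_roots C. g \<beta> \<notin> pos_roots C} = pos_roots C"
    using card_subset_eq[OF finite_pos_roots, of "{\<beta> \<in> pos_roots C. g \<beta> \<notin> pos_roots C}"] assms(2)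
    unfolding inv_count_def by auto
  then have "g \<beta> \<notin> pos_roots C" using assms(3) by blast
  moreover have "\<beta> \<in> roots C" using assms(3) by (simp add: pos_roots_def)
  ultimately show ?thesis using root_pos_or_neg[OF W_root[OF assms(1)], of \<beta>] by blast
qed

lemma exists_inv_count_max: "\<exists>g\<in>W. inv_count g = card (pos_roots C)"
proof -
  define n where "n = Max (inv_count ` W)"
  have fin: "finite (inv_count ` W)"
    by (rule finite_subset[of _ "{..card (pos_roots C)}"]) (use inv_count_le in auto)
  then have "n \<in> inv_count ` W" unfolding n_def using id_W by (intro Max_in) auto
  then obtain g where g: "g \<in> W" "inv_count g = n" by blast
  then obtain w where w: "g = weyl_word C w" by blast
  have "- weyl_word C w (axis i 1) \<in> pos_roots C" for i
  proof (rule ccontr)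
    assume "- weyl_word C w (axis i 1) \<notin> pos_roots C"
    then have "g (axis i 1) \<in> pos_roots C" using root_pos_or_neg[OF weyl_word_root[OF axis_root]] w by blast
    then have "inv_count (g \<circ> srefl i) = n + 1" using inv_count_step[OF g(1)] g(2) by simp
    moreover have "inv_count (g \<circ> srefl i) \<le> n"
      unfolding n_def using fin W_comp[OF g(1) refl_W] by (intro Max_ge) auto
    ultimately show False by simp
  qed
  then have "g \<beta> \<notin> pos_roots C" if "\<beta> \<in> pos_roots C" for \<beta>
    using weyl_neg_if_simple_neg[OF _ that, of w] not_pos_neg w by (metis add.inverse_inverse)
  then have "{\<beta> \<in> pos_roots C. g \<beta> \<notin> pos_roots C} = pos_roots C" by blast
  then show ?thesis using g(1) unfolding inv_count_def by (intro bexI[of _ g]) simp_all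
qed

text \<open>The quotient of two such elements keeps all positive roots positive, so it has no
  inversions.\<close>

lemma inv_count_max_unique:
  assumes "g \<in> W" "inv_count g = card (pos_roots C)" "g' \<in> W" "inv_count g' = card (pos_roots C)"
  shows "g = g'"
proof -
  obtain h where h: "h \<in> W" "h \<circ> g = id" "g \<circ> h = id" using W_inverse[OF assms(1)] by blast
  have hneg: "- h \<beta> \<in> pos_roots C" if "\<beta> \<in> pos_roots C" for \<beta>
  proof (rule ccontr)
    assume a: "- h \<beta> \<notin> pos_roots C"
    have "\<beta> \<in> roots C" using that by (simp add: pos_roots_def)
    then have "h \<beta> \<in> pos_roots C" using a root_pos_or_neg[OF W_root[OF h(1)]] by blast
    then have "- g (h \<beta>) \<in> pos_roots C" by (rule all_negative_if_inv_count_max[OF assms(1,2)])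
    then have "- \<beta> \<in> pos_roots C" using h(3) by (simp add: fun_eq_iff)
    then show False using not_pos_neg[OF that] by blast
  qed
  have "h (g' \<beta>) \<in> pos_roots C" if "\<beta> \<in> pos_roots C" for \<beta>
    using hneg[OF all_negative_if_inv_count_max[OF assms(3,4) that]] W_neg[OF h(1)] by simp
  then have "{\<beta> \<in> pos_roots C. (h \<circ> g') \<beta> \<notin> pos_roots C} = {}" by auto
  then have "inv_count (h \<circ> g') = 0" unfolding inv_count_def by (metis card.empty)
  then have "h \<circ> g' = id" using inv_count_zero W_comp[OF h(1) assms(3)] by blast
  then have "g \<circ> (h \<circ> g') = g" by simp
  then have "(g \<circ> h) \<circ> g' = g" by (simp only: comp_assoc)
  then show ?thesis using h(3) by simp
qed

lemma longest_element:
  "longest_element C \<in> W" "\<beta> \<in> pos_roots C \<Longrightarrow> - longest_element C \<beta> \<in> pos_roots C"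
proof -
  obtain g where g: "g \<in> W" "inv_count g = card (pos_roots C)" using exists_inv_count_max by blast
  have "longest_element C = g"
    unfolding longest_element_def
  proof (rule the_equality)
    show "g \<in> W \<and> (\<forall>g'\<in>W. weyl_length C g' \<le> weyl_length C g)"
      using g inv_count_le weyl_length_eq_inv_count by auto
    fix g' assume g': "g' \<in> W \<and> (\<forall>g''\<in>W. weyl_length C g'' \<le> weyl_length C g')"
    then have "inv_count g \<le> inv_count g'" using g(1) weyl_length_eq_inv_count by metis
    then have "inv_count g' = card (pos_roots C)" using g(2) inv_count_le[of g'] by simp
    then show "g' = g" using inv_count_max_unique g g' by blast
  qed
  then show "longest_element C \<in> W" "\<beta> \<in> pos_roots C \<Longrightarrow> - longest_element C \<beta> \<in> pos_roots C"
    using g all_negative_if_inv_count_max by auto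
qed

lemma longest_involution: "longest_element C (longest_element C x) = x"
proof -
  let ?g = "longest_element C"
  have "(?g \<circ> ?g) \<beta> \<in> pos_roots C" if "\<beta> \<in> pos_roots C" for \<beta>
    using longest_element(2)[OF longest_element(2)[OF that]] W_neg[OF longest_element(1)] by simp
  then have "{\<beta> \<in> pos_roots C. (?g \<circ> ?g) \<beta> \<notin> pos_roots C} = {}" by auto
  then have "inv_count (?g \<circ> ?g) = 0" unfolding inv_count_def by (metis card.empty)
  then have "?g \<circ> ?g = id" using inv_count_zero W_comp longest_element(1) by blast
  then show ?thesis by (simp add: fun_eq_iff)
qed

lemma axis_inject: "axis i (1::int) = axis j 1 \<longleftrightarrow> i = j"
  by (auto simp: vec_eq_iff axis_nth split: if_splits)

text \<open>The map -w_0 is an involution preserving the positive roots, so \<alpha>_j is a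
  nonnegative combination of the positive roots \<open>p k\<close> = -w_0 \<alpha>_k. Since
  \<alpha>_j is indecomposable, every \<open>p k\<close> that occurs equals \<alpha>_j.\<close>

lemma longest_simple: "\<exists>k. longest_element C (axis j 1) = - axis k 1"
proof -
  let ?g = "longest_element C"
  define \<beta> where "\<beta> = - ?g (axis j 1)"
  have \<beta>: "\<beta> \<in> pos_roots C" unfolding \<beta>_def by (rule longest_element(2)[OF axis_pos_root])
  obtain w where w: "?g = weyl_word C w" using longest_element(1) by blast
  define p where "p k = - ?g (axis k 1)" for k
  have p: "p k \<in> pos_roots C" for k unfolding p_def by (rule longest_element(2)[OF axis_pos_root])
  have nonneg: "0 \<le> p k $ l" "0 \<le> \<beta> $ k" for k l using p \<beta> by (auto simp: pos_roots_def)
  have "axis j 1 = - ?g \<beta>" unfolding \<beta>_def W_neg[OF longest_element(1)] by (simp add: longest_involution)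
  also have "?g \<beta> = (\<Sum>k\<in>UNIV. \<beta> $ k *s ?g (axis k 1))"
    unfolding w by (subst vec_axis_expand[of \<beta>]) (simp add: weyl_word_sum weyl_word_smult)
  finally have eq: "axis j 1 = (\<Sum>k\<in>UNIV. \<beta> $ k *s p k)" unfolding p_def by (simp add: sum_negf vec_eq_iff)
  have sub: "\<beta> $ k * p k $ l \<le> axis j 1 $ l" for k l
    unfolding eq sum_component using nonneg
    by (intro order_trans[OF _ member_le_sum[of k UNIV "\<lambda>k. (\<beta> $ k *s p k) $ l"]]) auto
  have ge: "1 \<le> p k $ l" if "p k $ l \<noteq> 0" for k l using nonneg(1)[of k l] that by linarith
  obtain k where k: "\<beta> $ k \<noteq> 0" using \<beta> root_nonzero by (auto simp: pos_roots_def vec_eq_iff)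
  then have k1: "1 \<le> \<beta> $ k" using nonneg(2)[of k] by linarith
  have supp: "p m $ l = 0" if "\<beta> $ m \<noteq> 0" "l \<noteq> j" for m l
  proof (rule ccontr)
    assume "p m $ l \<noteq> 0"
    then have "0 < \<beta> $ m * p m $ l" using ge[of m l] that nonneg(2)[of m] by (simp add: less_le)
    then show False using sub[of m l] that(2) by (simp add: axis_nth)
  qed
  have pm: "p m = axis j 1" if "\<beta> $ m \<noteq> 0" for m
  proof -
    have eqm: "p m = axis j (p m $ j)" using supp[OF that] by (auto simp: vec_eq_iff axis_nth)
    have "p m \<in> roots C" using p by (simp add: pos_roots_def)
    then have "p m $ j = 1 \<or> p m $ j = - 1" using axis_multiple_root[of j "p m $ j"] eqm by simp
    then have "p m $ j = 1" using nonneg(1)[of m j] by auto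
    then show ?thesis using eqm by simp
  qed
  have "p k = axis j 1" using pm[OF k] .
  have "?g (axis k 1) = - axis j 1" using pm[OF k] unfolding p_def by (metis add.inverse_inverse)
  then have "?g (?g (axis k 1)) = - ?g (axis j 1)" by (simp add: W_neg[OF longest_element(1)])
  then have "?g (axis j 1) = - axis k 1" by (metis longest_involution add.inverse_inverse)
  then show ?thesis by blast
qed

lemma longest_star: "longest_element C (axis j 1) = - axis (star C j) 1"
proof -
  obtain k where k: "longest_element C (axis j 1) = - axis k 1" using longest_simple by blast
  have "star C j = k" unfolding star_def by (rule the_equality) (use k in \<open>auto simp: axis_inject\<close>)
  then show ?thesis using k by simp
qed

lemma star_star: "star C (star C j) = j"
proof -
  have "axis j 1 = longest_element C (longest_element C (axis j 1))" by (simp add: longest_involution)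
  also have "\<dots> = axis (star C (star C j)) 1"
    unfolding longest_star W_neg[OF longest_element(1)] by simp
  finally show ?thesis by (simp add: axis_inject)
qed

lemma d_star: "d (star C j) = d j"
proof -
  obtain w where w: "longest_element C = weyl_word C w" using longest_element(1) by blast
  have "form (longest_element C (axis j 1)) (longest_element C (axis j 1)) = form (axis j 1) (axis j 1)"
    unfolding w form_weyl ..
  then show ?thesis unfolding longest_star by (simp add: form_neg_left form_neg_right form_axis_left mat_vec_axis diag)
qed

text \<open>An orbit contains at most one antidominant weight. A weight is represented by an
  additive functional \<open>f\<close> on the root lattice, its translate by
  \<open>f \<circ> u\<close>; the induction is on the inversions of the inverse
  \<open>u'\<close>.\<close>

lemma antidominant_unique_aux:
  assumes f: "\<And>x y. f (x + y) = f x + (f y :: int)" and anti: "\<And>\<beta>. \<beta> \<in> pos_roots C \<Longrightarrow> f \<beta> \<le> 0"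
    and u: "u \<in> W" "u' \<in> W" "u \<circ> u' = id" "u' \<circ> u = id"
    and anti': "\<And>\<beta>. \<beta> \<in> pos_roots C \<Longrightarrow> f (u \<beta>) \<le> 0"
  shows "f (u x) = f x"
  using u anti'
proof (induction "inv_count u'" arbitrary: u u' x)
  case 0
  then have "u' = id" using inv_count_zero by simp
  then show ?case using 0 by simp
next
  case (Suc n)
  have f0: "f 0 = 0" using f[of 0 0] by simp
  have fneg: "f (- x) = - f x" for x using f[of x "- x"] f0 by simp
  have "\<exists>i. - u' (axis i 1) \<in> pos_roots C"
  proof (rule ccontr)
    assume neg: "\<nexists>i. - u' (axis i 1) \<in> pos_roots C"
    obtain w where w: "u' = weyl_word C w" using Suc.prems(2) by blast
    have "u' (axis i 1) \<in> pos_roots C" for i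
      using neg root_pos_or_neg[OF W_root[OF Suc.prems(2) axis_root[of i]]] by blast
    then have "u' \<beta> \<in> pos_roots C" if "\<beta> \<in> pos_roots C" for \<beta>
      using weyl_pos_if_simple_pos[OF _ that, of w] w by simp
    then have "{\<beta> \<in> pos_roots C. u' \<beta> \<notin> pos_roots C} = {}" by blast
    then have "inv_count u' = 0" unfolding inv_count_def by (metis card.empty)
    then show False using Suc(2) by simp
  qed
  then obtain i where i: "- u' (axis i 1) \<in> pos_roots C" by blast
  \<comment> \<open>Antidominance of the translate at this positive root makes \<open>f\<close>
    nonnegative at \<alpha>_i, antidominance of \<open>f\<close> gives the opposite inequality. So
    s_i fixes \<open>f\<close> and can be absorbed into \<open>u\<close>.\<close>
  have "f (u (- u' (axis i 1))) \<le> 0" using Suc.prems(5)[OF i] .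
  then have "0 \<le> f (axis i 1)"
    using Suc.prems(3) W_neg[OF Suc.prems(1)] fneg by (simp add: fun_eq_iff)
  then have fi: "f (axis i 1) = 0" using anti[OF axis_pos_root[of i]] by simp
  have fnat: "f (axis i (int m)) = 0" for m
  proof (induction m)
    case 0
    have z: "axis i (int 0) = (0 :: int ^ 'i)" by (simp add: vec_eq_iff axis_nth)
    show ?case unfolding z by (rule f0)
  next
    case (Suc m)
    have "axis i (int (Suc m)) = axis i (int m) + axis i 1" by (simp add: vec_eq_iff axis_nth)
    then show ?case using f Suc fi by simp
  qed
  have faxis: "f (axis i c) = 0" for c
  proof (cases "0 \<le> c")
    case True
    then show ?thesis using fnat[of "nat c"] by simp
  next
    case False
    have "axis i c = - axis i (- c)" by (simp add: vec_eq_iff axis_nth)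
    then show ?thesis using False fneg[of "axis i (- c)"] fnat[of "nat (- c)"] by simp
  qed
  have fs: "f (srefl i x) = f x" for x
    using f[of "srefl i x" "axis i ((C *v x) $ i)"] faxis by (simp add: simple_reflection_def)
  have "inv_count (u' \<circ> srefl i) = n" using inv_count_step'[OF Suc.prems(2) i] Suc(2) by simp
  moreover have "srefl i \<circ> u \<in> W" "u' \<circ> srefl i \<in> W" using W_comp refl_W Suc.prems by blast+
  moreover have "(srefl i \<circ> u) \<circ> (u' \<circ> srefl i) = id" "(u' \<circ> srefl i) \<circ> (srefl i \<circ> u) = id"
    using Suc.prems(3,4) by (auto simp: fun_eq_iff)
  moreover have "f ((srefl i \<circ> u) \<beta>) \<le> 0" if "\<beta> \<in> pos_roots C" for \<beta>
    using Suc.prems(5)[OF that] by (simp add: fs)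
  ultimately have "f ((srefl i \<circ> u) x) = f x" using Suc(1)[of "u' \<circ> srefl i" "srefl i \<circ> u" x] by simp
  then show ?case by (simp add: fs)
qed

text \<open>Taking the coefficient at \<alpha>_j stands for \<omega>_j up to scale. Its translate by
  w_0 is antidominant, so any other antidominant translate coincides with that one.\<close>

lemma antidominant_weight:
  assumes "\<And>\<beta>. \<beta> \<in> pos_roots C \<Longrightarrow> weyl_word C w \<beta> $ j \<le> 0"
  shows "weyl_word C w (axis k 1) $ j = (if k = star C j then - 1 else 0)"
proof -
  let ?g = "longest_element C"
  define f where "f x = ?g x $ j" for x
  define u where "u = ?g \<circ> weyl_word C w"
  obtain v where v: "?g = weyl_word C v" using longest_element(1) by blast
  have u: "u \<in> W" unfolding u_def using W_comp longest_element(1) by blast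
  obtain u' where u': "u' \<in> W" "u \<circ> u' = id" "u' \<circ> u = id" using W_inverse[OF u] by blast
  have fu: "f (u x) = weyl_word C w x $ j" for x unfolding f_def u_def by (simp add: longest_involution)
  have "f (u (axis k 1)) = f (axis k 1)"
  proof (rule antidominant_unique_aux[of f u u'])
    show "f (x + y) = f x + f y" for x y unfolding f_def v by (simp add: weyl_word_add)
    show "f \<beta> \<le> 0" if "\<beta> \<in> pos_roots C" for \<beta>
      using longest_element(2)[OF that] by (auto simp: f_def pos_roots_def dest: spec[of _ j])
    show "f (u \<beta>) \<le> 0" if "\<beta> \<in> pos_roots C" for \<beta> using assms[OF that] by (simp add: fu)
  qed (use u u' in auto)
  then have "weyl_word C w (axis k 1) $ j = - axis (star C k) 1 $ j"
    unfolding fu by (simp add: f_def longest_star)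
  moreover have "j = star C k \<longleftrightarrow> k = star C j" using star_star by metis
  ultimately show ?thesis by (simp add: axis_nth)
qed

end

section \<open>Pairs of roots and their angles\<close>

context finite_cartan
begin

lemma adj_sym: "adj C i j \<Longrightarrow> adj C j i"
  using d_sym[of i j] d_pos[of i] d_pos[of j] unfolding adj_def
  by (metis mult_pos_neg mult_less_0_iff not_less_iff_gr_or_eq)

lemma root_proportional:
  assumes "\<alpha> \<in> roots C" "\<beta> \<in> roots C" "p *s \<alpha> = q *s \<beta>" "p \<noteq> 0"
  shows "\<alpha> = \<beta> \<or> \<alpha> = - \<beta>"
proof -
  obtain w i where w: "\<beta> = weyl_word C w (axis i 1)" using root_eq_weyl_word[OF assms(2)] by blast
  define \<alpha>' where "\<alpha>' = weyl_word C (rev w) \<alpha>"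
  have r: "\<alpha>' \<in> roots C" unfolding \<alpha>'_def by (rule weyl_word_root[OF assms(1)])
  have "p *s \<alpha>' = q *s weyl_word C (rev w) \<beta>"
    unfolding \<alpha>'_def weyl_word_smult[symmetric] assms(3) ..
  then have "p *s \<alpha>' = q *s axis i 1" unfolding w weyl_word_rev .
  then have "p * \<alpha>' $ k = q * axis i 1 $ k" for k by (metis vector_smult_component)
  then have "\<alpha>' $ k = 0" if "k \<noteq> i" for k using that assms(4) by (metis axis_nth mult_eq_0_iff)
  then have eq: "\<alpha>' = axis i (\<alpha>' $ i)" by (simp add: vec_eq_iff axis_nth)
  then have "\<alpha>' $ i = 1 \<or> \<alpha>' $ i = - 1" using axis_multiple_root[of i "\<alpha>' $ i"] r by simp
  moreover have "axis i (- 1 :: int) = - axis i 1" by (simp add: vec_eq_iff axis_nth)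
  ultimately have "\<alpha>' = axis i 1 \<or> \<alpha>' = - axis i 1" using eq by metis
  moreover have "\<alpha> = weyl_word C w \<alpha>'" unfolding \<alpha>'_def weyl_word_rev' ..
  ultimately show ?thesis unfolding w by (auto simp: weyl_word_neg)
qed

text \<open>Strict Cauchy-Schwarz: the product is an integer equal to 4 (\<alpha>,\<beta>)^2 /
  ((\<alpha>,\<alpha>) (\<beta>,\<beta>)) < 4.\<close>

lemma pairing_product:
  assumes "root_coroot C \<alpha> a" "root_coroot C \<beta> b" "\<alpha> \<noteq> \<beta>" "\<alpha> \<noteq> - \<beta>"
  shows "pairing b \<alpha> * pairing a \<beta> \<le> 3"
proof -
  have r: "\<alpha> \<in> roots C" "\<beta> \<in> roots C" using assms root_coroot_root by auto
  define x y z where "x = form \<alpha> \<alpha>" and "y = form \<beta> \<beta>" and "z = form \<alpha> \<beta>"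
  have xy: "0 < x" "0 < y" using r root_norm_pos by (auto simp: x_def y_def)
  \<comment> \<open>A multiple of the component of \<alpha> orthogonal to \<beta>; it vanishes only
    for proportional roots.\<close>
  define v where "v = y *s \<alpha> - z *s \<beta>"
  have "v \<noteq> 0" using root_proportional[OF r, of y z] xy assms(3,4) by (auto simp: v_def)
  then have "0 < form v v" by (rule form_pos)
  also have "form v v = y * (x * y - z * z)"
    unfolding v_def form_diff_left form_diff_right form_smult_left form_smult_right form_sym[of \<beta> \<alpha>]
    by (simp add: x_def y_def z_def algebra_simps)
  finally have "z * z < x * y" using xy by (simp add: zero_less_mult_iff)
  moreover have "y * pairing b \<alpha> = 2 * z" "x * pairing a \<beta> = 2 * z"
    using pairing_eq[OF assms(1), of \<beta>] pairing_eq[OF assms(2), of \<alpha>] form_sym[of \<beta> \<alpha>]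
    by (simp_all add: x_def y_def z_def)
  then have "(y * pairing b \<alpha>) * (x * pairing a \<beta>) = 4 * (z * z)" by simp
  then have "(x * y) * (pairing b \<alpha> * pairing a \<beta>) = 4 * (z * z)" by (simp add: mult_ac)
  ultimately have "(x * y) * (pairing b \<alpha> * pairing a \<beta>) < (x * y) * 4" by simp
  then show ?thesis using xy by (simp add: mult_less_cancel_left)
qed

lemma pairing_pos:
  assumes "root_coroot C \<beta> b" "0 < form \<beta> x"
  shows "0 < pairing b x"
  using pairing_eq[OF assms(1), of x] assms(2) root_norm_pos[OF root_coroot_root[OF assms(1)]]
  by (metis mult_pos_pos zero_less_mult_pos zero_less_numeral)

text \<open>Both pairings are positive with product at most 3, so one of them is 1, and the
  corresponding reflection subtracts one root from the other.\<close>

lemma diff_root: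
  assumes "\<alpha> \<in> roots C" "\<beta> \<in> roots C" "0 < form \<alpha> \<beta>" "\<alpha> \<noteq> \<beta>"
  shows "\<alpha> - \<beta> \<in> roots C"
proof -
  obtain a b where ab: "root_coroot C \<alpha> a" "root_coroot C \<beta> b" using assms by (auto simp: roots_def)
  have "\<alpha> \<noteq> - \<beta>" using assms(3) root_norm_pos[OF assms(2)] by (auto simp: form_neg_left)
  then have le: "pairing b \<alpha> * pairing a \<beta> \<le> 3" using pairing_product[OF ab assms(4)] by blast
  have pos: "0 < pairing b \<alpha>" "0 < pairing a \<beta>"
    using pairing_pos[OF ab(2), of \<alpha>] pairing_pos[OF ab(1), of \<beta>] assms(3) form_sym by auto
  have "pairing b \<alpha> = 1 \<or> pairing a \<beta> = 1"
  proof (rule ccontr)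
    assume "\<not> ?thesis"
    then have "2 * 2 \<le> pairing b \<alpha> * pairing a \<beta>" using pos by (intro mult_mono) auto
    then show False using le by simp
  qed
  then show ?thesis
  proof
    assume "pairing b \<alpha> = 1"
    then show ?thesis using root_reflection[OF ab(2) assms(1)] by simp
  next
    assume "pairing a \<beta> = 1"
    then have "\<beta> - \<alpha> \<in> roots C" using root_reflection[OF ab(1) assms(2)] by simp
    from neg_root[OF this] show ?thesis by simp
  qed
qed

lemma cartan_product_le: "i \<noteq> j \<Longrightarrow> C $ i $ j * C $ j $ i \<le> 3"
proof -
  assume ij: "i \<noteq> j"
  have p: "pairing (axis i 1) (axis j 1) = C $ i $ j" for i j
    unfolding pairing_def using sum_axis_mult[of "\<lambda>k. (C *v axis j 1) $ k" i 1]
    by (simp add: mult.commute mat_vec_axis)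
  have "axis j 1 \<noteq> (axis i 1 :: int ^ 'i)" "axis j 1 \<noteq> (- axis i 1 :: int ^ 'i)"
    using ij by (auto simp: vec_eq_iff axis_nth)
  then show ?thesis
    using pairing_product[OF root_coroot.simple[of C j] root_coroot.simple[of C i]] by (simp add: p)
qed

end

section \<open>Irreducible root systems\<close>

locale connected_cartan = finite_cartan C d
  for C :: "int ^ 'i::finite ^ 'i" and d :: "'i \<Rightarrow> int" +
  assumes connected: "S \<noteq> {} \<Longrightarrow> S \<noteq> UNIV \<Longrightarrow> \<exists>i\<in>S. \<exists>j\<in>- S. adj C i j"
begin

definition height :: "int ^ 'i \<Rightarrow> int" where
  "height \<beta> = (\<Sum>i\<in>UNIV. \<beta> $ i)"

lemma height_add: "height (x + y) = height x + height y"
  by (simp add: height_def sum.distrib)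

lemma height_axis: "height (axis i c) = c"
  unfolding height_def using sum_axis_mult[of "\<lambda>_. 1" i c] by simp

definition dominant :: "int ^ 'i \<Rightarrow> bool" where
  "dominant \<beta> \<longleftrightarrow> (\<forall>i. 0 \<le> (C *v \<beta>) $ i)"

lemma form_dominant: "dominant \<beta> \<Longrightarrow> (\<And>i. 0 \<le> x $ i) \<Longrightarrow> 0 \<le> form x \<beta>"
  unfolding form_def dominant_def using d_pos by (intro sum_nonneg) (auto simp: less_imp_le)

lemma dominant_root_pos: "\<beta> \<in> roots C \<Longrightarrow> dominant \<beta> \<Longrightarrow> \<beta> \<in> pos_roots C"
proof (rule ccontr)
  assume a: "\<beta> \<in> roots C" "dominant \<beta>" "\<beta> \<notin> pos_roots C"
  then have "- \<beta> \<in> pos_roots C" using root_pos_or_neg by blast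
  then have "0 \<le> form (- \<beta>) \<beta>" using form_dominant[OF a(2), of "- \<beta>"] by (auto simp: pos_roots_def)
  then show False using root_norm_pos[OF a(1)] by (simp add: form_neg_left)
qed

text \<open>At a vertex outside the support but adjacent to it, \<open>C *v \<beta>\<close> would be
  negative; connectedness provides such a vertex if the support is proper.\<close>

lemma dominant_root_support:
  assumes "\<beta> \<in> roots C" "dominant \<beta>"
  shows "0 < \<beta> $ i"
proof -
  have p: "\<beta> \<in> pos_roots C" by (rule dominant_root_pos[OF assms])
  then have nn: "0 \<le> \<beta> $ k" for k by (simp add: pos_roots_def)
  let ?S = "{k. \<beta> $ k \<noteq> 0}"
  have "?S \<noteq> {}" using root_nonzero[OF assms(1)] by (auto simp: vec_eq_iff)
  moreover have False if nU: "?S \<noteq> UNIV"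
  proof -
    obtain k j where kj: "k \<in> ?S" "j \<in> - ?S" "adj C k j"
      using connected[OF \<open>?S \<noteq> {}\<close> nU] by blast
    have le: "0 \<le> - (C $ j $ l * \<beta> $ l)" for l
      using offdiag[of j l] nn[of l] kj(2) by (cases "l = j") (auto simp: mult_le_0_iff)
    have "0 < \<beta> $ k" using kj(1) nn[of k] by (simp add: less_le)
    moreover have "C $ j $ k < 0" using adj_sym[OF kj(3)] by (simp add: adj_def)
    ultimately have "0 < - (C $ j $ k * \<beta> $ k)" by (simp add: mult_neg_pos)
    then have "0 < (\<Sum>l\<in>UNIV. - (C $ j $ l * \<beta> $ l))"
      using le by (intro sum_pos2[of _ k]) auto
    moreover have "0 \<le> (C *v \<beta>) $ j" using assms(2) by (simp add: dominant_def)
    ultimately show False by (simp add: mat_vec_nth sum_negf)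
  qed
  ultimately have "\<beta> $ i \<noteq> 0" by blast
  then show ?thesis using nn[of i] by simp
qed

text \<open>This makes dominant roots comparable: the difference of two distinct ones is a root, and
  the ratio of their lengths is bounded.\<close>

lemma form_dominant_roots:
  assumes "\<alpha> \<in> roots C" "dominant \<alpha>" "\<beta> \<in> roots C" "dominant \<beta>"
  shows "0 < form \<alpha> \<beta>"
proof -
  have "C *v \<beta> \<noteq> 0" using cartan_injective root_nonzero[OF assms(3)] by blast
  then obtain k where "(C *v \<beta>) $ k \<noteq> 0" by (auto simp: vec_eq_iff)
  then have "0 < (C *v \<beta>) $ k" using assms(4) by (auto simp: dominant_def less_le)
  then have "0 < d k * \<alpha> $ k * (C *v \<beta>) $ k" using dominant_root_support[OF assms(1,2), of k] d_pos[of k] by simp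
  moreover have "0 \<le> d l * \<alpha> $ l * (C *v \<beta>) $ l" for l
    using dominant_root_support[OF assms(1,2), of l] d_pos[of l] assms(4) by (simp add: dominant_def less_imp_le)
  ultimately show ?thesis unfolding form_def by (intro sum_pos2[of _ k]) auto
qed

text \<open>A root of greatest height among those above \<beta> is dominant: if
  \<open>C *v \<alpha>\<close> were negative at i, then \<alpha> + \<alpha>_i would be a
  root.\<close>

lemma dominant_above:
  assumes "\<beta> \<in> roots C"
  shows "\<exists>\<alpha>\<in>roots C. dominant \<alpha> \<and> (\<forall>i. \<beta> $ i \<le> \<alpha> $ i)"
proof -
  let ?A = "{\<alpha> \<in> roots C. \<forall>i. \<beta> $ i \<le> \<alpha> $ i}"
  have "finite ?A" "?A \<noteq> {}" using finite_roots assms by auto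
  then have "Max (height ` ?A) \<in> height ` ?A" by (intro Max_in) auto
  then obtain \<alpha> where \<alpha>: "\<alpha> \<in> ?A" "height \<alpha> = Max (height ` ?A)" by auto
  then have \<alpha>: "\<alpha> \<in> ?A" "\<And>x. x \<in> ?A \<Longrightarrow> height x \<le> height \<alpha>"
    using \<open>finite ?A\<close> by (auto intro: Max_ge)
  have "0 \<le> (C *v \<alpha>) $ i" for i
  proof (rule ccontr)
    assume neg: "\<not> 0 \<le> (C *v \<alpha>) $ i"
    \<comment> \<open>\<open>diff_root\<close> does not cover this case; here \<alpha>_i itself lies
      above \<beta> and has greater height than \<alpha>.\<close>
    have "\<alpha> \<noteq> - axis i 1"
    proof
      assume eq: "\<alpha> = - axis i 1"
      have "\<beta> $ k \<le> axis i 1 $ k" for k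
        using \<alpha>(1) unfolding eq by (auto simp: axis_nth split: if_splits dest: spec[of _ k])
      then have "height (axis i 1) \<le> height \<alpha>" using \<alpha>(2)[of "axis i 1"] axis_root by blast
      moreover have "\<alpha> = axis i (- 1)" unfolding eq by (simp add: vec_eq_iff axis_nth)
      ultimately show False by (simp add: height_axis)
    qed
    moreover have "0 < form (- axis i 1) \<alpha>" using neg d_pos[of i] by (simp add: form_neg_left form_axis_left mult_pos_neg)
    then have "0 < form \<alpha> (- axis i 1)" by (simp add: form_sym)
    ultimately have "\<alpha> - - axis i 1 \<in> roots C"
      using diff_root[OF _ neg_root[OF axis_root[of i]]] \<alpha>(1) by blast
    moreover have "\<beta> $ k \<le> (\<alpha> - - axis i 1) $ k" for k
      using \<alpha>(1) by (auto simp: axis_nth intro: order_trans)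
    ultimately have "\<alpha> - - axis i 1 \<in> ?A" by blast
    then have "height (\<alpha> - - axis i 1) \<le> height \<alpha>" by (rule \<alpha>(2))
    then show False by (simp add: height_add height_axis)
  qed
  then show ?thesis using \<alpha>(1) by (auto simp: dominant_def)
qed

lemma dominant_conjugate: "\<exists>w. dominant (weyl_word C w \<beta>)" if "\<beta> \<in> roots C"
proof -
  let ?A = "range (\<lambda>w. weyl_word C w \<beta>)"
  have fin: "finite ?A" by (rule finite_subset[OF _ finite_roots]) (use weyl_word_root[OF that] in auto)
  define m where "m = Max (height ` ?A)"
  have "m \<in> height ` ?A" unfolding m_def using fin by (intro Max_in) auto
  then obtain w where w: "height (weyl_word C w \<beta>) = m" by auto
  have "0 \<le> (C *v weyl_word C w \<beta>) $ i" for i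
  proof -
    have "height (weyl_word C (i # w) \<beta>) \<le> m"
      unfolding m_def using fin by (intro Max_ge) auto
    moreover have "weyl_word C (i # w) \<beta> = weyl_word C w \<beta> + axis i (- (C *v weyl_word C w \<beta>) $ i)"
      by (simp add: weyl_word_Cons simple_reflection_def vec_eq_iff axis_nth)
    ultimately show ?thesis using w by (simp add: height_add height_axis)
  qed
  then show ?thesis by (auto simp: dominant_def)
qed

section \<open>Root lengths and the lacing number\<close>

lemma dominant_conjugate_simple: "\<exists>\<beta>\<in>roots C. dominant \<beta> \<and> form \<beta> \<beta> = 2 * d i"
proof -
  obtain w where "dominant (weyl_word C w (axis i 1))" using dominant_conjugate[OF axis_root] by blast
  moreover have "form (weyl_word C w (axis i 1)) (weyl_word C w (axis i 1)) = 2 * d i"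
    unfolding form_weyl by (simp add: form_axis_left mat_vec_axis diag)
  ultimately show ?thesis using weyl_word_root[OF axis_root] by blast
qed

text \<open>\<open>p\<close> and \<open>q\<close> are the two pairings of dominant roots with these
  lengths, or 1 if the roots coincide. This compares \<open>d\<close> at arbitrary vertices, not
  only at adjacent ones.\<close>

lemma d_ratio: "\<exists>p q. 0 < p \<and> 0 < q \<and> p * q \<le> 3 \<and> p * d i = q * d j"
proof -
  obtain \<alpha> \<beta> where \<alpha>: "\<alpha> \<in> roots C" "dominant \<alpha>" "form \<alpha> \<alpha> = 2 * d i"
    and \<beta>: "\<beta> \<in> roots C" "dominant \<beta>" "form \<beta> \<beta> = 2 * d j"
    using dominant_conjugate_simple by metis
  obtain a b where ab: "root_coroot C \<alpha> a" "root_coroot C \<beta> b" using \<alpha> \<beta> by (auto simp: roots_def)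
  have pos: "0 < form \<alpha> \<beta>" by (rule form_dominant_roots[OF \<alpha>(1,2) \<beta>(1,2)])
  show ?thesis
  proof (cases "\<alpha> = \<beta>")
    case True
    then show ?thesis using \<alpha>(3) \<beta>(3) by (intro exI[of _ 1]) simp
  next
    case False
    have "\<alpha> \<noteq> - \<beta>" using pos root_norm_pos[OF \<beta>(1)] by (auto simp: form_neg_left)
    then have "pairing b \<alpha> * pairing a \<beta> \<le> 3" using pairing_product[OF ab False] by blast
    moreover have "0 < pairing b \<alpha>" "0 < pairing a \<beta>"
      using pairing_pos[OF ab(2), of \<alpha>] pairing_pos[OF ab(1), of \<beta>] pos form_sym by auto
    moreover have "pairing a \<beta> * d i = pairing b \<alpha> * d j"
      using pairing_eq[OF ab(1), of \<beta>] pairing_eq[OF ab(2), of \<alpha>] form_sym[of \<alpha> \<beta>] \<alpha>(3) \<beta>(3) by (simp add: mult.commute)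
    ultimately show ?thesis by (metis mult.commute)
  qed
qed

definition dmax :: int where "dmax = Max (range d)"

lemma d_le_dmax: "d i \<le> dmax"
  unfolding dmax_def by simp

lemma dmax_attained: "\<exists>i. d i = dmax"
proof -
  have "dmax \<in> range d" unfolding dmax_def by (intro Max_in) auto
  then show ?thesis by auto
qed

lemma exists_d_one: "\<exists>i. d i = 1"
proof -
  define m where "m = Min (range d)"
  have "m \<in> range d" unfolding m_def by (intro Min_in) auto
  then obtain i where i: "m = d i" by blast
  have "m dvd d k" for k
  proof -
    obtain p q where pq: "0 < p" "0 < q" "p * q \<le> 3" "p * d k = q * d i" using d_ratio by blast
    have "d i \<le> d k" unfolding i[symmetric] m_def by simp
    have "p = 1"
    proof (rule ccontr)
      assume "p \<noteq> 1"
      then have "2 \<le> p" using pq(1) by simp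
      have "q = 1"
      proof (rule ccontr)
        assume "q \<noteq> 1"
        then have "2 * 2 \<le> p * q" using \<open>2 \<le> p\<close> pq(2) by (intro mult_mono) auto
        then show False using pq(3) by simp
      qed
      then have "2 * d k \<le> d i" using \<open>2 \<le> p\<close> pq(4) d_pos[of k] by (metis mult_1 mult_right_mono less_imp_le)
      then show False using \<open>d i \<le> d k\<close> d_pos[of i] by simp
    qed
    then show ?thesis using pq(4) i by simp
  qed
  then have "m dvd Gcd (range d)" by (auto intro: Gcd_greatest)
  then have "m = 1" using d_Gcd d_pos[of i] i by simp
  then show ?thesis using i by metis
qed

lemma d_values: "d k = 1 \<or> d k = dmax" and dmax_le: "dmax \<le> 3"
proof -
  obtain i where i: "d i = 1" using exists_d_one by blast
  have le: "d l \<in> {1, 2, 3}" for l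
  proof -
    obtain p q where pq: "0 < p" "0 < q" "p * q \<le> 3" "p * d l = q" using d_ratio[of l i] i by auto
    have "1 * 1 \<le> p * p" using pq(1) by (intro mult_mono) auto
    then have "1 * d l \<le> p * p * d l" using d_pos[of l] by (intro mult_right_mono) auto
    also have "\<dots> \<le> 3" using pq by (simp add: mult.assoc)
    finally show ?thesis using d_pos[of l] by auto
  qed
  obtain m where m: "d m = dmax" using dmax_attained by blast
  then show "dmax \<le> 3" using le[of m] by auto
  show "d k = 1 \<or> d k = dmax"
  proof (rule ccontr)
    assume a: "\<not> ?thesis"
    then have "d k = 2" "d m = 3" using le[of k] le[of m] d_le_dmax[of k] m by auto
    moreover obtain p q where pq: "0 < p" "0 < q" "p * q \<le> 3" "p * d k = q * d m" using d_ratio by blast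
    \<comment> \<open>Three lengths 1, 2, 3 would need the ratio 3/2, which is incompatible with
      \<open>p * q \<le> 3\<close>.\<close>
    ultimately have "2 * p = 3 * q" by simp
    then have "2 * (p * q) = 3 * (q * q)" by (metis mult.assoc)
    then have "3 * (q * q) \<le> 6" using pq(3) by linarith
    moreover have "q \<ge> 2" using \<open>2 * p = 3 * q\<close> pq by presburger
    then have "2 * 2 \<le> q * q" by (intro mult_mono) auto
    ultimately show False by linarith
  qed
qed

lemma adj_cases:
  assumes "adj C i j"
  obtains "d i = d j" "C $ i $ j = - 1" "C $ j $ i = - 1"
  | "d i = 1" "d j = dmax" "1 < dmax" "C $ i $ j = - dmax" "C $ j $ i = - 1"
  | "d j = 1" "d i = dmax" "1 < dmax" "C $ j $ i = - dmax" "C $ i $ j = - 1"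
proof -
  define a b where "a = - C $ i $ j" and "b = - C $ j $ i"
  have ab: "1 \<le> a" "1 \<le> b" using assms adj_sym[OF assms] by (auto simp: adj_def a_def b_def)
  have prod: "a * b \<le> 3" using cartan_product_le[of i j] assms by (simp add: a_def b_def adj_def)
  have sym: "d i * a = d j * b" using d_sym[of i j] by (simp add: a_def b_def)
  have sq: "x = 1" if "1 \<le> x" "c * (x * x) \<le> 3" "1 \<le> c" for x c :: int
  proof (rule ccontr)
    assume "x \<noteq> 1"
    then have "2 * 2 \<le> x * x" using that(1) by (intro mult_mono) auto
    then have "1 * 4 \<le> c * (x * x)" using that(3) by (intro mult_mono) auto
    then show False using that(2) by simp
  qed
  consider "d i = d j" | "d i = 1" "d j = dmax" "1 < dmax" | "d j = 1" "d i = dmax" "1 < dmax"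
    using d_values[of i] d_values[of j] d_le_dmax[of i] d_le_dmax[of j] by force
  then show ?thesis
  proof cases
    case 1
    then have "a = b" using sym d_pos[of j] by simp
    then show ?thesis using that(1) 1 sq[of b 1] prod ab by (simp add: a_def b_def)
  next
    case 2
    then have "a = dmax * b" using sym by simp
    then have "b = 1" using sq[of b dmax] prod ab 2 by (simp add: mult.assoc)
    then show ?thesis using that(2) 2 \<open>a = dmax * b\<close> by (simp add: a_def b_def)
  next
    case 3
    then have "b = dmax * a" using sym by simp
    then have "a = 1" using sq[of a dmax] prod ab 3 by (simp add: mult_ac)
    then show ?thesis using that(3) 3 \<open>b = dmax * a\<close> by (simp add: a_def b_def)
  qed
qed

text \<open>If there are two lengths, connectedness provides an edge between vertices of different
  length, and its multiplicity is \<open>dmax\<close>.\<close>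

lemma lacing_number_eq: "int (lacing_number C) = dmax"
proof -
  let ?A = "{nat (C $ i $ j * C $ j $ i) | i j. adj C i j}"
  have dp: "1 \<le> dmax" using d_le_dmax d_pos by (metis order_trans zless_imp_add1_zle add_0)
  have fin: "finite ?A"
    by (rule finite_subset[of _ "(\<lambda>(i, j). nat (C $ i $ j * C $ j $ i)) ` UNIV"]) auto
  have le: "x \<le> nat dmax" if "x \<in> insert 1 ?A" for x
  proof (cases "x = 1")
    case False
    then have "x \<in> ?A" using that by blast
    then obtain i j where ij: "x = nat (C $ i $ j * C $ j $ i)" "adj C i j" by blast
    from ij(2) show ?thesis by (cases rule: adj_cases) (use ij(1) dp in auto)
  qed (use dp in simp)
  have mem: "nat dmax \<in> insert 1 ?A"
  proof (cases "dmax = 1")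
    case False
    obtain m where m: "d m = dmax" using dmax_attained by blast
    have "{k. d k = 1} \<noteq> {}" using exists_d_one by blast
    moreover have "{k. d k = 1} \<noteq> UNIV" using m False by (metis (mono_tags) UNIV_I mem_Collect_eq)
    ultimately obtain i j where ij: "d i = 1" "d j \<noteq> 1" "adj C i j"
      using connected[of "{k. d k = 1}"] by auto
    from ij(3) have "C $ i $ j * C $ j $ i = dmax" by (cases rule: adj_cases) (use ij in auto)
    then have "nat dmax \<in> ?A" using ij(3) by force
    then show ?thesis by blast
  qed simp
  have "lacing_number C = nat dmax"
    unfolding lacing_number_def by (rule Max_eqI) (use fin le mem in auto)
  then show ?thesis using dp by simp
qed

section \<open>Highest root and dual Coxeter number\<close>

lemma highest_root_exists: "\<exists>\<theta>. highest_root C \<theta> \<and> dominant \<theta> \<and> \<theta> \<in> roots C"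
proof -
  have "finite (height ` roots C)" "height ` roots C \<noteq> {}" using finite_roots axis_root by auto
  then have "Max (height ` roots C) \<in> height ` roots C" by (rule Max_in)
  then obtain \<theta>' where \<theta>': "\<theta>' \<in> roots C" "height \<theta>' = Max (height ` roots C)" by auto
  then have hmax: "height x \<le> height \<theta>'" if "x \<in> roots C" for x using that finite_roots by auto
  obtain \<theta> where \<theta>: "\<theta> \<in> roots C" "dominant \<theta>" "\<forall>i. \<theta>' $ i \<le> \<theta> $ i"
    using dominant_above[OF \<theta>'(1)] by blast
  have "height \<theta>' \<le> height \<theta>" unfolding height_def using \<theta>(3) by (intro sum_mono) auto
  then have hmax: "height x \<le> height \<theta>" if "x \<in> roots C" for x using hmax[OF that] by simp
  have "\<beta> $ i \<le> \<theta> $ i" if \<beta>: "\<beta> \<in> roots C" for \<beta> i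
  proof -
    obtain \<alpha> where \<alpha>: "\<alpha> \<in> roots C" "dominant \<alpha>" "\<beta> $ i \<le> \<alpha> $ i" using dominant_above[OF \<beta>] by blast
    have "\<alpha> $ i \<le> \<theta> $ i"
    proof (cases "\<alpha> = \<theta>")
      case False
      \<comment> \<open>Distinct dominant roots differ by a root, and that root is positive because
        \<theta> has maximal height.\<close>
      have "\<theta> - \<alpha> \<in> roots C"
        using diff_root[OF \<theta>(1) \<alpha>(1) form_dominant_roots[OF \<theta>(1,2) \<alpha>(1,2)]] False by blast
      then consider "\<theta> - \<alpha> \<in> pos_roots C" | "\<alpha> - \<theta> \<in> pos_roots C" using root_pos_or_neg by force
      then show ?thesis
      proof cases
        case 1
        then have "0 \<le> (\<theta> - \<alpha>) $ i" unfolding pos_roots_def by blast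
        then show ?thesis by simp
      next
        case 2
        have "height (\<alpha> - \<theta>) > 0"
        proof -
          obtain k where "(\<alpha> - \<theta>) $ k \<noteq> 0" using False by (auto simp: vec_eq_iff)
          then show ?thesis unfolding height_def using 2 by (intro sum_pos2[of _ k]) (auto simp: pos_roots_def less_le)
        qed
        then have "height \<theta> < height \<alpha>" using height_add[of "\<alpha> - \<theta>" \<theta>] by simp
        then show ?thesis using hmax[OF \<alpha>(1)] by simp
      qed
    qed simp
    then show ?thesis using \<alpha>(3) by simp
  qed
  then have "highest_root C \<theta>" using \<theta>(1) unfolding highest_root_def roots_def by blast
  then show ?thesis using \<theta> by blast
qed

lemma highest_root_unique: "highest_root C \<theta> \<Longrightarrow> highest_root C \<theta>' \<Longrightarrow> \<theta> = \<theta>'"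
  unfolding highest_root_def vec_eq_iff by (meson antisym)

lemma coroot_unique:
  assumes "root_coroot C \<beta> \<gamma>" "root_coroot C \<beta> \<gamma>'"
  shows "\<gamma> = \<gamma>'"
proof -
  have "form \<beta> \<beta> * \<gamma> $ k = form \<beta> \<beta> * \<gamma>' $ k" for k
    using coroot_eq[OF assms(1), of k] coroot_eq[OF assms(2), of k] by simp
  then show ?thesis using root_norm_pos[OF root_coroot_root[OF assms(1)]] by (auto simp: vec_eq_iff)
qed

text \<open>A dominant conjugate b of \<beta> satisfies (b,b) \<le> (\<theta>,b) \<le>
  (\<theta>,\<theta>), since \<theta> - b has nonnegative coordinates.\<close>

lemma highest_root_long:
  assumes "highest_root C \<theta>" "dominant \<theta>" "\<theta> \<in> roots C" "\<beta> \<in> roots C"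
  shows "form \<beta> \<beta> \<le> form \<theta> \<theta>"
proof -
  obtain w where w: "dominant (weyl_word C w \<beta>)" using dominant_conjugate[OF assms(4)] by blast
  let ?b = "weyl_word C w \<beta>"
  have r: "?b \<in> roots C" by (rule weyl_word_root[OF assms(4)])
  then have "?b $ i \<le> \<theta> $ i" for i using assms(1) unfolding highest_root_def roots_def by blast
  then have nn: "0 \<le> (\<theta> - ?b) $ i" for i by simp
  have "0 \<le> form (\<theta> - ?b) \<theta>" "0 \<le> form (\<theta> - ?b) ?b"
    using form_dominant[OF assms(2), of "\<theta> - ?b"] form_dominant[OF w, of "\<theta> - ?b"] nn by blast+
  then have "form ?b ?b \<le> form \<theta> \<theta>" using form_sym[of \<theta> ?b] by (simp add: form_diff_left)
  then show ?thesis by (simp add: form_weyl)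
qed

lemma highest_root_norm:
  assumes "highest_root C \<theta>" "dominant \<theta>" "\<theta> \<in> roots C"
  shows "form \<theta> \<theta> = 2 * dmax"
proof -
  obtain i where i: "form \<theta> \<theta> = 2 * d i" using root_norm[OF assms(3)] by blast
  obtain m where m: "d m = dmax" using dmax_attained by blast
  have "form (axis m 1) (axis m 1) \<le> form \<theta> \<theta>" by (rule highest_root_long[OF assms axis_root])
  then show ?thesis using i m d_le_dmax[of i] by (simp add: form_axis_left mat_vec_axis diag)
qed

text \<open>A self-adjoint operator commuting with the Weyl group; irreducibility makes it a scalar,
  and this scalar carries the dual Coxeter number.\<close>

definition casimir :: "int ^ 'i \<Rightarrow> int ^ 'i" where
  "casimir x = (\<Sum>\<beta>\<in>roots C. form x \<beta> *s \<beta>)"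

lemma casimir_nth: "casimir x $ k = (\<Sum>\<beta>\<in>roots C. form x \<beta> * \<beta> $ k)"
  by (simp add: casimir_def sum_component)

lemma casimir_refl: "casimir (srefl i x) = srefl i (casimir x)"
proof -
  have bij: "bij_betw (srefl i) (roots C) (roots C)"
    by (rule bij_betw_byWitness[where f' = "srefl i"]) (use refl_root in auto)
  have "casimir (srefl i x) = (\<Sum>\<beta>\<in>roots C. form (srefl i x) (srefl i \<beta>) *s srefl i \<beta>)"
    unfolding casimir_def using sum.reindex_bij_betw[OF bij, of "\<lambda>\<beta>. form (srefl i x) \<beta> *s \<beta>"] by simp
  also have "\<dots> = srefl i (casimir x)"
    unfolding casimir_def using weyl_word_sum[OF finite_roots, of C "[i]" "\<lambda>\<beta>. form x \<beta> *s \<beta>"]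
    by (simp add: weyl_word_Cons form_refl refl_smult)
  finally show ?thesis .
qed

lemma casimir_form: "form (casimir x) y = (\<Sum>\<beta>\<in>roots C. form x \<beta> * form \<beta> y)"
  unfolding casimir_def by (simp add: form_sum_left[OF finite_roots] form_smult_left)

lemma casimir_form_sym: "form (casimir x) y = form (casimir y) x"
  unfolding casimir_form by (intro sum.cong refl) (metis form_sym mult.commute)

lemma casimir_smult: "casimir (c *s x) = c *s casimir x"
  by (simp add: vec_eq_iff casimir_nth form_smult_left sum_distrib_left mult.assoc)

lemma casimir_add: "casimir (x + y) = casimir x + casimir y"
  by (simp add: vec_eq_iff casimir_nth form_add_left distrib_right sum.distrib)

lemma casimir_axis_aux: "casimir (axis i 1) = axis i (casimir (axis i 1) $ i)"
proof -
  let ?v = "casimir (axis i 1)"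
  have "casimir (- axis i 1) = - ?v"
    by (simp add: vec_eq_iff casimir_nth form_neg_left sum_negf)
  then have "srefl i ?v = - ?v" using casimir_refl[of i "axis i 1"] by (simp add: refl_axis_self)
  then have neg: "srefl i ?v $ k = - ?v $ k" for k by simp
  have "?v $ k = 0" if "k \<noteq> i" for k
  proof -
    have "srefl i ?v $ k = ?v $ k" using that by (simp add: refl_nth)
    then show ?thesis using neg[of k] by simp
  qed
  then show ?thesis by (simp add: vec_eq_iff axis_nth)
qed

text \<open>Schur's lemma by hand: commuting with s_i, the operator preserves the line of
  \<alpha>_i; being self-adjoint, it has equal eigenvalues at adjacent vertices.\<close>

lemma casimir_scalar: "\<exists>c. \<forall>x. casimir x = c *s x"
proof -
  define e where "e i = casimir (axis i 1) $ i" for i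
  have ax: "casimir (axis i 1) = axis i (e i)" for i unfolding e_def by (rule casimir_axis_aux)
  have adj: "e i = e j" if "adj C i j" for i j
  proof -
    have "e i * d i * C $ i $ j = e j * d j * C $ j $ i"
      using casimir_form_sym[of "axis i 1" "axis j 1"] unfolding ax form_axis_left mat_vec_axis by simp
    then have "e i * (d i * C $ i $ j) = e j * (d i * C $ i $ j)"
      using d_sym[of i j] by (simp add: mult.assoc)
    moreover have "d i * C $ i $ j \<noteq> 0" using that d_pos[of i] by (simp add: adj_def)
    ultimately show ?thesis by simp
  qed
  obtain i0 :: 'i where True by blast
  have "e j = e i0" for j
  proof -
    have "{k. e k = e i0} = UNIV"
    proof (rule ccontr)
      assume "{k. e k = e i0} \<noteq> UNIV"
      moreover have "{k. e k = e i0} \<noteq> {}" by blast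
      ultimately obtain i j where "e i = e i0" "e j \<noteq> e i0" "adj C i j"
        using connected[of "{k. e k = e i0}"] by blast
      then show False using adj by metis
    qed
    then show ?thesis by blast
  qed
  then have ax': "casimir (axis i 1) = e i0 *s axis i 1" for i
    using ax[of i] by (simp add: vec_eq_iff axis_nth)
  have "casimir x = e i0 *s x" for x
  proof -
    have c0: "casimir 0 = 0" by (simp add: casimir_def)
    have "casimir (\<Sum>i\<in>A. x $ i *s axis i 1) = e i0 *s (\<Sum>i\<in>A. x $ i *s axis i 1)" if "finite A" for A
      using that
    proof (induction A rule: finite_induct)
      case empty
      then show ?case using c0 by simp
    next
      case (insert a A)
      then show ?case by (simp add: casimir_add casimir_smult ax' vec_eq_iff algebra_simps)
    qed
    from this[of UNIV] show ?thesis using vec_axis_expand[of x] by simp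
  qed
  then show ?thesis by blast
qed

lemma sum_roots_pos:
  assumes "\<And>\<beta>. f (- \<beta>) = (f \<beta> :: int)"
  shows "(\<Sum>\<beta>\<in>roots C. f \<beta>) = 2 * (\<Sum>\<beta>\<in>pos_roots C. f \<beta>)"
proof -
  have eq: "roots C = pos_roots C \<union> uminus ` pos_roots C"
  proof (intro equalityI subsetI)
    fix x assume "x \<in> roots C"
    then consider "x \<in> pos_roots C" | "- x \<in> pos_roots C" using root_pos_or_neg by blast
    then show "x \<in> pos_roots C \<union> uminus ` pos_roots C"
      by cases (auto intro: image_eqI[of _ _ "- x"])
  next
    fix x assume "x \<in> pos_roots C \<union> uminus ` pos_roots C"
    then show "x \<in> roots C" using neg_root by (auto simp: pos_roots_def)
  qed
  have "pos_roots C \<inter> uminus ` pos_roots C = {}" using not_pos_neg by auto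
  then have "(\<Sum>\<beta>\<in>roots C. f \<beta>) = (\<Sum>\<beta>\<in>pos_roots C. f \<beta>) + (\<Sum>\<beta>\<in>uminus ` pos_roots C. f \<beta>)"
    unfolding eq using finite_pos_roots by (intro sum.union_disjoint) auto
  also have "(\<Sum>\<beta>\<in>uminus ` pos_roots C. f \<beta>) = (\<Sum>\<beta>\<in>pos_roots C. f \<beta>)"
    by (subst sum.reindex) (auto simp: inj_on_def assms)
  finally show ?thesis by simp
qed

text \<open>The scalar is computed on \<theta>. A positive root other than \<theta> pairs with
  \<theta>^\<or> to 0 or 1, which is its own square, while \<theta> itself pairs to 2. So the sum of
  the squares over the positive roots is that of the pairings plus 2, that is, the pairing of
  2\<rho> with \<theta>^\<or> plus 2, or 2 h^\<or>.\<close>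

lemma dual_coxeter_casimir:
  "(\<Sum>\<beta>\<in>pos_roots C. d i * (C *v \<beta>) $ i * \<beta> $ k)
    = (if k = i then int (lacing_number C * dual_coxeter_number C) else 0)"
proof -
  obtain \<theta> where \<theta>: "highest_root C \<theta>" "dominant \<theta>" "\<theta> \<in> roots C" using highest_root_exists by blast
  obtain \<gamma> where \<gamma>: "root_coroot C \<theta> \<gamma>" using \<theta>(3) by (auto simp: roots_def)
  obtain c where c: "casimir x = c *s x" for x using casimir_scalar by blast
  have D: "form \<theta> \<theta> = 2 * dmax" by (rule highest_root_norm[OF \<theta>])
  have Dpos: "0 < dmax" using root_norm_pos[OF \<theta>(3)] D by simp
  have \<theta>p: "\<theta> \<in> pos_roots C" by (rule dominant_root_pos[OF \<theta>(3,2)])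
  have pt: "dmax * pairing \<gamma> x = form \<theta> x" for x using pairing_eq[OF \<gamma>, of x] D by simp
  have p\<theta>: "pairing \<gamma> \<theta> = 2" using pt[of \<theta>] D Dpos by simp
  have sq: "pairing \<gamma> \<beta> * pairing \<gamma> \<beta> = pairing \<gamma> \<beta> + (if \<beta> = \<theta> then 2 else 0)"
    if \<beta>: "\<beta> \<in> pos_roots C" for \<beta>
  proof (cases "\<beta> = \<theta>")
    case False
    have r: "\<beta> \<in> roots C" using \<beta> by (simp add: pos_roots_def)
    obtain b where b: "root_coroot C \<beta> b" using r by (auto simp: roots_def)
    have "0 \<le> form \<beta> \<theta>" using form_dominant[OF \<theta>(2), of \<beta>] \<beta> by (simp add: pos_roots_def)
    then have "0 \<le> dmax * pairing \<gamma> \<beta>" using pt[of \<beta>] form_sym[of \<beta> \<theta>] by simp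
    then have nn: "0 \<le> pairing \<gamma> \<beta>" using Dpos by (simp add: zero_le_mult_iff)
    have "\<theta> \<noteq> - \<beta>" using not_pos_neg[OF \<beta>] \<theta>p by metis
    then have le: "pairing \<gamma> \<beta> * pairing b \<theta> \<le> 3"
      using pairing_product[OF b \<gamma>] False by (metis add.inverse_inverse)
    have bb: "0 < form \<beta> \<beta>" by (rule root_norm_pos[OF r])
    have "form \<beta> \<beta> * pairing b \<theta> = form \<theta> \<theta> * pairing \<gamma> \<beta>"
      using pairing_eq[OF b, of \<theta>] pairing_eq[OF \<gamma>, of \<beta>] form_sym[of \<beta> \<theta>] by simp
    also have "\<dots> \<ge> form \<beta> \<beta> * pairing \<gamma> \<beta>"
      using highest_root_long[OF \<theta> r] nn by (rule mult_right_mono)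
    finally have ge: "pairing \<gamma> \<beta> \<le> pairing b \<theta>" using bb by simp
    have "pairing \<gamma> \<beta> < 2"
    proof (rule ccontr)
      assume "\<not> ?thesis"
      then have "2 * 2 \<le> pairing \<gamma> \<beta> * pairing b \<theta>" using ge by (intro mult_mono) auto
      then show False using le by simp
    qed
    then have "pairing \<gamma> \<beta> = 0 \<or> pairing \<gamma> \<beta> = 1" using nn by auto
    then show ?thesis using False by auto
  qed (simp add: p\<theta>)
  have sum1: "(\<Sum>\<beta>\<in>pos_roots C. pairing \<gamma> \<beta>) = 2 * (\<Sum>k\<in>UNIV. \<gamma> $ k)"
  proof -
    have "dmax * (\<Sum>\<beta>\<in>pos_roots C. pairing \<gamma> \<beta>) = form two_rho \<theta>"
      unfolding sum_distrib_left pt two_rho_def form_sum_left[OF finite_pos_roots] by (simp add: form_sym)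
    also have "\<dots> = dmax * pairing \<gamma> two_rho" using pt form_sym by metis
    also have "pairing \<gamma> two_rho = 2 * (\<Sum>k\<in>UNIV. \<gamma> $ k)"
      unfolding pairing_def two_rho_pairing by (simp add: sum_distrib_left mult.commute)
    finally show ?thesis using Dpos by simp
  qed
  have sum2: "(\<Sum>\<beta>\<in>pos_roots C. pairing \<gamma> \<beta> * pairing \<gamma> \<beta>) = 2 * (1 + (\<Sum>k\<in>UNIV. \<gamma> $ k))"
  proof -
    have "(\<Sum>\<beta>\<in>pos_roots C. pairing \<gamma> \<beta> * pairing \<gamma> \<beta>)
        = (\<Sum>\<beta>\<in>pos_roots C. pairing \<gamma> \<beta> + (if \<beta> = \<theta> then 2 else 0))"
      using sq by (intro sum.cong) auto
    then show ?thesis using \<theta>p finite_pos_roots by (simp add: sum.distrib sum1)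
  qed
  have "c * (2 * dmax) = form (casimir \<theta>) \<theta>" by (simp add: c form_smult_left D)
  also have "\<dots> = 2 * (\<Sum>\<beta>\<in>pos_roots C. form \<theta> \<beta> * form \<beta> \<theta>)"
    unfolding casimir_form by (rule sum_roots_pos) (simp add: form_neg_left form_neg_right)
  also have "(\<Sum>\<beta>\<in>pos_roots C. form \<theta> \<beta> * form \<beta> \<theta>) = dmax * dmax * (2 * (1 + (\<Sum>k\<in>UNIV. \<gamma> $ k)))"
    unfolding sum2[symmetric] sum_distrib_left
    by (intro sum.cong refl) (metis pt form_sym mult.assoc mult.left_commute)
  finally have c_eq: "c = 2 * (dmax * (1 + (\<Sum>k\<in>UNIV. \<gamma> $ k)))" using Dpos by simp
  have "0 \<le> \<gamma> $ k" for k
  proof -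
    have "0 \<le> 2 * d k * \<theta> $ k" using \<theta>p d_pos[of k] by (simp add: pos_roots_def less_imp_le)
    then have "0 \<le> form \<theta> \<theta> * \<gamma> $ k" using coroot_eq[OF \<gamma>, of k] by simp
    then show ?thesis using root_norm_pos[OF \<theta>(3)] by (simp add: zero_le_mult_iff)
  qed
  then have "0 \<le> (\<Sum>k\<in>UNIV. \<gamma> $ k)" by (intro sum_nonneg) auto
  moreover have "dual_coxeter_number C = nat (1 + (\<Sum>k\<in>UNIV. \<gamma> $ k))"
    unfolding dual_coxeter_number_def
  proof (rule the_equality)
    show "\<exists>\<theta> \<gamma>'. highest_root C \<theta> \<and> root_coroot C \<theta> \<gamma>' \<and> int (nat (1 + (\<Sum>k\<in>UNIV. \<gamma> $ k))) = 1 + (\<Sum>k\<in>UNIV. \<gamma>' $ k)"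
      using \<theta>(1) \<gamma> calculation by (intro exI[of _ \<theta>] exI[of _ \<gamma>]) simp
    fix h assume "\<exists>\<theta> \<gamma>'. highest_root C \<theta> \<and> root_coroot C \<theta> \<gamma>' \<and> int h = 1 + (\<Sum>k\<in>UNIV. \<gamma>' $ k)"
    then obtain \<theta>' \<gamma>' where *: "highest_root C \<theta>'" "root_coroot C \<theta>' \<gamma>'" "int h = 1 + (\<Sum>k\<in>UNIV. \<gamma>' $ k)" by blast
    then have "\<gamma>' = \<gamma>" using highest_root_unique[OF \<theta>(1) *(1)] coroot_unique \<gamma> by metis
    then show "h = nat (1 + (\<Sum>k\<in>UNIV. \<gamma> $ k))" using *(3) by simp
  qed
  ultimately have h: "int (dual_coxeter_number C) = 1 + (\<Sum>k\<in>UNIV. \<gamma> $ k)" by simp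
  have "2 * (\<Sum>\<beta>\<in>pos_roots C. form (axis i 1) \<beta> * \<beta> $ k) = casimir (axis i 1) $ k"
    unfolding casimir_nth by (rule sum_roots_pos[symmetric]) (simp add: form_neg_right)
  also have "\<dots> = (if k = i then c else 0)" unfolding c by (simp add: axis_nth)
  also have "c = 2 * int (lacing_number C * dual_coxeter_number C)"
    unfolding c_eq of_nat_mult lacing_number_eq h by simp
  finally have "(\<Sum>\<beta>\<in>pos_roots C. form (axis i 1) \<beta> * \<beta> $ k)
      = (if k = i then int (lacing_number C * dual_coxeter_number C) else 0)" by (auto split: if_splits)
  then show ?thesis by (simp add: form_axis_left)
qed

end

section \<open>The Cartan matrix of a simple Lie algebra\<close>

context complex_lie_algebra
begin

lemma bracket_add_left: "bracket (x + y) z = bracket x z + bracket y z"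
  and bracket_scale_left: "bracket (scale c x) z = scale c (bracket x z)"
  using linear_left by (simp_all add: Vector_Spaces.linear_def module_hom_def module_hom_axioms_def)

lemma bracket_add_right: "bracket z (x + y) = bracket z x + bracket z y"
  and bracket_scale_right: "bracket z (scale c x) = scale c (bracket z x)"
  using linear_right by (simp_all add: Vector_Spaces.linear_def module_hom_def module_hom_axioms_def)

lemma bracket_zero_left: "bracket 0 z = 0" and bracket_zero_right: "bracket z 0 = 0"
  using bracket_add_left[of 0 0 z] bracket_add_right[of z 0 0] by simp_all

lemma bracket_anti: "bracket x y = - bracket y x"
proof -
  have "bracket (x + y) (x + y) = bracket x y + bracket y x"
    unfolding bracket_add_left bracket_add_right by (simp add: alternating)
  then show ?thesis by (simp add: alternating eq_neg_iff_add_eq_0)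
qed

lemma bracket_neg_left: "bracket (- x) z = - bracket x z"
  using bracket_add_left[of x "- x" z] bracket_zero_left[of z] by (simp add: eq_neg_iff_add_eq_0 add.commute)

lemma bracket_neg_right: "bracket z (- x) = - bracket z x"
  using bracket_add_right[of z x "- x"] bracket_zero_right[of z] by (simp add: eq_neg_iff_add_eq_0 add.commute)

lemma bracket_sum_right: "finite A \<Longrightarrow> bracket z (\<Sum>a\<in>A. f a) = (\<Sum>a\<in>A. bracket z (f a))"
  by (induction rule: finite_induct) (simp_all add: bracket_zero_right bracket_add_right)

lemma derivation: "bracket h (bracket x y) = bracket (bracket h x) y + bracket x (bracket h y)"
proof -
  have 1: "bracket x (bracket y h) = - bracket x (bracket h y)"
    unfolding bracket_anti[of y h] by (rule bracket_neg_right)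
  have 2: "bracket y (bracket h x) = - bracket (bracket h x) y" by (rule bracket_anti)
  show ?thesis using jacobi[of h x y] unfolding 1 2 by (simp add: algebra_simps)
qed

lemma bracket_root_space:
  assumes "x \<in> root_space H a" "y \<in> root_space H b"
  shows "bracket x y \<in> root_space H (\<lambda>h. a h + b h)"
  using assms unfolding root_space_def
  by (simp add: derivation bracket_scale_left bracket_scale_right scale_left_distrib)

text \<open>The functionals only matter through their values on \<open>H\<close>.\<close>

lemma finite_weights:
  assumes fd: "\<exists>B. finite B \<and> span B = UNIV"
    and v: "\<And>i. i \<in> I \<Longrightarrow> v i \<noteq> 0 \<and> v i \<in> root_space H (c i)"
    and c: "\<And>i k. i \<in> I \<Longrightarrow> k \<in> I \<Longrightarrow> i \<noteq> k \<Longrightarrow> \<exists>h\<in>H. c i h \<noteq> c k h"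
  shows "finite I"
proof -
  have inj: "inj_on v I"
  proof (rule inj_onI, rule ccontr)
    fix i k assume ik: "i \<in> I" "k \<in> I" "v i = v k" "i \<noteq> k"
    from c[OF ik(1,2,4)] obtain h where h: "h \<in> H" "c i h \<noteq> c k h" by (elim bexE)
    have "scale (c i h) (v i) = bracket h (v i)" using v[OF ik(1)] h(1) by (simp add: root_space_def)
    also have "\<dots> = scale (c k h) (v i)" unfolding ik(3) using v[OF ik(2)] h(1) by (simp add: root_space_def)
    finally have "c i h = c k h \<or> v i = 0" by (rule scale_cancel_right[THEN iffD1])
    then show False using h(2) v[OF ik(1)] by simp
  qed
  have ind: "independent (v ` K)" if "finite K" "K \<subseteq> I" for K
    using that
  proof (induction rule: finite_induct)
    case (insert k K)
    then have K: "K \<subseteq> I" "k \<in> I" "independent (v ` K)" by simp_all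
    have "v k \<notin> span (v ` K)"
    proof
      assume "v k \<in> span (v ` K)"
      then obtain u where u: "v k = (\<Sum>w\<in>v ` K. scale (u w) w)"
        using span_finite[of "v ` K"] insert.hyps(1) by auto
      have injK: "inj_on v K" using inj K(1) by (rule inj_on_subset)
      have u': "v k = (\<Sum>i\<in>K. scale (u (v i)) (v i))"
        unfolding u by (simp add: sum.reindex[OF injK])
      have "u (v i) = 0" if i: "i \<in> K" for i
      proof -
        have "i \<in> I" "i \<noteq> k" using i K insert.hyps(2) by auto
        from c[OF this(1) K(2) this(2)] obtain h where h: "h \<in> H" "c i h \<noteq> c k h" by (elim bexE)
        have e: "bracket h (v l) = scale (c l h) (v l)" if "l \<in> I" for l
          using v[OF that] h(1) by (simp add: root_space_def)
        have "(\<Sum>l\<in>K. scale (u (v l) * c l h) (v l)) = bracket h (v k)"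
          unfolding u' bracket_sum_right[OF insert.hyps(1)] bracket_scale_right
          by (rule sum.cong) (use e K(1) in \<open>simp_all add: subset_iff\<close>)
        also have "\<dots> = (\<Sum>l\<in>K. scale (u (v l) * c k h) (v l))"
          unfolding e[OF K(2)] by (subst u') (simp add: scale_sum_right mult.commute)
        finally have "(\<Sum>l\<in>K. scale (u (v l) * (c l h - c k h)) (v l)) = 0"
          by (simp add: right_diff_distrib scale_left_diff_distrib sum_subtractf)
        then have s: "(\<Sum>w\<in>v ` K. scale (u w * (c (the_inv_into K v w) h - c k h)) w) = 0"
          by (simp add: sum.reindex[OF injK] the_inv_into_f_f[OF injK])
        have "u (v i) * (c (the_inv_into K v (v i)) h - c k h) = 0"
          by (rule independentD[OF K(3) _ _ s, of "v i"]) (use insert.hyps(1) i in simp_all)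
        then show ?thesis using h(2) by (simp add: the_inv_into_f_f[OF injK i])
      qed
      then have "v k = 0" unfolding u' by (intro sum.neutral ballI) simp
      then show False using v[OF K(2)] by simp
    qed
    then show ?case using K(3) by (simp add: independent_insert)
  qed (simp add: independent_empty)
  obtain B where B: "finite B" "span B = UNIV" using fd by (elim exE conjE)
  have "finite K \<and> card K \<le> card B" if "finite K" "K \<subseteq> I" for K
  proof -
    have "card (v ` K) \<le> card B"
      using independent_span_bound[OF B(1) ind[OF that]] B(2) by simp
    then show ?thesis using card_image[OF inj_on_subset[OF inj that(2)]] that(1) by simp
  qed
  note bound = this
  show ?thesis
  proof (rule ccontr)
    assume "infinite I"
    from infinite_arbitrarily_large[OF this, of "Suc (card B)"]
    obtain K where "finite K \<and> card K = Suc (card B) \<and> K \<subseteq> I" by (elim exE)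
    then show False using bound[of K] by simp
  qed
qed

text \<open>Applying ad h - k removes the term with eigenvalue k and multiplies the others by
  nonzero factors.\<close>

lemma eigenvectors_sum_zero:
  assumes "finite T" "\<And>t. bracket h (z t) = scale t (z t)" "(\<Sum>t\<in>T. z t) = 0" "t \<in> T"
  shows "z t = 0"
  using assms
proof (induction T arbitrary: z t rule: finite_induct)
  case (insert k T)
  define y where "y t = scale (t - k) (z t)" for t
  have hy: "bracket h (y t) = scale t (y t)" for t
    unfolding y_def bracket_scale_right insert.prems(1) by (simp add: mult.commute)
  have zk: "z k + (\<Sum>t\<in>T. z t) = 0" using insert.prems(2) insert.hyps by simp
  have "(\<Sum>t\<in>T. y t) = bracket h (\<Sum>t\<in>T. z t) - scale k (\<Sum>t\<in>T. z t)"
    unfolding y_def bracket_sum_right[OF insert.hyps(1)] insert.prems(1) scale_sum_right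
    by (simp add: scale_left_diff_distrib sum_subtractf)
  also have "\<dots> = bracket h (- z k) - scale k (- z k)" using zk by (simp add: add_eq_0_iff)
  also have "\<dots> = 0" unfolding bracket_neg_right insert.prems(1) by simp
  finally have sy: "(\<Sum>t\<in>T. y t) = 0" .
  have zT: "z t = 0" if "t \<in> T" for t
  proof -
    have "y t = 0" by (rule insert.IH[OF hy sy that])
    moreover have "t \<noteq> k" using that insert.hyps by auto
    ultimately show ?thesis by (simp add: y_def)
  qed
  then have "z k = 0" using zk by simp
  then show ?case using zT insert.prems(3) by auto
qed simp

text \<open>Representations of sl_2: applying \<open>e\<close> to \<open>x\<close> ends at a highest
  weight vector \<open>w\<close> on which the coroot acts by \<open>M = m + 2 * p\<close>, and
  applying \<open>f\<close> to \<open>w\<close> gives nonzero vectors for M steps, among them one of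
  weight b - m a.\<close>

lemma root_string:
  assumes fd: "\<exists>B. finite B \<and> span B = UNIV"
    and e: "e \<in> root_space H a" and f: "f \<in> root_space H (\<lambda>x. - a x)"
    and h: "bracket e f \<in> H" "a (bracket e f) = 2"
    and x: "x \<in> root_space H b" "x \<noteq> 0" and m: "b (bracket e f) = of_nat m"
  shows "root_space H (\<lambda>h. b h - of_nat m * a h) \<noteq> {0}"
proof -
  let ?h = "bracket e f"
  define E where "E q = (bracket e ^^ q) x" for q
  have E: "E q \<in> root_space H (\<lambda>h. b h + of_nat q * a h)" for q
  proof (induction q)
    case (Suc q)
    show ?case using bracket_root_space[OF e Suc] by (simp add: E_def algebra_simps)
  qed (simp add: E_def x)
  have "\<exists>q. E q = 0"
  proof (rule ccontr)
    assume n: "\<not> ?thesis"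
    \<comment> \<open>If no \<open>E q\<close> vanished, there would be infinitely many weights,
      separated by their values at \<open>bracket e f\<close>.\<close>
    have "finite (UNIV :: nat set)"
    proof (rule finite_weights[OF fd, of _ E H "\<lambda>q h. b h + of_nat q * a h"])
      fix q k :: nat assume "q \<noteq> k"
      then show "\<exists>h\<in>H. b h + of_nat q * a h \<noteq> b h + of_nat k * a h" using h by (intro bexI[of _ ?h]) simp_all
    qed (use n E in simp)
    then show False by simp
  qed
  then obtain q where q: "E q = 0" "\<And>k. k < q \<Longrightarrow> E k \<noteq> 0" using exists_least_iff[of "\<lambda>q. E q = 0"] by auto
  have "q \<noteq> 0" using q(1) x(2) by (cases q) (simp_all add: E_def)
  then obtain p where p: "q = Suc p" by (cases q) simp_all
  define w where "w = E p"
  have w0: "w \<noteq> 0" using q(2)[of p] p by (simp add: w_def)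
  have ew: "bracket e w = 0" using q(1) p by (simp add: w_def E_def)
  define F where "F k = (bracket f ^^ k) w" for k
  have F: "F k \<in> root_space H (\<lambda>h. b h + of_nat p * a h - of_nat k * a h)" for k
  proof (induction k)
    case (Suc k)
    show ?case using bracket_root_space[OF f Suc] by (simp add: F_def algebra_simps)
  qed (simp add: F_def w_def E)
  define M :: nat where "M = m + 2 * p"
  have hF: "bracket ?h (F k) = scale (of_nat M - 2 * of_nat k) (F k)" for k
    using F[of k] h m by (simp add: root_space_def M_def)
  have eF: "bracket e (F (Suc k)) = scale (of_nat (Suc k) * (of_nat M - of_nat k)) (F k)" for k
  proof (induction k)
    case 0
    have "bracket e (F (Suc 0)) = bracket ?h w + bracket f (bracket e w)"
      by (simp add: F_def derivation[of e f w])
    then show ?case using hF[of 0] ew by (simp add: F_def bracket_zero_right)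
  next
    case (Suc k)
    have "bracket e (F (Suc (Suc k))) = bracket ?h (F (Suc k)) + bracket f (bracket e (F (Suc k)))"
      by (simp add: F_def derivation[of e f])
    also have "bracket f (bracket e (F (Suc k))) = scale (of_nat (Suc k) * (of_nat M - of_nat k)) (F (Suc k))"
      unfolding Suc.IH bracket_scale_right by (simp add: F_def)
    finally show ?case unfolding hF scale_left_distrib[symmetric] by (simp add: algebra_simps)
  qed
  have nz: "k \<le> M \<Longrightarrow> F k \<noteq> 0" for k
  proof (induction k)
    case (Suc k)
    then have "of_nat (Suc k) * (of_nat M - of_nat k) \<noteq> (0 :: complex)"
      by (metis Suc_leD Suc_n_not_le_n eq_iff_diff_eq_0 mult_eq_0_iff of_nat_eq_iff of_nat_neq_0)
    then have "bracket e (F (Suc k)) \<noteq> 0" unfolding eF using Suc by simp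
    then show ?case using bracket_zero_right by force
  qed (simp add: F_def w0)
  \<comment> \<open>After p steps down the weight is b again, after m more it is b - m a.\<close>
  have "F (m + p) \<noteq> 0" by (rule nz) (simp add: M_def)
  moreover have "F (m + p) \<in> root_space H (\<lambda>h. b h - of_nat m * a h)" using F[of "m + p"] by (simp add: algebra_simps)
  ultimately show ?thesis by auto
qed

lemma weight_neg:
  assumes "v \<in> root_space H a" "v \<noteq> 0" "h \<in> H" "- h \<in> H"
  shows "a (- h) = - a h"
proof -
  have "scale (a (- h)) v = bracket (- h) v" using assms by (simp add: root_space_def)
  also have "\<dots> = scale (- a h) v" using assms by (simp add: root_space_def bracket_neg_left scale_minus_left)
  finally have "a (- h) = - a h \<or> v = 0" by (rule scale_cancel_right[THEN iffD1])
  then show ?thesis using assms(2) by simp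
qed

lemma zero_root_space: "0 \<in> root_space H a"
  by (simp add: root_space_def bracket_zero_right)

text \<open>For negative m the roles of \<open>e\<close> and \<open>f\<close> are exchanged, which
  replaces a by -a.\<close>

lemma root_reflect:
  assumes fd: "\<exists>B. finite B \<and> span B = UNIV" and H: "subspace H"
    and a: "root H a" "coroot H a h" and b: "root H b" "b h = of_int m"
  shows "root_space H (\<lambda>x. b x - of_int m * a x) \<noteq> {0}"
proof -
  obtain e f where ef: "e \<in> root_space H a" "f \<in> root_space H (\<lambda>x. - a x)" "bracket e f = h"
    using a(2) by (auto simp: coroot_def)
  have h: "h \<in> H" "a h = 2" using a(2) by (simp_all add: coroot_def)
  obtain x where x: "x \<in> root_space H b" "x \<noteq> 0" using b(1) zero_root_space by (auto simp: root_def)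
  obtain y where y: "y \<in> root_space H a" "y \<noteq> 0" using a(1) zero_root_space by (auto simp: root_def)
  show ?thesis
  proof (cases "0 \<le> m")
    case True
    then have "b (bracket e f) = of_nat (nat m)" using b(2) ef(3) by simp
    from root_string[OF fd ef(1,2) _ _ x this] h ef(3) True show ?thesis by simp
  next
    case False
    have fe: "bracket f e = - h" using bracket_anti[of f e] ef(3) by simp
    have mh: "- h \<in> H" using subspace_neg[OF H h(1)] .
    have "b (bracket f e) = of_nat (nat (- m))"
      using weight_neg[OF x h(1) mh] b(2) fe False by simp
    from root_string[OF fd ef(2) _ _ _ x this] ef(1) fe mh weight_neg[OF y h(1) mh] h(2) False
    show ?thesis by simp
  qed
qed

text \<open>Commuting diagonalizable operators: splitting a common eigenvector for \<open>B\<close> into eigenvectors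
  of \<open>h\<close> produces common eigenvectors, by independence of the eigenspaces of \<open>h\<close>.\<close>

lemma simultaneous_eigenvectors:
  assumes B: "finite B" "\<And>x y. x \<in> B \<Longrightarrow> y \<in> B \<Longrightarrow> bracket x y = 0"
    and diag: "\<And>x. x \<in> B \<Longrightarrow> span {v. \<exists>c. bracket x v = scale c v} = UNIV"
  shows "span {v. \<forall>x\<in>B. \<exists>c. bracket x v = scale c v} = UNIV"
  using assms
proof (induction B rule: finite_induct)
  case (insert h B)
  let ?E = "\<lambda>B. {v. \<forall>x\<in>B. \<exists>c. bracket x v = scale c v}"
  have "span (?E B) = UNIV" by (rule insert.IH) (use insert.prems in simp_all)
  moreover have "?E B \<subseteq> span (?E (insert h B))" (is "?L \<subseteq> ?R")
  proof
    fix v assume v: "v \<in> ?E B"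
    have "v \<in> span {v. \<exists>c. bracket h v = scale c v}" using insert.prems(2)[of h] by simp
    then obtain S r where S: "finite S" "S \<subseteq> {v. \<exists>c. bracket h v = scale c v}" "v = (\<Sum>s\<in>S. scale (r s) s)"
      by (auto simp: span_explicit)
    define c where "c s = (SOME c. bracket h s = scale c s)" for s
    have c: "bracket h s = scale (c s) s" if "s \<in> S" for s
      unfolding c_def by (rule someI_ex) (use S(2) that in auto)
    define p where "p t = (\<Sum>s\<in>{s \<in> S. c s = t}. scale (r s) s)" for t
    have fin: "finite {s \<in> S. c s = t}" for t using S(1) by simp
    have hp: "bracket h (p t) = scale t (p t)" for t
      unfolding p_def bracket_sum_right[OF fin] bracket_scale_right scale_sum_right
      by (rule sum.cong) (use c in \<open>auto simp: mult.commute\<close>)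
    have vp: "v = (\<Sum>t\<in>c ` S. p t)"
      unfolding S(3) p_def by (rule sum.group[symmetric]) (use S(1) in simp_all)
    have "p t \<in> ?E (insert h B)" if t: "t \<in> c ` S" for t
    proof -
      have "\<exists>l. bracket x (p t) = scale l (p t)" if x: "x \<in> B" for x
      proof -
        obtain l where l: "bracket x v = scale l v" using v x by auto
        have hx: "bracket h x = 0" using insert.prems(1)[of h x] x by simp
        define z where "z t = bracket x (p t) - scale l (p t)" for t
        have hz: "bracket h (z t) = scale t (z t)" for t
          unfolding z_def diff_conv_add_uminus bracket_add_right bracket_neg_right bracket_scale_right
            derivation[of h x] hx hp bracket_zero_left by (simp add: scale_right_diff_distrib mult.commute)
        have sz: "(\<Sum>t\<in>c ` S. z t) = 0"
        proof -
          have "(\<Sum>t\<in>c ` S. z t) = bracket x (\<Sum>t\<in>c ` S. p t) - scale l (\<Sum>t\<in>c ` S. p t)"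
            unfolding z_def sum_subtractf scale_sum_right by (subst bracket_sum_right) (use S(1) in simp_all)
          then show ?thesis using l unfolding vp[symmetric] by simp
        qed
        have "z t = 0"
          using eigenvectors_sum_zero[of "c ` S" h z, OF _ hz sz] S(1) t by simp
        then show ?thesis by (auto simp: z_def)
      qed
      then show ?thesis using hp by auto
    qed
    then show "v \<in> span (?E (insert h B))" unfolding vp by (intro span_sum) (auto intro: span_base)
  qed
  then have "span ?L \<subseteq> ?R" by (rule span_minimal) (rule subspace_span)
  ultimately show ?case by (simp add: top.extremum_unique)
qed simp

end

section \<open>From the roots of the Lie algebra to the axioms on the Cartan matrix\<close>

locale cartan_data = simple_lie_algebra scale bracket
  for scale :: "complex \<Rightarrow> 'g::ab_group_add \<Rightarrow> 'g" and bracket +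
  fixes H :: "'g set" and \<alpha> :: "'i::finite \<Rightarrow> 'g \<Rightarrow> complex" and cr :: "'i \<Rightarrow> 'g"
    and C :: "int ^ 'i ^ 'i" and d :: "'i \<Rightarrow> int"
  assumes cartan: "cartan_subalgebra H" and basis: "root_basis H \<alpha>"
    and coroots: "coroot H (\<alpha> i) (cr i)" and C_eq: "of_int (C $ i $ j) = \<alpha> j (cr i)"
    and sym: "symmetrizer C d"
begin

definition ev :: "int ^ 'i \<Rightarrow> 'g \<Rightarrow> complex" where
  "ev v = (\<lambda>x. \<Sum>i\<in>UNIV. of_int (v $ i) * \<alpha> i x)"

text \<open>The roots of the Lie algebra in coordinates. The inclusion of \<open>roots C\<close> in
  \<open>LR\<close> is what matters: finiteness and sign coherence pass to subsets.\<close>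

definition LR :: "(int ^ 'i) set" where
  "LR = {v. root H (ev v)}"

lemma H_subspace: "subspace H" and H_abelian: "x \<in> H \<Longrightarrow> y \<in> H \<Longrightarrow> bracket x y = 0"
  and H_diag: "x \<in> H \<Longrightarrow> span {v. \<exists>c. bracket x v = scale c v} = UNIV"
  using cartan by (auto simp: cartan_subalgebra_def toral_def)

lemma alpha_root: "root H (\<alpha> i)"
  using basis by (simp add: root_basis_def)

lemma alpha_independent: "(\<And>x. (\<Sum>i\<in>UNIV. c i * \<alpha> i x) = 0) \<Longrightarrow> c i = 0"
  using basis by (simp add: root_basis_def)

lemma ev_axis: "ev (axis i 1) = \<alpha> i"
proof
  fix x
  have "ev (axis i 1) x = (\<Sum>k\<in>UNIV. if k = i then \<alpha> k x else 0)"
    unfolding ev_def by (intro sum.cong refl) (simp add: axis_nth)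
  then show "ev (axis i 1) x = \<alpha> i x" by simp
qed

lemma ev_add: "ev (v + w) x = ev v x + ev w x" and ev_diff: "ev (v - w) x = ev v x - ev w x"
  by (simp_all add: ev_def algebra_simps sum.distrib sum_subtractf)

lemma ev_zero: "ev v = (\<lambda>_. 0) \<longleftrightarrow> v = 0"
proof
  assume *: "ev v = (\<lambda>_. 0)"
  have "of_int (v $ i) = (0 :: complex)" for i
    by (rule alpha_independent) (use fun_cong[OF *] in \<open>simp add: ev_def\<close>)
  then show "v = 0" by (simp add: vec_eq_iff)
qed (simp add: ev_def fun_eq_iff)

lemma ev_inj: "inj ev"
proof (rule injI)
  fix v w assume "ev v = ev w"
  then have "ev (v - w) = (\<lambda>_. 0)" by (simp add: ev_diff fun_eq_iff)
  then show "v = w" by (simp add: ev_zero)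
qed

lemma ev_coroot: "ev v (cr i) = of_int ((C *v v) $ i)"
  by (simp add: ev_def mat_vec_nth C_eq[symmetric] mult.commute)

lemma ev_outside: "x \<notin> H \<Longrightarrow> ev v x = 0"
  using alpha_root by (simp add: ev_def root_def)

lemma LR_I: "v \<noteq> 0 \<Longrightarrow> root_space H (ev v) \<noteq> {0} \<Longrightarrow> v \<in> LR"
  using ev_outside[of _ v] ev_zero[of v] by (auto simp: LR_def root_def fun_eq_iff)

lemma LR_nonzero: "v \<in> LR \<Longrightarrow> v \<noteq> 0"
  using ev_zero[of v] by (auto simp: LR_def root_def)

lemma axis_LR: "axis i 1 \<in> LR"
  by (simp add: LR_def ev_axis alpha_root)

lemma LR_refl:
  assumes "v \<in> LR"
  shows "simple_reflection C i v \<in> LR"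
proof (rule LR_I)
  let ?m = "(C *v v) $ i"
  have "axis i ?m = ?m *s axis i 1" by (simp add: vec_eq_iff axis_nth)
  moreover have "ev (?m *s axis i 1) x = of_int ?m * ev (axis i 1) x" for x
    by (simp add: ev_def sum_distrib_left mult.assoc)
  ultimately have e: "ev (simple_reflection C i v) = (\<lambda>x. ev v x - of_int ?m * \<alpha> i x)"
    by (simp add: simple_reflection_def ev_diff fun_eq_iff ev_axis)
  show "root_space H (ev (simple_reflection C i v)) \<noteq> {0}"
    unfolding e using assms ev_coroot
    by (intro root_reflect[OF finite_dimensional H_subspace alpha_root coroots]) (simp_all add: LR_def)
  show "simple_reflection C i v \<noteq> 0"
  proof
    assume "simple_reflection C i v = 0"
    then have 0: "ev v x = of_int ?m * \<alpha> i x" for x using e ev_zero[of 0] by (simp add: fun_eq_iff)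
    have "of_int ?m = (of_int ?m * 2 :: complex)"
      using 0[of "cr i"] ev_coroot[of v i] coroots[of i] by (simp add: coroot_def)
    then have "?m = 0" by simp
    then have "ev v = (\<lambda>_. 0)" using 0 by (simp add: fun_eq_iff)
    then show False using LR_nonzero[OF assms] by (simp add: ev_zero)
  qed
qed

lemma roots_LR: "roots C \<subseteq> LR"
proof
  fix \<beta> assume "\<beta> \<in> roots C"
  then obtain \<gamma> where "root_coroot C \<beta> \<gamma>" by (auto simp: roots_def)
  then show "\<beta> \<in> LR" by induction (simp_all add: axis_LR LR_refl)
qed

lemma finite_LR: "finite LR"
proof -
  have ne: "\<exists>x. x \<in> root_space H b \<and> x \<noteq> 0" if "root H b" for b
    using that zero_root_space by (auto simp: root_def)
  have "finite {b. root H b}"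
  proof (rule finite_weights[OF finite_dimensional])
    fix b assume "b \<in> {b. root H b}"
    then show "(SOME x. x \<in> root_space H b \<and> x \<noteq> 0) \<noteq> 0 \<and> (SOME x. x \<in> root_space H b \<and> x \<noteq> 0) \<in> root_space H b"
      using someI_ex[OF ne[of b]] by simp
  next
    fix b b' assume b: "b \<in> {b. root H b}" "b' \<in> {b. root H b}" "b \<noteq> b'"
    then obtain x where "b x \<noteq> b' x" by (auto simp: fun_eq_iff)
    then show "\<exists>h\<in>H. b h \<noteq> b' h" using b by (cases "x \<in> H") (auto simp: root_def)
  qed
  then have "finite (ev -` {b. root H b})" using ev_inj by (rule finite_vimageI)
  then show ?thesis by (simp add: LR_def vimage_def)
qed

lemma root_ev:
  assumes "root H b"
  obtains v where "v \<in> LR" "b = ev v" "(\<forall>i. 0 \<le> v $ i) \<or> (\<forall>i. v $ i \<le> 0)"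
proof -
  obtain n :: "'i \<Rightarrow> nat" where "(\<forall>x. b x = (\<Sum>i\<in>UNIV. of_nat (n i) * \<alpha> i x)) \<or> (\<forall>x. b x = - (\<Sum>i\<in>UNIV. of_nat (n i) * \<alpha> i x))"
    using basis[unfolded root_basis_def, THEN conjunct2, THEN conjunct2, rule_format, OF assms] by (elim exE)
  then consider "b = ev (\<chi> i. int (n i))" | "b = ev (- (\<chi> i. int (n i)))"
    by (auto simp: ev_def fun_eq_iff sum_negf)
  then show thesis
  proof cases
    case 1
    then show thesis using assms by (intro that[of "\<chi> i. int (n i)"]) (simp_all add: LR_def)
  next
    case 2
    then show thesis using assms by (intro that[of "- (\<chi> i. int (n i))"]) (simp_all add: LR_def)
  qed
qed

lemma LR_coherent: "v \<in> LR \<Longrightarrow> (\<forall>i. 0 \<le> v $ i) \<or> (\<forall>i. v $ i \<le> 0)"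
proof -
  assume "v \<in> LR"
  then have "root H (ev v)" by (simp add: LR_def)
  then obtain w where "ev v = ev w" "(\<forall>i. 0 \<le> w $ i) \<or> (\<forall>i. w $ i \<le> 0)" by (rule root_ev)
  then show ?thesis using ev_inj by (simp add: inj_eq)
qed

lemma cartan_diag: "C $ i $ i = 2"
proof -
  have "(of_int (C $ i $ i) :: complex) = of_int 2" using C_eq[of i i] coroots[of i] by (simp add: coroot_def)
  then show ?thesis by (simp only: of_int_eq_iff)
qed

text \<open>s_i \<alpha>_j = \<alpha>_j - c_ij \<alpha>_i is a root with coefficient 1 at
  \<alpha>_j, so its other coefficient is nonnegative.\<close>

lemma cartan_offdiag:
  assumes "i \<noteq> j"
  shows "C $ i $ j \<le> 0"
proof -
  let ?v = "simple_reflection C i (axis j 1)"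
  have "?v $ j = 1" "?v $ i = - (C $ i $ j)" using assms by (simp_all add: refl_nth mat_vec_axis axis_nth)
  then show ?thesis using LR_coherent[OF LR_refl[OF axis_LR], of i j] by (metis neg_0_le_iff_le not_one_le_zero)
qed

sublocale finite_cartan C d
proof unfold_locales
  show "finite (roots C)" by (rule finite_subset[OF roots_LR finite_LR])
  show "(\<forall>i. 0 \<le> \<beta> $ i) \<or> (\<forall>i. \<beta> $ i \<le> 0)" if "\<beta> \<in> roots C" for \<beta>
    by (rule LR_coherent[OF subsetD[OF roots_LR that]])
qed (use cartan_diag cartan_offdiag sym in simp_all)

text \<open>A root meeting both sides is reflected so as to shrink its part in S. Positive
  definiteness on that part yields i in S at which v and C v have the same sign. A coordinate q
  outside S fixes the sign of all coordinates before and after the reflection, so the absolute value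
  at i drops.\<close>

lemma LR_support:
  assumes S: "\<And>i k. i \<in> S \<Longrightarrow> k \<notin> S \<Longrightarrow> C $ i $ k = 0" and v: "v \<in> LR"
  shows "(\<forall>i\<in>S. v $ i = 0) \<or> (\<forall>i. i \<notin> S \<longrightarrow> v $ i = 0)"
  using v
proof (induction "nat (\<Sum>i\<in>S. \<bar>v $ i\<bar>)" arbitrary: v rule: less_induct)
  case less
  show ?case
  proof (rule ccontr)
    assume "\<not> ?thesis"
    then obtain p q where pq: "p \<in> S" "v $ p \<noteq> 0" "q \<notin> S" "v $ q \<noteq> 0" by auto
    define vS :: "int ^ 'i" where "vS = (\<chi> i. if i \<in> S then v $ i else 0)"
    have CvS: "(C *v vS) $ i = (C *v v) $ i" if "i \<in> S" for i
      unfolding mat_vec_nth by (rule sum.cong) (use S[OF that] in \<open>auto simp: vS_def\<close>)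
    have "vS \<noteq> 0" using pq by (auto simp: vS_def vec_eq_iff)
    then have "0 < form vS vS" by (rule form_pos)
    have "\<exists>i. 0 < d i * vS $ i * (C *v vS) $ i"
    proof (rule ccontr)
      assume "\<not> ?thesis"
      then have "form vS vS \<le> 0" unfolding form_def by (intro sum_nonpos) (simp add: not_less)
      then show False using \<open>0 < form vS vS\<close> by simp
    qed
    then obtain i where i: "0 < d i * vS $ i * (C *v vS) $ i" by (elim exE)
    then have iS: "i \<in> S" by (auto simp: vS_def split: if_splits)
    let ?c = "(C *v v) $ i" and ?w = "simple_reflection C i v"
    have pos: "0 < v $ i * ?c" using i d_pos[of i] unfolding CvS[OF iS] by (simp add: vS_def iS mult.assoc zero_less_mult_iff)
    have w: "?w $ k = (if k = i then v $ i - ?c else v $ k)" for k by (simp add: refl_nth)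
    have wL: "?w \<in> LR" by (rule LR_refl[OF less.prems])
    have qi: "q \<noteq> i" using pq iS by auto
    have small: "\<bar>?w $ i\<bar> < \<bar>v $ i\<bar>"
    proof (cases "0 \<le> v $ q")
      case True
      then have "0 < v $ q" using pq by simp
      then have "0 \<le> v $ i" "0 \<le> ?w $ i"
        using LR_coherent[OF less.prems] LR_coherent[OF wL] w[of q] qi by (metis not_less)+
      then show ?thesis using pos w[of i] by (simp add: zero_less_mult_iff)
    next
      case False
      then have "v $ i \<le> 0" "?w $ i \<le> 0"
        using LR_coherent[OF less.prems] LR_coherent[OF wL] w[of q] qi by (metis not_less)+
      then show ?thesis using pos w[of i] by (auto simp: zero_less_mult_iff)
    qed
    have "(\<Sum>k\<in>S. \<bar>?w $ k\<bar>) < (\<Sum>k\<in>S. \<bar>v $ k\<bar>)"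
      by (rule sum_strict_mono_ex1) (use small iS w in \<open>auto intro!: bexI[of _ i]\<close>)
    moreover have "0 \<le> (\<Sum>k\<in>S. \<bar>?w $ k\<bar>)" by (rule sum_nonneg) simp
    ultimately have "nat (\<Sum>k\<in>S. \<bar>?w $ k\<bar>) < nat (\<Sum>k\<in>S. \<bar>v $ k\<bar>)" by linarith
    \<comment> \<open>The reflected root still contains q, so its part in S vanishes. Then i is the
      only vertex of S in the support of v, and the reflection merely changes the sign there,
      contradicting the decrease.\<close>
    from less.hyps[OF this wL] have "\<forall>k\<in>S. ?w $ k = 0" using pq w[of q] qi by auto
    then have z: "v $ k = 0" if "k \<in> S" "k \<noteq> i" for k using w[of k] that by auto
    have "?c = (\<Sum>k\<in>UNIV. if k = i then 2 * v $ k else 0)"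
      unfolding mat_vec_nth by (rule sum.cong) (use z S[OF iS] diag in auto)
    then have "?c = 2 * v $ i" by simp
    then show False using small w[of i] by simp
  qed
qed

definition g0 :: "'g set" where
  "g0 = {v. \<forall>h\<in>H. bracket h v = 0}"

text \<open>A finite basis of H acts by commuting diagonalizable operators. A common eigenvector for
  the basis is one for all of H, so it has weight zero or a root as weight.\<close>

lemma weight_decomposition: "span (g0 \<union> (\<Union>v\<in>LR. root_space H (ev v))) = UNIV"
proof -
  obtain B where B: "B \<subseteq> H" "independent B" "H \<subseteq> span B" using maximal_independent_subset[of H] by blast
  obtain T where T: "finite T" "span T = UNIV" using finite_dimensional by (elim exE conjE)
  have fB: "finite B" using independent_span_bound[OF T(1) B(2)] T(2) by simp
  have "{v. \<forall>x\<in>B. \<exists>c. bracket x v = scale c v} \<subseteq> g0 \<union> (\<Union>v\<in>LR. root_space H (ev v))"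
  proof
    fix v assume v: "v \<in> {v. \<forall>x\<in>B. \<exists>c. bracket x v = scale c v}"
    let ?E = "{x. \<exists>c. bracket x v = scale c v}"
    have "subspace ?E"
    proof (rule subspaceI)
      show "0 \<in> ?E" by (auto simp: bracket_zero_left intro: exI[of _ 0])
      show "x + y \<in> ?E" if "x \<in> ?E" "y \<in> ?E" for x y
        using that by (auto simp: bracket_add_left scale_left_distrib[symmetric])
      show "scale r x \<in> ?E" if "x \<in> ?E" for r x
        using that by (auto simp: bracket_scale_left)
    qed
    then have "span B \<subseteq> ?E" using v by (intro span_minimal) auto
    then have HE: "\<exists>c. bracket x v = scale c v" if "x \<in> H" for x using B(3) that by auto
    define a where "a x = (if x \<in> H then SOME c. bracket x v = scale c v else 0)" for x
    have va: "v \<in> root_space H a" unfolding root_space_def using someI_ex[OF HE] by (simp add: a_def)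
    show "v \<in> g0 \<union> (\<Union>v\<in>LR. root_space H (ev v))"
    proof (cases "v = 0 \<or> (\<forall>x. a x = 0)")
      case True
      then have "v \<in> g0" using va by (auto simp: g0_def root_space_def bracket_zero_right)
      then show ?thesis by (rule UnI1)
    next
      case False
      then have "root H a" using va by (auto simp: root_def a_def)
      then obtain w where "w \<in> LR" "a = ev w" by (rule root_ev)
      then show ?thesis using va by auto
    qed
  qed
  moreover have "span {v. \<forall>x\<in>B. \<exists>c. bracket x v = scale c v} = UNIV"
    using fB by (rule simultaneous_eigenvectors) (use B(1) H_abelian H_diag in \<open>simp_all add: subset_iff\<close>)
  ultimately show ?thesis using span_mono by blast
qed

text \<open>If the diagram were split by \<open>S\<close>, the centralizer of the root spaces supported outside \<open>S\<close>
  would be a proper nonzero ideal.\<close>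

lemma cartan_connected:
  assumes ne: "S \<noteq> {}" "S \<noteq> UNIV"
  shows "\<exists>i\<in>S. \<exists>k\<in>- S. adj C i k"
proof (rule ccontr)
  assume "\<not> ?thesis"
  then have S: "C $ i $ k = 0" if "i \<in> S" "k \<notin> S" for i k
    using that offdiag[of i k] by (force simp: adj_def)
  define A where "A = (\<Union>v\<in>{v \<in> LR. \<forall>i. i \<notin> S \<longrightarrow> v $ i = 0}. root_space H (ev v))"
  define B where "B = (\<Union>v\<in>{v \<in> LR. \<forall>i\<in>S. v $ i = 0}. root_space H (ev v))"
  define J where "J = {z. \<forall>b\<in>B. bracket z b = 0}"
  have AB: "bracket x y = 0" if "x \<in> A" "y \<in> B" for x y
  proof -
    obtain v where v: "v \<in> LR" "\<forall>i. i \<notin> S \<longrightarrow> v $ i = 0" "x \<in> root_space H (ev v)" using \<open>x \<in> A\<close> by (auto simp: A_def)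
    obtain w where w: "w \<in> LR" "\<forall>i\<in>S. w $ i = 0" "y \<in> root_space H (ev w)" using \<open>y \<in> B\<close> by (auto simp: B_def)
    obtain p where p: "v $ p \<noteq> 0" using LR_nonzero[OF v(1)] by (auto simp: vec_eq_iff)
    obtain q where q: "w $ q \<noteq> 0" using LR_nonzero[OF w(1)] by (auto simp: vec_eq_iff)
    have pS: "p \<in> S" using p v(2) by auto
    have qS: "q \<notin> S" using q w(2) by auto
    have vw: "(v + w) $ p \<noteq> 0" "(v + w) $ q \<noteq> 0" using p q pS qS v(2) w(2) by simp_all
    have "v + w \<notin> LR" using LR_support[of S "v + w"] S vw pS qS by auto
    moreover have "v + w \<noteq> 0" using vw(1) by (metis zero_index)
    ultimately have "root_space H (ev (v + w)) = {0}" using LR_I by blast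
    moreover have "bracket x y \<in> root_space H (ev (v + w))"
      using bracket_root_space[OF v(3) w(3)] by (simp add: ev_add[abs_def])
    ultimately show ?thesis by simp
  qed
  have g0B: "bracket h b \<in> B" if "h \<in> g0" "b \<in> B" for h b
  proof -
    obtain w where w: "w \<in> LR" "\<forall>i\<in>S. w $ i = 0" "b \<in> root_space H (ev w)" using \<open>b \<in> B\<close> by (auto simp: B_def)
    have "h \<in> root_space H (\<lambda>_. 0)" using \<open>h \<in> g0\<close> by (simp add: g0_def root_space_def)
    from bracket_root_space[OF this w(3)] show ?thesis using w(1,2) by (auto simp: B_def)
  qed
  have subJ: "subspace J"
    unfolding J_def by (rule subspaceI) (simp_all add: bracket_zero_left bracket_add_left bracket_scale_left)
  have "lie_ideal J" unfolding lie_ideal_def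
  proof (intro conjI allI ballI subJ)
    fix x z assume z: "z \<in> J"
    have zb: "bracket z b = 0" if "b \<in> B" for b using z that by (simp add: J_def)
    let ?G = "{x. bracket x z \<in> J}"
    have "subspace ?G"
      using subJ by (intro subspaceI)
        (simp_all add: bracket_zero_left bracket_add_left bracket_scale_left subspace_0 subspace_add subspace_scale)
    moreover have "g0 \<union> (\<Union>v\<in>LR. root_space H (ev v)) \<subseteq> ?G"
    proof
      fix x assume "x \<in> g0 \<union> (\<Union>v\<in>LR. root_space H (ev v))"
      moreover have "(\<Union>v\<in>LR. root_space H (ev v)) \<subseteq> A \<union> B"
        using LR_support[of S] S by (fastforce simp: A_def B_def)
      ultimately consider "x \<in> g0" | "x \<in> A" | "x \<in> B" by blast
      then have "bracket (bracket x z) b = 0" if b: "b \<in> B" for b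
      proof cases
        case 1
        then show ?thesis using derivation[of x z b] zb[OF b] zb[OF g0B[OF 1 b]] by (simp add: bracket_zero_right)
      next
        case 2
        then show ?thesis using derivation[of x z b] zb[OF b] AB[OF 2 b] by (simp add: bracket_zero_right)
      next
        case 3
        then show ?thesis using bracket_anti[of x z] zb[OF 3] by (simp add: bracket_zero_left)
      qed
      then show "x \<in> ?G" by (simp add: J_def)
    qed
    ultimately have "span (g0 \<union> (\<Union>v\<in>LR. root_space H (ev v))) \<subseteq> ?G" by (rule span_minimal[rotated])
    then show "bracket x z \<in> J" using weight_decomposition by auto
  qed
  then have J: "J = {0} \<or> J = UNIV" by (rule no_proper_ideal)
  obtain p q where pq: "p \<in> S" "q \<notin> S" using ne by auto
  have ex: "\<exists>x. x \<in> root_space H (\<alpha> i) \<and> x \<noteq> 0" for i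
    using alpha_root[of i] zero_root_space by (auto simp: root_def)
  obtain x where x: "x \<in> root_space H (\<alpha> p)" "x \<noteq> 0" using ex by blast
  obtain y where y: "y \<in> root_space H (\<alpha> q)" "y \<noteq> 0" using ex by blast
  have "x \<in> A" unfolding A_def using x pq axis_LR[of p] ev_axis[of p] by (auto simp: axis_nth intro!: bexI[of _ "axis p 1"])
  then have "x \<in> J" using AB by (simp add: J_def)
  \<comment> \<open>A nonzero ideal is everything, so it contains \<open>cr q\<close>, which acts on
    the root space of \<alpha>_q by 2 instead of 0.\<close>
  then have "cr q \<in> J" using J x(2) by auto
  moreover have "y \<in> B" unfolding B_def using y pq axis_LR[of q] ev_axis[of q] by (auto simp: axis_nth intro!: bexI[of _ "axis q 1"])
  ultimately have "bracket (cr q) y = 0" by (simp add: J_def)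
  moreover have "bracket (cr q) y = scale 2 y" using y(1) coroots[of q] by (simp add: root_space_def coroot_def)
  ultimately show False using y(2) by simp
qed

lemma connected_cartan: "connected_cartan C d"
  by unfold_locales (rule cartan_connected)

end

lemma connected_cartan_if_simple:
  fixes scale :: "complex \<Rightarrow> 'g::ab_group_add \<Rightarrow> 'g"
  assumes "simple_lie_algebra scale bracket" "complex_lie_algebra.is_cartan_matrix scale bracket C" "symmetrizer C d"
  shows "connected_cartan C d"
proof -
  interpret simple_lie_algebra scale bracket by (rule assms(1))
  obtain H \<alpha> where *: "cartan_subalgebra H" "root_basis H \<alpha>" "\<forall>i. \<exists>h. coroot H (\<alpha> i) h \<and> (\<forall>j. of_int (C $ i $ j) = \<alpha> j h)"
    using assms(2) unfolding is_cartan_matrix_def by (elim exE conjE)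
  obtain cr where cr: "\<forall>i. coroot H (\<alpha> i) (cr i) \<and> (\<forall>j. of_int (C $ i $ j) = \<alpha> j (cr i))"
    using choice[OF *(3)] by (elim exE)
  interpret cartan_data scale bracket H \<alpha> cr C d
    by unfold_locales (use *(1,2) cr assms(3) in simp_all)
  show ?thesis by (rule connected_cartan)
qed

section \<open>Dual of the generalized preprojective algebra\<close>

type_synonym ('i, 'k) wfun = "'i arrow list \<Rightarrow> 'k"

type_synonym ('i, 'k) wfam = "'i \<Rightarrow> int \<Rightarrow> ('i, 'k) wfun set"

abbreviation loops :: "nat \<Rightarrow> 'i \<Rightarrow> 'i arrow list" where
  "loops n i \<equiv> replicate n (Loop i)"

locale gpa_dual = connected_cartan C d
  for C :: "int ^ 'i::finite ^ 'i" and d :: "'i \<Rightarrow> int" +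
  fixes \<omega> :: "'i \<Rightarrow> 'i \<Rightarrow> int" and j :: 'i
  assumes signs: "sign_choice C \<omega>"
begin

definition a :: "'i \<Rightarrow> 'i \<Rightarrow> nat" where
  "a i k = nat (- C $ i $ k)"

lemma a_pos: "adj C i k \<Longrightarrow> 0 < a i k"
  by (simp add: a_def adj_def)

lemma int_a: "adj C i k \<Longrightarrow> int (a i k) = - C $ i $ k"
  by (simp add: a_def adj_def)

text \<open>This makes (R1) homogeneous: the power \<open>a i k\<close> of the loop at i has degree
  \<open>2 * max (d i) (d k)\<close>, which is symmetric in i and k.\<close>

lemma d_a: "adj C i k \<Longrightarrow> d i * int (a i k) = max (d i) (d k)"
  by (erule adj_cases) (auto simp: a_def max_def)

lemma d_a_sym: "adj C i k \<Longrightarrow> d k * int (a k i) = d i * int (a i k)"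
  using d_a[of i k] d_a[of k i] adj_sym[of i k] by (simp add: max.commute)

lemma omega_sq: "adj C i k \<Longrightarrow> of_int (\<omega> i k) * of_int (\<omega> i k) = (1 :: 'k::field)"
  using signs by (fastforce simp: sign_choice_def)

definition wdeg :: "'i arrow list \<Rightarrow> int" where
  "wdeg p = sum_list (map (arrow_deg d) p)"

lemma wdeg_simps [simp]:
  "wdeg [] = 0" "wdeg (x # p) = arrow_deg d x + wdeg p" "wdeg (p @ q) = wdeg p + wdeg q"
  "wdeg (loops n i) = 2 * d i * int n"
  by (simp_all add: wdeg_def sum_list_replicate)

lemma walk_loops [simp]: "walk C t (loops n i @ p) s \<longleftrightarrow> (if n = 0 then walk C t p s else t = i \<and> walk C i p s)"
  by (induction n arbitrary: t) (auto split: if_splits)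

text \<open>A functional on the left module \<open>\<Pi> e\<^sub>j / \<Pi> \<epsilon>\<^sub>j\<close> is determined by its values on the paths with source \<open>j\<close>, that
  is, by a function on words.  The next four conditions say that it kills the relations (R1) and (R2)
  and the multiples of \<open>\<epsilon>\<^sub>j\<close>, and that it lies in \<open>e\<^sub>i\<close> times the component of degree \<open>u\<close>.\<close>

definition rel1_ok :: "('i, 'k::field) wfun \<Rightarrow> bool" where
  "rel1_ok \<phi> \<longleftrightarrow> (\<forall>i k p q. adj C i k \<longrightarrow>
     \<phi> (p @ loops (a i k) i @ Arr i k # q) = \<phi> (p @ Arr i k # loops (a k i) k @ q))"

definition rel2_ok :: "('i, 'k::field) wfun \<Rightarrow> bool" where
  "rel2_ok \<phi> \<longleftrightarrow> (\<forall>i p q. (\<Sum>k | adj C i k. \<Sum>s<a i k.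
     of_int (\<omega> i k) * \<phi> (p @ loops s i @ Arr i k # Arr k i # loops (a i k - 1 - s) i @ q)) = 0)"

definition end_ok :: "('i, 'k::field) wfun \<Rightarrow> bool" where
  "end_ok \<phi> \<longleftrightarrow> (\<forall>p. \<phi> (p @ [Loop j]) = 0)"

definition supp_ok :: "'i \<Rightarrow> int \<Rightarrow> ('i, 'k::field) wfun \<Rightarrow> bool" where
  "supp_ok i u \<phi> \<longleftrightarrow> (\<forall>p. \<phi> p \<noteq> 0 \<longrightarrow> walk C i p j \<and> wdeg p = - u)"

definition Vfull :: "('i, 'k::field) wfam" where
  "Vfull i u = {\<phi>. rel1_ok \<phi> \<and> rel2_ok \<phi> \<and> end_ok \<phi> \<and> supp_ok i u \<phi>}"

text \<open>Finite support allows induction on the length of words. It turns out to be automatic,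
  \<open>Vfull_eq_V\<close>, but only after \<open>V\<close> is known to be
  finite-dimensional.\<close>

definition V :: "('i, 'k::field) wfam" where
  "V i u = {\<phi> \<in> Vfull i u. finite {p. \<phi> p \<noteq> 0}}"

text \<open>\<open>prep w\<close> is the action of the opposite of the path \<open>w\<close> on the dual.\<close>

definition prep :: "'i arrow list \<Rightarrow> ('i, 'k) wfun \<Rightarrow> ('i, 'k) wfun" where
  "prep w \<phi> = (\<lambda>p. \<phi> (w @ p))"

lemma prep_prep: "prep w (prep v \<phi>) = prep (v @ w) \<phi>"
  by (simp add: prep_def)

lemma prep_Nil [simp]: "prep [] \<phi> = \<phi>"
  by (simp add: prep_def)

lemma prep_add: "prep w (\<phi> + \<psi>) = prep w \<phi> + prep w (\<psi> :: ('i, 'k::field) wfun)"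
  by (simp add: prep_def fun_eq_iff)

lemma prep_zero [simp]: "prep w 0 = (0 :: ('i, 'k::field) wfun)"
  by (simp add: prep_def fun_eq_iff)

lemma finite_support_prep:
  assumes "finite {p. \<phi> p \<noteq> (0 :: 'k::field)}"
  shows "finite {p. prep w \<phi> p \<noteq> 0}"
proof -
  have "(\<lambda>p. w @ p) ` {p. prep w \<phi> p \<noteq> 0} \<subseteq> {p. \<phi> p \<noteq> 0}" by (auto simp: prep_def)
  then have "finite ((\<lambda>p. w @ p) ` {p. prep w \<phi> p \<noteq> 0})" using assms finite_subset by blast
  then show ?thesis by (rule finite_imageD) (simp add: inj_on_def)
qed

lemma prep_rel_ok:
  assumes "rel1_ok \<phi>" "rel2_ok \<phi>" "end_ok \<phi>"
  shows "rel1_ok (prep w \<phi>)" "rel2_ok (prep w \<phi>)" "end_ok (prep w \<phi>)"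
proof -
  show "rel1_ok (prep w \<phi>)" unfolding rel1_ok_def
  proof (intro allI impI)
    fix i k p q assume "adj C i k"
    then show "prep w \<phi> (p @ loops (a i k) i @ Arr i k # q) = prep w \<phi> (p @ Arr i k # loops (a k i) k @ q)"
      using assms(1)[unfolded rel1_ok_def, rule_format, of i k "w @ p" q] by (simp add: prep_def)
  qed
  show "rel2_ok (prep w \<phi>)" unfolding rel2_ok_def
  proof (intro allI)
    fix i p q
    show "(\<Sum>k | adj C i k. \<Sum>s<a i k.
     of_int (\<omega> i k) * prep w \<phi> (p @ loops s i @ Arr i k # Arr k i # loops (a i k - 1 - s) i @ q)) = 0"
      using assms(2)[unfolded rel2_ok_def, rule_format, of i "w @ p" q] by (simp add: prep_def)
  qed
  show "end_ok (prep w \<phi>)" using assms(3) unfolding end_ok_def prep_def by (metis append_assoc)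
qed

lemma prep_V:
  assumes "\<phi> \<in> V i u" "walk C i w k"
  shows "prep w \<phi> \<in> V k (u + wdeg w)"
proof -
  have split: "walk C i (w @ p) l \<longleftrightarrow> walk C k p l" for p l
    using assms(2)
  proof (induction w arbitrary: i)
    case (Cons x w)
    then show ?case by auto
  qed auto
  have "supp_ok k (u + wdeg w) (prep w \<phi>)"
    using assms(1) split by (auto simp: V_def Vfull_def supp_ok_def prep_def)
  then show ?thesis
    using assms(1) prep_rel_ok[of \<phi> w] finite_support_prep[of \<phi> w] by (auto simp: V_def Vfull_def)
qed

lemma rel1_ok_iter:
  assumes "rel1_ok \<phi>" "adj C i k"
  shows "\<phi> (p @ loops (t * a i k) i @ Arr i k # q) = \<phi> (p @ Arr i k # loops (t * a k i) k @ q)"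
proof (induction t arbitrary: q)
  case 0
  then show ?case by simp
next
  case (Suc t)
  have l: "loops (Suc t * n) x = loops (t * n) x @ loops n x" for n and x :: 'i
    by (simp add: replicate_add[symmetric] add.commute)
  have "\<phi> (p @ loops (Suc t * a i k) i @ Arr i k # q) = \<phi> ((p @ loops (t * a i k) i) @ loops (a i k) i @ Arr i k # q)"
    unfolding l by simp
  also have "\<dots> = \<phi> ((p @ loops (t * a i k) i) @ Arr i k # (loops (a k i) k @ q))"
    using assms unfolding rel1_ok_def by blast
  also have "\<dots> = \<phi> (p @ Arr i k # loops (t * a k i) k @ loops (a k i) k @ q)"
    using Suc.IH[of "loops (a k i) k @ q"] by simp
  finally show ?case unfolding l by simp
qed

lemma Vfull_subspace: "fs.subspace (Vfull i u :: ('i, 'k::field) wfun set)"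
proof (rule fs_subspaceI)
  show "0 \<in> (Vfull i u :: ('i, 'k::field) wfun set)"
    by (simp add: Vfull_def rel1_ok_def rel2_ok_def end_ok_def supp_ok_def)
next
  fix x y :: "('i, 'k::field) wfun" assume xy: "x \<in> Vfull i u" "y \<in> Vfull i u"
  have "supp_ok i u (x + y)" using xy unfolding Vfull_def supp_ok_def by (auto, force+)
  then show "x + y \<in> Vfull i u"
    using xy by (simp add: Vfull_def rel1_ok_def rel2_ok_def end_ok_def distrib_left sum.distrib)
next
  fix c and x :: "('i, 'k::field) wfun" assume "x \<in> Vfull i u"
  then show "(\<lambda>p. c * x p) \<in> Vfull i u"
    by (simp add: Vfull_def rel1_ok_def rel2_ok_def end_ok_def supp_ok_def mult.left_commute[of _ c] sum_distrib_left[symmetric])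
qed

lemma V_subspace: "fs.subspace (V i u :: ('i, 'k::field) wfun set)"
proof (rule fs_subspaceI)
  show "0 \<in> (V i u :: ('i, 'k::field) wfun set)"
    using fs.subspace_0[OF Vfull_subspace] by (simp add: V_def)
next
  fix x y :: "('i, 'k::field) wfun" assume xy: "x \<in> V i u" "y \<in> V i u"
  have "{p. (x + y) p \<noteq> 0} \<subseteq> {p. x p \<noteq> 0} \<union> {p. y p \<noteq> 0}" by auto
  then show "x + y \<in> V i u"
    using xy fs.subspace_add[OF Vfull_subspace] finite_subset unfolding V_def by blast
next
  fix c and x :: "('i, 'k::field) wfun" assume x: "x \<in> V i u"
  have "{p. c * x p \<noteq> 0} \<subseteq> {p. x p \<noteq> 0}" by auto
  then show "(\<lambda>p. c * x p) \<in> V i u"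
    using x fs.subspace_scale[OF Vfull_subspace] finite_subset unfolding V_def by blast
qed

text \<open>One copy of the neighbour k for each exponent s below \<open>a i k\<close>; higher
  powers of the loop at i can be moved across the arrow by (R1).\<close>

definition idx :: "'i \<Rightarrow> ('i \<times> nat) set" where
  "idx i = (SIGMA k:{k. adj C i k}. {..<a i k})"

lemma finite_idx: "finite (idx i)"
  by (simp add: idx_def)

lemma sum_idx: "(\<Sum>x\<in>idx i. f x) = (\<Sum>k | adj C i k. \<Sum>s<a i k. f (k, s))"
  unfolding idx_def by (subst sum.Sigma) (auto simp: case_prod_unfold)

lemma idx_iff: "(k, s) \<in> idx i \<longleftrightarrow> adj C i k \<and> s < a i k"
  by (simp add: idx_def)

text \<open>Degree shift of the operator \<open>\<alpha>\<^sub>k\<^sub>i \<epsilon>\<^sub>i\<^sup>s\<close>.\<close>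

definition sh :: "'i \<Rightarrow> 'i \<times> nat \<Rightarrow> int" where
  "sh i x = 2 * d i * int (snd x) - max (d i) (d (fst x))"

lemma wdeg_out: "wdeg (loops s i @ [Arr i k]) = sh i (k, s)"
  by (simp add: sh_def)

text \<open>\<open>out i\<close> applies all \<open>\<alpha>\<^sub>k\<^sub>i \<epsilon>\<^sub>i\<^sup>s\<close> to an element at the vertex \<open>i\<close>; relation (R2) says \<open>inn i \<circ> out i = 0\<close>.
  The kernel of \<open>inn i\<close> is the image of \<open>out i\<close>: \<open>glue i \<Psi> 0\<close> is a preimage of \<open>\<Psi>\<close>, its argument \<open>n\<close>
  counts the loops read so far.\<close>

definition out :: "'i \<Rightarrow> ('i, 'k::field) wfun \<Rightarrow> (('i \<times> nat) \<times> 'i arrow list \<Rightarrow> 'k)" where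
  "out i \<phi> = (\<lambda>((k, s), p). if (k, s) \<in> idx i then \<phi> (loops s i @ Arr i k # p) else 0)"

definition inn :: "'i \<Rightarrow> (('i \<times> nat) \<times> 'i arrow list \<Rightarrow> 'k::field) \<Rightarrow> ('i, 'k) wfun" where
  "inn i \<Psi> = (\<lambda>p. \<Sum>(k, s)\<in>idx i. of_int (\<omega> i k) * \<Psi> ((k, s), Arr k i # loops (a i k - 1 - s) i @ p))"

lemma linear_out: "Vector_Spaces.linear (\<lambda>c \<phi> x. c * \<phi> x) (\<lambda>c \<phi> x. c * \<phi> x) (out i :: ('i, 'k::field) wfun \<Rightarrow> _)"
  by (rule fs_linearI) (auto simp: out_def fun_eq_iff)

lemma linear_inn: "Vector_Spaces.linear (\<lambda>c \<phi> x. c * \<phi> x) (\<lambda>c \<phi> x. c * \<phi> x) (inn i :: _ \<Rightarrow> ('i, 'k::field) wfun)"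
proof (rule fs_linearI)
  fix x y :: "('i \<times> nat) \<times> 'i arrow list \<Rightarrow> 'k"
  show "inn i (x + y) = inn i x + inn i y"
    by (simp add: inn_def fun_eq_iff case_prod_unfold distrib_left sum.distrib)
next
  fix c and x :: "('i \<times> nat) \<times> 'i arrow list \<Rightarrow> 'k"
  show "inn i (\<lambda>p. c * x p) = (\<lambda>p. c * inn i x p)"
    unfolding inn_def case_prod_unfold sum_distrib_left by (simp only: mult.left_commute)
qed

lemma inn_out:
  assumes "\<phi> \<in> V i u"
  shows "inn i (out i \<phi>) = 0"
proof
  fix p
  have "inn i (out i \<phi>) p = (\<Sum>k | adj C i k. \<Sum>s<a i k.
      of_int (\<omega> i k) * \<phi> ([] @ loops s i @ Arr i k # Arr k i # loops (a i k - 1 - s) i @ p))"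
    unfolding inn_def sum_idx by (intro sum.cong refl) (simp add: out_def idx_iff)
  also have "\<dots> = 0" using assms unfolding V_def Vfull_def rel2_ok_def by blast
  finally show "inn i (out i \<phi>) p = 0 p" by simp
qed

text \<open>Write n = t a + r with a = \<open>a i k\<close>. The remainder r selects the copy of k,
  and the t a loops at i become \<open>t * a k i\<close> loops at k when moved across the arrow by
  (R1).\<close>

primrec glue :: "'i \<Rightarrow> (('i \<times> nat) \<times> 'i arrow list \<Rightarrow> 'k::field) \<Rightarrow> nat \<Rightarrow> 'i arrow list \<Rightarrow> 'k" where
  "glue i \<Psi> n [] = 0"
| "glue i \<Psi> n (x # p) = (if x = Loop i then glue i \<Psi> (Suc n) p else
     (case x of Loop _ \<Rightarrow> 0 | Arr l k \<Rightarrow> if l = i \<and> adj C i k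
       then \<Psi> ((k, n mod a i k), loops (n div a i k * a k i) k @ p) else 0))"

lemma glue_loops: "glue i \<Psi> n (loops m i @ p) = glue i \<Psi> (n + m) p"
  by (induction m arbitrary: n) simp_all

lemma glue_arr: "adj C i k \<Longrightarrow>
    glue i \<Psi> n (Arr i k # p) = \<Psi> ((k, n mod a i k), loops (n div a i k * a k i) k @ p)"
  by simp

lemma glue_other: "x \<noteq> Loop i \<Longrightarrow> (\<And>k. x = Arr i k \<Longrightarrow> \<not> adj C i k) \<Longrightarrow> glue i \<Psi> n (x # p) = 0"
  by (cases x) auto

declare glue.simps(2) [simp del]

lemma glue_Loop: "glue i \<Psi> n (Loop i # p) = glue i \<Psi> (Suc n) p"
  by (simp add: glue.simps(2))

lemma glue_Loop_other: "l \<noteq> i \<Longrightarrow> glue i \<Psi> n (Loop l # p) = 0"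
  by (simp add: glue.simps(2))

lemma glue_Arr_other: "l \<noteq> i \<Longrightarrow> glue i \<Psi> n (Arr l k # p) = 0"
  by (simp add: glue.simps(2))

lemma loops_commute: "loops n x @ loops m x @ p = loops m x @ loops n x @ p"
  by (metis add.commute append_assoc replicate_add)

lemma arrow_view:
  obtains "x = Loop i" | k where "x = Arr i k" "adj C i k"
    | "x \<noteq> Loop i" "\<And>k. x = Arr i k \<Longrightarrow> \<not> adj C i k"
  by blast

lemma mod_less_a: "adj C i k \<Longrightarrow> (k, n mod a i k) \<in> idx i"
  using a_pos by (simp add: idx_iff)

text \<open>Each condition on \<open>glue\<close> compares values on words with a common prefix. A
  prefix with an arrow out of i reduces it to the same condition on a component of \<Psi>, a prefix
  of loops at i only shifts n, and any other prefix gives zero. So the empty prefix is the only real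
  case.\<close>

lemma glue_cong:
  assumes rel: "\<And>k s w. (k, s) \<in> idx i \<Longrightarrow> f (\<lambda>x. \<Psi> ((k, s), w @ x)) = g (\<lambda>x. \<Psi> ((k, s), w @ x))"
    and base: "\<And>n. f (glue i \<Psi> n) = g (glue i \<Psi> n)"
    and zero: "f (\<lambda>_. 0) = g (\<lambda>_. 0)"
  shows "f (\<lambda>x. glue i \<Psi> n (p @ x)) = g (\<lambda>x. glue i \<Psi> n (p @ x))"
proof (induction p arbitrary: n)
  case Nil
  then show ?case using base by simp
next
  case (Cons x p)
  show ?case
  proof (cases x i rule: arrow_view)
    case 1
    then show ?thesis using Cons.IH by (simp add: glue_Loop)
  next
    case (2 k)
    show ?thesis
      using rel[OF mod_less_a[OF 2(2)], of n "loops (n div a i k * a k i) k @ p"]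
      by (simp add: 2 glue_arr)
  next
    case 3
    then show ?thesis using zero glue_other[of x i \<Psi> n] by simp
  qed
qed

lemma rel1_okD: "rel1_ok \<phi> \<Longrightarrow> adj C i k \<Longrightarrow>
    \<phi> (p @ loops (a i k) i @ Arr i k # q) = \<phi> (p @ Arr i k # loops (a k i) k @ q)"
  unfolding rel1_ok_def by blast

lemma rel2_okD: "rel2_ok \<phi> \<Longrightarrow> (\<Sum>k | adj C i k. \<Sum>s<a i k.
     of_int (\<omega> i k) * \<phi> (p @ loops s i @ Arr i k # Arr k i # loops (a i k - 1 - s) i @ q)) = 0"
  unfolding rel2_ok_def by blast

lemma sum_mod_shift: "0 < m \<Longrightarrow> (\<Sum>s<m. f ((n + s) mod m)) = (\<Sum>s<m. f s)" for m :: nat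
proof -
  assume m: "0 < m"
  have inj: "inj_on (\<lambda>s. (n + s) mod m) {..<m}"
  proof (rule linorder_inj_onI')
    fix x y assume xy: "x \<in> {..<m}" "y \<in> {..<m}" "x < y"
    show "(n + x) mod m \<noteq> (n + y) mod m"
    proof
      assume "(n + x) mod m = (n + y) mod m"
      then have "m dvd (n + y) - (n + x)" using xy(3) mod_eq_dvd_iff_nat[of "n + x" "n + y" m] by simp
      then have "m dvd y - x" by simp
      then show False using xy dvd_imp_le[of m "y - x"] by auto
    qed
  qed
  moreover have "(\<lambda>s. (n + s) mod m) ` {..<m} = {..<m}"
    by (rule endo_inj_surj) (use inj m in auto)
  ultimately show ?thesis by (metis (no_types, lifting) sum.reindex_cong)
qed

lemma glue_in_V:
  assumes \<Psi>: "\<And>k s. (k, s) \<in> idx i \<Longrightarrow> (\<lambda>w. \<Psi> ((k, s), w)) \<in> V k (u + sh i (k, s))"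
    and inn: "inn i \<Psi> = 0"
  shows "glue i \<Psi> 0 \<in> V i u"
proof -
  have r1: "rel1_ok (\<lambda>w. \<Psi> ((k, s), w))" and r2: "rel2_ok (\<lambda>w. \<Psi> ((k, s), w))"
    and eo: "end_ok (\<lambda>w. \<Psi> ((k, s), w))" and so: "supp_ok k (u + sh i (k, s)) (\<lambda>w. \<Psi> ((k, s), w))"
    and fo: "finite {w. \<Psi> ((k, s), w) \<noteq> 0}"
    if "(k, s) \<in> idx i" for k s using \<Psi>[OF that] by (simp_all add: V_def Vfull_def)
  have "rel1_ok (glue i \<Psi> 0)"
    unfolding rel1_ok_def
  proof (intro allI impI)
    fix l k p q assume lk: "adj C l k"
    let ?f = "\<lambda>h. h (loops (a l k) l @ Arr l k # q)" and ?g = "\<lambda>h. h (Arr l k # loops (a k l) k @ q)"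
    have "?f (\<lambda>x. glue i \<Psi> 0 (p @ x)) = ?g (\<lambda>x. glue i \<Psi> 0 (p @ x))"
    proof (rule glue_cong[where f = ?f and g = ?g])
      fix k' s' w assume "(k', s') \<in> idx i"
      then show "?f (\<lambda>x. \<Psi> ((k', s'), w @ x)) = ?g (\<lambda>x. \<Psi> ((k', s'), w @ x))"
        using rel1_okD[OF r1 lk] by blast
    next
      fix n
      show "?f (glue i \<Psi> n) = ?g (glue i \<Psi> n)"
      proof (cases "l = i")
        case True
        have "(n + a i k) div a i k = Suc (n div a i k)" using a_pos lk True by simp
        then show ?thesis using lk True by (simp add: glue_loops glue_arr replicate_add loops_commute[of "a k i"])
      next
        case False
        obtain m where m: "a l k = Suc m" using a_pos[OF lk] gr0_implies_Suc by blast
        show ?thesis unfolding m using False by (simp add: glue_Loop_other glue_Arr_other)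
      qed
    qed simp
    then show "glue i \<Psi> 0 (p @ loops (a l k) l @ Arr l k # q) = glue i \<Psi> 0 (p @ Arr l k # loops (a k l) k @ q)" .
  qed
  moreover have "rel2_ok (glue i \<Psi> 0)"
    unfolding rel2_ok_def
  proof (intro allI)
    fix l p q
    let ?f = "\<lambda>h :: 'i arrow list \<Rightarrow> 'a. \<Sum>k | adj C l k. \<Sum>s<a l k.
      of_int (\<omega> l k) * h (loops s l @ Arr l k # Arr k l # loops (a l k - 1 - s) l @ q)"
    have "?f (\<lambda>x. glue i \<Psi> 0 (p @ x)) = (\<lambda>_. 0) (\<lambda>x. glue i \<Psi> 0 (p @ x))"
    proof (rule glue_cong[where f = ?f and g = "\<lambda>_. 0"])
      fix k' s' w assume "(k', s') \<in> idx i"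
      then show "?f (\<lambda>x. \<Psi> ((k', s'), w @ x)) = 0"
        using rel2_okD[OF r2] by blast
    next
      fix n
      show "?f (glue i \<Psi> n) = 0"
      proof (cases "l = i")
        case True
        \<comment> \<open>The n loops already read are carried to the far end of the relation. This
          turns the exponent s into n + s modulo \<open>a i k\<close>, a cyclic shift that does not
          change the sum; what remains is \<open>inn i \<Psi>\<close> at a word starting with n
          loops.\<close>
        have tm: "glue i \<Psi> n (loops s i @ Arr i k # Arr k i # loops (a i k - 1 - s) i @ q)
            = \<Psi> ((k, (n + s) mod a i k), Arr k i # loops (a i k - 1 - (n + s) mod a i k) i @ loops n i @ q)"
          if k: "adj C i k" and s: "s < a i k" for k s
        proof -
          let ?m = "a i k" let ?t = "(n + s) div ?m" let ?r = "(n + s) mod ?m"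
          have "glue i \<Psi> n (loops s i @ Arr i k # Arr k i # loops (?m - 1 - s) i @ q)
            = \<Psi> ((k, ?r), [] @ loops (?t * a k i) k @ Arr k i # loops (?m - 1 - s) i @ q)"
            unfolding glue_loops using k by (simp add: glue_arr)
          also have "\<dots> = \<Psi> ((k, ?r), [] @ Arr k i # loops (?t * ?m) i @ loops (?m - 1 - s) i @ q)"
            using rel1_ok_iter[OF r1[OF mod_less_a[OF k]] adj_sym[OF k], where p = "[]" and t = ?t and q = "loops (?m - 1 - s) i @ q"] .
          also have "loops (?t * ?m) i @ loops (?m - 1 - s) i @ q = loops (?t * ?m + (?m - 1 - s)) i @ q"
            by (simp add: replicate_add)
          also have "?t * ?m + (?m - 1 - s) = (?m - 1 - ?r) + n"
          proof -
            have "?t * ?m + ?r = n + s" by simp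
            moreover have "?r < ?m" using a_pos[OF k] by simp
            ultimately show ?thesis using s by linarith
          qed
          finally show ?thesis by (simp add: replicate_add)
        qed
        have "?f (glue i \<Psi> n) = (\<Sum>k | adj C i k. \<Sum>s<a i k.
            (\<lambda>r. of_int (\<omega> i k) * \<Psi> ((k, r), Arr k i # loops (a i k - 1 - r) i @ loops n i @ q)) ((n + s) mod a i k))"
          unfolding True by (intro sum.cong refl) (simp only: tm mem_Collect_eq lessThan_iff)
        also have "\<dots> = (\<Sum>k | adj C i k. \<Sum>s<a i k.
            of_int (\<omega> i k) * \<Psi> ((k, s), Arr k i # loops (a i k - 1 - s) i @ loops n i @ q))"
          by (intro sum.cong refl sum_mod_shift) (simp add: a_pos)
        also have "\<dots> = inn i \<Psi> (loops n i @ q)" by (simp add: inn_def sum_idx)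
        finally show ?thesis using inn by simp
      next
        case False
        have "glue i \<Psi> n (loops s l @ Arr l k # r) = 0" for s k r
          by (cases s) (use False in \<open>simp_all add: glue_Loop_other glue_Arr_other\<close>)
        then show ?thesis by simp
      qed
    qed simp
    then show "(\<Sum>k | adj C l k. \<Sum>s<a l k.
      of_int (\<omega> l k) * glue i \<Psi> 0 (p @ loops s l @ Arr l k # Arr k l # loops (a l k - 1 - s) l @ q)) = 0" .
  qed
  moreover have "end_ok (glue i \<Psi> 0)"
    unfolding end_ok_def
  proof
    fix p
    let ?f = "\<lambda>h :: 'i arrow list \<Rightarrow> 'a. h [Loop j]"
    have "?f (\<lambda>x. glue i \<Psi> 0 (p @ x)) = (\<lambda>_. 0) (\<lambda>x. glue i \<Psi> 0 (p @ x))"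
    proof (rule glue_cong[where f = ?f and g = "\<lambda>_. 0"])
      fix k' s' w assume "(k', s') \<in> idx i"
      then show "?f (\<lambda>x. \<Psi> ((k', s'), w @ x)) = 0" using eo unfolding end_ok_def by blast
    next
      fix n show "glue i \<Psi> n [Loop j] = 0" by (cases "j = i") (simp_all add: glue_Loop glue_Loop_other)
    qed simp
    then show "glue i \<Psi> 0 (p @ [Loop j]) = 0" .
  qed
  \<comment> \<open>Only words consisting of m loops at i, an arrow out of i and a tail have a
    nonzero value, and m can be read off from the word.\<close>
  moreover have form: "\<exists>k q. p = loops m i @ Arr i k # q \<and> adj C i k
      \<and> \<Psi> ((k, (n + m) mod a i k), loops ((n + m) div a i k * a k i) k @ q) \<noteq> 0 \<and> m \<le> length p"
    if "glue i \<Psi> n p \<noteq> 0" and "m = length (takeWhile (\<lambda>x. x = Loop i) p)" for n p m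
    using that
  proof (induction p arbitrary: n m)
    case Nil
    then show ?case by simp
  next
    case (Cons x p)
    show ?case
    proof (cases x i rule: arrow_view)
      case 1
      then have "glue i \<Psi> (Suc n) p \<noteq> 0" using Cons.prems by (simp add: glue_Loop)
      from Cons.IH[OF this refl] show ?thesis using 1 Cons.prems by auto
    next
      case (2 k)
      then show ?thesis using Cons.prems by (auto simp: glue_arr)
    next
      case 3
      then show ?thesis using Cons.prems glue_other[of x i \<Psi> n p] by simp
    qed
  qed
  moreover have "supp_ok i u (glue i \<Psi> 0)"
    unfolding supp_ok_def
  proof (intro allI impI)
    fix p assume "glue i \<Psi> 0 p \<noteq> 0"
    from form[OF this refl] obtain k q m where p: "p = loops m i @ Arr i k # q" and k: "adj C i k"
      and nz: "\<Psi> ((k, m mod a i k), loops (m div a i k * a k i) k @ q) \<noteq> 0" by auto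
    let ?t = "m div a i k" let ?r = "m mod a i k"
    have "walk C k (loops (?t * a k i) k @ q) j" "wdeg (loops (?t * a k i) k @ q) = - (u + sh i (k, ?r))"
      using so[OF mod_less_a[OF k]] nz unfolding supp_ok_def by blast+
    then have w: "walk C k q j" and g: "2 * (d k * int (a k i)) * int ?t + wdeg q = - u - sh i (k, ?r)"
      by (auto split: if_splits simp: mult_ac)
    have "int m = int ?t * int (a i k) + int ?r" by (metis div_mult_mod_eq of_nat_add of_nat_mult)
    then have "2 * d i * int m = 2 * (d i * int (a i k)) * int ?t + 2 * d i * int ?r" by (simp add: algebra_simps)
    then have "wdeg p = - u" using g unfolding p d_a_sym[OF k] by (simp add: sh_def)
    then show "walk C i p j \<and> wdeg p = - u" using w k p by simp
  qed
  moreover have "finite {p. glue i \<Psi> 0 p \<noteq> 0}"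
  proof -
    \<comment> \<open>Such a word is recovered from the copy, a word w in the support of that
      component, and the number t of blocks of loops moved; t is at most the length of w because
      every block is nonempty.\<close>
    let ?S = "\<lambda>x. {w. \<Psi> (x, w) \<noteq> 0}"
    let ?F = "(\<lambda>(x, w, t). loops (t * a i (fst x) + snd x) i @ Arr i (fst x) # drop (t * a (fst x) i) w)
      ` (SIGMA x:idx i. SIGMA w:?S x. {..length w})"
    have "finite ?F" using finite_idx fo by (intro finite_imageI finite_SigmaI) auto
    moreover have "{p. glue i \<Psi> 0 p \<noteq> 0} \<subseteq> ?F"
    proof
      fix p assume "p \<in> {p. glue i \<Psi> 0 p \<noteq> 0}"
      then have "glue i \<Psi> 0 p \<noteq> 0" by simp
      from form[OF this refl] obtain k q m where p: "p = loops m i @ Arr i k # q" and k: "adj C i k"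
        and nz: "\<Psi> ((k, m mod a i k), loops (m div a i k * a k i) k @ q) \<noteq> 0" by auto
      let ?t = "m div a i k" let ?w = "loops (?t * a k i) k @ q"
      have "0 < a k i" using a_pos adj_sym k by blast
      then have "?t * 1 \<le> ?t * a k i" by (intro mult_le_mono2) simp
      moreover have "length ?w = ?t * a k i + length q" by simp
      ultimately have "?t \<le> length ?w" by linarith
      moreover have "p = loops (?t * a i k + m mod a i k) i @ Arr i k # drop (?t * a k i) ?w" using p by simp
      ultimately show "p \<in> ?F"
        using nz mod_less_a[OF k, of m] by (intro image_eqI[of _ _ "((k, m mod a i k), ?w, ?t)"]) auto
    qed
    ultimately show ?thesis by (rule rev_finite_subset)
  qed
  ultimately show ?thesis by (simp add: V_def Vfull_def)
qed

lemma out_glue: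
  assumes "\<And>x w. x \<notin> idx i \<Longrightarrow> \<Psi> (x, w) = 0"
  shows "out i (glue i \<Psi> 0) = \<Psi>"
proof
  fix y :: "('i \<times> nat) \<times> 'i arrow list"
  obtain k s w where y: "y = ((k, s), w)" by (metis surj_pair)
  show "out i (glue i \<Psi> 0) y = \<Psi> y"
  proof (cases "(k, s) \<in> idx i")
    case True
    then have "adj C i k" "s < a i k" by (auto simp: idx_iff)
    then show ?thesis using True by (simp add: y out_def glue_loops glue_arr)
  next
    case False
    then show ?thesis using assms by (simp add: y out_def)
  qed
qed

text \<open>A nonempty walk ending at j either consists of loops at j, where \<open>end_ok\<close>
  applies, or has a first arrow. Reducing the loops before that arrow modulo \<open>a i k\<close> by
  (R1) turns its value into a value of \<open>out i \<phi>\<close>.\<close>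

lemma out_zero_iff:
  assumes "\<phi> \<in> V i u"
  shows "out i \<phi> = 0 \<longleftrightarrow> (\<forall>p. p \<noteq> [] \<longrightarrow> \<phi> p = 0)"
proof
  assume z: "out i \<phi> = 0"
  have r1: "rel1_ok \<phi>" and eo: "end_ok \<phi>" and so: "supp_ok i u \<phi>" using assms by (simp_all add: V_def Vfull_def)
  show "\<forall>p. p \<noteq> [] \<longrightarrow> \<phi> p = 0"
  proof (intro allI impI, rule ccontr)
    fix p assume p: "p \<noteq> []" "\<phi> p \<noteq> 0"
    have walk: "walk C i p j" using so p(2) by (simp add: supp_ok_def)
    have "(\<exists>n. p = loops n i \<and> i = j) \<or> (\<exists>n k q. p = loops n i @ Arr i k # q \<and> adj C i k)"
      using walk
    proof (induction p)
      case Nil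
      then show ?case by auto
    next
      case (Cons x p)
      show ?case
      proof (cases x)
        case (Loop l)
        then have x: "x = Loop i" "walk C i p j" using Cons.prems by auto
        from Cons.IH[OF x(2)] show ?thesis
        proof (elim disjE exE conjE)
          fix n assume "p = loops n i" "i = j"
          then show ?thesis using x by (intro disjI1 exI[of _ "Suc n"]) simp
        next
          fix n k q assume "p = loops n i @ Arr i k # q" "adj C i k"
          then show ?thesis using x by (intro disjI2 exI[of _ "Suc n"] exI[of _ k] exI[of _ q]) simp
        qed
      next
        case (Arr l k)
        then show ?thesis using Cons.prems by (intro disjI2 exI[of _ 0] exI[of _ k] exI[of _ p]) auto
      qed
    qed
    then show False
    proof (elim disjE exE conjE)
      fix n assume n: "p = loops n i" "i = j"
      then obtain m where "n = Suc m" using p(1) by (cases n) auto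
      then have "p = loops m j @ [Loop j]" using n by (simp add: replicate_append_same)
      then show False using eo p(2) by (simp add: end_ok_def)
    next
      fix n k q assume n: "p = loops n i @ Arr i k # q" and k: "adj C i k"
      let ?t = "n div a i k" let ?r = "n mod a i k"
      have "loops n i = loops ?r i @ loops (?t * a i k) i" by (simp add: replicate_add[symmetric])
      then have "\<phi> p = \<phi> (loops ?r i @ Arr i k # loops (?t * a k i) k @ q)"
        using rel1_ok_iter[OF r1 k, of "loops ?r i" ?t q] n by simp
      also have "\<dots> = out i \<phi> ((k, ?r), loops (?t * a k i) k @ q)"
        using mod_less_a[OF k, of n] by (simp add: out_def)
      finally show False using z p(2) by simp
    qed
  qed
next
  assume "\<forall>p. p \<noteq> [] \<longrightarrow> \<phi> p = 0"
  then show "out i \<phi> = 0" by (auto simp: out_def fun_eq_iff)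
qed

text \<open>The functional dual to e_j. It spans the kernel of \<open>out j\<close>, the term
  [i = j] of the exact sequence.\<close>

definition delta :: "('i, 'k::field) wfun" where
  "delta = (\<lambda>p. if p = [] then 1 else 0)"

lemma delta_V: "delta \<in> V j 0"
proof -
  have "rel1_ok delta" by (auto simp: rel1_ok_def delta_def)
  moreover have "rel2_ok delta" by (auto simp: rel2_ok_def delta_def)
  moreover have "end_ok delta" by (auto simp: end_ok_def delta_def)
  moreover have "supp_ok j 0 delta" by (auto simp: supp_ok_def delta_def)
  moreover have "finite {p. delta p \<noteq> 0}" by (rule finite_subset[of _ "{[]}"]) (auto simp: delta_def)
  ultimately show ?thesis by (simp add: V_def Vfull_def)
qed

lemma kernel_out:
  "{\<phi> \<in> V i u. out i \<phi> = 0} = (if i = j \<and> u = 0 then fs.span {delta} else {0 :: ('i, 'k::field) wfun})"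
proof -
  have V0: "0 \<in> (V i u :: ('i, 'k::field) wfun set)" using fs.subspace_0[OF V_subspace] .
  have eq: "\<phi> = (\<lambda>p. \<phi> [] * delta p)" if "\<phi> \<in> V i u" "out i \<phi> = 0" for \<phi> :: "('i, 'k) wfun"
  proof -
    have "\<forall>p. p \<noteq> [] \<longrightarrow> \<phi> p = 0" using that out_zero_iff by blast
    then show ?thesis by (simp add: delta_def fun_eq_iff)
  qed
  show ?thesis
  proof (cases "i = j \<and> u = 0")
    case True
    have "out j delta = (0 :: _ \<Rightarrow> 'k)" using out_zero_iff[OF delta_V] by (simp add: delta_def)
    then have "{delta} \<subseteq> {\<phi> \<in> V i u. out i \<phi> = (0 :: _ \<Rightarrow> 'k)}" using True delta_V by simp
    moreover have "fs.subspace {\<phi> \<in> V i u. out i \<phi> = (0 :: _ \<Rightarrow> 'k)}"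
    proof -
      interpret o: module_hom "\<lambda>c (\<phi> :: ('i, 'k) wfun) x. c * \<phi> x" "\<lambda>c (\<phi> :: ('i \<times> nat) \<times> 'i arrow list \<Rightarrow> 'k) x. c * \<phi> x" "out i"
        by (rule linear_imp_mh[OF linear_out])
      show ?thesis using fs.subspace_inter[OF V_subspace o.subspace_kernel] by (simp add: Collect_conj_eq)
    qed
    ultimately have "fs.span {delta} \<subseteq> {\<phi> \<in> V i u. out i \<phi> = (0 :: _ \<Rightarrow> 'k)}" by (rule fs.span_minimal)
    moreover have "{\<phi> \<in> V i u. out i \<phi> = (0 :: _ \<Rightarrow> 'k)} \<subseteq> fs.span {delta}"
    proof
      fix \<phi> :: "('i, 'k) wfun" assume "\<phi> \<in> {\<phi> \<in> V i u. out i \<phi> = 0}"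
      then have "\<phi> = (\<lambda>p. \<phi> [] * delta p)" using eq by blast
      moreover have "(\<lambda>p. \<phi> [] * delta p) \<in> fs.span {delta}" by (rule fs.span_scale[OF fs.span_base]) simp
      ultimately show "\<phi> \<in> fs.span {delta}" by simp
    qed
    ultimately show ?thesis using True by auto
  next
    case False
    have "\<phi> = 0" if "\<phi> \<in> V i u" "out i \<phi> = 0" for \<phi> :: "('i, 'k) wfun"
    proof -
      have "\<phi> [] = 0"
      proof (rule ccontr)
        assume "\<phi> [] \<noteq> 0"
        then have "walk C i [] j \<and> wdeg [] = - u" using that(1) unfolding V_def Vfull_def supp_ok_def by blast
        then show False using False by simp
      qed
      then show ?thesis using eq[OF that] by (auto simp: fun_eq_iff)
    qed
    moreover have "out i (0 :: ('i, 'k) wfun) = 0" by (auto simp: out_def fun_eq_iff)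
    ultimately show ?thesis using False V0 by auto
  qed
qed

end

section \<open>Graded submodules and reflection functors\<close>

abbreviation fsum :: "('a \<Rightarrow> int) \<Rightarrow> int" where "fsum \<equiv> Sum_any"

lemma fsum_add: "finite {u. g u \<noteq> 0} \<Longrightarrow> finite {u. h u \<noteq> 0} \<Longrightarrow> fsum (\<lambda>u. g u + h u) = fsum g + fsum h"
  by (rule Sum_any.distrib)

lemma fsum_shift: "fsum (\<lambda>u. g (u + c)) = fsum (g :: int \<Rightarrow> int)"
proof (rule Sum_any.reindex_cong[symmetric])
  show "bij (\<lambda>u. u + c)" by (rule bijI') (auto intro: exI[of _ "_ - c"])
  show "g \<circ> (\<lambda>u. u + c) = (\<lambda>u. g (u + c))" by auto
qed

lemma finite_shift: "finite {u. g u \<noteq> (0::int)} \<Longrightarrow> finite {u :: int. g (u + c) \<noteq> 0}"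
proof -
  assume f: "finite {u. g u \<noteq> (0::int)}"
  have "{u :: int. g (u + c) \<noteq> 0} = (\<lambda>u. u - c) ` {u. g u \<noteq> 0}" by (auto intro: image_eqI[of _ _ "_ + c"])
  then show ?thesis using f by simp
qed

lemma fsum_sum:
  assumes "finite A" "\<And>x. x \<in> A \<Longrightarrow> finite {u. g x u \<noteq> 0}"
  shows "finite {u. (\<Sum>x\<in>A. g x u) \<noteq> 0} \<and> fsum (\<lambda>u. \<Sum>x\<in>A. g x u) = (\<Sum>x\<in>A. fsum (g x))"
  using assms
proof (induction A rule: finite_induct)
  case (insert x A)
  have "finite {u. g x u + (\<Sum>x\<in>A. g x u) \<noteq> 0}"
    by (rule finite_subset[of _ "{u. g x u \<noteq> 0} \<union> {u. (\<Sum>x\<in>A. g x u) \<noteq> 0}"]) (use insert in auto)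
  then show ?case using insert fsum_add[of "g x" "\<lambda>u. \<Sum>x\<in>A. g x u"] by simp
qed simp

lemma fsum_mono:
  assumes "finite {u. g u \<noteq> 0}" "finite {u. h u \<noteq> 0}" "\<And>u. g u \<le> h u"
  shows "fsum g \<le> fsum h"
proof -
  let ?A = "{u. g u \<noteq> 0} \<union> {u. h u \<noteq> 0}"
  have "fsum g = sum g ?A" "fsum h = sum h ?A" using assms by (auto intro: Sum_any.expand_superset)
  then show ?thesis using assms(3) by (simp add: sum_mono)
qed

lemma fsum_mono_eq:
  assumes "finite {u. g u \<noteq> 0}" "finite {u. h u \<noteq> 0}" "\<And>u. g u \<le> h u" "fsum h \<le> fsum g"
  shows "g u = h u"
proof (rule ccontr)
  assume "g u \<noteq> h u"
  let ?A = "insert u ({u. g u \<noteq> 0} \<union> {u. h u \<noteq> 0})"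
  have "fsum g = sum g ?A" "fsum h = sum h ?A" using assms by (auto intro: Sum_any.expand_superset)
  moreover have "sum g ?A < sum h ?A"
    using assms \<open>g u \<noteq> h u\<close> by (intro sum_strict_mono_ex1) (auto intro!: bexI[of _ u] simp: less_le)
  ultimately show False using assms(4) by simp
qed

definition gd :: "(int \<Rightarrow> ('x \<Rightarrow> 'k::field) set) \<Rightarrow> int \<Rightarrow> int" where
  "gd Z u = int (fs.dim (Z u))"

text \<open>The graded dimension paired with a function of the degree: the constant 1 gives the
  total dimension, a linear function the first moment.\<close>

definition wt :: "(int \<Rightarrow> int) \<Rightarrow> (int \<Rightarrow> ('x \<Rightarrow> 'k::field) set) \<Rightarrow> int" where
  "wt f Z = fsum (\<lambda>u. f u * gd Z u)"

abbreviation tot :: "(int \<Rightarrow> ('x \<Rightarrow> 'k::field) set) \<Rightarrow> int" where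
  "tot \<equiv> wt (\<lambda>_. 1)"

definition gspace :: "(int \<Rightarrow> ('x \<Rightarrow> 'k::field) set) \<Rightarrow> bool" where
  "gspace Z \<longleftrightarrow> (\<forall>u. fs.subspace (Z u) \<and> fs.fin_dim (Z u)) \<and> finite {u. Z u \<noteq> {0}}"

lemma gspaceD: "gspace Z \<Longrightarrow> fs.subspace (Z u)" "gspace Z \<Longrightarrow> fs.fin_dim (Z u)" "gspace Z \<Longrightarrow> finite {u. Z u \<noteq> {0}}"
  by (simp_all add: gspace_def)

lemma gspace_supp: "gspace Z \<Longrightarrow> finite {u. f u * gd Z u \<noteq> 0}"
  by (rule finite_subset[OF _ gspaceD(3)]) (auto simp: gd_def fs.dim_zero_space)

lemma gspace_sub:
  assumes "gspace Z" "\<And>u. Y u \<subseteq> Z u" "\<And>u. fs.subspace (Y u)"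
  shows "gspace Y"
proof -
  have "{u. Y u \<noteq> {0}} \<subseteq> {u. Z u \<noteq> {0}}" using assms(2,3) fs.subspace_0 by fastforce
  then have "finite {u. Y u \<noteq> {0}}" using gspaceD(3)[OF assms(1)] by (rule finite_subset)
  moreover have "fs.fin_dim (Y u)" for u by (rule fs.fin_dim_mono[OF gspaceD(2)[OF assms(1)] assms(2)])
  ultimately show ?thesis using assms(3) by (simp add: gspace_def)
qed

lemma gd_mono: "gspace Z \<Longrightarrow> (\<And>u. Y u \<subseteq> Z u) \<Longrightarrow> gd Y u \<le> gd Z u"
  unfolding gd_def of_nat_le_iff by (rule fs.dim_mono_fin[OF gspaceD(2)])

lemma tot_mono:
  assumes "gspace Z" "gspace Y" "\<And>u. Y u \<subseteq> Z u"
  shows "tot Y \<le> tot Z"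
  unfolding wt_def using gspace_supp[OF assms(1), of "\<lambda>_. 1"] gspace_supp[OF assms(2), of "\<lambda>_. 1"]
  by (intro fsum_mono) (auto intro: gd_mono[OF assms(1,3)])

text \<open>Nested submodules are compared through their total dimensions; this turns equality of
  numbers into equality of components.\<close>

lemma tot_eq:
  assumes "gspace Z" "gspace Y" "\<And>u. Y u \<subseteq> Z u" "tot Z \<le> tot Y"
  shows "Y = Z"
proof
  fix u
  have "1 * gd Y u = 1 * gd Z u"
  proof (rule fsum_mono_eq[where g = "\<lambda>u. 1 * gd Y u" and h = "\<lambda>u. 1 * gd Z u"])
    show "finite {u. 1 * gd Y u \<noteq> 0}" "finite {u. 1 * gd Z u \<noteq> 0}"
      using gspace_supp[OF assms(2), of "\<lambda>_. 1"] gspace_supp[OF assms(1), of "\<lambda>_. 1"] by simp_all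
    show "1 * gd Y u \<le> 1 * gd Z u" for u using gd_mono[OF assms(1,3)] by simp
    show "fsum (\<lambda>u. 1 * gd Z u) \<le> fsum (\<lambda>u. 1 * gd Y u)" using assms(4) by (simp add: wt_def)
  qed
  then show "Y u = Z u"
    using fs.subspace_eq_if_dim_le[OF gspaceD(2)[OF assms(1)] assms(3) gspaceD(1)[OF assms(2)]] by (simp add: gd_def)
qed

lemma tot_nonneg: "gspace Z \<Longrightarrow> 0 \<le> tot Z"
  unfolding wt_def using fsum_mono[of "\<lambda>_. 0" "\<lambda>u. 1 * gd Z u"] gspace_supp[of Z "\<lambda>_. 1"] by (simp add: gd_def)

section \<open>Largest and smallest components at a vertex\<close>

context gpa_dual
begin

definition graded_sub :: "('i, 'k::field) wfam \<Rightarrow> bool" where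
  "graded_sub N \<longleftrightarrow> (\<forall>k. gspace (N k)) \<and> (\<forall>k u. N k u \<subseteq> V k u)
     \<and> (\<forall>i u. \<forall>\<phi>\<in>N i u. prep [Loop i] \<phi> \<in> N i (u + 2 * d i))
     \<and> (\<forall>i k u. adj C i k \<longrightarrow> (\<forall>\<phi>\<in>N i u. prep [Arr i k] \<phi> \<in> N k (u - max (d i) (d k))))"

lemma graded_subD:
  assumes "graded_sub N"
  shows "gspace (N k)" "N k u \<subseteq> V k u" "\<phi> \<in> N i u \<Longrightarrow> prep [Loop i] \<phi> \<in> N i (u + 2 * d i)"
    "adj C i k \<Longrightarrow> \<phi> \<in> N i u \<Longrightarrow> prep [Arr i k] \<phi> \<in> N k (u - max (d i) (d k))"
  using assms unfolding graded_sub_def by blast+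

definition Nt :: "'i \<Rightarrow> int \<Rightarrow> ('i, 'k::field) wfam \<Rightarrow> (('i \<times> nat) \<times> 'i arrow list \<Rightarrow> 'k) set" where
  "Nt i u N = prod_space (idx i) (\<lambda>x. N (fst x) (u + sh i x))"

text \<open>The largest and the smallest component at \<open>i\<close> that make \<open>N\<close> a submodule, given its components at
  the other vertices.\<close>

definition upf :: "'i \<Rightarrow> ('i, 'k::field) wfam \<Rightarrow> int \<Rightarrow> ('i, 'k) wfun set" where
  "upf i N u = {\<phi> \<in> V i u. out i \<phi> \<in> Nt i u N}"

definition inf :: "'i \<Rightarrow> ('i, 'k::field) wfam \<Rightarrow> int \<Rightarrow> ('i, 'k) wfun set" where
  "inf i N u = inn i ` Nt i (u + 2 * d i) N"

lemma out_component: "(k, s) \<in> idx i \<Longrightarrow> (\<lambda>w. out i \<phi> ((k, s), w)) = prep (loops s i @ [Arr i k]) \<phi>"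
  by (simp add: out_def prep_def)

lemma out_Nt_iff: "out i \<phi> \<in> Nt i u N \<longleftrightarrow>
    (\<forall>k s. (k, s) \<in> idx i \<longrightarrow> prep (loops s i @ [Arr i k]) \<phi> \<in> N k (u + sh i (k, s)))"
proof -
  have "out i \<phi> \<in> Nt i u N \<longleftrightarrow> (\<forall>x\<in>idx i. (\<lambda>w. out i \<phi> (x, w)) \<in> N (fst x) (u + sh i x))"
    by (auto simp: Nt_def prod_space_def out_def)
  also have "\<dots> \<longleftrightarrow> (\<forall>k s. (k, s) \<in> idx i \<longrightarrow> (\<lambda>w. out i \<phi> ((k, s), w)) \<in> N k (u + sh i (k, s)))" by auto
  finally show ?thesis by (simp add: out_component cong: imp_cong)
qed

lemma upf_iff: "\<phi> \<in> upf i N u \<longleftrightarrow> \<phi> \<in> V i u \<and>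
    (\<forall>k s. (k, s) \<in> idx i \<longrightarrow> prep (loops s i @ [Arr i k]) \<phi> \<in> N k (u + sh i (k, s)))"
  by (simp add: upf_def out_Nt_iff)

lemma upf_cong: "(\<And>k. k \<noteq> i \<Longrightarrow> N k = N' k) \<Longrightarrow> upf i N = upf i N'"
proof (rule ext, rule Set.set_eqI)
  fix u \<phi> assume "\<And>k. k \<noteq> i \<Longrightarrow> N k = N' k"
  then have "N k = N' k" if "(k, s) \<in> idx i" for k s using that by (auto simp: idx_iff adj_def)
  then show "\<phi> \<in> upf i N u \<longleftrightarrow> \<phi> \<in> upf i N' u" unfolding upf_iff by (metis (no_types))
qed

lemma Nt_cong: "(\<And>k. k \<noteq> i \<Longrightarrow> N k = N' k) \<Longrightarrow> Nt i u N = Nt i u N'"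
proof -
  assume "\<And>k. k \<noteq> i \<Longrightarrow> N k = N' k"
  then have "N (fst x) = N' (fst x)" if "x \<in> idx i" for x using that by (auto simp: idx_def adj_def)
  then show ?thesis by (auto simp: Nt_def prod_space_def)
qed

lemma inf_cong: "(\<And>k. k \<noteq> i \<Longrightarrow> N k = N' k) \<Longrightarrow> inf i N = inf i N'"
  unfolding inf_def by (rule ext) (use Nt_cong in blast)

lemma upf_mono: "(\<And>k u. k \<noteq> i \<Longrightarrow> N k u \<subseteq> N' k u) \<Longrightarrow> upf i N u \<subseteq> upf i N' u"
  unfolding upf_iff[abs_def] subset_iff by (auto simp: idx_iff adj_def upf_iff)

lemma inf_mono: "(\<And>k u. k \<noteq> i \<Longrightarrow> N k u \<subseteq> N' k u) \<Longrightarrow> inf i N u \<subseteq> inf i N' u"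
proof -
  assume "\<And>k u. k \<noteq> i \<Longrightarrow> N k u \<subseteq> N' k u"
  moreover have "fst x \<noteq> i" if "x \<in> idx i" for x using that by (auto simp: idx_def adj_def)
  ultimately have "N (fst x) v \<subseteq> N' (fst x) v" if "x \<in> idx i" for x v using that by blast
  then have "Nt i (u + 2 * d i) N \<subseteq> Nt i (u + 2 * d i) N'" unfolding Nt_def prod_space_def by fast
  then show ?thesis unfolding inf_def by blast
qed

lemma Nt_space:
  assumes "\<And>k. gspace (N k)"
  shows "fs.subspace (Nt i u N)" "fs.fin_dim (Nt i u N)"
    "int (fs.dim (Nt i u N)) = (\<Sum>x\<in>idx i. gd (N (fst x)) (u + sh i x))"
proof -
  have s: "fs.subspace (N (fst x) (u + sh i x))" and f: "fs.fin_dim (N (fst x) (u + sh i x))" for x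
    by (rule gspaceD[OF assms])+
  show "fs.subspace (Nt i u N)" unfolding Nt_def by (rule prod_space_subspace[OF s])
  show "fs.fin_dim (Nt i u N)" "int (fs.dim (Nt i u N)) = (\<Sum>x\<in>idx i. gd (N (fst x)) (u + sh i x))"
    unfolding Nt_def gd_def using prod_space_dim[OF finite_idx s f] by simp_all
qed

lemma upf_subspace:
  assumes "\<And>k. gspace (N k)"
  shows "fs.subspace (upf i N u :: ('i, 'k::field) wfun set)"
proof -
  interpret o: module_hom "\<lambda>c (\<phi> :: ('i, 'k) wfun) x. c * \<phi> x" "\<lambda>c (\<phi> :: ('i \<times> nat) \<times> 'i arrow list \<Rightarrow> 'k) x. c * \<phi> x" "out i"
    by (rule linear_imp_mh[OF linear_out])
  have "fs.subspace {\<phi>. out i \<phi> \<in> Nt i u N}"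
    by (rule o.subspace_linear_preimage[OF Nt_space(1)[OF assms]])
  then have "fs.subspace (V i u \<inter> {\<phi>. out i \<phi> \<in> Nt i u N})" using V_subspace fs.subspace_inter by blast
  moreover have "upf i N u = V i u \<inter> {\<phi>. out i \<phi> \<in> Nt i u N}" by (auto simp: upf_def)
  ultimately show ?thesis by simp
qed

lemma inf_space:
  assumes "\<And>k. gspace (N k)"
  shows "fs.subspace (inf i N u :: ('i, 'k::field) wfun set)" "fs.fin_dim (inf i N u)"
proof -
  interpret m: module_hom "\<lambda>c (\<phi> :: ('i \<times> nat) \<times> 'i arrow list \<Rightarrow> 'k) x. c * \<phi> x" "\<lambda>c (\<phi> :: ('i, 'k) wfun) x. c * \<phi> x" "inn i"
    by (rule linear_imp_mh[OF linear_inn])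
  show "fs.subspace (inf i N u)" unfolding inf_def by (rule m.subspace_image[OF Nt_space(1)[OF assms]])
  show "fs.fin_dim (inf i N u)" unfolding inf_def by (rule fsp.fin_dim_image[OF linear_inn Nt_space(2)[OF assms]])
qed

text \<open>Exactness in the middle: (R2) gives one inclusion, gluing the other. The glued function
  lies in the largest component because its image under \<open>out i\<close> is the given
  element.\<close>

lemma image_out_upf:
  assumes "\<And>k u. N k u \<subseteq> V k u"
  shows "out i ` upf i N u = {\<Psi> \<in> Nt i u N. inn i \<Psi> = 0}"
proof (intro equalityI subsetI)
  fix \<Psi> assume "\<Psi> \<in> out i ` upf i N u"
  then show "\<Psi> \<in> {\<Psi> \<in> Nt i u N. inn i \<Psi> = 0}" using inn_out by (auto simp: upf_def)
next
  fix \<Psi> assume "\<Psi> \<in> {\<Psi> \<in> Nt i u N. inn i \<Psi> = 0}"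
  then have \<Psi>: "\<Psi> \<in> Nt i u N" "inn i \<Psi> = 0" by auto
  have "(\<lambda>w. \<Psi> ((k, s), w)) \<in> V k (u + sh i (k, s))" if "(k, s) \<in> idx i" for k s
    using \<Psi>(1) that assms unfolding Nt_def prod_space_def by fastforce
  then have g: "glue i \<Psi> 0 \<in> V i u" using glue_in_V \<Psi>(2) by blast
  have "out i (glue i \<Psi> 0) = \<Psi>" using \<Psi>(1) by (intro out_glue) (auto simp: Nt_def prod_space_def)
  then show "\<Psi> \<in> out i ` upf i N u" using g \<Psi>(1) by (intro image_eqI[of _ _ "glue i \<Psi> 0"]) (auto simp: upf_def)
qed

text \<open>Rank and nullity of \<open>out i\<close> on the largest component and of
  \<open>inn i\<close> on the sum of neighbours. The smallest component appears in degree
  \<open>u - 2 * d i\<close> because (R2) is homogeneous of degree -2 d_i.\<close>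

lemma dim_formula:
  assumes gs: "\<And>k. gspace (N k)" and NV: "\<And>k u. N k u \<subseteq> V k u"
  shows "fs.fin_dim (upf i N u :: ('i, 'k::field) wfun set)"
    "gd (upf i N) u + gd (inf i N) (u - 2 * d i)
      = (if i = j \<and> u = 0 then 1 else 0) + (\<Sum>x\<in>idx i. gd (N (fst x)) (u + sh i x))"
proof -
  let ?K = "{\<phi> \<in> upf i N u. out i \<phi> = 0}"
  have 0: "0 \<in> Nt i u N" using fs.subspace_0[OF Nt_space(1)[OF gs]] .
  have K: "?K = {\<phi> \<in> V i u. out i \<phi> = 0}" using 0 by (auto simp: upf_def)
  have dn: "delta \<noteq> (0 :: ('i, 'k) wfun)"
  proof
    assume "delta = (0 :: ('i, 'k) wfun)"
    then have "delta [] = (0 :: 'k)" by simp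
    then show False by (simp add: delta_def)
  qed
  have Kfin: "fs.fin_dim ?K" and Kdim: "fs.dim ?K = (if i = j \<and> u = 0 then 1 else 0)"
  proof -
    have "fs.fin_dim ?K \<and> fs.dim ?K = (if i = j \<and> u = 0 then 1 else 0)"
    proof (cases "i = j \<and> u = 0")
      case True
      then have KK: "?K = fs.span {delta}" unfolding K kernel_out by (rule if_P)
      show ?thesis unfolding if_P[OF True] KK
        by (intro conjI fs.fin_dim_span_singleton fs.dim_span_singleton_nonzero dn)
    next
      case False
      then have KK: "?K = {0}" unfolding K kernel_out by (rule if_not_P)
      show ?thesis unfolding if_not_P[OF False] KK by (intro conjI fs.fin_dim_zero fs.dim_zero_space)
    qed
    then show "fs.fin_dim ?K" "fs.dim ?K = (if i = j \<and> u = 0 then 1 else 0)" by blast+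
  qed
  have sub: "fs.subspace (upf i N u)" by (rule upf_subspace[OF gs])
  have "fs.fin_dim {\<Psi> \<in> Nt i u N. inn i \<Psi> = 0}" by (rule fs.fin_dim_mono[OF Nt_space(2)[OF gs]]) (rule Collect_restrict)
  then have ifin: "fs.fin_dim (out i ` upf i N u)" unfolding image_out_upf[OF NV] .
  show fin: "fs.fin_dim (upf i N u)"
    by (rule fsp.fin_dim_if_kernel_image[OF linear_out sub Kfin ifin])
  have 1: "fs.dim (upf i N u) = fs.dim ?K + fs.dim (out i ` upf i N u)"
    by (rule fsp.rank_nullity[OF linear_out sub fin])
  have 2: "fs.dim (Nt i u N) = fs.dim {\<Psi> \<in> Nt i u N. inn i \<Psi> = 0} + fs.dim (inn i ` Nt i u N)"
    by (rule fsp.rank_nullity[OF linear_inn Nt_space(1,2)[OF gs]])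
  have 3: "inf i N (u - 2 * d i) = inn i ` Nt i u N" unfolding inf_def by simp
  have "fs.dim (upf i N u) + fs.dim (inf i N (u - 2 * d i)) = (if i = j \<and> u = 0 then 1 else 0) + fs.dim (Nt i u N)"
    using 1 2 unfolding image_out_upf[OF NV] Kdim 3 by linarith
  then have "int (fs.dim (upf i N u)) + int (fs.dim (inf i N (u - 2 * d i)))
      = (if i = j \<and> u = 0 then 1 else 0) + int (fs.dim (Nt i u N))"
  proof -
    define c :: nat where "c = (if i = j \<and> u = 0 then 1 else 0)"
    assume "fs.dim (upf i N u) + fs.dim (inf i N (u - 2 * d i)) = (if i = j \<and> u = 0 then 1 else 0) + fs.dim (Nt i u N)"
    then have "int (fs.dim (upf i N u)) + int (fs.dim (inf i N (u - 2 * d i))) = int c + int (fs.dim (Nt i u N))"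
      unfolding c_def[symmetric] by linarith
    moreover have "int c = (if i = j \<and> u = 0 then 1 else 0)" unfolding c_def by simp
    ultimately show ?thesis by simp
  qed
  then show "gd (upf i N) u + gd (inf i N) (u - 2 * d i)
      = (if i = j \<and> u = 0 then 1 else 0) + (\<Sum>x\<in>idx i. gd (N (fst x)) (u + sh i x))"
    unfolding Nt_space(3)[OF gs] gd_def .
qed

lemma sum_fun_at: "(\<Sum>x\<in>A. f x) p = (\<Sum>x\<in>A. f x p :: 'k::field)"
  by (induction A rule: infinite_finite_induct) simp_all

lemma inn_term:
  "inn i \<Psi> = (\<Sum>x\<in>idx i. (\<lambda>p. of_int (\<omega> i (fst x)) * prep (Arr (fst x) i # loops (a i (fst x) - 1 - snd x) i) (\<lambda>w. \<Psi> (x, w)) p))"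
  unfolding inn_def prep_def by (simp add: fun_eq_iff case_prod_unfold sum_fun_at)

lemma prep_loops_in:
  assumes "\<And>u \<phi>. \<phi> \<in> Z u \<Longrightarrow> prep [Loop i] \<phi> \<in> Z (u + 2 * d i)" "\<phi> \<in> Z u"
  shows "prep (loops n i) \<phi> \<in> Z (u + 2 * d i * int n)"
proof (induction n)
  case (Suc n)
  have "prep (loops (Suc n) i) \<phi> = prep [Loop i] (prep (loops n i) \<phi>)"
    by (simp add: prep_prep replicate_append_same)
  then show ?case using assms(1)[OF Suc] by (simp add: algebra_simps)
qed (simp add: assms)

lemma inn_degree: "(k, s) \<in> idx i \<Longrightarrow>
    u + 2 * d i + sh i (k, s) - max (d k) (d i) + 2 * d i * int (a i k - 1 - s) = u"
proof -
  assume "(k, s) \<in> idx i"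
  then have k: "adj C i k" "s < a i k" by (auto simp: idx_iff)
  then have "int (a i k - 1 - s) = int (a i k) - 1 - int s" by simp
  then show ?thesis using d_a[OF k(1)] by (simp add: sh_def max.commute algebra_simps)
qed

text \<open>Every term of \<open>inn i\<close> reads an arrow and then loops at i, so it stays in
  any loop-stable family of subspaces that receives the arrows.\<close>

lemma inf_least:
  assumes Z: "\<And>u. fs.subspace (Z u)" "\<And>u \<phi>. \<phi> \<in> Z u \<Longrightarrow> prep [Loop i] \<phi> \<in> Z (u + 2 * d i)"
    and A: "\<And>k u \<phi>. adj C i k \<Longrightarrow> \<phi> \<in> N k u \<Longrightarrow> prep [Arr k i] \<phi> \<in> Z (u - max (d k) (d i))"
  shows "inf i N u \<subseteq> Z u"
proof
  fix \<phi> assume "\<phi> \<in> inf i N u"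
  then obtain \<Psi> where \<Psi>: "\<Psi> \<in> Nt i (u + 2 * d i) N" "\<phi> = inn i \<Psi>" by (auto simp: inf_def)
  have "(\<lambda>p. of_int (\<omega> i (fst x)) * prep (Arr (fst x) i # loops (a i (fst x) - 1 - snd x) i) (\<lambda>w. \<Psi> (x, w)) p) \<in> Z u"
    if x: "x \<in> idx i" for x
  proof (rule fs.subspace_scale[OF Z(1)])
    obtain k s where ks: "x = (k, s)" "(k, s) \<in> idx i" using x by (cases x) auto
    then have "adj C i k" by (simp add: idx_iff)
    moreover have "(\<lambda>w. \<Psi> (x, w)) \<in> N k (u + 2 * d i + sh i (k, s))"
      using \<Psi>(1) ks by (auto simp: Nt_def prod_space_def)
    ultimately have "prep [Arr k i] (\<lambda>w. \<Psi> (x, w)) \<in> Z (u + 2 * d i + sh i (k, s) - max (d k) (d i))" by (rule A)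
    from prep_loops_in[of Z, OF Z(2) this, of "a i k - 1 - s"]
    show "prep (Arr (fst x) i # loops (a i (fst x) - 1 - snd x) i) (\<lambda>w. \<Psi> (x, w)) \<in> Z u"
      unfolding inn_degree[OF ks(2)] by (simp add: ks prep_prep)
  qed
  then show "\<phi> \<in> Z u" unfolding \<Psi>(2) inn_term by (intro fs.subspace_sum[OF Z(1)]) auto
qed

lemma V_closed:
  "\<phi> \<in> V i u \<Longrightarrow> prep [Loop i] \<phi> \<in> V i (u + 2 * d i)"
  "adj C i k \<Longrightarrow> \<phi> \<in> V i u \<Longrightarrow> prep [Arr i k] \<phi> \<in> V k (u - max (d i) (d k))"
  using prep_V[of \<phi> i u "[Loop i]" i] prep_V[of \<phi> i u "[Arr i k]" k] by simp_all

lemma inf_E: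
  assumes N: "graded_sub N" and \<phi>: "\<phi> \<in> inf i N u"
  shows "prep [Loop i] \<phi> \<in> inf i N (u + 2 * d i)"
proof -
  obtain \<Psi> where \<Psi>: "\<Psi> \<in> Nt i (u + 2 * d i) N" "\<phi> = inn i \<Psi>" using \<phi> by (auto simp: inf_def)
  have comp: "(\<lambda>w. \<Psi> ((k, s), w)) \<in> N k (u + 2 * d i + sh i (k, s))" if "(k, s) \<in> idx i" for k s
    using \<Psi>(1) that unfolding Nt_def prod_space_def by fastforce
  have rel: "rel1_ok (\<lambda>w. \<Psi> ((k, s), w))" if "(k, s) \<in> idx i" for k s
    using comp[OF that] graded_subD(2)[OF N] by (auto simp: V_def Vfull_def)
  \<comment> \<open>One more loop at i shifts the copies by one. The copy s = 0 wraps around to the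
    last one, its \<open>a i k\<close> loops turning into \<open>a k i\<close> loops at k by
    (R1).\<close>
  define \<Phi> where "\<Phi> y = (case y of ((k, s), w) \<Rightarrow> if (k, s) \<in> idx i then
     (if Suc s < a i k then \<Psi> ((k, Suc s), w) else \<Psi> ((k, 0), loops (a k i) k @ w)) else 0)" for y
  have "\<Phi> \<in> Nt i (u + 2 * d i + 2 * d i) N"
    unfolding Nt_def prod_space_def
  proof (rule CollectI, intro conjI ballI allI impI)
    fix x assume x: "x \<in> idx i"
    obtain k s where ks: "x = (k, s)" by (cases x)
    have k: "adj C i k" "s < a i k" using x ks by (auto simp: idx_iff)
    show "(\<lambda>b. \<Phi> (x, b)) \<in> N (fst x) (u + 2 * d i + 2 * d i + sh i x)"
    proof (cases "Suc s < a i k")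
      case True
      then have e: "(\<lambda>b. \<Phi> ((k, s), b)) = (\<lambda>b. \<Psi> ((k, Suc s), b))" using x ks by (simp add: \<Phi>_def)
      have e2: "u + 2 * d i + 2 * d i + sh i (k, s) = u + 2 * d i + sh i (k, Suc s)" by (simp add: sh_def algebra_simps)
      show ?thesis unfolding ks fst_conv e2 e using comp[of k "Suc s"] True k by (simp add: idx_iff)
    next
      case False
      then have s: "s = a i k - 1" using k by simp
      have "(\<lambda>b. \<Phi> (x, b)) = prep (loops (a k i) k) (\<lambda>b. \<Psi> ((k, 0), b))" using x ks False by (simp add: \<Phi>_def prep_def)
      moreover have "prep (loops (a k i) k) (\<lambda>b. \<Psi> ((k, 0), b)) \<in> N k (u + 2 * d i + sh i (k, 0) + 2 * d k * int (a k i))"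
        using comp[of k 0] k by (intro prep_loops_in[of "N k"] graded_subD(3)[OF N]) (auto simp: idx_iff)
      moreover have "u + 2 * d i + sh i (k, 0) + 2 * d k * int (a k i) = u + 2 * d i + 2 * d i + sh i (k, s)"
        using d_a_sym[OF k(1)] k s by (simp add: sh_def algebra_simps of_nat_diff)
      ultimately show ?thesis using ks by simp
    qed
  qed (auto simp: \<Phi>_def)
  moreover have "prep [Loop i] \<phi> = inn i \<Phi>"
  proof
    fix p
    have "(\<Sum>s<a i k. \<Psi> ((k, s), Arr k i # loops (a i k - 1 - s) i @ Loop i # p))
        = (\<Sum>s<a i k. \<Phi> ((k, s), Arr k i # loops (a i k - 1 - s) i @ p))" if k: "adj C i k" for k
    proof -
      obtain m where m: "a i k = Suc m" using a_pos[OF k] gr0_implies_Suc by blast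
      have l: "loops n i @ Loop i # p = loops (Suc n) i @ p" for n
        by (simp add: replicate_app_Cons_same)
      have "(\<Sum>s<a i k. \<Psi> ((k, s), Arr k i # loops (a i k - 1 - s) i @ Loop i # p))
        = \<Psi> ((k, 0), Arr k i # loops (a i k) i @ p) + (\<Sum>s<m. \<Psi> ((k, Suc s), Arr k i # loops (m - Suc s) i @ Loop i # p))"
        unfolding m by (subst sum.lessThan_Suc_shift) (simp add: l)
      also have "\<Psi> ((k, 0), Arr k i # loops (a i k) i @ p) = \<Psi> ((k, 0), loops (a k i) k @ Arr k i # p)"
        using rel1_okD[OF rel[of k 0] adj_sym[OF k], of "[]" p] k m by (simp add: idx_iff)
      also have "\<dots> + (\<Sum>s<m. \<Psi> ((k, Suc s), Arr k i # loops (m - Suc s) i @ Loop i # p))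
        = (\<Sum>s<Suc m. \<Phi> ((k, s), Arr k i # loops (m - s) i @ p))"
      proof -
        have "\<Phi> ((k, m), Arr k i # p) = \<Psi> ((k, 0), loops (a k i) k @ Arr k i # p)"
          using k m by (simp add: \<Phi>_def idx_iff)
        moreover have "\<Phi> ((k, s), Arr k i # loops (m - s) i @ p) = \<Psi> ((k, Suc s), Arr k i # loops (m - Suc s) i @ Loop i # p)"
          if "s < m" for s
          using k m that by (simp add: \<Phi>_def idx_iff l Suc_diff_Suc)
        ultimately show ?thesis by simp
      qed
      finally show ?thesis using m by simp
    qed
    then show "prep [Loop i] \<phi> p = inn i \<Phi> p"
      unfolding \<Psi>(2) by (simp add: inn_def prep_def sum_idx sum_distrib_left[symmetric])
  qed
  ultimately show ?thesis by (simp add: inf_def)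
qed

text \<open>An element of \<open>N k\<close> is placed in the last copy, where no loops at i follow
  the arrow; the sign is compensated by \<omega>^2 = 1.\<close>

lemma inf_A:
  assumes N: "graded_sub N" and k: "adj C i k" and \<phi>: "\<phi> \<in> N k u"
  shows "prep [Arr k i] \<phi> \<in> inf i N (u - max (d k) (d i))"
proof -
  let ?x = "(k, a i k - 1)"
  have x: "?x \<in> idx i" using a_pos[OF k] k by (simp add: idx_iff)
  define \<Psi> where "\<Psi> y = (if fst y = ?x then of_int (\<omega> i k) * \<phi> (snd y) else 0)" for y
  have deg: "u - max (d k) (d i) + 2 * d i + sh i ?x = u"
    using inn_degree[OF x, of "u - max (d k) (d i)"] by simp
  have "\<Psi> \<in> Nt i (u - max (d k) (d i) + 2 * d i) N"
    unfolding Nt_def prod_space_def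
  proof (rule CollectI, intro conjI ballI allI impI)
    fix y assume "y \<in> idx i"
    show "(\<lambda>b. \<Psi> (y, b)) \<in> N (fst y) (u - max (d k) (d i) + 2 * d i + sh i y)"
    proof (cases "y = ?x")
      case True
      have "(\<lambda>b. of_int (\<omega> i k) * \<phi> b) \<in> N k u"
        using fs.subspace_scale[OF gspaceD(1)[OF graded_subD(1)[OF N]] \<phi>] .
      then show ?thesis unfolding True deg \<Psi>_def by simp
    next
      case False
      then show ?thesis using fs.subspace_0[OF gspaceD(1)[OF graded_subD(1)[OF N]]]
        by (simp add: \<Psi>_def zero_fun_def)
    qed
  qed (use x in \<open>auto simp: \<Psi>_def\<close>)
  moreover have "prep [Arr k i] \<phi> = inn i \<Psi>"
  proof
    fix p
    have "inn i \<Psi> p = (\<Sum>y\<in>idx i. if y = ?x then of_int (\<omega> i k) * (of_int (\<omega> i k) * \<phi> (Arr k i # p)) else 0)"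
      unfolding inn_def
    proof (rule sum.cong[OF refl])
      fix y assume "y \<in> idx i"
      show "(case y of (l, s) \<Rightarrow> of_int (\<omega> i l) * \<Psi> ((l, s), Arr l i # loops (a i l - 1 - s) i @ p))
        = (if y = ?x then of_int (\<omega> i k) * (of_int (\<omega> i k) * \<phi> (Arr k i # p)) else 0)"
        by (cases y; cases "y = ?x") (auto simp: \<Psi>_def)
    qed
    also have "\<dots> = of_int (\<omega> i k) * of_int (\<omega> i k) * \<phi> (Arr k i # p)"
      using x finite_idx by (simp add: mult.assoc)
    finally show "prep [Arr k i] \<phi> p = inn i \<Psi> p" by (simp add: omega_sq[OF k] prep_def)
  qed
  ultimately show ?thesis by (simp add: inf_def)
qed

lemma upf_E:
  assumes N: "graded_sub N" and \<phi>: "\<phi> \<in> upf i N u"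
  shows "prep [Loop i] \<phi> \<in> upf i N (u + 2 * d i)"
  unfolding upf_iff
proof (intro conjI allI impI)
  have V: "\<phi> \<in> V i u" using \<phi> by (simp add: upf_iff)
  then show "prep [Loop i] \<phi> \<in> V i (u + 2 * d i)" by (rule V_closed)
  fix k s assume ks: "(k, s) \<in> idx i"
  then have k: "adj C i k" "s < a i k" by (auto simp: idx_iff)
  have eq: "prep (loops s i @ [Arr i k]) (prep [Loop i] \<phi>) = prep (loops (Suc s) i @ [Arr i k]) \<phi>"
    by (simp add: prep_prep)
  have c: "prep (loops s i @ [Arr i k]) \<phi> \<in> N k (u + sh i (k, s))" if "s < a i k" for s
    using \<phi> that k by (simp add: upf_iff idx_iff)
  show "prep (loops s i @ [Arr i k]) (prep [Loop i] \<phi>) \<in> N k (u + 2 * d i + sh i (k, s))"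
  proof (cases "Suc s < a i k")
    case True
    then show ?thesis unfolding eq using c[OF True] by (simp add: sh_def algebra_simps)
  next
    case False
    then have s: "Suc s = a i k" using k by simp
    have "prep (loops (Suc s) i @ [Arr i k]) \<phi> = prep (loops (a k i) k) (prep [Arr i k] \<phi>)"
    proof
      fix p
      have "rel1_ok \<phi>" using V by (simp add: V_def Vfull_def)
      from rel1_okD[OF this k(1), of "[]" p]
      show "prep (loops (Suc s) i @ [Arr i k]) \<phi> p = prep (loops (a k i) k) (prep [Arr i k] \<phi>) p"
        unfolding s by (simp add: prep_def)
    qed
    moreover have "prep (loops (a k i) k) (prep [Arr i k] \<phi>) \<in> N k (u + sh i (k, 0) + 2 * d k * int (a k i))"
      using c[of 0] a_pos[OF k(1)] by (intro prep_loops_in[of "N k"] graded_subD(3)[OF N]) auto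
    moreover have "u + sh i (k, 0) + 2 * d k * int (a k i) = u + 2 * d i + sh i (k, s)"
    proof -
      have "d k * int (a k i) = d i * (1 + int s)" using d_a_sym[OF k(1)] s by simp
      then show ?thesis by (simp add: sh_def algebra_simps)
    qed
    ultimately show ?thesis unfolding eq by simp
  qed
qed

lemma inf_sub:
  assumes "graded_sub N"
  shows "inf i N u \<subseteq> N i u"
  by (rule inf_least[where Z = "N i"]) (use graded_subD[OF assms] gspaceD(1) adj_sym in blast)+

lemma sub_upf:
  assumes "graded_sub N"
  shows "N i u \<subseteq> upf i N u"
proof
  fix \<phi> assume \<phi>: "\<phi> \<in> N i u"
  show "\<phi> \<in> upf i N u" unfolding upf_iff
  proof (intro conjI allI impI)
    show "\<phi> \<in> V i u" using \<phi> graded_subD(2)[OF assms] by blast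
    fix k s assume "(k, s) \<in> idx i"
    then have k: "adj C i k" by (simp add: idx_iff)
    have "prep (loops s i) \<phi> \<in> N i (u + 2 * d i * int s)"
      using \<phi> graded_subD(3)[OF assms] by (intro prep_loops_in[of "N i"]) auto
    from graded_subD(4)[OF assms k this]
    show "prep (loops s i @ [Arr i k]) \<phi> \<in> N k (u + sh i (k, s))" by (simp add: prep_prep sh_def algebra_simps)
  qed
qed

lemma upf_gspace:
  assumes N: "graded_sub N"
  shows "gspace (upf i N :: int \<Rightarrow> ('i, 'k::field) wfun set)"
proof -
  have gs: "gspace (N k)" for k by (rule graded_subD(1)[OF N])
  have NV: "N k u \<subseteq> V k u" for k u by (rule graded_subD(2)[OF N])
  let ?B = "insert 0 (\<Union>x\<in>idx i. (\<lambda>v. v - sh i x) ` {v. N (fst x) v \<noteq> {0}})"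
  have "finite ?B" using finite_idx gspaceD(3)[OF gs] by auto
  moreover have "{u. upf i N u \<noteq> {0}} \<subseteq> ?B"
  proof
    fix u assume u: "u \<in> {u. upf i N u \<noteq> {0}}"
    show "u \<in> ?B"
    proof (rule ccontr)
      assume n: "u \<notin> ?B"
      have "N (fst x) (u + sh i x) = {0}" if x: "x \<in> idx i" for x
      proof (rule ccontr)
        assume "N (fst x) (u + sh i x) \<noteq> {0}"
        then have "u \<in> (\<lambda>v. v - sh i x) ` {v. N (fst x) v \<noteq> {0}}" by (intro image_eqI[of _ _ "u + sh i x"]) auto
        then show False using n x by blast
      qed
      then have "gd (N (fst x)) (u + sh i x) = 0" if "x \<in> idx i" for x using that by (simp add: gd_def fs.dim_zero_space)
      then have "gd (upf i N) u + gd (inf i N) (u - 2 * d i) = 0"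
        unfolding dim_formula(2)[OF gs NV] using n by simp
      then have "fs.dim (upf i N u) = 0" by (simp add: gd_def)
      then have "upf i N u = {0}" by (rule fs.dim_eq_zero_fin[OF dim_formula(1)[OF gs NV] _ upf_subspace[OF gs]])
      then show False using u by simp
    qed
  qed
  ultimately have "finite {u. upf i N u \<noteq> {0}}" by (rule rev_finite_subset)
  then show ?thesis unfolding gspace_def
    by (intro conjI allI upf_subspace[OF gs] dim_formula(1)[OF gs NV])
qed

lemma inf_gspace:
  assumes N: "graded_sub N"
  shows "gspace (inf i N)"
  using gspace_sub[OF graded_subD(1)[OF N] inf_sub[OF N] inf_space(1)[OF graded_subD(1)[OF N]]] .

text \<open>The two extremes encode exactly the conditions on arrows to and from i. Spaces strictly
  between them are allowed as well; the rank two argument uses one at an auxiliary vertex.\<close>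

lemma replace_graded_sub:
  assumes N: "graded_sub N" and Z: "gspace Z" "\<And>u. inf i N u \<subseteq> Z u" "\<And>u. Z u \<subseteq> upf i N u"
    "\<And>u \<phi>. \<phi> \<in> Z u \<Longrightarrow> prep [Loop i] \<phi> \<in> Z (u + 2 * d i)"
  shows "graded_sub (N(i := Z))"
  unfolding graded_sub_def
proof (intro conjI allI impI ballI)
  fix k show "gspace ((N(i := Z)) k)" using Z(1) graded_subD(1)[OF N] by simp
next
  fix k u show "(N(i := Z)) k u \<subseteq> V k u" using Z(3) graded_subD(2)[OF N] by (auto simp: upf_def)
next
  fix k u \<phi> assume "\<phi> \<in> (N(i := Z)) k u"
  then show "prep [Loop k] \<phi> \<in> (N(i := Z)) k (u + 2 * d k)"
    using Z(4) graded_subD(3)[OF N] by (auto split: if_splits)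
next
  fix l k u \<phi> assume lk: "adj C l k" and \<phi>: "\<phi> \<in> (N(i := Z)) l u"
  have "l \<noteq> k" using lk by (simp add: adj_def)
  consider "l = i" | "k = i" | "l \<noteq> i" "k \<noteq> i" by blast
  then show "prep [Arr l k] \<phi> \<in> (N(i := Z)) k (u - max (d l) (d k))"
  proof cases
    case 1
    then have "\<phi> \<in> upf i N u" using \<phi> Z(3) by auto
    moreover have "(k, 0) \<in> idx i" using lk 1 a_pos by (simp add: idx_iff)
    ultimately have "prep [Arr i k] \<phi> \<in> N k (u + sh i (k, 0))" unfolding upf_iff by fastforce
    then show ?thesis using 1 \<open>l \<noteq> k\<close> by (simp add: sh_def)
  next
    case 2
    then have "\<phi> \<in> N l u" using \<phi> \<open>l \<noteq> k\<close> by simp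
    then show ?thesis using inf_A[OF N adj_sym[OF lk], of \<phi> u] 2 Z(2) by auto
  next
    case 3
    then show ?thesis using \<phi> graded_subD(4)[OF N lk] by simp
  qed
qed

definition U :: "'i \<Rightarrow> ('i, 'k::field) wfam \<Rightarrow> ('i, 'k) wfam" where
  "U i N = N(i := upf i N)"

definition D :: "'i \<Rightarrow> ('i, 'k::field) wfam \<Rightarrow> ('i, 'k) wfam" where
  "D i N = N(i := inf i N)"

lemma graded_sub_U: "graded_sub N \<Longrightarrow> graded_sub (U i N)"
  unfolding U_def
  by (rule replace_graded_sub[OF _ upf_gspace subset_trans[OF inf_sub sub_upf] subset_refl upf_E])

lemma graded_sub_D: "graded_sub N \<Longrightarrow> graded_sub (D i N)"
  unfolding D_def
  by (rule replace_graded_sub[OF _ inf_gspace subset_refl subset_trans[OF inf_sub sub_upf] inf_E])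

lemma upf_U [simp]: "upf i (U i N) = upf i N" and upf_D [simp]: "upf i (D i N) = upf i N"
  and inf_U [simp]: "inf i (U i N) = inf i N" and inf_D [simp]: "inf i (D i N) = inf i N"
  by (auto intro!: upf_cong inf_cong simp: U_def D_def)

lemma U_same [simp]: "U i N i = upf i N" and U_other: "k \<noteq> i \<Longrightarrow> U i N k = N k"
  and D_same [simp]: "D i N i = inf i N" and D_other: "k \<noteq> i \<Longrightarrow> D i N k = N k"
  by (simp_all add: U_def D_def)

text \<open>The exact sequences of all degrees summed against an arbitrary function of the degree;
  total dimensions and first moments are both instances.\<close>

lemma weighted_formula:
  assumes N: "graded_sub N"
  shows "wt f (upf i N) + wt (\<lambda>u. f (u + 2 * d i)) (inf i N)
      = (if i = j then f 0 else 0) + (\<Sum>x\<in>idx i. wt (\<lambda>u. f (u - sh i x)) (N (fst x)))"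
proof -
  have gs: "gspace (N k)" for k by (rule graded_subD(1)[OF N])
  have NV: "N k u \<subseteq> V k u" for k u by (rule graded_subD(2)[OF N])
  let ?I = "\<lambda>u. f (u + 2 * d i) * gd (inf i N) u"
  let ?N = "\<lambda>x u. f (u - sh i x) * gd (N (fst x)) u"
  have I: "finite {u. ?I u \<noteq> 0}" by (rule gspace_supp[OF inf_gspace[OF N], of "\<lambda>u. f (u + 2 * d i)"])
  have fN: "finite {u. ?N x u \<noteq> 0}" for x by (rule gspace_supp[OF gs, of "\<lambda>u. f (u - sh i x)"])
  have fN': "finite {u. ?N x (u + sh i x) \<noteq> 0}" for x by (rule finite_shift[OF fN])
  have sumN: "finite {u. (\<Sum>x\<in>idx i. ?N x (u + sh i x)) \<noteq> 0}"
    "fsum (\<lambda>u. \<Sum>x\<in>idx i. ?N x (u + sh i x)) = (\<Sum>x\<in>idx i. fsum (\<lambda>u. ?N x (u + sh i x)))"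
    using fsum_sum[of "idx i" "\<lambda>x u. ?N x (u + sh i x)", OF finite_idx fN'] by simp_all
  have fU: "finite {u. f u * gd (upf i N) u \<noteq> 0}" by (rule gspace_supp[OF upf_gspace[OF N]])
  have d0: "finite {u :: int. (if i = j \<and> u = 0 then f 0 else 0) \<noteq> 0}"
    by (rule finite_subset[of _ "{0}"]) (auto split: if_splits)
  have "fsum (\<lambda>u. f u * gd (upf i N) u) + fsum (\<lambda>u. ?I (u + - (2 * d i)))
      = fsum (\<lambda>u. f u * gd (upf i N) u + ?I (u + - (2 * d i)))"
    by (rule fsum_add[symmetric, OF fU finite_shift[OF I]])
  also have "\<dots> = fsum (\<lambda>u. (if i = j \<and> u = 0 then f 0 else 0) + (\<Sum>x\<in>idx i. ?N x (u + sh i x)))"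
  proof (rule Sum_any.cong)
    fix u
    have "f u * gd (upf i N) u + ?I (u + - (2 * d i)) = f u * (gd (upf i N) u + gd (inf i N) (u - 2 * d i))"
      by (simp add: distrib_left)
    then show "f u * gd (upf i N) u + ?I (u + - (2 * d i))
        = (if i = j \<and> u = 0 then f 0 else 0) + (\<Sum>x\<in>idx i. ?N x (u + sh i x))"
      unfolding dim_formula(2)[OF gs NV] by (simp add: distrib_left sum_distrib_left)
  qed
  also have "\<dots> = fsum (\<lambda>u :: int. if i = j \<and> u = 0 then f 0 else 0) + fsum (\<lambda>u. \<Sum>x\<in>idx i. ?N x (u + sh i x))"
    by (rule fsum_add[OF d0 sumN(1)])
  also have "fsum (\<lambda>u. \<Sum>x\<in>idx i. ?N x (u + sh i x)) = (\<Sum>x\<in>idx i. fsum (\<lambda>u. ?N x (u + sh i x)))"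
    by (rule sumN(2))
  also have "fsum (\<lambda>u :: int. if i = j \<and> u = 0 then f 0 else 0) = (if i = j then f 0 else 0)"
    by (cases "i = j") simp_all
  finally show ?thesis unfolding fsum_shift[of ?I] fsum_shift[of "?N _"] wt_def .
qed

end

text \<open>\<open>p k\<close> will be the weight at the next letter of a chain of reflections at
  two vertices, and \<open>M\<close> their Coxeter number. Since \<open>a * b\<close> is at most 3,
  six cases remain and are followed term by term. The bound \<open>t\<close> reflects that the
  recurrence is available only as far as the chain has been controlled.\<close>

lemma alternating_recurrence:
  fixes p :: "nat \<Rightarrow> int" and a b :: nat
  assumes M: "(a = 0 \<and> b = 0 \<and> M = 2) \<or> (a * b = 1 \<and> M = 3) \<or> (a * b = 2 \<and> M = 4) \<or> (a * b = 3 \<and> M = 6)"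
    and PQ: "0 \<le> P" "0 \<le> Q" and p0: "p 0 = P" and p1: "0 < t \<Longrightarrow> p 1 = Q + int b * P"
    and rec: "\<And>k. Suc k < t \<Longrightarrow> p (Suc (Suc k)) = int (if even k then a else b) * p (Suc k) - p k"
  shows "k < M \<Longrightarrow> k \<le> t \<Longrightarrow> 0 \<le> p k" "M \<le> t \<Longrightarrow> p M = - P" "M \<le> t \<Longrightarrow> p (M - 1) = Q"
proof -
  have r2: "1 < t \<Longrightarrow> p 2 = int a * p 1 - p 0" using rec[of 0] by (simp add: numeral_2_eq_2)
  have r3: "2 < t \<Longrightarrow> p 3 = int b * p 2 - p 1" using rec[of 1] by (simp add: numeral_3_eq_3 numeral_2_eq_2)
  have r4: "3 < t \<Longrightarrow> p 4 = int a * p 3 - p 2" using rec[of 2] by simp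
  have r5: "4 < t \<Longrightarrow> p 5 = int b * p 4 - p 3" using rec[of 3] by simp
  have r6: "5 < t \<Longrightarrow> p 6 = int a * p 5 - p 4" using rec[of 4] by simp
  have small: "x * y = 1 \<Longrightarrow> x = 1 \<and> y = 1" "x * y = 2 \<Longrightarrow> (x = 1 \<and> y = 2) \<or> (x = 2 \<and> y = 1)"
    "x * y = 3 \<Longrightarrow> (x = 1 \<and> y = 3) \<or> (x = 3 \<and> y = 1)" for x y :: nat
  proof -
    show "x * y = 1 \<Longrightarrow> x = 1 \<and> y = 1" by simp
    have "x * y = 2 \<Longrightarrow> x dvd 2" "x * y = 3 \<Longrightarrow> x dvd 3" by (metis dvd_triv_left)+
    then show "x * y = 2 \<Longrightarrow> (x = 1 \<and> y = 2) \<or> (x = 2 \<and> y = 1)"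
      "x * y = 3 \<Longrightarrow> (x = 1 \<and> y = 3) \<or> (x = 3 \<and> y = 1)"
    proof -
      assume x: "x * y = 2" "x * y = 2 \<Longrightarrow> x dvd 2"
      then have "x \<le> 2" by (intro dvd_imp_le) auto
      moreover have "x \<noteq> 0" using x(1) by (intro notI) simp
      ultimately have "x = 1 \<or> x = 2" by linarith
      then show "(x = 1 \<and> y = 2) \<or> (x = 2 \<and> y = 1)" using x(1) by auto
    next
      assume x: "x * y = 3" "x * y = 3 \<Longrightarrow> x dvd 3"
      then have "x \<le> 3" by (intro dvd_imp_le) auto
      moreover have "x \<noteq> 0" using x(1) by (intro notI) simp
      ultimately have "x = 1 \<or> x = 2 \<or> x = 3" by linarith
      then show "(x = 1 \<and> y = 3) \<or> (x = 3 \<and> y = 1)" proof (elim disjE)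
        assume "x = 2"
        then have "2 * y = 3" using x(1) by simp
        then show ?thesis by presburger
      qed (use x(1) in simp_all)
    qed
  qed
  consider "a = 0" "b = 0" "M = 2" | "a = 1" "b = 1" "M = 3" | "a = 1" "b = 2" "M = 4" | "a = 2" "b = 1" "M = 4"
    | "a = 1" "b = 3" "M = 6" | "a = 3" "b = 1" "M = 6"
    using M small by blast
  then have "(k < M \<longrightarrow> k \<le> t \<longrightarrow> 0 \<le> p k) \<and> (M \<le> t \<longrightarrow> p M = - P) \<and> (M \<le> t \<longrightarrow> p (M - 1) = Q)" for k
  proof cases
    case 1
    have "k < M \<Longrightarrow> k = 0 \<or> k = 1" using 1(3) by linarith
    then show ?thesis using 1 p0 p1 r2 PQ by auto
  next
    case 2
    have "k < M \<Longrightarrow> k = 0 \<or> k = 1 \<or> k = 2" using 2(3) by linarith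
    then show ?thesis using 2 p0 p1 r2 r3 PQ by auto
  next
    case 3
    have "k < M \<Longrightarrow> k = 0 \<or> k = 1 \<or> k = 2 \<or> k = 3" using 3(3) by linarith
    then show ?thesis using 3 p0 p1 r2 r3 r4 PQ by auto
  next
    case 4
    have "k < M \<Longrightarrow> k = 0 \<or> k = 1 \<or> k = 2 \<or> k = 3" using 4(3) by linarith
    then show ?thesis using 4 p0 p1 r2 r3 r4 PQ by auto
  next
    case 5
    have "k < M \<Longrightarrow> k = 0 \<or> k = 1 \<or> k = 2 \<or> k = 3 \<or> k = 4 \<or> k = 5" using 5(3) by linarith
    then show ?thesis using 5 p0 p1 r2 r3 r4 r5 r6 PQ by auto
  next
    case 6
    have "k < M \<Longrightarrow> k = 0 \<or> k = 1 \<or> k = 2 \<or> k = 3 \<or> k = 4 \<or> k = 5" using 6(3) by linarith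
    then show ?thesis using 6 p0 p1 r2 r3 r4 r5 r6 PQ by auto
  qed
  then show "k < M \<Longrightarrow> k \<le> t \<Longrightarrow> 0 \<le> p k" "M \<le> t \<Longrightarrow> p M = - P" "M \<le> t \<Longrightarrow> p (M - 1) = Q" by blast+
qed

section \<open>Weights and codimensions\<close>

context gpa_dual
begin

definition dvec :: "('i, 'k::field) wfam \<Rightarrow> int ^ 'i" where
  "dvec N = (\<chi> k. tot (N k))"

text \<open>The coordinates of the weight \<open>\<omega>\<^sub>j - \<Sum>\<^sub>k dim N\<^sub>k \<alpha>\<^sub>k\<close>.\<close>

definition lam :: "('i, 'k::field) wfam \<Rightarrow> 'i \<Rightarrow> int" where
  "lam N i = (if i = j then 1 else 0) - (C *v dvec N) $ i"

lemma nonadj: "k \<noteq> i \<Longrightarrow> \<not> adj C i k \<Longrightarrow> C $ i $ k = 0"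
  using offdiag[of i k] by (auto simp: adj_def)

lemma a_nonadj: "k \<noteq> i \<Longrightarrow> C $ i $ k = - int (a i k)"
  using offdiag[of i k] by (auto simp: a_def)

lemma cartan_row: "(C *v x) $ i = 2 * x $ i - (\<Sum>k | adj C i k. int (a i k) * x $ k)"
proof -
  have "(C *v x) $ i = (\<Sum>k\<in>UNIV. C $ i $ k * x $ k)" by (rule mat_vec_nth)
  also have "\<dots> = 2 * x $ i + (\<Sum>k\<in>UNIV - {i}. C $ i $ k * x $ k)"
    by (subst sum.remove[of UNIV i]) (simp_all add: diag)
  also have "(\<Sum>k\<in>UNIV - {i}. C $ i $ k * x $ k) = (\<Sum>k | adj C i k. C $ i $ k * x $ k)"
    by (rule sum.mono_neutral_right) (auto simp: nonadj adj_def)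
  also have "\<dots> = (\<Sum>k | adj C i k. - (int (a i k) * x $ k))"
    by (rule sum.cong) (auto simp: int_a)
  finally show ?thesis by (simp add: sum_negf)
qed

lemma total_formula:
  assumes "graded_sub N"
  shows "tot (upf i N) + tot (inf i N) = (if i = j then 1 else 0) + (\<Sum>k | adj C i k. int (a i k) * tot (N k))"
proof -
  have "(\<Sum>x\<in>idx i. tot (N (fst x))) = (\<Sum>k | adj C i k. int (a i k) * tot (N k))"
    unfolding sum_idx by simp
  then show ?thesis using weighted_formula[OF assms, of "\<lambda>_. 1" i] by simp
qed

text \<open>The weight is dim(N+/N) - dim(N/N-) at i. Once one of the two terms is known to vanish,
  the sign of the weight decides about the other.\<close>

lemma lam_eq:
  assumes "graded_sub N"
  shows "lam N i = (tot (upf i N) - tot (N i)) - (tot (N i) - tot (inf i N))"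
  using total_formula[OF assms, of i] by (simp add: lam_def cartan_row dvec_def)

lemma tot_le:
  assumes "graded_sub N"
  shows "tot (N i) \<le> tot (upf i N)" "tot (inf i N) \<le> tot (N i)"
  by (rule tot_mono[OF upf_gspace[OF assms] graded_subD(1)[OF assms] sub_upf[OF assms]])
    (rule tot_mono[OF graded_subD(1)[OF assms] inf_gspace[OF assms] inf_sub[OF assms]])

text \<open>The vertex i does not occur in the top of N.\<close>

definition topfree :: "'i \<Rightarrow> ('i, 'k::field) wfam \<Rightarrow> bool" where
  "topfree i N \<longleftrightarrow> inf i N = N i"

definition full :: "'i \<Rightarrow> ('i, 'k::field) wfam \<Rightarrow> bool" where
  "full i N \<longleftrightarrow> upf i N = N i"

lemma topfreeI:
  assumes "graded_sub N" "tot (N i) \<le> tot (inf i N)"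
  shows "topfree i N"
  unfolding topfree_def
  using tot_eq[OF graded_subD(1)[OF assms(1)] inf_gspace[OF assms(1)] inf_sub[OF assms(1)] assms(2)] .

lemma fullI:
  assumes "graded_sub N" "tot (upf i N) \<le> tot (N i)"
  shows "full i N"
  unfolding full_def
  using tot_eq[OF upf_gspace[OF assms(1)] graded_subD(1)[OF assms(1)] sub_upf[OF assms(1)] assms(2)] by simp

lemma topfree_if_full:
  assumes "graded_sub N" "full i N" "0 \<le> lam N i"
  shows "topfree i N"
  using lam_eq[OF assms(1), of i] assms by (intro topfreeI) (auto simp: full_def)

lemma full_if_topfree:
  assumes "graded_sub N" "topfree i N" "lam N i \<le> 0"
  shows "full i N"
  using lam_eq[OF assms(1), of i] assms by (intro fullI) (auto simp: topfree_def)

definition extremal :: "('i, 'k::field) wfam \<Rightarrow> bool" where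
  "extremal N \<longleftrightarrow> (\<forall>i. topfree i N \<or> full i N)"

lemma U_full: "full i N \<Longrightarrow> U i N = N"
  by (simp add: U_def full_def)

lemma U_D_full: "full i N \<Longrightarrow> U i (D i N) = N"
  by (simp add: U_def D_def full_def fun_eq_iff)
    (metis D_def full_def upf_D)

lemma D_U_topfree: "topfree i N \<Longrightarrow> D i (U i N) = N"
  by (simp add: U_def D_def topfree_def fun_eq_iff)
    (metis U_def topfree_def inf_U)

lemma topfree_D: "topfree i (D i N)"
  by (simp add: topfree_def)

lemma full_U: "full i (U i N)"
  by (simp add: full_def)

lemma dvec_U:
  assumes "graded_sub N" "topfree i N"
  shows "dvec (U i N) = dvec N + axis i (lam N i)"
proof -
  have "tot (upf i N) = tot (N i) + lam N i" using lam_eq[OF assms(1), of i] assms(2) by (simp add: topfree_def)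
  then show ?thesis by (auto simp: dvec_def vec_eq_iff axis_nth U_def)
qed

lemma lam_U:
  assumes "graded_sub N" "topfree i N"
  shows "lam (U i N) k = lam N k - C $ k $ i * lam N i"
  unfolding lam_def[of "U i N"] dvec_U[OF assms]
  by (simp add: lam_def[of N k] matrix_vector_right_distrib mat_vec_axis)

lemma lam_U_same: "graded_sub N \<Longrightarrow> topfree i N \<Longrightarrow> lam (U i N) i = - lam N i"
  by (simp add: lam_U diag)

lemma lam_U_other: "graded_sub N \<Longrightarrow> topfree i N \<Longrightarrow> k \<noteq> i \<Longrightarrow> lam (U i N) k = lam N k + int (a k i) * lam N i"
  by (simp add: lam_U a_nonadj)

text \<open>The total formulas at x for N' and for R are subtracted. As R agrees with
  \<open>U x N'\<close> away from x and y, only y contributes; the last summand is the defect of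
  fullness of R at x.\<close>

lemma codim_step:
  assumes N': "graded_sub N'" "topfree x N'" and R: "graded_sub R" and xy: "x \<noteq> y"
    and eq: "\<And>z. z \<noteq> x \<Longrightarrow> z \<noteq> y \<Longrightarrow> R z = U x N' z"
  shows "tot (N' x) - tot (inf x R) = int (a x y) * (tot (U x N' y) - tot (R y))
    - (tot (U x N' x) - tot (R x)) + (tot (upf x R) - tot (R x))"
proof -
  have "(\<Sum>k | adj C x k. int (a x k) * tot (N' k)) - (\<Sum>k | adj C x k. int (a x k) * tot (R k))
      = (\<Sum>k | adj C x k. if k = y then int (a x y) * (tot (N' y) - tot (R y)) else 0)"
    unfolding sum_subtractf[symmetric]
  proof (rule sum.cong[OF refl])
    fix k assume "k \<in> {k. adj C x k}"
    then have "k \<noteq> x" by (auto simp: adj_def)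
    then show "int (a x k) * tot (N' k) - int (a x k) * tot (R k) = (if k = y then int (a x y) * (tot (N' y) - tot (R y)) else 0)"
      using eq[of k] by (auto simp: U_other right_diff_distrib)
  qed
  also have "\<dots> = int (a x y) * (tot (N' y) - tot (R y))"
  proof (cases "adj C x y")
    case True
    then show ?thesis by simp
  next
    case False
    then have "a x y = 0" using nonadj[of y x] xy by (simp add: a_def)
    then show ?thesis using False by simp
  qed
  finally show ?thesis
    using total_formula[OF N'(1), of x] total_formula[OF R, of x] N'(2) xy
    by (simp add: topfree_def U_other)
qed

lemma full_D_U:
  assumes N1: "graded_sub N1" and im: "i \<noteq> m"
  shows "upf i (D m (U i N1)) = U i N1 i"
proof
  fix u
  let ?N = "U i N1"
  have N: "graded_sub ?N" by (rule graded_sub_U[OF N1])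
  have "upf i (D m ?N) u \<subseteq> upf i ?N u"
    by (rule upf_mono) (use inf_sub[OF N] in \<open>auto simp: D_def\<close>)
  moreover have "D m ?N i u \<subseteq> upf i (D m ?N) u" by (rule sub_upf[OF graded_sub_D[OF N]])
  ultimately show "upf i (D m ?N) u = ?N i u" using im by (auto simp: D_other)
qed

text \<open>Let \<open>T\<close> be the left-hand side.  Enlarging \<open>D m N\<close> by \<open>T\<close> at \<open>m\<close> leaves \<open>inf i\<close> unchanged, because the
  arrow to \<open>i\<close> already maps \<open>T\<close> into \<open>inf i (D m N)\<close>; counting codimensions forces \<open>T = inf m N\<close>.\<close>

lemma full_D_D_U_U:
  assumes N2: "graded_sub N2" and tf: "topfree i (U m N2)" and im: "i \<noteq> m" and pos: "0 < a i m"
  defines "N \<equiv> U i (U m N2)"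
  shows "upf m (D i (D m N)) = inf m N"
proof -
  let ?N1 = "U m N2" let ?R0 = "D m N" let ?R1 = "D i (D m N)"
  have N1: "graded_sub ?N1" by (rule graded_sub_U[OF N2])
  have N: "graded_sub N" unfolding N_def by (rule graded_sub_U[OF N1])
  have R0: "graded_sub ?R0" by (rule graded_sub_D[OF N])
  have R1: "graded_sub ?R1" by (rule graded_sub_D[OF R0])
  define T where "T = upf m ?R1"
  have R0N: "?R0 k u \<subseteq> N k u" for k u using inf_sub[OF N] by (auto simp: D_def)
  have R1N1: "?R1 k u \<subseteq> ?N1 k u" if "k \<noteq> m" for k u
  proof (cases "k = i")
    case True
    have "inf i ?R0 u \<subseteq> inf i N u" by (rule inf_mono) (rule R0N)
    also have "\<dots> \<subseteq> ?N1 i u" unfolding N_def inf_U by (rule inf_sub[OF N1])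
    finally show ?thesis using True by simp
  next
    case False
    then show ?thesis using that im by (simp add: D_other N_def U_other)
  qed
  have lower: "inf m N u \<subseteq> T u" for u
    using sub_upf[OF R1, of m u] im unfolding T_def by (simp add: D_other)
  have TN: "T u \<subseteq> N m u" for u
  proof -
    have "T u \<subseteq> upf m ?N1 u" unfolding T_def by (rule upf_mono) (rule R1N1)
    also have "\<dots> = N m u" using im by (simp add: N_def U_other)
    finally show ?thesis .
  qed
  define Rp where "Rp = N(m := T)"
  have Rp: "graded_sub Rp" unfolding Rp_def
  proof (rule replace_graded_sub[OF N])
    show "gspace T" unfolding T_def by (rule upf_gspace[OF R1])
    show "inf m N u \<subseteq> T u" for u by (rule lower)
    show "T u \<subseteq> upf m N u" for u using TN sub_upf[OF N] by blast
    show "\<phi> \<in> T u \<Longrightarrow> prep [Loop m] \<phi> \<in> T (u + 2 * d m)" for u \<phi>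
      unfolding T_def by (rule upf_E[OF R1])
  qed
  have RpN: "Rp k u \<subseteq> N k u" for k u using TN by (auto simp: Rp_def)
  have R0Rp: "?R0 k u \<subseteq> Rp k u" for k u using lower by (auto simp: Rp_def D_def)
  have "inf i Rp u \<subseteq> inf i ?R0 u" for u
  proof (rule inf_least)
    show "fs.subspace (inf i ?R0 u)" for u by (rule gspaceD(1)[OF inf_gspace[OF R0]])
    show "\<phi> \<in> inf i ?R0 u \<Longrightarrow> prep [Loop i] \<phi> \<in> inf i ?R0 (u + 2 * d i)" for u \<phi> by (rule inf_E[OF R0])
    fix k u \<phi> assume k: "adj C i k" and \<phi>: "\<phi> \<in> Rp k u"
    show "prep [Arr k i] \<phi> \<in> inf i ?R0 (u - max (d k) (d i))"
    proof (cases "k = m")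
      case True
      then have "\<phi> \<in> upf m ?R1 u" using \<phi> by (simp add: Rp_def T_def)
      moreover have "(i, 0) \<in> idx m" using k True adj_sym a_pos by (simp add: idx_iff)
      ultimately have "prep [Arr m i] \<phi> \<in> ?R1 i (u + sh m (i, 0))" unfolding upf_iff by fastforce
      then show ?thesis using True by (simp add: sh_def)
    next
      case False
      then have "\<phi> \<in> ?R0 k u" using \<phi> by (simp add: Rp_def D_other)
      then show ?thesis by (rule inf_A[OF R0 k])
    qed
  qed
  moreover have "inf i ?R0 u \<subseteq> inf i Rp u" for u by (rule inf_mono) (rule R0Rp)
  ultimately have infeq: "inf i Rp = inf i ?R0" by (intro ext equalityI)
  have upfeq: "upf i Rp = N i"
  proof (intro ext equalityI)
    fix u
    have "upf i Rp u \<subseteq> upf i N u" by (rule upf_mono) (rule RpN)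
    then show "upf i Rp u \<subseteq> N i u" by (simp add: N_def)
    show "N i u \<subseteq> upf i Rp u" using sub_upf[OF Rp, of i u] im by (simp add: Rp_def)
  qed
  have upfeq': "upf i ?R0 = N i" unfolding N_def by (rule full_D_U[OF N1 im])
  have ne: "z \<noteq> i \<Longrightarrow> z \<noteq> m \<Longrightarrow> Rp z = U i ?N1 z" "z \<noteq> i \<Longrightarrow> z \<noteq> m \<Longrightarrow> ?R0 z = U i ?N1 z" for z
    by (simp_all add: Rp_def D_other N_def)
  have "tot (?N1 i) - tot (inf i ?R0) = int (a i m) * (tot (N m) - tot (Rp m))"
    using codim_step[OF N1 tf Rp im ne(1)] im unfolding infeq upfeq N_def[symmetric] by (simp add: Rp_def)
  moreover have "tot (?N1 i) - tot (inf i ?R0) = int (a i m) * (tot (N m) - tot (?R0 m))"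
    using codim_step[OF N1 tf R0 im ne(2)] im unfolding upfeq' N_def[symmetric] by (simp add: D_other)
  ultimately have "int (a i m) * (tot (N m) - tot (Rp m)) = int (a i m) * (tot (N m) - tot (?R0 m))" by linarith
  then have "tot T = tot (inf m N)" using pos by (simp add: Rp_def)
  then show ?thesis
    using tot_eq[of T "inf m N", OF _ inf_gspace[OF N] lower] upf_gspace[OF R1] by (simp add: T_def)
qed

definition lt :: "'i \<Rightarrow> 'i \<Rightarrow> nat \<Rightarrow> 'i" where
  "lt X Y k = (if even k then X else Y)"

primrec up :: "'i \<Rightarrow> 'i \<Rightarrow> ('i, 'k::field) wfam \<Rightarrow> nat \<Rightarrow> ('i, 'k) wfam" where
  "up X Y N 0 = N"
| "up X Y N (Suc k) = U (lt X Y k) (up X Y N k)"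

lemma up_shift: "up Y X (U X N) k = up X Y N (Suc k)"
  by (induction k) (simp_all add: lt_def)

lemma graded_sub_up: "graded_sub N \<Longrightarrow> graded_sub (up X Y N k)"
  by (induction k) (simp_all add: graded_sub_U)

lemma up_outside: "z \<noteq> X \<Longrightarrow> z \<noteq> Y \<Longrightarrow> up X Y N k z = N z"
  by (induction k) (simp_all add: U_other lt_def)

lemma up_increasing: "graded_sub N \<Longrightarrow> up X Y N k z u \<subseteq> up X Y N (Suc k) z u"
  using sub_upf[OF graded_sub_up[of N X Y k]] by (cases "z = lt X Y k") (simp_all add: U_other)

text \<open>R is a submodule of N that differs from it at x and y only, so that its size relative to
  N is described by two codimensions.\<close>

definition codim_ok :: "'i \<Rightarrow> 'i \<Rightarrow> ('i, 'k::field) wfam \<Rightarrow> ('i, 'k) wfam \<Rightarrow> bool" where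
  "codim_ok x y N R \<longleftrightarrow> graded_sub R \<and> (\<forall>z u. R z u \<subseteq> N z u) \<and> (\<forall>z. z \<noteq> x \<longrightarrow> z \<noteq> y \<longrightarrow> R z = N z)"

lemma codim_ok_sym: "codim_ok x y N R \<Longrightarrow> codim_ok y x N R"
  by (auto simp: codim_ok_def)

lemma codim_ok_step:
  assumes N': "graded_sub N'" and tf: "topfree x N'" and R: "codim_ok x y (U x N') R" and xy: "x \<noteq> y"
  shows "codim_ok x y N' (D x R)"
    "tot (N' x) - tot (D x R x) = int (a x y) * (tot (U x N' y) - tot (R y))
      - (tot (U x N' x) - tot (R x)) + (tot (upf x R) - tot (R x))"
    "tot (N' y) - tot (D x R y) = tot (U x N' y) - tot (R y)"
proof -
  have gR: "graded_sub R" using R by (simp add: codim_ok_def)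
  have "inf x R u \<subseteq> N' x u" for u
  proof -
    have "inf x R u \<subseteq> inf x (U x N') u" by (rule inf_mono) (use R in \<open>auto simp: codim_ok_def\<close>)
    also have "\<dots> \<subseteq> N' x u" using inf_sub[OF N'] by simp
    finally show ?thesis .
  qed
  moreover have "R z u \<subseteq> N' z u" if "z \<noteq> x" for z u
    using R U_other[OF that, of N'] unfolding codim_ok_def by metis
  ultimately have sub: "D x R z u \<subseteq> N' z u" for z u by (cases "z = x") (simp_all add: D_other)
  have "D x R z = N' z" if "z \<noteq> x" "z \<noteq> y" for z
    using R that by (simp add: codim_ok_def D_other U_other)
  then show "codim_ok x y N' (D x R)"
    unfolding codim_ok_def using graded_sub_D[OF gR] sub by blast
  show "tot (N' x) - tot (D x R x) = int (a x y) * (tot (U x N' y) - tot (R y))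
      - (tot (U x N' x) - tot (R x)) + (tot (upf x R) - tot (R x))"
    unfolding D_same by (rule codim_step[OF N' tf gR xy]) (use R in \<open>auto simp: codim_ok_def\<close>)
  show "tot (N' y) - tot (D x R y) = tot (U x N' y) - tot (R y)" using xy by (simp add: U_other D_other)
qed

lemma codim_ok_D: "graded_sub N \<Longrightarrow> codim_ok x y N (D y N)"
  unfolding codim_ok_def
proof (intro conjI allI impI)
  assume N: "graded_sub N"
  then show "graded_sub (D y N)" by (rule graded_sub_D)
  show "D y N z u \<subseteq> N z u" for z u using inf_sub[OF N] by (cases "z = y") (simp_all add: D_other)
qed (simp add: D_other)

lemma upf_excess: "codim_ok x y N R \<Longrightarrow> 0 \<le> tot (upf z R) - tot (R z)"
  using tot_le(1)[of R z] by (simp add: codim_ok_def)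

text \<open>Replace the component at \<open>m\<close> by \<open>inf m N\<close> and follow the chain downwards: the codimensions satisfy
  at least the rank two Cartan recurrence, so they do not drop below the initial one.\<close>

lemma chain_codim:
  assumes XY: "X \<noteq> Y" and N0: "graded_sub N0" and tf: "\<And>k. k < t \<Longrightarrow> topfree (lt X Y k) (up X Y N0 k)"
    and t: "t = 1 \<or> (t = 2 \<and> 1 \<le> a X Y * a Y X) \<or> (t = 3 \<and> 2 \<le> a X Y * a Y X)
      \<or> (t = 4 \<and> a X Y * a Y X = 3) \<or> (t = 5 \<and> a X Y * a Y X = 3)"
  defines "N \<equiv> up X Y N0 t" and "m \<equiv> lt X Y t"
  shows "\<exists>R. codim_ok X Y N0 R \<and> tot (N m) - tot (inf m N) \<le> tot (N0 Y) - tot (R Y)"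
proof -
  define i where "i = lt X Y (Suc t)"
  \<comment> \<open>The index k counts steps down from the top of the chain; \<open>l k\<close> is
    the letter undone between \<open>H k\<close> and \<open>H (Suc k)\<close>, and
    \<open>R k\<close> is a submodule of \<open>H k\<close> that follows along.\<close>
  define H where "H k = up X Y N0 (t - k)" for k
  define l where "l k = (if even k then i else m)" for k :: nat
  define R where "R = rec_nat (D m N) (\<lambda>k. D (l k))"
  have R0: "R 0 = D m N" and RS: "R (Suc k) = D (l k) (R k)" for k by (simp_all add: R_def)
  have im: "i \<noteq> m" using XY by (simp add: i_def m_def lt_def)
  have ltl: "lt X Y (t - Suc k) = l k" if "k < t" for k
  proof -
    have "even (t - Suc k) \<longleftrightarrow> (even k \<longleftrightarrow> odd t)" using that by (auto simp: even_diff_nat)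
    then show ?thesis by (auto simp: l_def i_def m_def lt_def)
  qed
  have HS: "H k = U (l k) (H (Suc k))" if "k < t" for k
  proof -
    have "t - k = Suc (t - Suc k)" using that by simp
    then show ?thesis unfolding H_def using ltl[OF that] by simp
  qed
  have gH: "graded_sub (H k)" for k unfolding H_def by (rule graded_sub_up[OF N0])
  have tfH: "topfree (l k) (H (Suc k))" if "k < t" for k
    using tf[of "t - Suc k"] ltl[OF that] that by (simp add: H_def)
  have H0: "H 0 = N" and Ht: "H t = N0" by (simp_all add: H_def N_def)
  define ol where "ol k = (if even k then m else i)" for k :: nat
  have lo: "l k \<noteq> ol k" for k using im by (simp add: l_def ol_def)
  have ok: "codim_ok (l k) (ol k) (H k) (R k)" if "k \<le> t" for k
    using that
  proof (induction k)
    case 0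
    then show ?case using codim_ok_D[of N i m] gH[of 0] by (simp add: R0 H0 l_def ol_def)
  next
    case (Suc k)
    then have k: "k < t" by simp
    have "codim_ok (l k) (ol k) (H (Suc k)) (R (Suc k))"
      unfolding RS by (rule codim_ok_step(1)[OF gH tfH[OF k] _ lo]) (use Suc HS[OF k] in simp)
    then show ?case by (auto intro: codim_ok_sym simp: l_def ol_def)
  qed
  define r where "r k z = tot (H k z) - tot (R k z)" for k z
  \<comment> \<open>The defect of fullness perturbs the recurrence in the favourable direction. It
    has to vanish exactly in the first two steps; afterwards nonnegativity is enough.\<close>
  define e where "e k = tot (upf (l k) (R k)) - tot (R k (l k))" for k
  have rl: "r (Suc k) (l k) = int (a (l k) (ol k)) * r k (ol k) - r k (l k) + e k"
    and ro: "r (Suc k) (ol k) = r k (ol k)" if "k < t" for k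
  proof -
    have "codim_ok (l k) (ol k) (U (l k) (H (Suc k))) (R k)" using ok[of k] that HS[OF that] by simp
    from codim_ok_step(2,3)[OF gH tfH[OF that] this lo]
    show "r (Suc k) (l k) = int (a (l k) (ol k)) * r k (ol k) - r k (l k) + e k" "r (Suc k) (ol k) = r k (ol k)"
      unfolding r_def e_def RS HS[OF that, symmetric] by simp_all
  qed
  have e: "0 \<le> e k" if "k \<le> t" for k unfolding e_def by (rule upf_excess[OF ok[OF that]])
  define s where "s = tot (N m) - tot (inf m N)"
  have s: "0 \<le> s" unfolding s_def using tot_le(2)[of N m] gH[of 0] by (simp add: H0)
  have r0: "r 0 i = 0" "r 0 m = s" using im by (simp_all add: r_def H0 R0 s_def D_other)
  have t1: "1 \<le> t" using t by auto
  have e0: "e 0 = 0"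
    using full_D_U[OF gH[of 1] im] HS[of 0] t1 im by (simp add: e_def R0 H0 l_def D_other)
  define A B where "A = int (a i m)" and "B = int (a m i)"
  have AB: "A * B = int (a X Y * a Y X)" unfolding A_def B_def i_def m_def lt_def by (simp add: mult.commute)
  have r1: "r 1 m = s" "r 1 i = A * s"
    using rl[of 0] ro[of 0] t1 r0 e0 by (simp_all add: l_def ol_def A_def)
  have e1: "e 1 = 0" if "2 \<le> t" "0 < A"
  proof -
    have N_eq: "N = U i (U m (H 2))" using HS[of 0] HS[of 1, unfolded Suc_1] that(1) H0 by (simp add: l_def)
    have "topfree i (U m (H 2))" using tfH[of 0] HS[of 1, unfolded Suc_1] that(1) by (simp add: l_def)
    then have "upf m (D i (D m N)) = inf m N"
      unfolding N_eq by (rule full_D_D_U_U[OF gH _ im]) (use that(2) in \<open>simp add: A_def\<close>)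
    then show ?thesis using im by (simp add: e_def l_def RS R0 D_other)
  qed
  have r2: "r 2 i = A * s" "r 2 m = (A * B - 1) * s" if "2 \<le> t" "0 < A"
    using rl[of 1, unfolded Suc_1] ro[of 1, unfolded Suc_1] that r1 e1 by (simp_all add: l_def ol_def B_def algebra_simps)
  have r3: "r 3 m = (A * B - 1) * s" "A * (A * B - 2) * s \<le> r 3 i" if "3 \<le> t" "0 < A"
  proof -
    have "2 \<le> t" using that by simp
    note r2 = r2[OF this that(2)]
    show "r 3 m = (A * B - 1) * s" using ro[of 2] that r2 by (simp add: l_def ol_def)
    have "A * (A * B - 2) * s = A * r 2 m - r 2 i" unfolding r2 by (simp add: algebra_simps)
    also have "\<dots> \<le> r 3 i" using rl[of 2] e[of 2] that by (simp add: l_def ol_def A_def)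
    finally show "A * (A * B - 2) * s \<le> r 3 i" .
  qed
  have r4: "r 4 i = r 3 i" "B * r 3 i - r 3 m \<le> r 4 m" if "4 \<le> t"
    using rl[of 3] ro[of 3] e[of 3] that by (simp_all add: l_def ol_def B_def)
  have r5: "r 5 m = r 4 m" if "5 \<le> t"
    using ro[of 4] that by (simp add: l_def ol_def)
  have Apos: "0 < A" "0 < B" if "1 \<le> A * B"
  proof -
    have "0 \<le> A" "0 \<le> B" by (simp_all add: A_def B_def)
    moreover have "A \<noteq> 0" "B \<noteq> 0" using that by auto
    ultimately show "0 < A" "0 < B" by linarith+
  qed
  have scale: "s \<le> c * s" if "1 \<le> c" for c using mult_right_mono[OF that s] by simp
  \<comment> \<open>Without defects the codimensions at the active letter would be s, A s, (A B - 1)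
    s, A (A B - 2) s and so on; in the range allowed by t each of them is at least s.\<close>
  have "s \<le> r t Y"
    using t
  proof (elim disjE conjE)
    assume t: "t = 1"
    then have "m = Y" by (simp add: m_def lt_def)
    then show ?thesis using r1 t by simp
  next
    assume t: "t = 2" and ab: "1 \<le> a X Y * a Y X"
    then have "1 \<le> A * B" using AB by linarith
    then have "i = Y" "1 \<le> A" using t Apos by (auto simp: i_def lt_def)
    then show ?thesis using r2 t scale[of A] by simp
  next
    assume t: "t = 3" and ab: "2 \<le> a X Y * a Y X"
    then have ab: "2 \<le> A * B" using AB by linarith
    then have "m = Y" "0 < A" using t Apos by (auto simp: m_def lt_def)
    then show ?thesis using r3 t scale[of "A * B - 1"] ab by simp
  next
    assume t: "t = 4" and ab: "a X Y * a Y X = 3"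
    then have ab: "A * B = 3" using AB by linarith
    then have "i = Y" "1 \<le> A" using t Apos by (auto simp: i_def lt_def)
    then show ?thesis using r3(2) r4 t scale[of A] ab by simp
  next
    assume t: "t = 5" and ab: "a X Y * a Y X = 3"
    then have ab: "A * B = 3" using AB by linarith
    have m: "m = Y" and A: "1 \<le> A" "0 < B" using t ab Apos by (auto simp: m_def lt_def)
    have "A * s \<le> r 3 i" using r3(2) t A ab by simp
    then have "B * (A * s) \<le> B * r 3 i" using A by (intro mult_left_mono) auto
    moreover have "B * (A * s) = 3 * s" using ab by (simp add: mult.assoc[symmetric] mult.commute)
    moreover have "r 3 m = 2 * s" using r3(1) t A ab by simp
    ultimately show ?thesis using r4(2) r5 t m by simp
  qed
  moreover have "codim_ok X Y N0 (R t)"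
  proof -
    have "(l t = X \<and> ol t = Y) \<or> (l t = Y \<and> ol t = X)" by (auto simp: l_def ol_def i_def m_def lt_def)
    then show ?thesis using ok[of t] Ht codim_ok_sym by fastforce
  qed
  ultimately show ?thesis using Ht unfolding s_def[symmetric] r_def by auto
qed

end

section \<open>Chains of reflections at two vertices\<close>

context gpa_dual
begin

lemma finite_support_graded_sub:
  assumes N: "graded_sub (N :: ('i, 'k::field) wfam)"
  shows "finite {p. \<exists>z u. \<exists>\<phi>\<in>N z u. \<phi> p \<noteq> 0}"
proof -
  let ?S = "\<lambda>z u. {p. \<exists>\<phi>\<in>N z u. \<phi> p \<noteq> 0}"
  have one: "finite (?S z u)" for z u
  proof -
    have "fs.fin_dim (N z u)" by (rule gspaceD(2)[OF graded_subD(1)[OF N]])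
    from fs.fin_dim_basis[OF this] obtain B where B: "B \<subseteq> N z u" "fs.independent B" "finite B"
      "N z u \<subseteq> fs.span B" "card B = fs.dim (N z u)" by (elim exE conjE)
    let ?T = "\<Union>\<phi>\<in>B. {p. \<phi> p \<noteq> 0}"
    have "finite {p. \<phi> p \<noteq> 0}" if "\<phi> \<in> B" for \<phi>
    proof -
      have "\<phi> \<in> V z u" by (rule subsetD[OF graded_subD(2)[OF N] subsetD[OF B(1) that]])
      then show ?thesis by (simp add: V_def)
    qed
    then have fT: "finite ?T" by (rule finite_UN_I[OF B(3)])
    have "fs.subspace {\<phi> :: ('i, 'k) wfun. \<forall>p. p \<notin> ?T \<longrightarrow> \<phi> p = 0}" by (rule fs_subspaceI) auto
    moreover have "B \<subseteq> {\<phi>. \<forall>p. p \<notin> ?T \<longrightarrow> \<phi> p = 0}" by auto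
    ultimately have "fs.span B \<subseteq> {\<phi>. \<forall>p. p \<notin> ?T \<longrightarrow> \<phi> p = 0}" by (rule fs.span_minimal[rotated])
    then have "N z u \<subseteq> {\<phi>. \<forall>p. p \<notin> ?T \<longrightarrow> \<phi> p = 0}" using B(4) by (rule subset_trans[rotated])
    then have vanish: "\<phi> p = 0" if "\<phi> \<in> N z u" "p \<notin> ?T" for \<phi> p using that by (simp add: subset_iff)
    have "?S z u \<subseteq> ?T"
    proof
      fix p assume "p \<in> ?S z u"
      then obtain \<phi> where "\<phi> \<in> N z u" "\<phi> p \<noteq> 0" by (elim CollectE bexE)
      then show "p \<in> ?T" using vanish[of \<phi> p] by (rule_tac ccontr) simp
    qed
    then show ?thesis using fT by (rule finite_subset)
  qed
  have "{p. \<exists>z u. \<exists>\<phi>\<in>N z u. \<phi> p \<noteq> 0} \<subseteq> (\<Union>z\<in>UNIV. \<Union>u\<in>{u. N z u \<noteq> {0}}. ?S z u)"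
  proof
    fix p assume "p \<in> {p. \<exists>z u. \<exists>\<phi>\<in>N z u. \<phi> p \<noteq> 0}"
    then obtain z u \<phi> where *: "\<phi> \<in> N z u" "\<phi> p \<noteq> 0" by (elim CollectE exE bexE)
    have "N z u \<noteq> {0}"
    proof
      assume "N z u = {0}"
      then have "\<phi> = 0" using *(1) by simp
      then show False using *(2) by simp
    qed
    then show "p \<in> (\<Union>z\<in>UNIV. \<Union>u\<in>{u. N z u \<noteq> {0}}. ?S z u)"
      using * by (intro UN_I[of z] UN_I[of u] CollectI bexI[of _ \<phi>]) simp_all
  qed
  moreover have "finite (\<Union>z\<in>UNIV. \<Union>u\<in>{u. N z u \<noteq> {0}}. ?S z u)"
    by (rule finite_UN_I[OF finite], rule finite_UN_I[OF gspaceD(3)[OF graded_subD(1)[OF N]]], rule one)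
  ultimately show ?thesis by (rule finite_subset)
qed

text \<open>Iterating \<open>inf X N = N X\<close> and \<open>inf Y N = N Y\<close> replaces an element modulo \<open>R\<close> by functions supported on
  shorter and shorter words.\<close>

lemma topfree_pair:
  assumes N: "graded_sub (N :: ('i, 'k::field) wfam)" and tf: "topfree X N" "topfree Y N"
    and R: "codim_ok X Y N R"
  shows "R = N"
proof -
  define L where "L = Max (insert 0 (length ` {p. \<exists>z u. \<exists>\<phi>\<in>N z u. \<phi> p \<noteq> 0}))"
  define Len where "Len n = {\<phi> :: ('i, 'k) wfun. \<forall>p. \<phi> p \<noteq> 0 \<longrightarrow> length p + n \<le> L}" for n
  have gR: "graded_sub R" and RN: "R z u \<subseteq> N z u" and Req: "z \<noteq> X \<Longrightarrow> z \<noteq> Y \<Longrightarrow> R z = N z" for z u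
    using R by (simp_all add: codim_ok_def)
  have Len0: "N z u \<subseteq> Len 0" for z u
  proof
    fix \<phi> assume \<phi>: "\<phi> \<in> N z u"
    have "length p \<le> L" if "\<phi> p \<noteq> 0" for p
      unfolding L_def using finite_support_graded_sub[OF N] \<phi> that by (intro Max_ge) auto
    then show "\<phi> \<in> Len 0" by (simp add: Len_def)
  qed
  have LenSub: "fs.subspace (Len n)" for n
  proof (rule fs_subspaceI)
    fix x y assume "x \<in> Len n" "y \<in> Len n"
    then show "x + y \<in> Len n" unfolding Len_def by (auto, force)
  qed (auto simp: Len_def)
  have sub: "fs.subspace (N z u)" "fs.subspace (R z u)" for z u
    using gspaceD(1) graded_subD(1) N gR by blast+
  \<comment> \<open>After n rounds the remainder modulo R is supported on words of length at most L
    - n: topfreeness says that everything arrives through arrows, and reading an arrow shortens the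
    words by one.\<close>
  have claim: "N z u \<subseteq> {r + y | r y. r \<in> R z u \<and> y \<in> N z u \<inter> Len n}" if "z = X \<or> z = Y" for z u n
    using that
  proof (induction n arbitrary: z u)
    case 0
    show ?case
    proof
      fix \<phi> assume "\<phi> \<in> N z u"
      then show "\<phi> \<in> {r + y | r y. r \<in> R z u \<and> y \<in> N z u \<inter> Len 0}"
        using Len0 fs.subspace_0[OF sub(2)] by (intro CollectI exI[of _ 0] exI[of _ \<phi>]) auto
    qed
  next
    case (Suc n)
    define Z where "Z u = {r + y | r y. r \<in> R z u \<and> y \<in> N z u \<inter> Len (Suc n)}" for u
    have prepLen: "prep w y \<in> Len (n + length w)" if "y \<in> Len n" for w y n
      using that by (auto simp: Len_def prep_def)
    have weak: "Len (Suc n) \<subseteq> Len n" for n by (auto simp: Len_def)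
    have "inf z N u \<subseteq> Z u"
    proof (rule inf_least)
      show "fs.subspace (Z u)" for u
        unfolding Z_def using sub LenSub fs.subspace_inter by (intro fs.subspace_sums) blast+
      show "prep [Loop z] \<phi> \<in> Z (u + 2 * d z)" if "\<phi> \<in> Z u" for u \<phi>
      proof -
        obtain r y where ry: "\<phi> = r + y" "r \<in> R z u" "y \<in> N z u" "y \<in> Len (Suc n)"
          using \<open>\<phi> \<in> Z u\<close> by (auto simp: Z_def)
        have "prep [Loop z] y \<in> Len (Suc n)" using prepLen[OF ry(4), of "[Loop z]"] weak by auto
        then show ?thesis unfolding Z_def ry(1) prep_add
          using graded_subD(3)[OF gR ry(2)] graded_subD(3)[OF N ry(3)] by blast
      qed
      fix k u \<phi> assume k: "adj C z k" and \<phi>: "\<phi> \<in> N k u"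
      note k' = adj_sym[OF k]
      show "prep [Arr k z] \<phi> \<in> Z (u - max (d k) (d z))"
      proof (cases "k = X \<or> k = Y")
        case True
        then obtain r y where ry: "\<phi> = r + y" "r \<in> R k u" "y \<in> N k u" "y \<in> Len n" using Suc.IH \<phi> by blast
        have "prep [Arr k z] y \<in> Len (Suc n)" using prepLen[OF ry(4), of "[Arr k z]"] by simp
        then show ?thesis unfolding Z_def ry(1) prep_add
          using graded_subD(4)[OF gR k' ry(2)] graded_subD(4)[OF N k' ry(3)] by blast
      next
        case False
        then have "\<phi> \<in> R k u" using \<phi> Req by metis
        then have "prep [Arr k z] \<phi> \<in> R z (u - max (d k) (d z))" by (rule graded_subD(4)[OF gR k'])
        moreover have "0 \<in> N z (u - max (d k) (d z)) \<inter> Len (Suc n)"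
          using fs.subspace_0[OF sub(1)] fs.subspace_0[OF LenSub] by blast
        ultimately show ?thesis unfolding Z_def by (intro CollectI exI[of _ "prep [Arr k z] \<phi>"] exI[of _ 0]) auto
      qed
    qed
    moreover have "inf z N = N z" using tf Suc.prems by (auto simp: topfree_def)
    ultimately have "N z u \<subseteq> Z u" by simp
    then show ?case unfolding Z_def .
  qed
  have "N z u \<subseteq> R z u" for z u
  proof (cases "z = X \<or> z = Y")
    case True
    have "Len (Suc L) = {0}" by (auto simp: Len_def fun_eq_iff)
    then show ?thesis using claim[OF True, of u "Suc L"] by auto
  next
    case False
    then show ?thesis using Req by auto
  qed
  then show ?thesis using RN by (intro ext equalityI) auto
qed

text \<open>The Coxeter number of the rank two subsystem.\<close>

definition cox :: "'i \<Rightarrow> 'i \<Rightarrow> nat" where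
  "cox X Y = (if a X Y * a Y X = 0 then 2 else if a X Y * a Y X = 1 then 3 else if a X Y * a Y X = 2 then 4 else 6)"

lemma a_product:
  assumes "X \<noteq> Y"
  shows "(a X Y = 0 \<and> a Y X = 0 \<and> cox X Y = 2) \<or> (a X Y * a Y X = 1 \<and> cox X Y = 3)
    \<or> (a X Y * a Y X = 2 \<and> cox X Y = 4) \<or> (a X Y * a Y X = 3 \<and> cox X Y = 6)"
proof (cases "adj C X Y")
  case True
  have "int (a X Y * a Y X) \<le> 3"
    using cartan_product_le[OF assms] int_a[OF True] int_a[OF adj_sym[OF True]] by simp
  then have "a X Y * a Y X \<le> 3" by linarith
  moreover have "a X Y * a Y X \<noteq> 0" using a_pos[OF True] a_pos[OF adj_sym[OF True]] by simp
  ultimately have "a X Y * a Y X = 1 \<or> a X Y * a Y X = 2 \<or> a X Y * a Y X = 3" by linarith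
  then show ?thesis by (auto simp: cox_def)
next
  case False
  have False': "\<not> adj C Y X" using False adj_sym by blast
  have "a X Y = 0" "a Y X = 0"
    using nonadj[OF assms[symmetric] False] nonadj[OF assms False'] by (simp_all add: a_def)
  then show ?thesis by (simp add: cox_def)
qed

lemma chain_condition:
  assumes "X \<noteq> Y" "1 \<le> t" "t < cox X Y"
  shows "t = 1 \<or> (t = 2 \<and> 1 \<le> a X Y * a Y X) \<or> (t = 3 \<and> 2 \<le> a X Y * a Y X)
      \<or> (t = 4 \<and> a X Y * a Y X = 3) \<or> (t = 5 \<and> a X Y * a Y X = 3)"
proof -
  define p where "p = a X Y * a Y X"
  have "(p = 0 \<and> cox X Y = 2) \<or> (p = 1 \<and> cox X Y = 3) \<or> (p = 2 \<and> cox X Y = 4) \<or> (p = 3 \<and> cox X Y = 6)"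
    using a_product[OF assms(1)] by (auto simp: p_def)
  then show ?thesis unfolding p_def[symmetric] using assms(2,3) by linarith
qed

lemma cox_sym: "cox X Y = cox Y X"
  by (simp add: cox_def mult.commute)

lemma chain_lam:
  assumes XY: "X \<noteq> Y" and N0: "graded_sub N0" and tf: "\<And>k. k < t \<Longrightarrow> topfree (lt X Y k) (up X Y N0 k)"
    and dom: "0 \<le> lam N0 X" "0 \<le> lam N0 Y"
  shows "k < cox X Y \<Longrightarrow> k \<le> t \<Longrightarrow> 0 \<le> lam (up X Y N0 k) (lt X Y k)"
    "cox X Y \<le> t \<Longrightarrow> lam (up X Y N0 (cox X Y)) (lt X Y (cox X Y)) = - lam N0 X"
    "cox X Y \<le> t \<Longrightarrow> lam (up X Y N0 (cox X Y)) (lt X Y (Suc (cox X Y))) = - lam N0 Y"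
proof -
  let ?H = "up X Y N0" and ?l = "lt X Y"
  define p where "p k = lam (?H k) (?l k)" for k
  have g: "graded_sub (?H k)" for k by (rule graded_sub_up[OF N0])
  have same: "lam (?H (Suc k)) (?l k) = - p k" if "k < t" for k
    using lam_U_same[OF g tf[OF that]] by (simp add: p_def)
  have other: "p (Suc k) = lam (?H k) (?l (Suc k)) + int (a (?l (Suc k)) (?l k)) * p k" if "k < t" for k
    using lam_U_other[OF g tf[OF that], of "?l (Suc k)"] XY by (auto simp: p_def lt_def)
  have p0: "p 0 = lam N0 X" by (simp add: p_def lt_def)
  have p1: "0 < t \<Longrightarrow> p 1 = lam N0 Y + int (a Y X) * lam N0 X"
    using other[of 0] by (simp add: lt_def p0)
  have rec: "p (Suc (Suc k)) = int (if even k then a X Y else a Y X) * p (Suc k) - p k" if "Suc k < t" for k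
  proof -
    have "?l (Suc (Suc k)) = ?l k" by (simp add: lt_def)
    moreover have "a (?l k) (?l (Suc k)) = (if even k then a X Y else a Y X)" by (simp add: lt_def)
    ultimately show ?thesis using other[OF that] same[of k] that by simp
  qed
  note ar = alternating_recurrence[OF a_product[OF XY] dom p0 p1 rec]
  show "k < cox X Y \<Longrightarrow> k \<le> t \<Longrightarrow> 0 \<le> lam (?H k) (?l k)" using ar(1) by (simp add: p_def)
  assume t: "cox X Y \<le> t"
  show "lam (?H (cox X Y)) (?l (cox X Y)) = - lam N0 X" using ar(2) t by (simp add: p_def)
  obtain c where c: "cox X Y = Suc c" using a_product[OF XY] by (cases "cox X Y") auto
  have "lam (?H (Suc c)) (?l c) = - p c" using same[of c] c t by simp
  moreover have "?l (Suc (Suc c)) = ?l c" by (simp add: lt_def)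
  ultimately show "lam (?H (cox X Y)) (?l (Suc (cox X Y))) = - lam N0 Y" using ar(3) t c by simp
qed

text \<open>\<open>chain_codim\<close> bounds the codimension of the smallest component by that of
  some R in N0 at Y, and \<open>topfree_pair\<close> forces R = N0.\<close>

lemma chain_topfree:
  assumes XY: "X \<noteq> Y" and N0: "graded_sub N0" and tf: "\<And>k. k < t \<Longrightarrow> topfree (lt X Y k) (up X Y N0 k)"
    and tf0: "topfree X N0" "topfree Y N0" and t: "t < cox X Y"
  shows "topfree (lt X Y t) (up X Y N0 t)"
proof (cases t)
  case 0
  then show ?thesis using tf0 by (simp add: lt_def)
next
  case (Suc t')
  have cond: "1 \<le> t" using Suc by simp
  obtain R where R: "codim_ok X Y N0 R"
    "tot (up X Y N0 t (lt X Y t)) - tot (inf (lt X Y t) (up X Y N0 t)) \<le> tot (N0 Y) - tot (R Y)"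
    using chain_codim[OF XY N0 tf chain_condition[OF XY cond t]] by blast
  have "R = N0" by (rule topfree_pair[OF N0 tf0 R(1)])
  then show ?thesis using R(2) by (intro topfreeI[OF graded_sub_up[OF N0]]) simp
qed

text \<open>The codimension estimate is applied to the chain starting one step later, with the
  letters interchanged. It bounds the codimension of the smallest component by
  \<open>lam N0 X\<close>. As the weight at this place is \<open>- lam N0 X\<close>, no room is left
  up to the largest component.\<close>

lemma chain_full:
  assumes XY: "X \<noteq> Y" and N0: "graded_sub N0"
    and tf: "\<And>k. k < cox X Y \<Longrightarrow> topfree (lt X Y k) (up X Y N0 k)"
    and tf0: "topfree X N0" "topfree Y N0" and dom: "0 \<le> lam N0 X" "0 \<le> lam N0 Y"
  shows "full (lt X Y (cox X Y)) (up X Y N0 (cox X Y))"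
proof -
  let ?c = "cox X Y"
  obtain t where t: "?c = Suc t" "1 \<le> t" using a_product[OF XY] by (cases ?c) auto
  let ?N1 = "U X N0" let ?N = "up X Y N0 ?c" let ?m = "lt X Y ?c"
  have g: "graded_sub ?N" by (rule graded_sub_up[OF N0])
  have N1: "graded_sub ?N1" by (rule graded_sub_U[OF N0])
  have lts: "lt Y X k = lt X Y (Suc k)" for k by (simp add: lt_def)
  have cond: "t < cox Y X" using t cox_sym[of X Y] by simp
  have "topfree (lt Y X k) (up Y X ?N1 k)" if "k < t" for k
    using tf[of "Suc k"] that t unfolding up_shift lts by simp
  from chain_codim[OF XY[symmetric] N1 this chain_condition[OF XY[symmetric] t(2) cond]]
  obtain R where R: "codim_ok Y X ?N1 R" "tot (?N ?m) - tot (inf ?m ?N) \<le> tot (?N1 X) - tot (R X)"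
    unfolding up_shift lts t(1)[symmetric] by blast
  have gR: "graded_sub R" using R(1) by (simp add: codim_ok_def)
  have "codim_ok X Y N0 (D X R)"
    by (rule codim_ok_step(1)[OF N0 tf0(1) codim_ok_sym[OF R(1)] XY])
  then have "D X R = N0" by (rule topfree_pair[OF N0 tf0])
  then have "inf X R = N0 X" by (metis D_same)
  then have "tot (N0 X) \<le> tot (R X)" using tot_le(2)[OF gR, of X] by simp
  moreover have "tot (?N1 X) - tot (N0 X) = lam N0 X"
    using lam_eq[OF N0, of X] tf0(1) by (simp add: topfree_def)
  ultimately have "tot (?N ?m) - tot (inf ?m ?N) \<le> lam N0 X" using R(2) by linarith
  moreover have "lam ?N ?m = - lam N0 X" by (rule chain_lam(2)[OF XY N0 tf dom order_refl])
  ultimately have "tot (upf ?m ?N) \<le> tot (?N ?m)" using lam_eq[OF g, of ?m] by linarith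
  then show ?thesis by (rule fullI[OF g])
qed

section \<open>Induction along the reflection process\<close>

definition total :: "('i, 'k::field) wfam \<Rightarrow> int" where
  "total N = (\<Sum>k\<in>UNIV. tot (N k))"

lemma total_nonneg: "graded_sub N \<Longrightarrow> 0 \<le> total N"
  unfolding total_def by (intro sum_nonneg tot_nonneg graded_subD(1))

lemma total_eq:
  assumes "graded_sub N" "graded_sub N'" "\<And>z u. N z u \<subseteq> N' z u" "total N' \<le> total N"
  shows "N = N'"
proof
  fix z
  have le: "tot (N k) \<le> tot (N' k)" for k by (rule tot_mono) (use graded_subD(1) assms in blast)+
  have "tot (N' z) \<le> tot (N z)"
  proof (rule ccontr)
    assume "\<not> ?thesis"
    then have "total N < total N'" unfolding total_def using le by (intro sum_strict_mono_ex1) (auto simp: not_le)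
    then show False using assms(4) by simp
  qed
  then show "N z = N' z" by (intro tot_eq) (use graded_subD(1) assms in blast)+
qed

lemma total_U:
  assumes "graded_sub (N :: ('i, 'k::field) wfam)" "topfree i N"
  shows "total (U i N) = total N + lam N i"
proof -
  have "total N' = height (dvec N')" for N' :: "('i, 'k::field) wfam"
    by (simp add: total_def height_def dvec_def)
  then show ?thesis by (simp add: dvec_U[OF assms] height_add height_axis)
qed

text \<open>The submodules met by the process. Each step has positive weight and so enlarges the
  module strictly, which makes \<open>total\<close> an induction measure.\<close>

inductive CC :: "('i, 'k::field) wfam \<Rightarrow> bool" where
  zero: "CC (\<lambda>_ _. {0})"
| step: "CC N \<Longrightarrow> 0 < lam N i \<Longrightarrow> topfree i N \<Longrightarrow> CC (U i N)"

lemma graded_sub_zero: "graded_sub (\<lambda>_ _. {0})"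
  unfolding graded_sub_def gspace_def
  by (auto simp: fs.fin_dim_zero fs.subspace_0[OF V_subspace])

lemma CC_graded_sub: "CC N \<Longrightarrow> graded_sub N"
  by (induction rule: CC.induct) (simp_all add: graded_sub_zero graded_sub_U)

text \<open>Extremality alone does not pass through the induction. One must also be able to go down
  at any vertex of negative weight, not just at the last one used, and stay within
  \<open>CC\<close>.\<close>

definition good :: "('i, 'k::field) wfam \<Rightarrow> bool" where
  "good N \<longleftrightarrow> extremal N \<and> (\<forall>m. lam N m < 0 \<longrightarrow> CC (D m N))"

lemma good_topfree: "CC N \<Longrightarrow> good N \<Longrightarrow> 0 \<le> lam N i \<Longrightarrow> topfree i N"
  using topfree_if_full CC_graded_sub by (auto simp: good_def extremal_def)

lemma good_full: "CC N \<Longrightarrow> good N \<Longrightarrow> lam N i \<le> 0 \<Longrightarrow> full i N"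
  using full_if_topfree CC_graded_sub by (auto simp: good_def extremal_def)

lemma good_descend:
  assumes "CC N" "good N" "lam N m < 0"
  shows "CC (D m N)" "U m (D m N) = N" "topfree m (D m N)" "lam (D m N) m = - lam N m" "total (D m N) < total N"
proof -
  show D: "CC (D m N)" using assms by (simp add: good_def)
  show UD: "U m (D m N) = N" using good_full[OF assms(1,2)] assms(3) by (simp add: U_D_full)
  show tf: "topfree m (D m N)" by (rule topfree_D)
  show l: "lam (D m N) m = - lam N m"
    using lam_U_same[OF CC_graded_sub[OF D] tf] UD by simp
  show "total (D m N) < total N"
    using total_U[OF CC_graded_sub[OF D] tf] UD l assms(3) by simp
qed

text \<open>Going down alternately at x and y while the weight at the other vertex is negative ends
  at a module N0 dominant at both, like the passage to a minimal coset representative for a rank two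
  parabolic subgroup.\<close>

lemma descend:
  fixes N :: "('i, 'k::field) wfam"
  assumes "CC N" "0 < lam N x" "x \<noteq> y" and IH: "\<forall>N' :: ('i, 'k) wfam. CC N' \<longrightarrow> total N' \<le> total N \<longrightarrow> good N'"
  shows "\<exists>X Y N0 t. X \<noteq> Y \<and> (X = x \<and> Y = y \<or> X = y \<and> Y = x) \<and> CC N0 \<and> total N0 \<le> total N \<and> 0 \<le> lam N0 X \<and> 0 \<le> lam N0 Y
    \<and> N = up X Y N0 t \<and> lt X Y t = x
    \<and> (\<forall>k<t. 0 < lam (up X Y N0 k) (lt X Y k) \<and> topfree (lt X Y k) (up X Y N0 k))"
  using assms
proof (induction "nat (total N)" arbitrary: N x y rule: less_induct)
  case less
  show ?case
  proof (cases "0 \<le> lam N y")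
    case True
    then show ?thesis
      using less.prems(1,2,3) by (intro exI[of _ x] exI[of _ y] exI[of _ N] exI[of _ 0]) (simp add: lt_def)
  next
    case False
    have gN: "good N" using less.prems by simp
    note ds = good_descend[OF less.prems(1) gN, of y]
    let ?N = "D y N"
    have N: "CC ?N" "U y ?N = N" "topfree y ?N" "0 < lam ?N y" "total ?N < total N" using ds False by simp_all
    have "nat (total ?N) < nat (total N)" using N(5) total_nonneg[OF CC_graded_sub[OF N(1)]] by simp
    note hyp = less.hyps[OF this N(1) N(4) less.prems(3)[symmetric]]
    have "\<forall>N' :: ('i, 'k) wfam. CC N' \<longrightarrow> total N' \<le> total ?N \<longrightarrow> good N'"
      using less.prems(4) N(5) by (meson dual_order.strict_trans2 less_imp_le)
    note ex = hyp[OF this]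
    obtain X Y N0 t where *: "X \<noteq> Y" "X = y \<and> Y = x \<or> X = x \<and> Y = y" "CC N0" "total N0 \<le> total ?N" "0 \<le> lam N0 X" "0 \<le> lam N0 Y"
      "?N = up X Y N0 t" "lt X Y t = y"
      "\<forall>k<t. 0 < lam (up X Y N0 k) (lt X Y k) \<and> topfree (lt X Y k) (up X Y N0 k)"
      using ex by (elim exE conjE) (rule that; assumption)
    have "lt X Y (Suc t) = x" using *(2,8) less.prems(3) by (auto simp: lt_def split: if_splits)
    moreover have "N = up X Y N0 (Suc t)" using N(2) *(7,8) by simp
    moreover have "\<forall>k<Suc t. 0 < lam (up X Y N0 k) (lt X Y k) \<and> topfree (lt X Y k) (up X Y N0 k)"
    proof (intro allI impI)
      fix k assume that: "k < Suc t"
      show "0 < lam (up X Y N0 k) (lt X Y k) \<and> topfree (lt X Y k) (up X Y N0 k)"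
      proof (cases "k = t")
        case True
        then show ?thesis using N(3,4) *(7,8) by simp
      next
        case False
        then show ?thesis using *(9) that by simp
      qed
    qed
    moreover have "X = x \<and> Y = y \<or> X = y \<and> Y = x" using *(2) by (elim disjE conjE) simp_all
    moreover have "total N0 \<le> total N" using *(4) N(5) by linarith
    ultimately show ?thesis
      using *(1,3,5,6) by - (rule exI[of _ X], rule exI[of _ Y], rule exI[of _ N0], rule exI[of _ "Suc t"], intro conjI; assumption)
  qed
qed

text \<open>The step at \<open>i\<close> is compared with a second vertex \<open>m\<close>: descend in the directions \<open>i, m\<close> to a dominant \<open>N0\<close>.
  Before the rank two chain from \<open>N0\<close> is complete, \<open>N\<close> has no top at \<open>m\<close>; when it is complete, the chain with
  the letters interchanged ends in the same submodule by positivity of the form.\<close>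

lemma CC_good:
  fixes N :: "('i, 'k::field) wfam"
  shows "CC N \<Longrightarrow> good N"
proof (induction "nat (total N)" arbitrary: N rule: less_induct)
  case less
  have IH: "good N'" if "CC N'" "total N' < total N" for N' :: "('i, 'k) wfam"
    using less.hyps[OF _ that(1)] that(2) total_nonneg[OF CC_graded_sub[OF that(1)]] by simp
  from less.prems show ?case
  proof cases
    case zero
    have tf: "topfree i N" for i
    proof -
      have "inf i N u = {0}" for u
        using inf_sub[OF graded_sub_zero, of i u] fs.subspace_0[OF inf_space(1)[OF graded_subD(1)[OF graded_sub_zero]], of i u]
        unfolding zero by auto
      then show ?thesis by (auto simp: topfree_def zero)
    qed
    have "dvec N = 0" unfolding zero by (simp add: dvec_def wt_def gd_def fs.dim_zero_space vec_eq_iff)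
    then have "0 \<le> lam N m" for m by (simp add: lam_def)
    then show ?thesis using tf by (auto simp: good_def extremal_def not_less[symmetric])
  next
    case (step N' i)
    have gN': "graded_sub N'" and gN: "graded_sub N" using CC_graded_sub step less.prems by auto
    have tN': "total N' < total N" using total_U[OF gN' step(4)] step by simp
    have lami: "lam N i = - lam N' i" using lam_U_same[OF gN' step(4)] step by simp
    have main: "(topfree m N \<or> full m N) \<and> (lam N m < 0 \<longrightarrow> CC (D m N))" if im: "m \<noteq> i" for m
    proof -
      obtain X Y N0 t where ch: "X \<noteq> Y" "X = i \<and> Y = m \<or> X = m \<and> Y = i" "CC N0" "total N0 \<le> total N'" "0 \<le> lam N0 X" "0 \<le> lam N0 Y"
        "N' = up X Y N0 t" "lt X Y t = i"
        "\<forall>k<t. 0 < lam (up X Y N0 k) (lt X Y k) \<and> topfree (lt X Y k) (up X Y N0 k)"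
      proof -
        have "\<forall>N'' :: ('i, 'k) wfam. CC N'' \<longrightarrow> total N'' \<le> total N' \<longrightarrow> good N''"
        proof (intro allI impI)
          fix N'' :: "('i, 'k) wfam"
          assume N'': "CC N''" "total N'' \<le> total N'"
          show "good N''" by (rule IH[OF N''(1)]) (use N''(2) tN' in linarith)
        qed
        from descend[OF step(2,3) im[symmetric] this] show ?thesis by (elim exE conjE) (rule that; assumption)
      qed
      let ?c = "cox X Y"
      have g0: "graded_sub N0" by (rule CC_graded_sub[OF ch(3)])
      have good0: "good N0" using IH[OF ch(3)] ch(4) tN' by simp
      have tf0: "topfree X N0" "topfree Y N0" using good_topfree[OF ch(3) good0] ch by auto
      have N: "N = up X Y N0 (Suc t)" using ch step by simp
      have m: "lt X Y (Suc t) = m" using ch(1,2,8) im by (auto simp: lt_def split: if_splits)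
      have tf: "topfree (lt X Y k) (up X Y N0 k)" and pos: "0 < lam (up X Y N0 k) (lt X Y k)" if "k < Suc t" for k
        using that ch(7,8,9) step by (auto simp: less_Suc_eq)
      \<comment> \<open>At the Coxeter number the weight would be nonpositive, while every step of
        the chain has positive weight.\<close>
      have le: "Suc t \<le> ?c"
      proof (rule ccontr)
        assume "\<not> ?thesis"
        then have c: "?c < Suc t" by simp
        then have "lam (up X Y N0 ?c) (lt X Y ?c) = - lam N0 X"
          using chain_lam(2)[OF ch(1) g0 tf ch(5,6), of "Suc t"] by simp
        then show False using pos[OF c] ch(5) by simp
      qed
      show ?thesis
      proof (cases "Suc t < ?c")
        case True
        have "topfree m N" using chain_topfree[OF ch(1) g0 tf tf0 True] m N by simp
        then have "topfree m N" "0 \<le> lam N m"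
          using chain_lam(1)[OF ch(1) g0 tf ch(5,6) True order_refl] m N by simp_all
        then show ?thesis by simp
      next
        case False
        then have c: "?c = Suc t" using le by simp
        have tfc: "topfree (lt X Y k) (up X Y N0 k)" if "k < ?c" for k using tf that c by simp
        have full: "full m N" using chain_full[OF ch(1) g0 tfc tf0 ch(5,6)] m N c by simp
        have lamm: "lam N m = - lam N0 X" using chain_lam(2)[OF ch(1) g0 tfc ch(5,6) order_refl] m N c by simp
        have "CC (D m N)" if neg: "lam N m < 0"
        proof -
          have fulli: "full i N" using step by (simp add: full_U)
          have lami': "lam N i < 0" using lami step by simp
          let ?H = "up Y X N0"
          \<comment> \<open>N is full at both letters, so the chain with the letters interchanged
            cannot leave N.\<close>
          have HN: "?H k z u \<subseteq> N z u" for k z u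
          proof (induction k arbitrary: z u)
            case 0
            have "up X Y N0 0 z u \<subseteq> up X Y N0 n z u" for n
            proof (induction n)
              case (Suc n)
              then show ?case using up_increasing[OF g0, of X Y n z u] by (rule subset_trans)
            qed simp
            from this[of "Suc t"] show ?case by (simp only: N up.simps(1))
          next
            case (Suc k)
            have "lt Y X k = i \<or> lt Y X k = m" using ch(2) by (auto simp: lt_def)
            then have f: "upf (lt Y X k) N = N (lt Y X k)" using full fulli by (auto simp: full_def)
            show ?case
            proof (cases "z = lt Y X k")
              case True
              have "upf z (?H k) u \<subseteq> upf z N u" by (rule upf_mono) (rule Suc)
              then show ?thesis using True f by simp
            next
              case False
              then show ?thesis using Suc by (simp add: U_other)
            qed
          qed
          have gH: "graded_sub (?H k)" for k by (rule graded_sub_up[OF g0])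
          have YX: "Y \<noteq> X" using ch(1) by simp
          have cs: "cox Y X = ?c" by (rule cox_sym)
          have H: "k \<le> ?c \<Longrightarrow> CC (?H k) \<and> (\<forall>l<k. topfree (lt Y X l) (?H l))" for k
          proof (induction k)
            case 0
            then show ?case using ch(3) by simp
          next
            case (Suc k)
            then have CCk: "CC (?H k)" and tfk: "\<And>l. l < k \<Longrightarrow> topfree (lt Y X l) (?H l)" and kc: "k < cox Y X"
              using cs by auto
            have nn: "0 \<le> lam (?H k) (lt Y X k)"
              by (rule chain_lam(1)[OF YX g0 tfk ch(6,5) kc order_refl])
            \<comment> \<open>The other chain has a nonnegative weight at its next letter, whereas N
              has negative weight at both letters. So it has not reached N yet, and the induction
              hypothesis applies to it.\<close>
            have "total (?H k) < total N"
            proof (rule ccontr)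
              assume "\<not> ?thesis"
              then have "?H k = N" using total_eq[OF gH gN HN] by simp
              then have "0 \<le> lam N (lt Y X k)" using nn by simp
              moreover have "lt Y X k = i \<or> lt Y X k = m" using ch(2) by (auto simp: lt_def)
              ultimately show False using lami' neg by auto
            qed
            then have gk: "good (?H k)" by (rule IH[OF CCk])
            have tf': "topfree (lt Y X k) (?H k)" by (rule good_topfree[OF CCk gk nn])
            have "CC (?H (Suc k))"
            proof (cases "lam (?H k) (lt Y X k) = 0")
              case True
              then have "full (lt Y X k) (?H k)" using good_full[OF CCk gk] by simp
              then show ?thesis using CCk by (simp add: U_full)
            next
              case False
              then show ?thesis using CC.step[OF CCk _ tf'] nn by simp
            qed
            then show ?case using tfk tf' by (auto simp: less_Suc_eq)
          qed
          then have CCc: "CC (?H ?c)" and tfH: "\<And>k. k < ?c \<Longrightarrow> topfree (lt Y X k) (?H k)" by blast+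
          have lamX: "lam (?H ?c) (lt Y X ?c) = - lam N0 Y" "lam (?H ?c) (lt Y X (Suc ?c)) = - lam N0 X"
            using chain_lam(2,3)[OF YX g0 _ ch(6,5), of ?c] tfH cs by auto
          have lamN: "lam N (lt X Y ?c) = - lam N0 X" "lam N (lt X Y (Suc ?c)) = - lam N0 Y"
            using chain_lam(2,3)[OF ch(1) g0 _ ch(5,6), of ?c] tfc N c by auto
          have lts: "lt X Y ?c = lt Y X (Suc ?c)" "lt X Y (Suc ?c) = lt Y X ?c" by (simp_all add: lt_def)
          have lam_same: "lam (?H ?c) z = lam N z" if "z = X \<or> z = Y" for z
          proof -
            have "z = lt Y X ?c \<or> z = lt Y X (Suc ?c)" using that by (auto simp: lt_def)
            then show ?thesis using lamX lamN lts by auto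
          qed
          \<comment> \<open>The two ends have the same weight at X and Y and the same components
            elsewhere, so their dimension vectors differ by an isotropic vector.\<close>
          define v where "v = dvec N - dvec (?H ?c)"
          have v_out: "v $ z = 0" if "z \<noteq> X" "z \<noteq> Y" for z
            using up_outside[OF that, of N0 "Suc t"] up_outside[of z Y X N0 ?c] that by (simp add: v_def dvec_def N)
          have v_in: "(C *v v) $ z = 0" if "z = X \<or> z = Y" for z
            using lam_same[OF that] by (simp add: v_def lam_def matrix_vector_mult_diff_distrib)
          have "form v v = 0" unfolding form_def
            by (rule sum.neutral) (use v_out v_in in \<open>metis mult_zero_left mult_zero_right\<close>)
          then have "v = 0" using form_pos[of v] by (cases "v = 0") auto
          then have "total N = total (?H ?c)" by (simp add: v_def total_def dvec_def vec_eq_iff)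
          then have HcN: "?H ?c = N" using total_eq[OF gH gN HN] by simp
          have "?H ?c = U (lt Y X t) (?H t)" using c by simp
          moreover have ltm: "lt Y X t = m" using m by (simp add: lt_def split: if_splits)
          ultimately have "D m N = ?H t" using HcN D_U_topfree[OF tfH[of t]] c by simp
          moreover have "CC (?H t)" using H[of t] c by simp
          ultimately show ?thesis by simp
        qed
        then show ?thesis using full by blast
      qed
    qed
    have "full i N" using step by (simp add: full_U)
    moreover have "CC (D i N)" using D_U_topfree[OF step(4)] step by simp
    ultimately show ?thesis using main unfolding good_def extremal_def by metis
  qed
qed

end

section \<open>The process ends at V\<close>

context gpa_dual
begin

text \<open>The pairing of the weight with the root lattice, normalised by (\<omega>_k, \<alpha>_l)
  = d_k \<delta>_kl.\<close>

definition lampair :: "('i, 'k::field) wfam \<Rightarrow> int ^ 'i \<Rightarrow> int" where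
  "lampair N \<beta> = (\<Sum>k\<in>UNIV. lam N k * d k * \<beta> $ k)"

lemma lampair_axis: "lampair N (axis k 1) = lam N k * d k"
  unfolding lampair_def by (simp add: sum_axis_mult)

lemma lampair_neg: "lampair N (- \<beta>) = - lampair N \<beta>"
  by (simp add: lampair_def sum_negf)

lemma lampair_U:
  assumes "graded_sub (N :: ('i, 'k::field) wfam)" "topfree i N"
  shows "lampair (U i N) \<beta> = lampair N (srefl i \<beta>)"
proof -
  have "lampair (U i N) \<beta> = lampair N \<beta> - lam N i * (\<Sum>k\<in>UNIV. d k * C $ k $ i * \<beta> $ k)"
    unfolding lampair_def lam_U[OF assms] by (simp add: sum_subtractf sum_distrib_left algebra_simps)
  also have "(\<Sum>k\<in>UNIV. d k * C $ k $ i * \<beta> $ k) = d i * (C *v \<beta>) $ i"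
    unfolding d_sym[of _ i] mat_vec_nth by (simp add: sum_distrib_left algebra_simps)
  also have "lampair N \<beta> - lam N i * (d i * (C *v \<beta>) $ i) = lampair N (srefl i \<beta>)"
    unfolding lampair_def simple_reflection_def
    by (simp add: sum_subtractf right_diff_distrib sum_axis_mult)
  finally show ?thesis .
qed

lemma dvec_zero: "dvec (\<lambda>_ _. {0} :: ('i, 'k::field) wfun set) = 0"
  by (simp add: dvec_def wt_def gd_def fs.dim_zero_space vec_eq_iff)

lemma lam_zero: "lam (\<lambda>_ _. {0} :: ('i, 'k::field) wfun set) k = (if k = j then 1 else 0)"
  by (simp add: lam_def dvec_zero)

text \<open>The weight of N is w^-1 \<omega>_j. The word grows on the right because reflecting the
  weight reflects the argument of the pairing.\<close>

lemma CC_word: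
  fixes N :: "('i, 'k::field) wfam"
  assumes "CC N"
  shows "\<exists>w. \<forall>\<beta>. lampair N \<beta> = d j * weyl_word C w \<beta> $ j"
  using assms
proof induction
  case zero
  have "lampair (\<lambda>_ _. {0} :: ('i, 'k) wfun set) \<beta> = d j * weyl_word C [] \<beta> $ j" for \<beta>
    unfolding lampair_def lam_zero by (simp add: if_distrib if_distribR cong: if_cong)
  then show ?case by (intro exI[of _ "[]"] allI)
next
  case (step N i)
  from step.IH obtain w where w: "\<forall>\<beta>. lampair N \<beta> = d j * weyl_word C w \<beta> $ j" by (elim exE)
  have "lampair (U i N) \<beta> = d j * weyl_word C (w @ [i]) \<beta> $ j" for \<beta>
    using w by (simp add: lampair_U[OF CC_graded_sub[OF step.hyps(1)] step.hyps(3)] weyl_word_append weyl_word_Cons)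
  then show ?case by (intro exI[of _ "w @ [i]"] allI)
qed

text \<open>Up to the factors d every coordinate of such a weight is a coefficient of a root, by
  \<open>CC_word\<close>, and there are finitely many roots.\<close>

lemma finite_lam_CC: "finite (lam ` Collect (CC :: ('i, 'k::field) wfam \<Rightarrow> bool))"
proof -
  define A where "A = (\<lambda>(\<beta>, k). d j * \<beta> $ j div d k) ` (roots C \<times> UNIV)"
  have "finite A" unfolding A_def using finite_roots by simp
  have "lam N k \<in> A" if N: "CC N" for N :: "('i, 'k) wfam" and k
  proof -
    from CC_word[OF N] obtain w where w: "\<forall>\<beta>. lampair N \<beta> = d j * weyl_word C w \<beta> $ j" by (elim exE)
    let ?\<beta> = "weyl_word C w (axis k 1)"
    have "lam N k * d k = d j * ?\<beta> $ j" using w lampair_axis[of N k] by simp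
    then have "lam N k = d j * ?\<beta> $ j div d k" using d_pos[of k] by (metis nonzero_mult_div_cancel_right less_irrefl)
    moreover have "?\<beta> \<in> roots C" by (intro weyl_word_root axis_root)
    ultimately show ?thesis unfolding A_def by (intro image_eqI[of _ _ "(?\<beta>, k)"]) simp_all
  qed
  then have "lam ` Collect (CC :: ('i, 'k) wfam \<Rightarrow> bool) \<subseteq> PiE UNIV (\<lambda>_. A)" by (auto simp: PiE_def)
  moreover have "finite (PiE (UNIV :: 'i set) (\<lambda>_. A))" using \<open>finite A\<close> by (intro finite_PiE) simp_all
  ultimately show ?thesis by (rule finite_subset)
qed

lemma total_lam:
  fixes N N' :: "('i, 'k::field) wfam"
  assumes "lam N = lam N'"
  shows "total N = total N'"
proof -
  have "C *v (dvec N - dvec N') = 0"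
    using fun_cong[OF assms] by (simp add: lam_def vec_eq_iff matrix_vector_mult_diff_distrib)
  then have "dvec N - dvec N' = 0" by (rule cartan_injective)
  then show ?thesis by (simp add: total_def dvec_def vec_eq_iff)
qed

lemma finite_total_CC: "finite (total ` Collect (CC :: ('i, 'k::field) wfam \<Rightarrow> bool))"
proof -
  let ?CC = "Collect (CC :: ('i, 'k) wfam \<Rightarrow> bool)"
  have "total ` ?CC \<subseteq> (\<lambda>l. total (SOME N. N \<in> ?CC \<and> lam N = l)) ` lam ` ?CC"
  proof
    fix x assume "x \<in> total ` ?CC"
    then obtain N where N: "N \<in> ?CC" "x = total N" by (elim imageE)
    let ?N' = "SOME N'. N' \<in> ?CC \<and> lam N' = lam N"
    have "?N' \<in> ?CC \<and> lam ?N' = lam N" by (rule someI[of _ N]) (simp add: N(1)[simplified])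
    then have "x = (\<lambda>l. total (SOME N. N \<in> ?CC \<and> lam N = l)) (lam N)" using total_lam[of N ?N'] N(2) by simp
    then show "x \<in> (\<lambda>l. total (SOME N. N \<in> ?CC \<and> lam N = l)) ` lam ` ?CC"
      by (intro image_eqI[OF _ imageI[OF N(1)]])
  qed
  then show ?thesis using finite_lam_CC by (rule finite_surj[rotated])
qed

text \<open>Induction on the length of the support: the components of \<open>out k \<phi>\<close>
  are supported on shorter words, hence lie in N, and fullness puts \<phi> itself into N.\<close>

lemma all_full_eq_V:
  fixes N :: "('i, 'k::field) wfam"
  assumes N: "graded_sub N" and full: "\<And>k. full k N"
  shows "N = V"
proof -
  have "\<phi> \<in> N k u" if "\<phi> \<in> V k u" "\<forall>p. \<phi> p \<noteq> 0 \<longrightarrow> length p < L" for \<phi> k u L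
    using that
  proof (induction L arbitrary: \<phi> k u)
    case 0
    have z: "\<phi> = 0" by (rule ext) (use 0 in simp)
    show ?case unfolding z by (rule fs.subspace_0[OF gspaceD(1)[OF graded_subD(1)[OF N]]])
  next
    case (Suc L)
    have "prep (loops s k @ [Arr k l]) \<phi> \<in> N l (u + sh k (l, s))" if "(l, s) \<in> idx k" for l s
    proof (rule Suc.IH)
      have "adj C k l" using that by (simp add: idx_iff)
      then have "prep (loops s k @ [Arr k l]) \<phi> \<in> V l (u + wdeg (loops s k @ [Arr k l]))"
        by (intro prep_V[OF Suc.prems(1)]) simp
      then show "prep (loops s k @ [Arr k l]) \<phi> \<in> V l (u + sh k (l, s))" by (simp only: wdeg_out)
      show "\<forall>p. prep (loops s k @ [Arr k l]) \<phi> p \<noteq> 0 \<longrightarrow> length p < L"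
      proof (intro allI impI)
        fix p assume "prep (loops s k @ [Arr k l]) \<phi> p \<noteq> 0"
        then have "length ((loops s k @ [Arr k l]) @ p) < Suc L" using Suc.prems(2) by (auto simp: prep_def)
        then show "length p < L" by simp
      qed
    qed
    then have "\<phi> \<in> upf k N u" using Suc.prems(1) by (simp add: upf_iff)
    then show ?case using full by (simp add: full_def)
  qed
  note * = this
  have "V k u \<subseteq> N k u" for k u
  proof
    fix \<phi> :: "('i, 'k) wfun" assume \<phi>: "\<phi> \<in> V k u"
    then have "finite (length ` {p. \<phi> p \<noteq> 0})" by (simp add: V_def)
    then have "length p < Suc (Max (length ` {p. \<phi> p \<noteq> 0}))" if "\<phi> p \<noteq> 0" for p
      using that by (simp add: less_Suc_eq_le)
    then show "\<phi> \<in> N k u" by (intro *[OF \<phi>] allI impI)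
  qed
  then show ?thesis using graded_subD(2)[OF N] by (intro ext equalityI)
qed

text \<open>A member of \<open>CC\<close> of greatest total dimension admits no further step, so its
  weight is antidominant and it is full everywhere. Antidominance also identifies the weight as w_0
  \<omega>_j.\<close>

lemma CC_V: "CC (V :: ('i, 'k::field) wfam)"
  and lam_V: "lam (V :: ('i, 'k::field) wfam) k = (if k = star C j then - 1 else 0)"
proof -
  let ?CC = "Collect (CC :: ('i, 'k) wfam \<Rightarrow> bool)"
  have ne: "total ` ?CC \<noteq> {}" using CC.zero by auto
  have "Max (total ` ?CC) \<in> total ` ?CC" by (rule Max_in[OF finite_total_CC ne])
  then obtain N where N: "N \<in> ?CC" "Max (total ` ?CC) = total N" by (elim imageE)
  have CCN: "CC N" using N(1) by simp
  have max: "total N' \<le> total N" if "CC N'" for N' :: "('i, 'k) wfam"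
    using Max_ge[OF finite_total_CC imageI[of N' ?CC]] that N(2) by simp
  have good: "good N" by (rule CC_good[OF CCN])
  have neg: "lam N k \<le> 0" for k
  proof (rule ccontr)
    assume "\<not> ?thesis"
    then have pos: "0 < lam N k" by simp
    have tf: "topfree k N" using pos by (intro good_topfree[OF CCN good]) simp
    have "CC (U k N)" by (rule CC.step[OF CCN pos tf])
    then show False using max[of "U k N"] total_U[OF CC_graded_sub[OF CCN] tf] pos by simp
  qed
  have NV: "N = V" by (rule all_full_eq_V[OF CC_graded_sub[OF CCN] good_full[OF CCN good neg]])
  then show "CC (V :: ('i, 'k) wfam)" using CCN by simp
  from CC_word[OF CCN] obtain w where w: "\<forall>\<beta>. lampair N \<beta> = d j * weyl_word C w \<beta> $ j" by (elim exE)
  have "weyl_word C w \<beta> $ j \<le> 0" if "\<beta> \<in> pos_roots C" for \<beta>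
  proof -
    have "lampair N \<beta> \<le> 0" unfolding lampair_def
      using that neg d_pos by (intro sum_nonpos mult_nonpos_nonneg) (auto simp: pos_roots_def less_imp_le)
    then have "d j * weyl_word C w \<beta> $ j \<le> 0" using w by simp
    then show ?thesis using d_pos[of j] by (simp add: mult_le_0_iff)
  qed
  from antidominant_weight[OF this, of k]
  have "lam N k * d k = (if k = star C j then - d k else 0)"
    using w[rule_format, of "axis k 1"] lampair_axis[of N k] d_star[of j] by auto
  then have "lam N k * d k = (if k = star C j then - 1 else 0) * d k" by simp
  moreover have "d k \<noteq> 0" using d_pos[of k] by simp
  ultimately have "lam N k = (if k = star C j then - 1 else 0)" by (rule mult_right_cancel[THEN iffD1, rotated])
  then show "lam (V :: ('i, 'k) wfam) k = (if k = star C j then - 1 else 0)"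
    using NV by simp
qed

lemma graded_sub_V: "graded_sub (V :: ('i, 'k::field) wfam)"
  by (rule CC_graded_sub[OF CC_V])

lemma upf_V: "upf k V = (V k :: int \<Rightarrow> ('i, 'k::field) wfun set)"
proof
  fix u
  have "upf k V u \<subseteq> (V k u :: ('i, 'k) wfun set)" unfolding upf_def by (rule Collect_restrict)
  then show "upf k V u = (V k u :: ('i, 'k) wfun set)" by (rule equalityI) (rule sub_upf[OF graded_sub_V])
qed

section \<open>First moments and the missing degree\<close>

lemma wt_add:
  assumes "gspace (Z :: int \<Rightarrow> ('x \<Rightarrow> 'k::field) set)"
  shows "wt (\<lambda>u. f u + g u) Z = wt f Z + wt g Z"
  unfolding wt_def distrib_right by (intro fsum_add gspace_supp[OF assms])

lemma wt_cmult:
  assumes "gspace (Z :: int \<Rightarrow> ('x \<Rightarrow> 'k::field) set)"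
  shows "wt (\<lambda>u. c) Z = c * tot Z"
proof -
  have "wt (\<lambda>u. c) Z = (\<Sum>u\<in>{u. gd Z u \<noteq> 0}. c * gd Z u)"
    unfolding wt_def using gspace_supp[OF assms, of "\<lambda>_. 1"] by (intro Sum_any.expand_superset) auto
  also have "\<dots> = c * (\<Sum>u\<in>{u. gd Z u \<noteq> 0}. gd Z u)" by (simp add: sum_distrib_left)
  also have "(\<Sum>u\<in>{u. gd Z u \<noteq> 0}. gd Z u) = tot Z" by (simp add: wt_def Sum_any.expand_set)
  finally show ?thesis .
qed

definition moment :: "('i, 'k::field) wfam \<Rightarrow> int ^ 'i" where
  "moment N = (\<chi> k. wt (\<lambda>u. u + d j) (N k))"

text \<open>The shifts of the summands at a vertex are symmetric about \<open>d\<^sub>i\<close>, hence cancel in the first moment.\<close>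

lemma sum_shift: "adj C i k \<Longrightarrow> (\<Sum>s<a i k. - d i - sh i (k, s)) = 0"
proof -
  assume k: "adj C i k"
  have "(\<Sum>s<n. - d i - (2 * d i * int s - d i * int m)) = d i * int n * (int m - int n)" for n m
    by (induction n) (simp_all add: algebra_simps)
  from this[of "a i k" "a i k"] show ?thesis by (simp add: sh_def d_a[OF k])
qed

text \<open>The exact sequence is weighted by f(u) = u + d_j - d_i. The two extremes then carry u +
  d_j shifted by -d_i and +d_i, the shifts of the neighbours cancel by \<open>sum_shift\<close>, and
  the term at i = j vanishes since f(0) = d_j - d_i.\<close>

lemma moment_formula:
  assumes N: "graded_sub (N :: ('i, 'k::field) wfam)"
  shows "wt (\<lambda>u. u + d j) (upf i N) + wt (\<lambda>u. u + d j) (inf i N)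
      = d i * (tot (upf i N) - tot (inf i N)) + 2 * moment N $ i - (C *v moment N) $ i"
proof -
  note gs = graded_subD(1)[OF N]
  have f: "wt (\<lambda>u. u + d j - d i) (upf i N) = wt (\<lambda>u. u + d j) (upf i N) - d i * tot (upf i N)"
    using wt_add[OF upf_gspace[OF N], of "\<lambda>u. u + d j" "\<lambda>u. - d i" i] wt_cmult[OF upf_gspace[OF N], of "- d i" i] by simp
  have g: "wt (\<lambda>u. u + 2 * d i + d j - d i) (inf i N) = wt (\<lambda>u. u + d j) (inf i N) + d i * tot (inf i N)"
    using wt_add[OF inf_gspace[OF N], of "\<lambda>u. u + d j" "\<lambda>u. d i" i] wt_cmult[OF inf_gspace[OF N], of "d i" i]
    by (simp add: algebra_simps)
  have "(\<Sum>x\<in>idx i. wt (\<lambda>u. u - sh i x + d j - d i) (N (fst x)))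
      = (\<Sum>k | adj C i k. \<Sum>s<a i k. wt (\<lambda>u. u + d j) (N k) + (- d i - sh i (k, s)) * tot (N k))"
    unfolding sum_idx
  proof (intro sum.cong refl)
    fix k s
    show "wt (\<lambda>u. u - sh i (k, s) + d j - d i) (N (fst (k, s)))
        = wt (\<lambda>u. u + d j) (N k) + (- d i - sh i (k, s)) * tot (N k)"
      using wt_add[OF gs, of "\<lambda>u. u + d j" "\<lambda>u. - d i - sh i (k, s)" k] wt_cmult[OF gs, of "- d i - sh i (k, s)" k]
      by (simp add: algebra_simps)
  qed
  also have "\<dots> = (\<Sum>k | adj C i k. int (a i k) * moment N $ k)"
  proof (rule sum.cong)
    fix k assume "k \<in> {k. adj C i k}"
    then have "(\<Sum>s<a i k. (- d i - sh i (k, s)) * tot (N k)) = 0"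
      using sum_shift[of i k] by (simp add: sum_distrib_right[symmetric])
    then show "(\<Sum>s<a i k. wt (\<lambda>u. u + d j) (N k) + (- d i - sh i (k, s)) * tot (N k)) = int (a i k) * moment N $ k"
      by (simp add: sum.distrib moment_def)
  qed simp
  also have "\<dots> = 2 * moment N $ i - (C *v moment N) $ i" by (simp add: cartan_row)
  finally show ?thesis
    using weighted_formula[OF N, of "\<lambda>u. u + d j - d i" i] f g by (auto simp: algebra_simps)
qed

text \<open>Only positive roots that the word of \<open>CC_word\<close> makes negative can
  contribute. A step at i permutes the positive roots other than \<alpha>_i and gives \<alpha>_i the
  coefficient d_i \<lambda>_i, which matches the change of the moments in
  \<open>moment_formula\<close>.\<close>

lemma CC_moment:
  fixes N :: "('i, 'k::field) wfam"
  assumes "CC N"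
  shows "moment N = (\<Sum>\<gamma>\<in>pos_roots C. max 0 (- lampair N \<gamma>) *s \<gamma>)"
  using assms
proof induction
  case zero
  have "max 0 (- lampair (\<lambda>_ _. {0} :: ('i, 'k) wfun set) \<gamma>) = 0" if "\<gamma> \<in> pos_roots C" for \<gamma>
  proof -
    have "0 \<le> lampair (\<lambda>_ _. {0} :: ('i, 'k) wfun set) \<gamma>" unfolding lampair_def lam_zero
      using that d_pos by (intro sum_nonneg) (auto simp: pos_roots_def less_imp_le)
    then show ?thesis by simp
  qed
  then have "(\<Sum>\<gamma>\<in>pos_roots C. max 0 (- lampair (\<lambda>_ _. {0} :: ('i, 'k) wfun set) \<gamma>) *s \<gamma>) = 0"
    by (intro sum.neutral ballI) simp
  moreover have "moment (\<lambda>_ _. {0} :: ('i, 'k) wfun set) = 0"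
    by (simp add: moment_def wt_def gd_def fs.dim_zero_space vec_eq_iff)
  ultimately show ?case by simp
next
  case (step N i)
  note N = CC_graded_sub[OF step.hyps(1)] and tf = step.hyps(3)
  define m where "m \<gamma> = max 0 (- lampair N \<gamma>)" for \<gamma>
  have "moment (U i N) $ k = (srefl i (moment N) + axis i (d i * lam N i)) $ k" for k
  proof (cases "k = i")
    case True
    have "lam N i = tot (upf i N) - tot (N i)" using lam_eq[OF N, of i] tf by (simp add: topfree_def)
    then show ?thesis using moment_formula[OF N, of i] tf True
      by (simp add: moment_def topfree_def refl_nth axis_nth)
  next
    case False
    then show ?thesis by (simp add: moment_def U_other refl_nth axis_nth)
  qed
  then have lhs: "moment (U i N) = srefl i (moment N) + axis i (d i * lam N i)" by (simp add: vec_eq_iff)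
  have pos: "0 < d i * lam N i" using step.hyps(2) d_pos by simp
  have mU: "max 0 (- lampair (U i N) \<gamma>) = m (srefl i \<gamma>)" for \<gamma> by (simp add: lampair_U[OF N tf] m_def)
  have m1: "m (srefl i (axis i 1)) = d i * lam N i" "m (axis i 1) = 0"
    unfolding refl_axis_self m_def lampair_neg lampair_axis using pos by (simp_all add: mult.commute)
  let ?P = "pos_roots C - {axis i 1}"
  have srefl_sum: "srefl i (\<Sum>\<gamma>\<in>A. f \<gamma>) = (\<Sum>\<gamma>\<in>A. srefl i (f \<gamma>))" if "finite A" for A and f :: "int ^ 'i \<Rightarrow> int ^ 'i"
    using weyl_word_sum[OF that, of C "[i]" f] by (simp add: weyl_word_Cons)
  have "(\<Sum>\<gamma>\<in>pos_roots C. m (srefl i \<gamma>) *s \<gamma>)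
      = m (srefl i (axis i 1)) *s axis i 1 + (\<Sum>\<gamma>\<in>?P. m (srefl i \<gamma>) *s \<gamma>)"
    by (rule sum.remove[OF finite_pos_roots axis_pos_root])
  also have "(\<Sum>\<gamma>\<in>?P. m (srefl i \<gamma>) *s \<gamma>) = (\<Sum>\<gamma>\<in>?P. m \<gamma> *s srefl i \<gamma>)"
    using sum.reindex_bij_betw[OF refl_bij_pos, of "\<lambda>\<gamma>. m \<gamma> *s srefl i \<gamma>" i] by simp
  also have "\<dots> = (\<Sum>\<gamma>\<in>pos_roots C. m \<gamma> *s srefl i \<gamma>)"
    unfolding sum.remove[OF finite_pos_roots axis_pos_root, of _ i] by (simp add: m1)
  also have "\<dots> = srefl i (moment N)"
    unfolding step.IH srefl_sum[OF finite_pos_roots] by (simp add: refl_smult m_def)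
  finally have rhs: "(\<Sum>\<gamma>\<in>pos_roots C. m (srefl i \<gamma>) *s \<gamma>) = axis i (d i * lam N i) + srefl i (moment N)"
    by (simp add: m1 vec_eq_iff axis_nth)
  show ?case unfolding mU lhs rhs by (simp add: add.commute)
qed

abbreviation rh :: int where
  "rh \<equiv> int (lacing_number C * dual_coxeter_number C)"

text \<open>For V the coefficient of \<gamma> is proportional to the coordinate of \<gamma> at
  \<open>star C j\<close>, and \<open>dual_coxeter_casimir\<close> evaluates the resulting
  sum.\<close>

lemma cartan_moment_V: "(C *v moment (V :: ('i, 'k::field) wfam)) $ i = (if i = star C j then rh else 0)"
proof -
  let ?m = "moment (V :: ('i, 'k) wfam)" and ?s = "star C j"
  have lp: "lampair (V :: ('i, 'k) wfam) \<gamma> = - (d ?s * \<gamma> $ ?s)" for \<gamma>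
    unfolding lampair_def lam_V by (simp add: if_distrib if_distribR cong: if_cong)
  have "?m = (\<Sum>\<gamma>\<in>pos_roots C. (d ?s * \<gamma> $ ?s) *s \<gamma>)"
    unfolding CC_moment[OF CC_V] lp
    by (rule sum.cong) (use d_pos in \<open>auto simp: pos_roots_def less_imp_le\<close>)
  then have m: "?m $ k = (\<Sum>\<gamma>\<in>pos_roots C. d ?s * \<gamma> $ ?s * \<gamma> $ k)" for k by simp
  have "d i * (C *v ?m) $ i = (\<Sum>\<gamma>\<in>pos_roots C. d ?s * (d i * (C *v \<gamma>) $ i * \<gamma> $ ?s))"
    unfolding mat_vec_nth m sum_distrib_left by (subst sum.swap) (simp add: sum_distrib_left sum_distrib_right mult_ac)
  also have "\<dots> = d ?s * (if ?s = i then rh else 0)"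
    unfolding sum_distrib_left[symmetric] dual_coxeter_casimir by simp
  finally show ?thesis using d_pos[of i] by (auto split: if_splits)
qed

lemma fsum_one:
  assumes "finite {u :: int. g u \<noteq> 0}" "\<And>u. 0 \<le> g u" "fsum g = 1"
  shows "\<exists>t. \<forall>u. g u = (if u = t then 1 else 0)"
proof -
  have "\<exists>t. g t \<noteq> 0"
  proof (rule ccontr)
    assume "\<not> ?thesis"
    then have "g = (\<lambda>_. 0)" by (simp add: fun_eq_iff)
    then show False using assms(3) by simp
  qed
  then obtain t where t: "g t \<noteq> 0" by (elim exE)
  let ?h = "\<lambda>u. if u = t then 1 else 0 :: int"
  have "fsum ?h = 1" by (subst Sum_any.expand_superset[of "{t}"]) auto
  moreover have "?h u \<le> g u" for u using assms(2)[of u] t assms(2)[of t] by auto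
  ultimately have "?h u = g u" for u
    using assms by (intro fsum_mono_eq[of ?h g]) (auto intro: finite_subset[of _ "{t}"])
  then show ?thesis by (intro exI[of _ t] allI) simp
qed

text \<open>The difference of the graded dimensions is nonnegative with total 1 at
  \<open>star C j\<close> and 0 elsewhere, so it sits in one degree t. The moment formula, in which
  V is its own largest component, gives t + d_j = r h^\<or> - d_i, and d_i = d_j there.\<close>

lemma inf_V_degree:
  "gd (inf i (V :: ('i, 'k::field) wfam)) u
    = gd ((V :: ('i, 'k) wfam) i) u - (if i = star C j \<and> u = rh - 2 * d j then 1 else 0)"
proof -
  let ?V = "V :: ('i, 'k) wfam"
  note gs = graded_subD(1)[OF graded_sub_V] and gi = inf_gspace[OF graded_sub_V]
  define g where "g u = gd (?V i) u - gd (inf i ?V) u" for u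
  have fV: "finite {u. gd (?V i) u \<noteq> 0}" and fi: "finite {u. gd (inf i ?V) u \<noteq> 0}"
    using gspace_supp[OF gs, of "\<lambda>_. 1"] gspace_supp[OF gi, of "\<lambda>_. 1"] by simp_all
  have fing: "finite {u. g u \<noteq> 0}"
    by (rule finite_subset[OF _ finite_UnI[OF fV fi]]) (auto simp: g_def)
  have ng: "0 \<le> g u" for u using gd_mono[OF gs inf_sub[OF graded_sub_V]] by (simp add: g_def)
  have gV: "gd (?V i) u = g u + gd (inf i ?V) u" for u by (simp add: g_def)
  have fin': "finite {u. f u * g u \<noteq> 0}" for f by (rule finite_subset[OF _ fing]) auto
  have w: "wt f (?V i) = fsum (\<lambda>u. f u * g u) + wt f (inf i ?V)" for f
    unfolding wt_def gV distrib_left by (rule fsum_add[OF fin' gspace_supp[OF gi]])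
  have "tot (?V i) - tot (inf i ?V) = (if i = star C j then 1 else 0)"
    using lam_eq[OF graded_sub_V[where 'k = 'k], of i] unfolding upf_V lam_V by (simp split: if_splits)
  then have sg: "fsum g = (if i = star C j then 1 else 0)" using w[of "\<lambda>_. 1"] by simp
  show ?thesis
  proof (cases "i = star C j")
    case False
    then have "fsum g \<le> fsum (\<lambda>_. 0)" using sg by simp
    then have "0 = g u" using fing ng by (intro fsum_mono_eq[of "\<lambda>_. 0" g]) simp_all
    then show ?thesis using False by (simp add: g_def)
  next
    case True
    then have "fsum g = 1" using sg by simp
    from fsum_one[OF fing ng this] obtain t where t: "\<forall>u. g u = (if u = t then 1 else 0)" by (elim exE)
    have "fsum (\<lambda>u. f u * g u) = f t" for f
      by (subst Sum_any.expand_superset[of "{t}"]) (use t in auto)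
    then have w': "wt f (?V i) = f t + wt f (inf i ?V)" for f using w by simp
    have "wt (\<lambda>u. u + d j) (?V i) + wt (\<lambda>u. u + d j) (inf i ?V) = d i + 2 * wt (\<lambda>u. u + d j) (?V i) - rh"
      using moment_formula[OF graded_sub_V[where 'k = 'k], of i] w'[of "\<lambda>_. 1"]
      unfolding upf_V cartan_moment_V using True by (simp add: moment_def)
    then have "t + d j = rh - d i" using w'[of "\<lambda>u. u + d j"] by simp
    then have "t = rh - 2 * d j" using d_star[of j] True by simp
    moreover have "gd (inf i ?V) u = gd (?V i) u - g u" by (simp add: g_def)
    ultimately show ?thesis using t[rule_format, of u] True by simp
  qed
qed

section \<open>The graded dimensions of V\<close>

lemma degree_formula:
  fixes u :: int
  defines "g \<equiv> \<lambda>i. gd ((V :: ('i, 'k::field) wfam) i)"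
  shows "g i u + g i (u - 2 * d i) - (\<Sum>x\<in>idx i. g (fst x) (u + sh i x))
    = (if i = j \<and> u = 0 then 1 else 0) + (if i = star C j \<and> u = rh then 1 else 0)"
proof -
  have "d i = d j" if "i = star C j" using that d_star by simp
  then have "(i = star C j \<and> u - 2 * d i = rh - 2 * d j) \<longleftrightarrow> (i = star C j \<and> u = rh)" by auto
  then show ?thesis
    using dim_formula(2)[OF graded_subD(1,2)[OF graded_sub_V], of i u, where 'k = 'k]
    unfolding g_def upf_V inf_V_degree by simp
qed

lemma sh_bounds:
  assumes "(k, s) \<in> idx i"
  shows "- max (d i) (d k) \<le> sh i (k, s)" "sh i (k, s) \<le> max (d i) (d k) - 2 * d i"
proof -
  have k: "adj C i k" "s < a i k" using assms by (simp_all add: idx_iff)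
  have "2 * d i * int s \<le> 2 * d i * (int (a i k) - 1)"
    using k(2) d_pos[of i] by (intro mult_left_mono) simp_all
  then have "2 * d i * int s \<le> 2 * max (d i) (d k) - 2 * d i" using d_a[OF k(1)] by (simp add: algebra_simps)
  then show "sh i (k, s) \<le> max (d i) (d k) - 2 * d i" by (simp add: sh_def)
  show "- max (d i) (d k) \<le> sh i (k, s)" using d_pos[of i] by (simp add: sh_def)
qed

lemma gd_nonneg: "0 \<le> gd Z u"
  by (simp add: gd_def)

text \<open>Exactness links a nonzero graded piece to one at a neighbour, with shifts limited by
  \<open>sh_bounds\<close>. Hence u - d_i is minimal only at i = j, u = 0, and u + d_i is maximal
  only where the smallest component lacks its one dimension.\<close>

lemma degree_bounds:
  fixes u :: int
  defines "g \<equiv> \<lambda>i. gd ((V :: ('i, 'k::field) wfam) i)"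
  assumes "g i u \<noteq> 0"
  shows "d i \<le> u + d j" "u + d j \<le> rh - d i"
proof -
  define S where "S = {(i, u). g i u \<noteq> 0}"
  have "finite {u. g i u \<noteq> 0}" for i
    unfolding g_def using gspace_supp[OF graded_subD(1)[OF graded_sub_V], of "\<lambda>_. 1"] by simp
  then have "finite (\<Union>i. Pair i ` {u. g i u \<noteq> 0})" by (intro finite_UN_I finite finite_imageI)
  then have S: "finite S" by (rule finite_subset[rotated]) (auto simp: S_def)
  have iu: "(i, u) \<in> S" using assms(2) by (simp add: S_def)
  have successor: "\<exists>k s. (k, s) \<in> idx i \<and> (k, u + sh i (k, s)) \<in> S"
    if "g i u + gd (inf i (V :: ('i, 'k) wfam)) (u - 2 * d i) > 0" "\<not> (i = j \<and> u = 0)" for i u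
  proof (rule ccontr)
    assume *: "\<not> ?thesis"
    have "(\<Sum>x\<in>idx i. g (fst x) (u + sh i x)) = 0"
    proof (rule sum.neutral, rule ballI)
      fix x assume "x \<in> idx i"
      then show "g (fst x) (u + sh i x) = 0" using * by (cases x) (auto simp: S_def)
    qed
    then show False
      using dim_formula(2)[OF graded_subD(1,2)[OF graded_sub_V], of i u, where 'k = 'k] that
      unfolding upf_V by (simp add: g_def)
  qed
  have lower: "- d j \<le> u - d i" if "(i, u) \<in> S" for i u
  proof -
    define h where "h = (\<lambda>(i, u). u - d i)"
    have "Min (h ` S) \<in> h ` S" using S that by (intro Min_in) auto
    then obtain x where x: "x \<in> S" "Min (h ` S) = h x" by (elim imageE)
    obtain i' u' where iu': "x = (i', u')" by (cases x)
    have min: "h x \<le> h y" if "y \<in> S" for y using S that x(2) by (metis Min_le finite_imageI imageI)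
    have "i' = j \<and> u' = 0"
    proof (rule ccontr)
      assume n: "\<not> ?thesis"
      have "g i' u' + gd (inf i' (V :: ('i, 'k) wfam)) (u' - 2 * d i') > 0"
        using x(1) iu' gd_nonneg[of "V i' :: int \<Rightarrow> ('i, 'k) wfun set" u']
          gd_nonneg[of "inf i' (V :: ('i, 'k) wfam)" "u' - 2 * d i'"]
        by (simp add: S_def g_def)
      from successor[OF this n] obtain k s where k: "(k, s) \<in> idx i'" "(k, u' + sh i' (k, s)) \<in> S" by (elim exE conjE)
      have "u' - d i' \<le> u' + sh i' (k, s) - d k" using min[OF k(2)] iu' by (simp add: h_def)
      then show False using sh_bounds(2)[OF k(1)] d_pos[of i'] d_pos[of k] by (simp add: max_def split: if_splits)
    qed
    then have "h x = - d j" using iu' by (simp add: h_def)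
    then show ?thesis using min[OF that] by (simp add: h_def)
  qed
  from lower[OF iu] show "d i \<le> u + d j" by simp
  have upper: "u + d i \<le> rh - d j" if "(i, u) \<in> S" for i u
  proof -
    define h where "h = (\<lambda>(i, u). u + d i)"
    have "Max (h ` S) \<in> h ` S" using S that by (intro Max_in) auto
    then obtain x where x: "x \<in> S" "Max (h ` S) = h x" by (elim imageE)
    obtain i' u' where iu': "x = (i', u')" by (cases x)
    have max: "h y \<le> h x" if "y \<in> S" for y using S that x(2) by (metis Max_ge finite_imageI imageI)
    \<comment> \<open>A nonzero smallest component here would, by the sequence in degree u' + 2
      d_i', force a neighbouring piece with a larger value of u + d_i.\<close>
    have "gd (inf i' (V :: ('i, 'k) wfam)) u' = 0"
    proof (rule ccontr)
      assume "\<not> ?thesis"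
      then have "g i' (u' + 2 * d i') + gd (inf i' (V :: ('i, 'k) wfam)) (u' + 2 * d i' - 2 * d i') > 0"
        using gd_nonneg[of "V i' :: int \<Rightarrow> ('i, 'k) wfun set" "u' + 2 * d i'"]
          gd_nonneg[of "inf i' (V :: ('i, 'k) wfam)" u'] by (simp add: g_def)
      moreover have "\<not> (i' = j \<and> u' + 2 * d i' = 0)"
        using lower[of i' u'] x(1) iu' d_pos[of j] by auto
      ultimately have "\<exists>k s. (k, s) \<in> idx i' \<and> (k, u' + 2 * d i' + sh i' (k, s)) \<in> S" by (rule successor)
      then obtain k s where k: "(k, s) \<in> idx i'" "(k, u' + 2 * d i' + sh i' (k, s)) \<in> S" by (elim exE conjE)
      have "u' + 2 * d i' + sh i' (k, s) + d k \<le> u' + d i'" using max[OF k(2)] iu' by (simp add: h_def)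
      then show False using sh_bounds(1)[OF k(1)] d_pos[of i'] d_pos[of k] by (simp add: max_def split: if_splits)
    qed
    then have "i' = star C j \<and> u' = rh - 2 * d j"
      using x(1) iu' inf_V_degree[of i' u', where 'k = 'k] by (simp add: S_def g_def split: if_splits)
    then have "h x = rh - d j" using iu' d_star[of j] by (simp add: h_def)
    then show ?thesis using max[OF that] by (simp add: h_def)
  qed
  from upper[OF iu] show "u + d j \<le> rh - d i" by simp
qed

primrec is_arr :: "'a arrow \<Rightarrow> bool" where
  "is_arr (Arr i k) = True"
| "is_arr (Loop i) = False"

definition arrs :: "'a arrow list \<Rightarrow> nat" where
  "arrs p = length (filter is_arr p)"

lemma arrs_simps [simp]: "arrs (p @ q) = arrs p + arrs q" "arrs (x # p) = (if is_arr x then 1 else 0) + arrs p"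
  "arrs (loops n i) = 0" "arrs [] = 0"
  by (simp_all add: arrs_def)

text \<open>A loop has degree at least 2, an arrow at least \<open>- dmax\<close>. So the degree and
  the number of arrows, which both relations preserve, together bound the length of a word.\<close>

lemma length_le_wdeg: "int (length p) \<le> wdeg p + (dmax + 1) * int (arrs p)"
proof (induction p)
  case (Cons x p)
  show ?case
  proof (cases x)
    case (Arr i k)
    then show ?thesis using Cons d_le_dmax[of i] d_le_dmax[of k] by (simp add: algebra_simps)
  next
    case (Loop i)
    then show ?thesis using Cons d_pos[of i] by simp
  qed
qed simp

lemma finite_arrows: "finite (UNIV :: 'i arrow set)"
proof -
  have "x \<in> range (\<lambda>y. Arr (fst y) (snd y)) \<union> range Loop" for x :: "'i arrow"
  proof (cases x)
    case (Arr i k)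
    then have "x = Arr (fst (i, k)) (snd (i, k))" by simp
    then have "x \<in> range (\<lambda>y. Arr (fst y) (snd y))" by (rule range_eqI)
    then show ?thesis by (rule UnI1)
  next
    case (Loop i)
    then have "x \<in> range Loop" by (rule range_eqI)
    then show ?thesis by (rule UnI2)
  qed
  then have "UNIV \<subseteq> range (\<lambda>y. Arr (fst y) (snd y)) \<union> range (Loop :: 'i \<Rightarrow> 'i arrow)" by (rule subsetI)
  moreover have "finite (range (\<lambda>y. Arr (fst y) (snd y)) \<union> range (Loop :: 'i \<Rightarrow> 'i arrow))"
    by (rule finite_UnI; rule finite_imageI; rule finite)
  ultimately show ?thesis by (rule finite_subset)
qed

end

context gpa_dual
begin

text \<open>Splitting a function by the number of non-loop arrows gives finitely supported parts, and the
  supports of all elements of \<open>V\<close> lie in one finite set.\<close>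

lemma Vfull_eq_V: "Vfull i u = (V i u :: ('i, 'k::field) wfun set)"
proof (intro equalityI subsetI)
  fix \<phi> :: "('i, 'k) wfun" assume \<phi>: "\<phi> \<in> Vfull i u"
  define c where "c n p = (if arrs p = n then \<phi> p else 0)" for n p
  have c: "c n \<in> V i u" for n
  proof -
    have ok: "rel1_ok \<phi>" "rel2_ok \<phi>" "end_ok \<phi>" "supp_ok i u \<phi>" using \<phi> by (simp_all add: Vfull_def)
    have "rel1_ok (c n)" unfolding rel1_ok_def
    proof (intro allI impI)
      fix z k p q assume k: "adj C z k"
      show "c n (p @ loops (a z k) z @ Arr z k # q) = c n (p @ Arr z k # loops (a k z) k @ q)"
        unfolding c_def rel1_okD[OF ok(1) k] by simp
    qed
    moreover have "rel2_ok (c n)" unfolding rel2_ok_def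
    proof (intro allI)
      fix z p q
      let ?f = "\<lambda>\<psi> :: ('i, 'k) wfun. \<Sum>k | adj C z k. \<Sum>s<a z k.
         of_int (\<omega> z k) * \<psi> (p @ loops s z @ Arr z k # Arr k z # loops (a z k - 1 - s) z @ q)"
      show "?f (c n) = 0"
      proof (cases "arrs p + (2 + arrs q) = n")
        case True
        then have "?f (c n) = ?f \<phi>" by (intro sum.cong refl) (simp add: c_def)
        then show ?thesis using rel2_okD[OF ok(2)] by simp
      next
        case False
        then show ?thesis by (intro sum.neutral ballI) (simp add: c_def)
      qed
    qed
    moreover have "end_ok (c n)" "supp_ok i u (c n)"
      using ok(3,4) by (simp_all add: end_ok_def supp_ok_def c_def)
    moreover have "finite {p. c n p \<noteq> 0}"
    proof (rule finite_subset)
      show "{p. c n p \<noteq> 0} \<subseteq> {p. set p \<subseteq> UNIV \<and> length p \<le> nat ((dmax + 1) * int n - u)}"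
      proof
        fix p assume "p \<in> {p. c n p \<noteq> 0}"
        then have "arrs p = n" "\<phi> p \<noteq> 0" by (auto simp: c_def split: if_splits)
        then have "wdeg p = - u" using \<phi> by (simp add: Vfull_def supp_ok_def)
        then have "int (length p) \<le> (dmax + 1) * int n - u" using length_le_wdeg[of p] \<open>arrs p = n\<close> by simp
        then show "p \<in> {p. set p \<subseteq> UNIV \<and> length p \<le> nat ((dmax + 1) * int n - u)}" by simp
      qed
      show "finite {p :: 'i arrow list. set p \<subseteq> UNIV \<and> length p \<le> nat ((dmax + 1) * int n - u)}"
        by (rule finite_lists_length_le[OF finite_arrows])
    qed
    ultimately show ?thesis by (simp add: V_def Vfull_def)
  qed
  have "{p. \<phi> p \<noteq> 0} \<subseteq> {p. \<exists>z u. \<exists>\<phi>\<in>(V z u :: ('i, 'k) wfun set). \<phi> p \<noteq> 0}"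
  proof
    fix p assume "p \<in> {p. \<phi> p \<noteq> 0}"
    then have "c (arrs p) p \<noteq> 0" by (simp add: c_def)
    then show "p \<in> {p. \<exists>z u. \<exists>\<phi>\<in>(V z u :: ('i, 'k) wfun set). \<phi> p \<noteq> 0}"
      by (intro CollectI exI[of _ i] exI[of _ u] bexI[of _ "c (arrs p)"] c)
  qed
  then have "finite {p. \<phi> p \<noteq> 0}" by (rule finite_subset[OF _ finite_support_graded_sub[OF graded_sub_V]])
  then show "\<phi> \<in> V i u" using \<phi> by (simp add: V_def)
qed (simp add: V_def)

end

section \<open>The path algebra\<close>

abbreviation sg :: "'i path \<Rightarrow> 'k::field \<Rightarrow> ('i, 'k) path_comb" where
  "sg \<equiv> Poly_Mapping.single"

abbreviation lk :: "('i, 'k::field) path_comb \<Rightarrow> 'i path \<Rightarrow> 'k" where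
  "lk \<equiv> Poly_Mapping.lookup"

abbreviation ks :: "('i, 'k::field) path_comb \<Rightarrow> 'i path set" where
  "ks \<equiv> Poly_Mapping.keys"

lemma comb_expand: "finite A \<Longrightarrow> ks x \<subseteq> A \<Longrightarrow> x = (\<Sum>p\<in>A. sg p (lk x p))"
proof (rule poly_mapping_eqI)
  fix k assume A: "finite A" "ks x \<subseteq> A"
  have "lk (\<Sum>p\<in>A. sg p (lk x p)) k = (\<Sum>p\<in>A. if p = k then lk x p else 0)"
    unfolding Poly_Mapping.lookup_sum Poly_Mapping.lookup_single when_def ..
  also have "\<dots> = lk x k" using A by (cases "k \<in> A") (auto simp: Poly_Mapping.in_keys_iff)
  finally show "lk x k = lk (\<Sum>p\<in>A. sg p (lk x p)) k" by simp
qed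

text \<open>Reduces additive identities to multiples of single paths; multilinear ones are treated
  by nesting it.\<close>

lemma comb_induct:
  assumes "P 0" "\<And>x y. P x \<Longrightarrow> P y \<Longrightarrow> P (x + y)" "\<And>p c. p \<in> ks x \<Longrightarrow> P (sg p c)"
  shows "P (x :: ('i, 'k::field) path_comb)"
proof -
  have "P (\<Sum>p\<in>A. sg p (lk x p))" if "finite A" "A \<subseteq> ks x" for A
    using that by (induction rule: finite_induct) (simp_all add: assms)
  from this[of "ks x"] show ?thesis using comb_expand[of "ks x" x] by simp
qed

lemma path_comp_zero [simp]: "path_comp p q 0 = 0"
  by (cases p; cases q) simp

lemma path_comp_add: "path_comp p q (a + b) = path_comp p q a + path_comp p q b"
  by (cases p; cases q) (simp add: Poly_Mapping.single_add)

lemma path_mult_superset: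
  assumes "finite A" "ks x \<subseteq> A" "finite B" "ks y \<subseteq> B"
  shows "path_mult x y = (\<Sum>p\<in>A. \<Sum>q\<in>B. path_comp p q (lk x p * lk y q))"
proof -
  have "(\<Sum>q\<in>ks y. path_comp p q (lk x p * lk y q)) = (\<Sum>q\<in>B. path_comp p q (lk x p * lk y q))" for p
    by (rule sum.mono_neutral_left) (use assms in \<open>auto simp: Poly_Mapping.in_keys_iff\<close>)
  then have "path_mult x y = (\<Sum>p\<in>ks x. \<Sum>q\<in>B. path_comp p q (lk x p * lk y q))"
    by (simp add: path_mult_def)
  also have "\<dots> = (\<Sum>p\<in>A. \<Sum>q\<in>B. path_comp p q (lk x p * lk y q))"
    by (rule sum.mono_neutral_left) (use assms in \<open>auto simp: Poly_Mapping.in_keys_iff\<close>)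
  finally show ?thesis .
qed

lemma path_mult_add_left: "path_mult (x + y) z = path_mult x z + path_mult y z"
proof -
  let ?A = "ks x \<union> ks y"
  have "ks (x + y) \<subseteq> ?A" by (rule Poly_Mapping.keys_add)
  then show ?thesis
    using path_mult_superset[of ?A "x + y" "ks z" z] path_mult_superset[of ?A x "ks z" z] path_mult_superset[of ?A y "ks z" z]
    by (simp add: Poly_Mapping.lookup_add distrib_right path_comp_add sum.distrib)
qed

lemma path_mult_add_right: "path_mult z (x + y) = path_mult z x + path_mult z y"
proof -
  let ?A = "ks x \<union> ks y"
  have "ks (x + y) \<subseteq> ?A" by (rule Poly_Mapping.keys_add)
  then show ?thesis
    using path_mult_superset[of "ks z" z ?A "x + y"] path_mult_superset[of "ks z" z ?A x] path_mult_superset[of "ks z" z ?A y]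
    by (simp add: Poly_Mapping.lookup_add distrib_left path_comp_add sum.distrib)
qed

lemma path_mult_zero [simp]: "path_mult 0 x = 0" "path_mult x 0 = 0"
  by (simp_all add: path_mult_def)

lemma path_mult_neg_left: "path_mult (- x) z = - path_mult x z"
  using path_mult_add_left[of x "- x" z] by (simp add: eq_neg_iff_add_eq_0 add.commute)

lemma path_mult_neg_right: "path_mult z (- x) = - path_mult z x"
  using path_mult_add_right[of z x "- x"] by (simp add: eq_neg_iff_add_eq_0 add.commute)

lemma path_mult_diff_left: "path_mult (x - y) z = path_mult x z - path_mult y z"
  unfolding diff_conv_add_uminus path_mult_add_left path_mult_neg_left ..

lemma path_mult_diff_right: "path_mult z (x - y) = path_mult z x - path_mult z y"
  unfolding diff_conv_add_uminus path_mult_add_right path_mult_neg_right ..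

lemma path_mult_sum_left: "path_mult (\<Sum>a\<in>A. f a) z = (\<Sum>a\<in>A. path_mult (f a) z)"
  by (induction A rule: infinite_finite_induct) (simp_all add: path_mult_add_left)

lemma path_mult_sum_right: "path_mult z (\<Sum>a\<in>A. f a) = (\<Sum>a\<in>A. path_mult z (f a))"
  by (induction A rule: infinite_finite_induct) (simp_all add: path_mult_add_right)

lemma path_mult_single: "path_mult (sg p a) (sg q b) = path_comp p q (a * b)"
  using path_mult_superset[of "{p}" "sg p a" "{q}" "sg q b"] by simp

lemma path_mult_paths: "path_mult (sg (t, p, s) a) (sg (s', q, r) b) = (if s = s' then sg (t, p @ q, r) (a * b) else 0)"
  by (simp add: path_mult_single)

lemma path_mult_assoc: "path_mult (path_mult x y) z = path_mult x (path_mult y z)"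
proof (rule comb_induct[where x = x and P = "\<lambda>x. path_mult (path_mult x y) z = path_mult x (path_mult y z)"])
  fix p a
  show "path_mult (path_mult (sg p a) y) z = path_mult (sg p a) (path_mult y z)"
  proof (rule comb_induct[where x = y and P = "\<lambda>y. path_mult (path_mult (sg p a) y) z = path_mult (sg p a) (path_mult y z)"])
    fix q b
    show "path_mult (path_mult (sg p a) (sg q b)) z = path_mult (sg p a) (path_mult (sg q b) z)"
    proof (rule comb_induct[where x = z and P = "\<lambda>z. path_mult (path_mult (sg p a) (sg q b)) z = path_mult (sg p a) (path_mult (sg q b) z)"])
      fix r c
      show "path_mult (path_mult (sg p a) (sg q b)) (sg r c) = path_mult (sg p a) (path_mult (sg q b) (sg r c))"
        by (cases p; cases q; cases r) (simp add: path_mult_paths mult.assoc)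
    qed (simp_all add: path_mult_add_right)
  qed (simp_all add: path_mult_add_right path_mult_add_left)
qed (simp_all add: path_mult_add_left)

lemma PA_scalar_mult_single: "path_mult (PA_scalar c) (sg (t :: 'i::finite, p, s) b) = sg (t, p, s) (c * b)"
  unfolding PA_scalar_def path_mult_sum_left path_mult_paths by simp

lemma PA_scalar_single_mult: "path_mult (sg (t, p, s :: 'i::finite) b) (PA_scalar c) = sg (t, p, s) (b * c)"
  unfolding PA_scalar_def path_mult_sum_right path_mult_paths by (simp add: if_distrib cong: if_cong)

lemma PA_scalar_one: "path_mult (PA_scalar 1) x = x" "path_mult x (PA_scalar 1) = (x :: ('i::finite, 'k::field) path_comb)"
proof -
  show "path_mult (PA_scalar 1) x = x"
  proof (rule comb_induct[where x = x])
    fix p c show "path_mult (PA_scalar 1) (sg p c :: ('i, 'k) path_comb) = sg p c"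
      by (cases p) (simp add: PA_scalar_mult_single)
  qed (simp_all add: path_mult_add_right)
  show "path_mult x (PA_scalar 1) = x"
  proof (rule comb_induct[where x = x])
    fix p c show "path_mult (sg p c :: ('i, 'k) path_comb) (PA_scalar 1) = sg p c"
      by (cases p) (simp add: PA_scalar_single_mult)
  qed (simp_all add: path_mult_add_left)
qed

lemma walk_append: "walk C t p m \<Longrightarrow> walk C m q s \<Longrightarrow> walk C t (p @ q) s"
  by (induction p arbitrary: t) auto

lemma PA_simps [simp]:
  "x \<in> carrier (PA C) \<longleftrightarrow> ks x \<subseteq> paths C" "x \<otimes>\<^bsub>PA C\<^esub> y = path_mult x y" "\<one>\<^bsub>PA C\<^esub> = PA_scalar 1"
  "\<zero>\<^bsub>PA C\<^esub> = 0" "x \<oplus>\<^bsub>PA C\<^esub> y = x + y"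
  by (simp_all add: PA_def)

lemma keys_add_paths: "ks x \<subseteq> paths C \<Longrightarrow> ks y \<subseteq> paths C \<Longrightarrow> ks (x + y) \<subseteq> paths C"
  using Poly_Mapping.keys_add[of x y] by blast

lemma keys_path_comp: "p \<in> paths C \<Longrightarrow> q \<in> paths C \<Longrightarrow> ks (path_comp p q c) \<subseteq> paths C"
  by (cases p; cases q) (auto simp: paths_def intro: walk_append)

lemma keys_sum_paths: "(\<And>a. a \<in> A \<Longrightarrow> ks (f a) \<subseteq> paths C) \<Longrightarrow> ks (\<Sum>a\<in>A. f a) \<subseteq> paths C"
  by (induction A rule: infinite_finite_induct) (simp_all add: keys_add_paths)

lemma keys_mult_paths: "ks x \<subseteq> paths C \<Longrightarrow> ks y \<subseteq> paths C \<Longrightarrow> ks (path_mult x y) \<subseteq> paths C"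
  unfolding path_mult_def by (intro keys_sum_paths keys_path_comp) auto

lemma keys_single_paths: "p \<in> paths C \<Longrightarrow> ks (sg p c) \<subseteq> paths C"
  by simp

lemma keys_scalar_paths: "ks (PA_scalar c :: ('i::finite, 'k::field) path_comb) \<subseteq> paths C"
  unfolding PA_scalar_def by (intro keys_sum_paths keys_single_paths) (simp add: paths_def)

lemma PA_ring: "ring (PA C :: ('i::finite, 'k::field) path_comb ring)"
proof (rule ringI)
  show "abelian_group (PA C :: ('i, 'k) path_comb ring)"
  proof (rule abelian_groupI)
    fix x :: "('i, 'k) path_comb" assume "x \<in> carrier (PA C)"
    then show "\<exists>y\<in>carrier (PA C). y \<oplus>\<^bsub>PA C\<^esub> x = \<zero>\<^bsub>PA C\<^esub>"
      by (intro bexI[of _ "- x"]) simp_all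
  qed (simp_all add: keys_add_paths add.assoc add.commute)
  show "monoid (PA C :: ('i, 'k) path_comb ring)"
    by (rule monoidI) (simp_all add: keys_mult_paths keys_scalar_paths path_mult_assoc PA_scalar_one)
qed (simp_all add: path_mult_add_left path_mult_add_right)

lemma PA_a_inv: "x \<in> carrier (PA C) \<Longrightarrow> \<ominus>\<^bsub>PA C\<^esub> x = - (x :: ('i::finite, 'k::field) path_comb)"
  by (rule abelian_group.minus_equality[OF ring.is_abelian_group[OF PA_ring]]) simp_all

lemma eps_pow_left: "path_mult (eps i [^]\<^bsub>PA C\<^esub> (n::nat)) (sg (i, p, s) c) = sg (i :: 'i::finite, replicate n (Loop i) @ p, s) (c :: 'k::field)"
proof (induction n arbitrary: p)
  case 0
  show ?case by (simp add: PA_scalar_mult_single nat_pow_def)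
next
  case (Suc n)
  have "eps i [^]\<^bsub>PA C\<^esub> Suc n = path_mult (eps i [^]\<^bsub>PA C\<^esub> n) (eps i :: ('i, 'k) path_comb)" by (simp add: nat_pow_def)
  then show ?case by (simp add: path_mult_assoc eps_def path_mult_paths Suc.IH[unfolded eps_def] replicate_app_Cons_same)
qed

lemma eps_pow_right: "path_mult (sg (t, p, i) c) (eps i [^]\<^bsub>PA C\<^esub> (n::nat)) = sg (t, p @ replicate n (Loop i), i :: 'i::finite) (c :: 'k::field)"
proof (induction n)
  case 0
  show ?case by (simp add: PA_scalar_single_mult nat_pow_def)
next
  case (Suc n)
  have "eps i [^]\<^bsub>PA C\<^esub> Suc n = path_mult (eps i [^]\<^bsub>PA C\<^esub> n) (eps i :: ('i, 'k) path_comb)" by (simp add: nat_pow_def)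
  then show ?case by (simp add: path_mult_assoc[symmetric] Suc.IH) (simp add: eps_def path_mult_paths replicate_append_same)
qed

lemma rel1_eq: "rel1 C i k = (sg (i :: 'i::finite, replicate (nat (- C $ i $ k)) (Loop i) @ [Arr i k], k) 1
    - sg (i, Arr i k # replicate (nat (- C $ k $ i)) (Loop k), k) (1 :: 'k::field))"
  unfolding rel1_def alpha_def PA_simps eps_pow_left eps_pow_right by simp

lemma rel2_eq: "rel2 C \<omega> i = (\<Sum>k | adj C k i. \<Sum>s = 0..<nat (- C $ i $ k).
    sg (i :: 'i::finite, replicate s (Loop i) @ Arr i k # Arr k i # replicate (nat (- C $ i $ k) - 1 - s) (Loop i), i) (of_int (\<omega> i k) :: 'k::field))"
  unfolding rel2_def
proof (intro sum.cong refl)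
  fix k s
  have "PA_scalar (of_int (\<omega> i k)) \<otimes>\<^bsub>PA C\<^esub> (eps i [^]\<^bsub>PA C\<^esub> s) \<otimes>\<^bsub>PA C\<^esub> alpha i k \<otimes>\<^bsub>PA C\<^esub> alpha k i
      \<otimes>\<^bsub>PA C\<^esub> (eps i [^]\<^bsub>PA C\<^esub> (nat (- C $ i $ k) - 1 - s))
    = path_mult (path_mult (PA_scalar (of_int (\<omega> i k))) (path_mult (path_mult (eps i [^]\<^bsub>PA C\<^esub> s) (alpha i k)) (alpha k i)))
      (eps i [^]\<^bsub>PA C\<^esub> (nat (- C $ i $ k) - 1 - s) :: ('i, 'k) path_comb)"
    by (simp add: path_mult_assoc)
  also have "\<dots> = sg (i, replicate s (Loop i) @ Arr i k # Arr k i # replicate (nat (- C $ i $ k) - 1 - s) (Loop i), i) (of_int (\<omega> i k))"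
    unfolding alpha_def eps_pow_left path_mult_paths by (simp add: PA_scalar_mult_single eps_pow_right)
  finally show "PA_scalar (of_int (\<omega> i k)) \<otimes>\<^bsub>PA C\<^esub> (eps i [^]\<^bsub>PA C\<^esub> s) \<otimes>\<^bsub>PA C\<^esub> alpha i k \<otimes>\<^bsub>PA C\<^esub> alpha k i
      \<otimes>\<^bsub>PA C\<^esub> (eps i [^]\<^bsub>PA C\<^esub> (nat (- C $ i $ k) - 1 - s))
    = (sg (i, replicate s (Loop i) @ Arr i k # Arr k i # replicate (nat (- C $ i $ k) - 1 - s) (Loop i), i) (of_int (\<omega> i k)) :: ('i, 'k) path_comb)" .
qed

lemma PA_op_superset: "finite A \<Longrightarrow> ks x \<subseteq> A \<Longrightarrow> PA_op x = (\<Sum>p\<in>A. sg (path_op p) (lk x p))"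
  unfolding PA_op_def by (rule sum.mono_neutral_left) (auto simp: Poly_Mapping.in_keys_iff)

lemma PA_op_add: "PA_op (x + y) = PA_op x + PA_op y"
proof -
  let ?A = "ks x \<union> ks y"
  have "ks (x + y) \<subseteq> ?A" by (rule Poly_Mapping.keys_add)
  then show ?thesis
    using PA_op_superset[of ?A "x + y"] PA_op_superset[of ?A x] PA_op_superset[of ?A y]
    by (simp add: Poly_Mapping.lookup_add Poly_Mapping.single_add sum.distrib)
qed

lemma PA_op_zero [simp]: "PA_op 0 = 0"
  by (simp add: PA_op_def)

lemma PA_op_single [simp]: "PA_op (sg p c) = sg (path_op p) c"
  using PA_op_superset[of "{p}" "sg p c"] by simp

lemma PA_op_neg: "PA_op (- x) = - PA_op x"
  using PA_op_add[of x "- x"] by (simp add: eq_neg_iff_add_eq_0 add.commute)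

lemma PA_op_diff: "PA_op (x - y) = PA_op x - PA_op y"
  unfolding diff_conv_add_uminus PA_op_add PA_op_neg ..

lemma PA_op_sum: "PA_op (\<Sum>a\<in>A. f a) = (\<Sum>a\<in>A. PA_op (f a))"
  by (induction A rule: infinite_finite_induct) (simp_all add: PA_op_add)

lemma arrow_op_op [simp]: "arrow_op (arrow_op x) = x"
  by (cases x) simp_all

lemma path_op_op: "path_op (path_op p) = p"
  by (cases p) (auto simp: rev_map intro: map_idI)

lemma PA_op_op: "PA_op (PA_op x) = x"
  by (rule comb_induct[where x = x]) (simp_all add: PA_op_add path_op_op)

lemma PA_op_mult: "PA_op (path_mult x y) = path_mult (PA_op y) (PA_op x)"
proof (rule comb_induct[where x = x and P = "\<lambda>x. PA_op (path_mult x y) = path_mult (PA_op y) (PA_op x)"])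
  fix p a
  show "PA_op (path_mult (sg p a) y) = path_mult (PA_op y) (PA_op (sg p a))"
  proof (rule comb_induct[where x = y and P = "\<lambda>y. PA_op (path_mult (sg p a) y) = path_mult (PA_op y) (PA_op (sg p a))"])
    fix q b
    show "PA_op (path_mult (sg p a) (sg q b)) = path_mult (PA_op (sg q b)) (PA_op (sg p a))"
      by (cases p; cases q) (auto simp: path_mult_paths mult.commute)
  qed (simp_all add: path_mult_add_right path_mult_add_left PA_op_add)
qed (simp_all add: path_mult_add_right path_mult_add_left PA_op_add)

section \<open>The quotient algebra and its cyclic module\<close>

context gpa_dual
begin

abbreviation Id :: "('i, 'k::field) path_comb set" where
  "Id \<equiv> GPA_ideal C \<omega>"

abbreviation Rq :: "('i, 'k::field) gpa ring" where
  "Rq \<equiv> GPA C \<omega>"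

abbreviation rels :: "('i, 'k::field) path_comb set" where
  "rels \<equiv> {rel1 C i k | i k. adj C i k} \<union> range (rel2 C \<omega>)"

abbreviation gc :: "('i, 'k::field) path_comb \<Rightarrow> ('i, 'k) gpa" where
  "gc \<equiv> GPA_class C \<omega>"

lemma rel1_form: "rel1 C i k = sg (i, loops (a i k) i @ [Arr i k], k) 1 - sg (i, Arr i k # loops (a k i) k, k) (1 :: 'k::field)"
  by (simp add: rel1_eq a_def)

lemma rel2_form: "rel2 C \<omega> i = (\<Sum>k | adj C i k. \<Sum>s<a i k.
    sg (i, loops s i @ Arr i k # Arr k i # loops (a i k - 1 - s) i, i) (of_int (\<omega> i k) :: 'k::field))"
proof -
  have "adj C k i \<longleftrightarrow> adj C i k" for k using adj_sym by blast
  then show ?thesis by (simp add: rel2_eq a_def atLeast0LessThan)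
qed

lemma walk_loops' [simp]: "walk C i (loops n i) i"
  using walk_loops[of i n i "[]" i] by simp

lemma rels_carrier: "(rels :: ('i, 'k::field) path_comb set) \<subseteq> carrier (PA C)"
proof -
  have "ks (rel1 C i k :: ('i, 'k) path_comb) \<subseteq> paths C" if "adj C i k" for i k
    unfolding rel1_form diff_conv_add_uminus
    using that by (intro keys_add_paths) (simp_all add: paths_def)
  moreover have "ks (rel2 C \<omega> i :: ('i, 'k) path_comb) \<subseteq> paths C" for i
    unfolding rel2_form
    by (intro keys_sum_paths keys_single_paths) (auto simp: paths_def adj_sym)
  ultimately show ?thesis by auto
qed

lemma Id_ideal: "ideal (Id :: ('i, 'k::field) path_comb set) (PA C)"
  unfolding GPA_ideal_def by (rule ring.genideal_ideal[OF PA_ring rels_carrier])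

lemma Id_rels: "(rels :: ('i, 'k::field) path_comb set) \<subseteq> Id"
  unfolding GPA_ideal_def by (rule ring.genideal_self[OF PA_ring rels_carrier])

lemma Id_minimal: "ideal J (PA C) \<Longrightarrow> rels \<subseteq> J \<Longrightarrow> (Id :: ('i, 'k::field) path_comb set) \<subseteq> J"
  unfolding GPA_ideal_def by (rule ring.genideal_minimal[OF PA_ring])

lemma Id_closed:
  fixes x y :: "('i, 'k::field) path_comb"
  shows "0 \<in> (Id :: ('i, 'k) path_comb set)" "x \<in> Id \<Longrightarrow> y \<in> Id \<Longrightarrow> x + y \<in> Id" "x \<in> Id \<Longrightarrow> - x \<in> Id" "x \<in> Id \<Longrightarrow> ks x \<subseteq> paths C"
    "x \<in> Id \<Longrightarrow> ks z \<subseteq> paths C \<Longrightarrow> path_mult z x \<in> Id" "x \<in> Id \<Longrightarrow> ks z \<subseteq> paths C \<Longrightarrow> path_mult x z \<in> Id"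
proof -
  interpret A: additive_subgroup "Id :: ('i, 'k) path_comb set" "PA C" by (rule ideal.axioms(1)[OF Id_ideal])
  show "0 \<in> (Id :: ('i, 'k) path_comb set)" using A.zero_closed by simp
  show "x + y \<in> Id" if "x \<in> Id" "y \<in> Id" using A.a_closed[OF that] by simp
  show c: "ks x \<subseteq> paths C" if "x \<in> Id" using A.a_Hcarr[OF that] by simp
  show "- x \<in> Id" if "x \<in> Id" using A.a_inv_closed[OF that] PA_a_inv[OF A.a_Hcarr[OF that]] by simp
  show "path_mult z x \<in> Id" if "x \<in> Id" "ks z \<subseteq> paths C" using ideal.I_l_closed[OF Id_ideal, of x z] that by simp
  show "path_mult x z \<in> Id" if "x \<in> Id" "ks z \<subseteq> paths C" using ideal.I_r_closed[OF Id_ideal, of x z] that by simp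
qed

lemma Id_minimalI:
  assumes "\<And>x. x \<in> J \<Longrightarrow> ks x \<subseteq> paths C" "0 \<in> J" "\<And>x y. x \<in> J \<Longrightarrow> y \<in> J \<Longrightarrow> x + y \<in> J" "\<And>x. x \<in> J \<Longrightarrow> - x \<in> J"
    "\<And>x z. x \<in> J \<Longrightarrow> ks z \<subseteq> paths C \<Longrightarrow> path_mult z x \<in> J" "\<And>x z. x \<in> J \<Longrightarrow> ks z \<subseteq> paths C \<Longrightarrow> path_mult x z \<in> J"
    "rels \<subseteq> J"
  shows "(Id :: ('i, 'k::field) path_comb set) \<subseteq> J"
proof (rule Id_minimal[OF _ assms(7)])
  interpret P: ring "PA C :: ('i, 'k) path_comb ring" by (rule PA_ring)
  show "ideal J (PA C)"
  proof (rule idealI)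
    show "subgroup J (add_monoid (PA C))"
    proof (rule P.add.subgroupI)
      show "J \<subseteq> carrier (PA C)" using assms(1) by auto
      show "J \<noteq> {}" using assms(2) by auto
      show "\<ominus>\<^bsub>PA C\<^esub> x \<in> J" if "x \<in> J" for x
        using assms(4)[OF that] assms(1)[OF that] by (simp add: PA_a_inv)
    qed (use assms(3) in simp)
  qed (use assms(5,6) P.ring_axioms in simp_all)
qed

lemma gc_eq_iff:
  assumes "ks x \<subseteq> paths C" "ks y \<subseteq> paths C"
  shows "gc x = gc y \<longleftrightarrow> x - y \<in> (Id :: ('i, 'k::field) path_comb set)"
proof -
  interpret ideal "Id :: ('i, 'k) path_comb set" "PA C" by (rule Id_ideal)
  have mem: "x \<in> Id +>\<^bsub>PA C\<^esub> y \<longleftrightarrow> x - y \<in> Id"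
    using assms by (subst a_rcos_module) (simp_all add: PA_a_inv)
  show ?thesis
    unfolding GPA_class_def
  proof
    assume e: "Id +>\<^bsub>PA C\<^esub> x = Id +>\<^bsub>PA C\<^esub> y"
    have "x \<in> Id +>\<^bsub>PA C\<^esub> x" using assms by (intro a_rcos_self) simp
    then show "x - y \<in> Id" using mem e by simp
  next
    assume "x - y \<in> Id"
    then have "Id +>\<^bsub>PA C\<^esub> y = Id +>\<^bsub>PA C\<^esub> x" using mem assms by (intro a_repr_independence') simp_all
    then show "Id +>\<^bsub>PA C\<^esub> x = Id +>\<^bsub>PA C\<^esub> y" ..
  qed
qed

lemma Rq_ring: "ring (Rq :: ('i, 'k::field) gpa ring)"
  unfolding GPA_def by (rule ideal.quotient_is_ring[OF Id_ideal])

lemma Rq_carrier: "carrier (Rq :: ('i, 'k::field) gpa ring) = gc ` {x. ks x \<subseteq> paths C}"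
  unfolding GPA_def FactRing_def GPA_class_def A_RCOSETS_def' by auto

lemma gc_carrier: "ks x \<subseteq> paths C \<Longrightarrow> gc x \<in> carrier (Rq :: ('i, 'k::field) gpa ring)"
  by (simp add: Rq_carrier)

lemma gc_mult:
  "ks x \<subseteq> paths C \<Longrightarrow> ks y \<subseteq> paths C \<Longrightarrow> gc x \<otimes>\<^bsub>Rq\<^esub> gc y = (gc (path_mult x y) :: ('i, 'k::field) gpa)"
  using ideal.rcoset_mult_add[OF Id_ideal, of x y] unfolding GPA_def FactRing_def GPA_class_def by simp

lemma gc_add:
  assumes "ks x \<subseteq> paths C" "ks y \<subseteq> paths C"
  shows "gc x \<oplus>\<^bsub>Rq\<^esub> gc y = (gc (x + y) :: ('i, 'k::field) gpa)"
proof -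
  interpret ideal "Id :: ('i, 'k) path_comb set" "PA C" by (rule Id_ideal)
  show ?thesis using a_rcos_sum[of x y] assms unfolding GPA_def FactRing_def GPA_class_def by simp
qed

lemma keys_eps: "ks (eps k :: ('i, 'k::field) path_comb) \<subseteq> paths C" and keys_idem: "ks (idem k :: ('i, 'k::field) path_comb) \<subseteq> paths C"
  by (simp_all add: eps_def idem_def paths_def)

abbreviation Lq :: "('i, 'k::field) gpa set" where
  "Lq \<equiv> left_ideal Rq (GPA_eps C \<omega> j)"

lemma Lq_eq: "(Lq :: ('i, 'k::field) gpa set) = {gc (path_mult z (eps j)) | z. ks z \<subseteq> paths C}"
proof -
  have "gc z \<otimes>\<^bsub>Rq\<^esub> gc (eps j) = (gc (path_mult z (eps j)) :: ('i, 'k) gpa)" if "ks z \<subseteq> paths C" for z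
    using that keys_eps by (rule gc_mult)
  then show ?thesis unfolding left_ideal_def Rq_carrier GPA_eps_def by auto
qed

lemma Lq_subgroup: "abelian_subgroup (Lq :: ('i, 'k::field) gpa set) Rq"
proof -
  interpret R: ring "Rq :: ('i, 'k) gpa ring" by (rule Rq_ring)
  have e: "GPA_eps C \<omega> j \<in> carrier (Rq :: ('i, 'k) gpa ring)"
    unfolding GPA_eps_def by (rule gc_carrier[OF keys_eps])
  have "subgroup (Lq :: ('i, 'k) gpa set) (add_monoid Rq)"
  proof (rule R.add.subgroupI)
    show "(Lq :: ('i, 'k) gpa set) \<subseteq> carrier Rq" using e R.m_closed by (auto simp: left_ideal_def)
    show "(Lq :: ('i, 'k) gpa set) \<noteq> {}" using R.zero_closed by (auto simp: left_ideal_def)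
    fix x :: "('i, 'k) gpa" assume "x \<in> Lq"
    then obtain y where y: "y \<in> carrier Rq" "x = y \<otimes>\<^bsub>Rq\<^esub> GPA_eps C \<omega> j" by (auto simp: left_ideal_def)
    then have "\<ominus>\<^bsub>Rq\<^esub> x = (\<ominus>\<^bsub>Rq\<^esub> y) \<otimes>\<^bsub>Rq\<^esub> GPA_eps C \<omega> j" using e by (simp add: R.l_minus)
    then show "\<ominus>\<^bsub>Rq\<^esub> x \<in> Lq" using y(1) by (auto simp: left_ideal_def)
    fix x' :: "('i, 'k) gpa" assume "x' \<in> Lq"
    then obtain y' where y': "y' \<in> carrier Rq" "x' = y' \<otimes>\<^bsub>Rq\<^esub> GPA_eps C \<omega> j" by (auto simp: left_ideal_def)
    then have "x \<oplus>\<^bsub>Rq\<^esub> x' = (y \<oplus>\<^bsub>Rq\<^esub> y') \<otimes>\<^bsub>Rq\<^esub> GPA_eps C \<omega> j" using y e by (simp add: R.l_distr)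
    then show "x \<oplus>\<^bsub>Rq\<^esub> x' \<in> Lq" using y(1) y'(1) by (auto simp: left_ideal_def)
  qed
  then show ?thesis by (intro abelian_subgroupI3 additive_subgroupI R.abelian_group_axioms)
qed

text \<open>Multiplication by e_j is built in, so that every element of the path algebra, whatever
  its sources, names an element of the module.\<close>

definition cls :: "('i, 'k::field) path_comb \<Rightarrow> ('i, 'k) gpa set" where
  "cls x = Lq +>\<^bsub>Rq\<^esub> gc (path_mult x (idem j))"

abbreviation Mq :: "(('i, 'k::field) gpa, ('i, 'k) gpa set) graded_module" where
  "Mq \<equiv> quot_mod Rq (GPA_comp C d \<omega>) (GPA_eps C \<omega> j) (GPA_idem C \<omega> j)"

lemma idem_mult: "ks x \<subseteq> paths C \<Longrightarrow> gc x \<otimes>\<^bsub>Rq\<^esub> GPA_idem C \<omega> j = (gc (path_mult x (idem j)) :: ('i, 'k::field) gpa)"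
  unfolding GPA_idem_def by (rule gc_mult[OF _ keys_idem])

lemma cls_image:
  assumes "A \<subseteq> {x. ks x \<subseteq> paths C}"
  shows "{Lq +>\<^bsub>Rq\<^esub> (X \<otimes>\<^bsub>Rq\<^esub> GPA_idem C \<omega> j) | X. X \<in> gc ` A} = (cls ` A :: ('i, 'k::field) gpa set set)"
proof -
  have "{Lq +>\<^bsub>Rq\<^esub> (X \<otimes>\<^bsub>Rq\<^esub> GPA_idem C \<omega> j) | X. X \<in> gc ` A}
      = (\<lambda>x. Lq +>\<^bsub>Rq\<^esub> (gc x \<otimes>\<^bsub>Rq\<^esub> GPA_idem C \<omega> j) :: ('i, 'k) gpa set) ` A" by auto
  also have "\<dots> = cls ` A"
    by (rule image_cong[OF refl]) (use assms in \<open>auto simp: cls_def idem_mult\<close>)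
  finally show ?thesis .
qed

lemma Mq_carrier: "carrier (Mq :: (('i, 'k::field) gpa, _) graded_module) = cls ` {x. ks x \<subseteq> paths C}"
  unfolding quot_mod_def by (simp add: Rq_carrier cls_image)

lemma Mq_comp: "graded_module.comp (Mq :: (('i, 'k::field) gpa, _) graded_module) u
    = cls ` {x. ks x \<subseteq> paths C \<and> (\<forall>p\<in>ks x. path_deg d p = u)}"
  unfolding quot_mod_def GPA_comp_def PA_comp_def by (simp, rule cls_image) auto

lemma Mq_add:
  assumes "ks x \<subseteq> paths C" "ks y \<subseteq> paths C"
  shows "cls x \<oplus>\<^bsub>Mq\<^esub> cls y = (cls (x + y) :: ('i, 'k::field) gpa set)"
proof -
  interpret abelian_subgroup "Lq :: ('i, 'k) gpa set" Rq by (rule Lq_subgroup)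
  have c: "ks (path_mult x (idem j)) \<subseteq> paths C" "ks (path_mult y (idem j)) \<subseteq> paths C"
    by (rule keys_mult_paths[OF assms(1) keys_idem], rule keys_mult_paths[OF assms(2) keys_idem])
  show ?thesis
    using a_rcos_sum[OF gc_carrier[OF c(1)] gc_carrier[OF c(2)]]
    unfolding quot_mod_def cls_def by (simp add: gc_add[OF c] path_mult_add_left)
qed

text \<open>Unpacks equality in the module on the level of the path algebra, where functionals can
  be evaluated: a multiple of \<epsilon>_j modulo the ideal.\<close>

lemma cls_eqD:
  assumes x: "ks x \<subseteq> paths C" and y: "ks y \<subseteq> paths C" and e: "cls x = (cls y :: ('i, 'k::field) gpa set)"
  shows "\<exists>z. ks z \<subseteq> paths C \<and> path_mult (x - y) (idem j) - path_mult z (eps j) \<in> Id"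
proof -
  interpret abelian_subgroup "Lq :: ('i, 'k) gpa set" Rq by (rule Lq_subgroup)
  have c: "ks (path_mult x (idem j)) \<subseteq> paths C" "ks (path_mult y (idem j)) \<subseteq> paths C"
    by (rule keys_mult_paths[OF x keys_idem], rule keys_mult_paths[OF y keys_idem])
  have "gc (path_mult x (idem j)) \<in> cls y"
    using a_rcos_self[OF gc_carrier[OF c(1)]] e by (simp add: cls_def)
  then obtain l where l: "l \<in> Lq" "gc (path_mult x (idem j)) = l \<oplus>\<^bsub>Rq\<^esub> gc (path_mult y (idem j))"
    unfolding cls_def a_r_coset_def' by auto
  obtain z where z: "ks z \<subseteq> paths C" "l = gc (path_mult z (eps j))" using l(1) unfolding Lq_eq by auto
  have ze: "ks (path_mult z (eps j)) \<subseteq> paths C" by (rule keys_mult_paths[OF z(1) keys_eps])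
  have "gc (path_mult x (idem j)) = gc (path_mult z (eps j) + path_mult y (idem j))"
    using l(2) z(2) gc_add[OF ze c(2)] by simp
  then have "path_mult x (idem j) - (path_mult z (eps j) + path_mult y (idem j)) \<in> Id"
    using gc_eq_iff[OF c(1) keys_add_paths[OF ze c(2)]] by simp
  then show ?thesis using z(1) by (intro exI[of _ z]) (simp add: path_mult_diff_left algebra_simps)
qed

lemma cls_cong:
  assumes x: "ks x \<subseteq> paths C" and y: "ks y \<subseteq> paths C" and "x - y \<in> Id"
  shows "cls x = (cls y :: ('i, 'k::field) gpa set)"
proof -
  have "path_mult x (idem j) - path_mult y (idem j) \<in> Id"
    using Id_closed(6)[OF assms(3) keys_idem] by (simp add: path_mult_diff_left)
  then have "gc (path_mult x (idem j)) = gc (path_mult y (idem j))"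
    using gc_eq_iff[OF keys_mult_paths[OF x keys_idem] keys_mult_paths[OF y keys_idem]] by simp
  then show ?thesis by (simp add: cls_def)
qed

lemma cls_idem: "cls (path_mult x (idem j)) = (cls x :: ('i, 'k::field) gpa set)"
proof -
  have "path_mult (idem j) (idem j) = (idem j :: ('i, 'k) path_comb)" by (simp add: idem_def path_mult_paths)
  then show ?thesis by (simp add: cls_def path_mult_assoc)
qed

lemma cls_eps: "ks z \<subseteq> paths C \<Longrightarrow> cls (path_mult z (eps j)) = (cls 0 :: ('i, 'k::field) gpa set)"
proof -
  assume z: "ks z \<subseteq> paths C"
  interpret abelian_subgroup "Lq :: ('i, 'k) gpa set" Rq by (rule Lq_subgroup)
  have "path_mult (path_mult z (eps j)) (idem j) = path_mult z (eps j)"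
    by (simp add: path_mult_assoc idem_def eps_def path_mult_paths)
  moreover have "gc (path_mult z (eps j)) \<in> Lq" using z by (auto simp: Lq_eq)
  moreover have "gc (path_mult 0 (idem j)) \<in> (Lq :: ('i, 'k) gpa set)"
    unfolding Lq_eq by (rule CollectI, rule exI[of _ 0]) simp
  ultimately show ?thesis unfolding cls_def by (simp add: a_rcos_const)
qed

lemma Mq_smult:
  assumes z: "ks z \<subseteq> paths C" and x: "ks x \<subseteq> paths C"
  shows "gc z \<odot>\<^bsub>Mq\<^esub> cls x = (cls (path_mult z x) :: ('i, 'k::field) gpa set)"
proof -
  interpret abelian_subgroup "Lq :: ('i, 'k) gpa set" Rq by (rule Lq_subgroup)
  have xi: "ks (path_mult x (idem j)) \<subseteq> paths C" by (rule keys_mult_paths[OF x keys_idem])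
  have zxi: "ks (path_mult z (path_mult x (idem j))) \<subseteq> paths C" by (rule keys_mult_paths[OF z xi])
  have same: "Lq +>\<^bsub>Rq\<^esub> (gc z \<otimes>\<^bsub>Rq\<^esub> X) = cls (path_mult z x)" if X: "X \<in> cls x" for X
  proof -
    obtain l where l: "l \<in> Lq" "X = l \<oplus>\<^bsub>Rq\<^esub> gc (path_mult x (idem j))"
      using X unfolding cls_def a_r_coset_def' by auto
    obtain w where w: "ks w \<subseteq> paths C" "l = gc (path_mult w (eps j))" using l(1) unfolding Lq_eq by auto
    have we: "ks (path_mult w (eps j)) \<subseteq> paths C" by (rule keys_mult_paths[OF w(1) keys_eps])
    have zw: "ks (path_mult z w) \<subseteq> paths C" by (rule keys_mult_paths[OF z w(1)])
    have zwe: "ks (path_mult (path_mult z w) (eps j)) \<subseteq> paths C" by (rule keys_mult_paths[OF zw keys_eps])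
    have "gc z \<otimes>\<^bsub>Rq\<^esub> X = gc (path_mult z (path_mult w (eps j) + path_mult x (idem j)))"
      unfolding l(2) w(2) gc_add[OF we xi] by (rule gc_mult[OF z keys_add_paths[OF we xi]])
    also have "\<dots> = gc (path_mult (path_mult z w) (eps j)) \<oplus>\<^bsub>Rq\<^esub> gc (path_mult z (path_mult x (idem j)))"
      unfolding gc_add[OF zwe zxi] by (simp add: path_mult_add_right path_mult_assoc)
    finally have e: "gc z \<otimes>\<^bsub>Rq\<^esub> X = gc (path_mult (path_mult z w) (eps j)) \<oplus>\<^bsub>Rq\<^esub> gc (path_mult z (path_mult x (idem j)))" .
    have "gc (path_mult (path_mult z w) (eps j)) \<in> Lq" using zw by (auto simp: Lq_eq)
    then have "gc z \<otimes>\<^bsub>Rq\<^esub> X \<in> Lq +>\<^bsub>Rq\<^esub> gc (path_mult z (path_mult x (idem j)))"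
      unfolding e a_r_coset_def' by auto
    then have "Lq +>\<^bsub>Rq\<^esub> gc (path_mult z (path_mult x (idem j))) = Lq +>\<^bsub>Rq\<^esub> (gc z \<otimes>\<^bsub>Rq\<^esub> X)"
      by (rule a_repr_independence'[OF _ gc_carrier[OF zxi]])
    then show ?thesis by (simp add: cls_def path_mult_assoc)
  qed
  have "gc (path_mult x (idem j)) \<in> cls x" unfolding cls_def by (rule a_rcos_self[OF gc_carrier[OF xi]])
  then have "(\<Union>X\<in>cls x. Lq +>\<^bsub>Rq\<^esub> (gc z \<otimes>\<^bsub>Rq\<^esub> X)) = cls (path_mult z x)" using same by blast
  then show ?thesis by (simp add: quot_mod_def)
qed

lemma PA_op_paths:
  assumes "ks x \<subseteq> paths C"
  shows "ks (PA_op x :: ('i, 'k::field) path_comb) \<subseteq> paths C"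
proof -
  have "walk C t w s \<Longrightarrow> walk C s (rev (map arrow_op w)) t" for t w s
  proof (induction w arbitrary: t)
    case (Cons x w)
    then have "walk C s (rev (map arrow_op w)) (src x)" by simp
    moreover have "walk C (src x) [arrow_op x] t" using Cons.prems adj_sym by (cases x) auto
    ultimately have "walk C s (rev (map arrow_op w) @ [arrow_op x]) t" by (rule walk_append)
    then show ?case by simp
  qed simp
  then have "path_op p \<in> paths C" if "p \<in> paths C" for p using that by (cases p) (simp add: paths_def)
  then show ?thesis unfolding PA_op_def using assms by (intro keys_sum_paths keys_single_paths) auto
qed

lemma PA_op_rel1: "PA_op (rel1 C i k) = - rel1 C k (i :: 'i) "
  unfolding rel1_form PA_op_diff by simp

text \<open>Reversal sends the term with exponent s to the one with exponent
  \<open>a i k - 1 - s\<close> and keeps its sign, because the middle \<alpha>_ik \<alpha>_ki is its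
  own reversal.\<close>

lemma PA_op_rel2: "PA_op (rel2 C \<omega> i) = (rel2 C \<omega> i :: ('i, 'k::field) path_comb)"
proof -
  have "(\<Sum>s<a i k. PA_op (sg (i, loops s i @ Arr i k # Arr k i # loops (a i k - 1 - s) i, i) (of_int (\<omega> i k) :: 'k)))
     = (\<Sum>s<a i k. sg (i, loops s i @ Arr i k # Arr k i # loops (a i k - 1 - s) i, i) (of_int (\<omega> i k)))" for k
    by (subst sum.nat_diff_reindex[symmetric]) simp
  then show ?thesis unfolding rel2_form PA_op_sum by simp
qed

text \<open>Minimality of the ideal gives one inclusion, and reversal being an involution gives the
  other.\<close>

lemma PA_op_Id: "PA_op ` (Id :: ('i, 'k::field) path_comb set) = Id"
proof -
  have sub: "(Id :: ('i, 'k) path_comb set) \<subseteq> {x. ks x \<subseteq> paths C \<and> PA_op x \<in> Id}"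
  proof (rule Id_minimalI)
    show "(rels :: ('i, 'k) path_comb set) \<subseteq> {x. ks x \<subseteq> paths C \<and> PA_op x \<in> Id}"
    proof
      fix x :: "('i, 'k) path_comb" assume x: "x \<in> rels"
      then have "PA_op x \<in> Id"
      proof
        assume "x \<in> {rel1 C i k | i k. adj C i k}"
        then obtain i k where ik: "x = rel1 C i k" "adj C i k" by auto
        have "rel1 C k i \<in> (Id :: ('i, 'k) path_comb set)" using Id_rels adj_sym[OF ik(2)] by auto
        then show ?thesis unfolding ik(1) PA_op_rel1 by (rule Id_closed(3))
      next
        assume "x \<in> range (rel2 C \<omega>)"
        then show ?thesis using Id_rels by (auto simp: PA_op_rel2)
      qed
      moreover have "x \<in> carrier (PA C)" by (rule subsetD[OF rels_carrier x])
      ultimately show "x \<in> {x. ks x \<subseteq> paths C \<and> PA_op x \<in> Id}" by simp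
    qed
  qed (simp_all add: Id_closed keys_add_paths keys_mult_paths PA_op_add PA_op_neg PA_op_mult PA_op_paths)
  show ?thesis
  proof
    show "PA_op ` Id \<subseteq> (Id :: ('i, 'k) path_comb set)" using sub by auto
    show "(Id :: ('i, 'k) path_comb set) \<subseteq> PA_op ` Id" using sub PA_op_op by (metis (no_types, lifting) image_iff mem_Collect_eq subsetD subsetI)
  qed
qed

lemma GPA_op_idem: "GPA_op (GPA_idem C \<omega> i) = (GPA_idem C \<omega> i :: ('i, 'k::field) gpa)"
proof -
  have c: "(gc x :: ('i, 'k) gpa) = (\<lambda>h. h + x) ` Id" for x unfolding GPA_class_def a_r_coset_def' by auto
  have "GPA_op (GPA_idem C \<omega> i) = (\<lambda>h. PA_op h + idem i) ` (Id :: ('i, 'k) path_comb set)"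
    unfolding GPA_op_def GPA_idem_def c image_image PA_op_add by (simp add: idem_def)
  also have "\<dots> = (\<lambda>h. h + idem i) ` (PA_op ` Id)" by (simp add: image_image)
  finally show ?thesis unfolding PA_op_Id GPA_idem_def c .
qed

end

lemma walk_append_iff: "walk C t (p @ q) s \<longleftrightarrow> (\<exists>m. walk C t p m \<and> walk C m q s)"
  by (induction p arbitrary: t) auto

section \<open>The dual module as functions on words\<close>

context gpa_dual
begin

definition ext :: "'i \<Rightarrow> ('i, 'k::field) wfun \<Rightarrow> 'i path \<Rightarrow> 'k" where
  "ext i w = (\<lambda>(t, p, s). if t = i \<and> s = j then w p else 0)"

text \<open>The linear functional on the path algebra given by w on the paths from j to i and by 0
  on all others.\<close>

definition lamf :: "'i \<Rightarrow> ('i, 'k::field) wfun \<Rightarrow> ('i, 'k) path_comb \<Rightarrow> 'k" where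
  "lamf i w x = (\<Sum>q\<in>ks x. lk x q * ext i w q)"

lemma lamf_superset: "finite A \<Longrightarrow> ks x \<subseteq> A \<Longrightarrow> lamf i w x = (\<Sum>q\<in>A. lk x q * ext i w q)"
  unfolding lamf_def by (rule sum.mono_neutral_left) (auto simp: Poly_Mapping.in_keys_iff)

lemma lamf_add: "lamf i w (x + y) = lamf i w x + lamf i w y"
proof -
  let ?A = "ks x \<union> ks y"
  have "ks (x + y) \<subseteq> ?A" by (rule Poly_Mapping.keys_add)
  then show ?thesis
    using lamf_superset[of ?A "x + y"] lamf_superset[of ?A x] lamf_superset[of ?A y]
    by (simp add: Poly_Mapping.lookup_add distrib_right sum.distrib)
qed

lemma lamf_zero [simp]: "lamf i w 0 = 0"
  by (simp add: lamf_def)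

lemma lamf_single: "lamf i w (sg q c) = c * ext i w q"
  using lamf_superset[of "{q}" "sg q c" i w] by simp

lemma lamf_neg: "lamf i w (- x) = - lamf i w x"
  using lamf_add[of i w x "- x"] by (simp add: eq_neg_iff_add_eq_0 add.commute)

lemma lamf_diff: "lamf i w (x - y) = lamf i w x - lamf i w y"
  unfolding diff_conv_add_uminus lamf_add lamf_neg ..

lemma lamf_sum: "lamf i w (\<Sum>a\<in>A. f a) = (\<Sum>a\<in>A. lamf i w (f a))"
  by (induction A rule: infinite_finite_induct) (simp_all add: lamf_add)

lemma lamf_idem: "lamf i w (path_mult x (idem j)) = lamf i w x"
proof (rule comb_induct[where x = x and P = "\<lambda>x. lamf i w (path_mult x (idem j)) = lamf i w x"])
  fix p c show "lamf i w (path_mult (sg p c) (idem j)) = lamf i w (sg p c)"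
    by (cases p) (simp add: idem_def path_mult_paths lamf_single ext_def)
qed (simp_all add: path_mult_add_left lamf_add)

lemma lamf_idem_left: "lamf i w (path_mult (idem i) x) = lamf i w x"
proof (rule comb_induct[where x = x and P = "\<lambda>x. lamf i w (path_mult (idem i) x) = lamf i w x"])
  fix p c show "lamf i w (path_mult (idem i) (sg p c)) = lamf i w (sg p c)"
    by (cases p) (simp add: idem_def path_mult_paths lamf_single ext_def)
qed (simp_all add: path_mult_add_right lamf_add)

lemma lamf_scale: "lamf i w (path_mult (PA_scalar c) x) = c * lamf i w x"
proof (rule comb_induct[where x = x and P = "\<lambda>x. lamf i w (path_mult (PA_scalar c) x) = c * lamf i w x"])
  fix p b show "lamf i w (path_mult (PA_scalar c) (sg p b)) = c * lamf i w (sg p b)"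
    by (cases p) (simp add: PA_scalar_mult_single lamf_single mult.assoc)
qed (simp_all add: path_mult_add_right lamf_add distrib_left)

lemma lamf_eps:
  assumes "w \<in> Vfull i u"
  shows "lamf i w (path_mult x (eps j)) = 0"
proof (rule comb_induct[where x = x and P = "\<lambda>x. lamf i w (path_mult x (eps j)) = 0"])
  fix p c show "lamf i w (path_mult (sg p c) (eps j)) = 0"
    using assms by (cases p) (simp add: eps_def path_mult_paths lamf_single ext_def Vfull_def end_ok_def)
qed (simp_all add: path_mult_add_left lamf_add)

lemma lamf_rel:
  assumes w: "w \<in> Vfull i u" and r: "r \<in> (rels :: ('i, 'k::field) path_comb set)"
  shows "lamf i w (path_mult (path_mult (sg (t, p, s) b) r) (sg (s', q, t') c)) = 0"
proof -
  have ok: "rel1_ok w" "rel2_ok w" using w by (simp_all add: Vfull_def)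
  from r show ?thesis
  proof
    assume "r \<in> {rel1 C i k | i k. adj C i k}"
    then obtain z k where zk: "r = rel1 C z k" "adj C z k" by auto
    show ?thesis
      using rel1_okD[OF ok(1) zk(2), of p q]
      by (auto simp: zk(1) rel1_form path_mult_diff_left path_mult_diff_right path_mult_paths lamf_diff lamf_single ext_def
          simp flip: right_diff_distrib)
  next
    assume "r \<in> range (rel2 C \<omega>)"
    then obtain z where z: "r = rel2 C \<omega> z" by auto
    show ?thesis
    proof (cases "s = z \<and> s' = z \<and> t = i \<and> t' = j")
      case True
      have "lamf i w (path_mult (path_mult (sg (t, p, s) b) r) (sg (s', q, t') c))
        = (\<Sum>k | adj C z k. \<Sum>l<a z k. b * c * (of_int (\<omega> z k) * w (p @ loops l z @ Arr z k # Arr k z # loops (a z k - 1 - l) z @ q)))"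
        using True by (simp add: z rel2_form path_mult_sum_left path_mult_sum_right path_mult_paths lamf_sum lamf_single ext_def mult_ac)
      also have "\<dots> = b * c * (\<Sum>k | adj C z k. \<Sum>l<a z k. of_int (\<omega> z k) * w (p @ loops l z @ Arr z k # Arr k z # loops (a z k - 1 - l) z @ q))"
        by (simp only: sum_distrib_left)
      finally show ?thesis unfolding rel2_okD[OF ok(2)] by simp
    next
      case False
      then show ?thesis
        by (simp add: z rel2_form path_mult_sum_left path_mult_sum_right path_mult_paths lamf_sum lamf_single ext_def)
          (intro sum.neutral ballI impI; auto simp: path_mult_paths lamf_single ext_def)
    qed
  qed
qed

lemma lamf_Id:
  assumes w: "w \<in> Vfull i u" and x: "x \<in> (Id :: ('i, 'k::field) path_comb set)"
  shows "lamf i w x = 0"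
proof -
  \<comment> \<open>The kernel of the functional is only a subspace; \<open>?J\<close> is the
    largest two-sided ideal inside it, and minimality of \<open>Id\<close> applies to that.\<close>
  let ?J = "{x. ks x \<subseteq> paths C \<and> (\<forall>y z. ks y \<subseteq> paths C \<longrightarrow> ks z \<subseteq> paths C \<longrightarrow> lamf i w (path_mult (path_mult y x) z) = 0)}"
  have "Id \<subseteq> ?J"
  proof (rule Id_minimalI)
    show "rels \<subseteq> ?J"
    proof
      fix r :: "('i, 'k) path_comb" assume r: "r \<in> rels"
      have "lamf i w (path_mult (path_mult y r) z) = 0" for y z
      proof (rule comb_induct[where x = y and P = "\<lambda>y. lamf i w (path_mult (path_mult y r) z) = 0"])
        fix p b
        show "lamf i w (path_mult (path_mult (sg p b) r) z) = 0"
        proof (rule comb_induct[where x = z and P = "\<lambda>z. lamf i w (path_mult (path_mult (sg p b) r) z) = 0"])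
          fix q c show "lamf i w (path_mult (path_mult (sg p b) r) (sg q c)) = 0"
            by (cases p; cases q) (simp only: lamf_rel[OF w r])
        qed (simp_all add: path_mult_add_right lamf_add)
      qed (simp_all add: path_mult_add_left lamf_add)
      moreover have "r \<in> carrier (PA C)" by (rule subsetD[OF rels_carrier r])
      ultimately show "r \<in> ?J" by simp
    qed
    fix x z :: "('i, 'k) path_comb" assume x: "x \<in> ?J" and z: "ks z \<subseteq> paths C"
    have "path_mult (path_mult y (path_mult z x)) y' = path_mult (path_mult (path_mult y z) x) y'" for y y'
      by (simp only: path_mult_assoc)
    then show "path_mult z x \<in> ?J" using x z by (simp add: keys_mult_paths)
    have "path_mult (path_mult y (path_mult x z)) y' = path_mult (path_mult y x) (path_mult z y')" for y y'
      by (simp only: path_mult_assoc)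
    then show "path_mult x z \<in> ?J" using x z by (simp add: keys_mult_paths)
  qed (auto simp: keys_add_paths path_mult_add_left path_mult_add_right path_mult_neg_left path_mult_neg_right lamf_add lamf_neg)
  then have "\<forall>y z. ks y \<subseteq> paths C \<longrightarrow> ks z \<subseteq> paths C \<longrightarrow> lamf i w (path_mult (path_mult y x) z) = 0" using x by auto
  from this[rule_format, of "PA_scalar 1" "PA_scalar 1"] show ?thesis by (simp add: keys_scalar_paths PA_scalar_one)
qed

definition rep :: "('i, 'k::field) gpa set \<Rightarrow> ('i, 'k) path_comb" where
  "rep m = (SOME x. ks x \<subseteq> paths C \<and> cls x = m)"

lemma rep_cls: "ks x \<subseteq> paths C \<Longrightarrow> ks (rep (cls x)) \<subseteq> paths C \<and> cls (rep (cls x)) = cls x"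
  unfolding rep_def by (rule someI[of _ x]) simp

text \<open>The induced functional on the module, through chosen representatives;
  \<open>G_cls\<close> shows independence of the choice for w in \<open>Vfull\<close>.\<close>

definition G :: "'i \<Rightarrow> ('i, 'k::field) wfun \<Rightarrow> ('i, 'k) gpa set \<Rightarrow> 'k" where
  "G i w = (\<lambda>m. if m \<in> carrier Mq then lamf i w (rep m) else 0)"

lemma cls_in: "ks x \<subseteq> paths C \<Longrightarrow> cls x \<in> carrier (Mq :: (('i, 'k::field) gpa, _) graded_module)"
  by (simp add: Mq_carrier)

lemma G_cls:
  assumes w: "w \<in> Vfull i u" and x: "ks x \<subseteq> paths C"
  shows "G i w (cls x) = (lamf i w x :: 'k::field)"
proof -
  have r: "ks (rep (cls x)) \<subseteq> paths C" "cls (rep (cls x)) = cls x" using rep_cls[OF x] by simp_all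
  from cls_eqD[OF r(1) x r(2)] obtain z where z: "ks z \<subseteq> paths C"
    "path_mult (rep (cls x) - x) (idem j) - path_mult z (eps j) \<in> Id" by (elim exE conjE)
  have "lamf i w (rep (cls x)) - lamf i w x = lamf i w (path_mult (rep (cls x) - x) (idem j) - path_mult z (eps j))"
    by (simp add: lamf_diff lamf_eps[OF w] lamf_idem)
  also have "\<dots> = 0" by (rule lamf_Id[OF w z(2)])
  finally show ?thesis using cls_in[OF x] by (simp add: G_def)
qed

lemma linear_G: "Vector_Spaces.linear (\<lambda>c \<phi> x. c * \<phi> x) (\<lambda>c \<phi> x. c * \<phi> x) (G i :: ('i, 'k::field) wfun \<Rightarrow> _)"
proof (rule fs_linearI)
  have add: "lamf i (w + w') x = lamf i w x + lamf i w' x" for w w' :: "('i, 'k) wfun" and x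
  proof -
    have "ext i (w + w') q = ext i w q + ext i w' q" for q by (simp add: ext_def split: prod.split)
    then show ?thesis by (simp add: lamf_def distrib_left sum.distrib)
  qed
  have scale: "lamf i (\<lambda>p. c * w p) x = c * lamf i w x" for w :: "('i, 'k) wfun" and x c
  proof -
    have "ext i (\<lambda>p. c * w p) q = c * ext i w q" for q by (simp add: ext_def split: prod.split)
    then show ?thesis by (simp add: lamf_def sum_distrib_left mult_ac)
  qed
  show "G i (w + w') = G i w + G i w'" for w w' :: "('i, 'k) wfun" by (rule ext) (simp add: G_def add)
  show "G i (\<lambda>p. c * w p) = (\<lambda>p. c * G i w p)" for w :: "('i, 'k) wfun" and c by (rule ext) (simp add: G_def scale)
qed

lemma single_path: "walk C i p j \<Longrightarrow> ks (sg (i, p, j) (c :: 'k::field)) \<subseteq> paths C"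
  by (rule keys_single_paths) (simp add: paths_def)

lemma G_inj:
  assumes w: "w \<in> Vfull i u" and 0: "G i w = (0 :: ('i, 'k::field) gpa set \<Rightarrow> 'k)"
  shows "w = 0"
proof
  fix p
  show "w p = 0 p"
  proof (cases "walk C i p j")
    case True
    have "w p = G i w (cls (sg (i, p, j) 1))" unfolding G_cls[OF w single_path[OF True]] by (simp add: lamf_single ext_def)
    then show ?thesis using 0 by simp
  next
    case False
    then show ?thesis using w by (auto simp: Vfull_def supp_ok_def)
  qed
qed

definition Dq :: "(('i, 'k::field) gpa set \<Rightarrow> 'k) set" where
  "Dq = {\<phi>. (\<forall>m. m \<notin> carrier Mq \<longrightarrow> \<phi> m = 0) \<and>
       (\<forall>m\<in>carrier Mq. \<forall>n\<in>carrier Mq. \<phi> (m \<oplus>\<^bsub>Mq\<^esub> n) = \<phi> m + \<phi> n) \<and>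
       (\<forall>c. \<forall>m\<in>carrier Mq. \<phi> (gc (PA_scalar c) \<odot>\<^bsub>Mq\<^esub> m) = c * \<phi> m) \<and>
       finite {u. \<exists>m\<in>graded_module.comp Mq u. \<phi> m \<noteq> 0}}"

lemma Ibar_comp: "graded_module.comp (Ibar C d \<omega> j) u = {\<phi> \<in> (Dq :: (('i, 'k::field) gpa set \<Rightarrow> 'k) set). \<forall>v. v \<noteq> - u \<longrightarrow> (\<forall>m\<in>graded_module.comp Mq v. \<phi> m = 0)}"
  by (simp add: Ibar_def restricted_dual_def Dq_def Let_def)

lemma Ibar_smult: "r \<odot>\<^bsub>Ibar C d \<omega> j\<^esub> \<phi> = (\<lambda>m. if m \<in> carrier Mq then \<phi> (GPA_op r \<odot>\<^bsub>Mq\<^esub> m) else (0 :: 'k::field))"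
  by (simp add: Ibar_def restricted_dual_def Let_def)

lemma G_act:
  assumes w: "w \<in> Vfull i u"
  shows "GPA_idem C \<omega> i \<odot>\<^bsub>Ibar C d \<omega> j\<^esub> (G i w :: _ \<Rightarrow> 'k::field) = G i w"
proof
  fix m
  show "(GPA_idem C \<omega> i \<odot>\<^bsub>Ibar C d \<omega> j\<^esub> G i w) m = G i w m"
  proof (cases "m \<in> carrier (Mq :: (('i, 'k) gpa, _) graded_module)")
    case True
    then obtain x where x: "ks x \<subseteq> paths C" "m = cls x" by (auto simp: Mq_carrier)
    have "G i w (gc (idem i) \<odot>\<^bsub>Mq\<^esub> cls x) = G i w (cls x)"
      unfolding Mq_smult[OF keys_idem x(1)] G_cls[OF w x(1)] G_cls[OF w keys_mult_paths[OF keys_idem x(1)]]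
      by (rule lamf_idem_left)
    then show ?thesis using True unfolding Ibar_smult GPA_op_idem x(2) by (simp add: GPA_idem_def)
  next
    case False
    then show ?thesis by (simp add: Ibar_smult G_def)
  qed
qed

lemma G_comp:
  assumes w: "w \<in> Vfull i u"
  shows "(G i w :: _ \<Rightarrow> 'k::field) \<in> graded_module.comp (Ibar C d \<omega> j) u"
proof -
  have deg: "G i w m = 0" if v: "v \<noteq> - u" and m: "m \<in> graded_module.comp Mq v" for v m
  proof -
    obtain x where x: "m = cls x" "ks x \<subseteq> paths C" "\<forall>p\<in>ks x. path_deg d p = v" using m unfolding Mq_comp by auto
    have "ext i w q = 0" if "q \<in> ks x" for q
    proof -
      obtain t p s where q: "q = (t, p, s)" by (cases q)
      have "wdeg p = v" using x(3) that by (auto simp: q wdeg_def)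
      then have "w p = 0" using w v by (auto simp: Vfull_def supp_ok_def)
      then show ?thesis by (simp add: q ext_def)
    qed
    then show ?thesis unfolding x(1) G_cls[OF w x(2)] lamf_def by (intro sum.neutral ballI) simp
  qed
  have "finite {v. \<exists>m\<in>graded_module.comp Mq v. G i w m \<noteq> (0 :: 'k)}"
    by (rule finite_subset[of _ "{- u}"]) (use deg in auto)
  moreover have "G i w (m \<oplus>\<^bsub>Mq\<^esub> n) = G i w m + G i w n" if mn: "m \<in> carrier Mq" "n \<in> carrier Mq" for m n
  proof -
    obtain x y where xy: "ks x \<subseteq> paths C" "m = cls x" "ks y \<subseteq> paths C" "n = cls y" using mn by (auto simp: Mq_carrier)
    show ?thesis unfolding xy(2,4) Mq_add[OF xy(1,3)] G_cls[OF w xy(1)] G_cls[OF w xy(3)]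
      G_cls[OF w keys_add_paths[OF xy(1,3)]] by (rule lamf_add)
  qed
  moreover have "G i w (gc (PA_scalar c) \<odot>\<^bsub>Mq\<^esub> m) = c * G i w m" if m: "m \<in> carrier Mq" for c m
  proof -
    obtain x where x: "ks x \<subseteq> paths C" "m = cls x" using m by (auto simp: Mq_carrier)
    show ?thesis unfolding x(2) Mq_smult[OF keys_scalar_paths x(1)] G_cls[OF w x(1)]
      G_cls[OF w keys_mult_paths[OF keys_scalar_paths x(1)]] by (rule lamf_scale)
  qed
  moreover have "G i w m = 0" if "m \<notin> carrier Mq" for m using that by (simp add: G_def)
  ultimately have "G i w \<in> Dq" unfolding Dq_def by blast
  then show ?thesis unfolding Ibar_comp using deg by blast
qed

lemma G_onto:
  assumes \<phi>: "\<phi> \<in> graded_module.comp (Ibar C d \<omega> j) u"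
  shows "\<exists>w\<in>Vfull i u. G i w = GPA_idem C \<omega> i \<odot>\<^bsub>Ibar C d \<omega> j\<^esub> (\<phi> :: _ \<Rightarrow> 'k::field)"
proof -
  define F where "F x = \<phi> (cls x)" for x
  have D: "\<phi> \<in> Dq" and deg: "\<And>v m. v \<noteq> - u \<Longrightarrow> m \<in> graded_module.comp Mq v \<Longrightarrow> \<phi> m = 0"
    using \<phi> unfolding Ibar_comp by simp_all
  have Fadd: "F (x + y) = F x + F y" if "ks x \<subseteq> paths C" "ks y \<subseteq> paths C" for x y
  proof -
    have "\<phi> (cls x \<oplus>\<^bsub>Mq\<^esub> cls y) = \<phi> (cls x) + \<phi> (cls y)" using D cls_in[OF that(1)] cls_in[OF that(2)] unfolding Dq_def by simp
    then show ?thesis unfolding F_def Mq_add[OF that] .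
  qed
  have F0: "F 0 = 0"
  proof -
    have "F (0 + 0) = F 0 + F 0" by (rule Fadd) simp_all
    then have "F 0 + 0 = F 0 + F 0" by (simp only: add_0_right)
    then show ?thesis by (rule add_left_imp_eq[symmetric])
  qed
  have Fneg: "F (- x) = - F x" if "ks x \<subseteq> paths C" for x
    using Fadd[OF that, of "- x"] that F0 by (simp add: eq_neg_iff_add_eq_0 add.commute)
  have Fdiff: "F (x - y) = F x - F y" if "ks x \<subseteq> paths C" "ks y \<subseteq> paths C" for x y
    unfolding diff_conv_add_uminus using Fadd[OF that(1), of "- y"] Fneg[OF that(2)] that by simp
  have Fsum: "ks (\<Sum>b\<in>A. f b) \<subseteq> paths C \<and> F (\<Sum>b\<in>A. f b) = (\<Sum>b\<in>A. F (f b))"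
    if "\<And>b. b \<in> A \<Longrightarrow> ks (f b) \<subseteq> paths C" for A :: "'z set" and f
    using that
  proof (induction A rule: infinite_finite_induct)
    case (insert b A)
    then show ?case by (simp add: Fadd keys_add_paths)
  qed (simp_all add: F0)
  have Fscale: "F (sg p c) = c * F (sg p 1)" if "p \<in> paths C" for p c
  proof -
    have x: "ks (sg p (1 :: 'k)) \<subseteq> paths C" using that by simp
    have "\<phi> (gc (PA_scalar c) \<odot>\<^bsub>Mq\<^esub> cls (sg p 1)) = c * \<phi> (cls (sg p 1))" using D cls_in[OF x] unfolding Dq_def by simp
    moreover have "path_mult (PA_scalar c) (sg p 1) = sg p c" by (cases p) (simp add: PA_scalar_mult_single)
    ultimately show ?thesis unfolding Mq_smult[OF keys_scalar_paths x] F_def by simp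
  qed
  have FId: "F x = 0" if "x \<in> Id" for x
  proof -
    have "cls x = cls 0" using that by (intro cls_cong) (simp_all add: Id_closed(4))
    then show ?thesis using F0 by (simp add: F_def)
  qed
  \<comment> \<open>The value on a walk is that of the functional on the class of the path; the
    relations hold for w because they are 0 in the module.\<close>
  define w where "w p = (if walk C i p j then F (sg (i, p, j) 1) else 0)" for p
  have F_Id3: "F (path_mult (path_mult (sg (i, p, z) 1) r) (sg (z', q, j) 1)) = 0"
    if "walk C i p z" "walk C z' q j" "r \<in> rels" for p z z' q r
  proof (rule FId, rule Id_closed(6), rule Id_closed(5))
    show "r \<in> Id" by (rule subsetD[OF Id_rels that(3)])
  qed (use that in \<open>simp_all add: paths_def\<close>)
  have "rel1_ok w" unfolding rel1_ok_def
  proof (intro allI impI)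
    fix z k p q assume k: "adj C z k"
    show "w (p @ loops (a z k) z @ Arr z k # q) = w (p @ Arr z k # loops (a k z) k @ q)"
    proof (cases "walk C i p z \<and> walk C k q j")
      case True
      have "F (sg (i, p @ loops (a z k) z @ Arr z k # q, j) 1 - sg (i, p @ Arr z k # loops (a k z) k @ q, j) 1) = 0"
        using F_Id3[of p z k q "rel1 C z k"] True k
        by (simp add: rel1_form path_mult_diff_left path_mult_diff_right path_mult_paths) blast
      moreover have "walk C i (p @ loops (a z k) z @ Arr z k # q) j" "walk C i (p @ Arr z k # loops (a k z) k @ q) j"
        using True k by (auto simp: walk_append_iff[of C i p])
      ultimately show ?thesis using Fdiff[OF single_path single_path] by (simp add: w_def)
    next
      case False
      then have "\<not> walk C i (p @ loops (a z k) z @ Arr z k # q) j" "\<not> walk C i (p @ Arr z k # loops (a k z) k @ q) j" using k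
        by (auto simp: walk_append_iff[of C i p] split: if_splits)
      then show ?thesis by (simp add: w_def)
    qed
  qed
  moreover have "rel2_ok w" unfolding rel2_ok_def
  proof (intro allI)
    fix z p q
    let ?t = "\<lambda>k s. p @ loops s z @ Arr z k # Arr k z # loops (a z k - 1 - s) z @ q"
    show "(\<Sum>k | adj C z k. \<Sum>s<a z k. of_int (\<omega> z k) * w (?t k s)) = 0"
    proof (cases "walk C i p z \<and> walk C z q j")
      case True
      have wk: "walk C i (?t k s) j" if "adj C z k" for k s
        using True that adj_sym[OF that] by (auto simp: walk_append_iff[of C i p])
      have pt: "ks (sg (i, ?t k s, j) (c :: 'k)) \<subseteq> paths C" if "adj C z k" for k s c by (rule single_path[OF wk[OF that]])
      have "path_mult (path_mult (sg (i, p, z) 1) (rel2 C \<omega> z)) (sg (z, q, j) 1)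
          = (\<Sum>k | adj C z k. \<Sum>s<a z k. sg (i, ?t k s, j) (of_int (\<omega> z k) :: 'k))"
        by (simp add: rel2_form path_mult_sum_left path_mult_sum_right path_mult_paths)
      then have "F (\<Sum>k | adj C z k. \<Sum>s<a z k. sg (i, ?t k s, j) (of_int (\<omega> z k))) = 0"
        using F_Id3[of p z z q "rel2 C \<omega> z"] True by simp
      moreover have "F (\<Sum>k | adj C z k. \<Sum>s<a z k. sg (i, ?t k s, j) (of_int (\<omega> z k)))
          = (\<Sum>k | adj C z k. F (\<Sum>s<a z k. sg (i, ?t k s, j) (of_int (\<omega> z k))))"
        by (rule conjunct2[OF Fsum], rule conjunct1[OF Fsum], rule pt) simp
      moreover have "F (\<Sum>s<a z k. sg (i, ?t k s, j) (of_int (\<omega> z k))) = (\<Sum>s<a z k. of_int (\<omega> z k) * w (?t k s))"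
        if "adj C z k" for k
      proof -
        have "F (\<Sum>s<a z k. sg (i, ?t k s, j) (of_int (\<omega> z k))) = (\<Sum>s<a z k. F (sg (i, ?t k s, j) (of_int (\<omega> z k))))"
          by (rule conjunct2[OF Fsum], rule pt[OF that])
        also have "\<dots> = (\<Sum>s<a z k. of_int (\<omega> z k) * w (?t k s))"
          by (rule sum.cong[OF refl], subst Fscale) (use wk[OF that] in \<open>simp_all add: paths_def w_def\<close>)
        finally show ?thesis .
      qed
      ultimately show ?thesis by simp
    next
      case False
      then have "\<not> walk C i (?t k s) j" for k s by (auto simp: walk_append_iff[of C i p] split: if_splits)
      then show ?thesis by (simp add: w_def)
    qed
  qed
  moreover have "end_ok w" unfolding end_ok_def
  proof
    fix p
    have "F (sg (i, p @ [Loop j], j) 1) = 0" if "walk C i p j"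
    proof -
      have "sg (i, p @ [Loop j], j) 1 = path_mult (sg (i, p, j) 1) (eps j :: ('i, 'k) path_comb)"
        by (simp add: eps_def path_mult_paths)
      moreover have "cls (path_mult (sg (i, p, j) 1) (eps j)) = (cls 0 :: ('i, 'k) gpa set)"
        by (rule cls_eps[OF single_path[OF that]])
      ultimately show ?thesis using F0 by (simp add: F_def)
    qed
    then show "w (p @ [Loop j]) = 0" by (auto simp: w_def walk_append_iff)
  qed
  moreover have "supp_ok i u w" unfolding supp_ok_def
  proof (intro allI impI)
    fix p assume "w p \<noteq> 0"
    then have p: "walk C i p j" "F (sg (i, p, j) 1) \<noteq> 0" by (auto simp: w_def split: if_splits)
    have "cls (sg (i, p, j) 1) \<in> graded_module.comp (Mq :: (('i, 'k) gpa, _) graded_module) (wdeg p)"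
      unfolding Mq_comp using p(1) by (intro imageI) (simp add: paths_def wdeg_def)
    then have "wdeg p = - u" using deg[of "wdeg p"] p(2) by (auto simp: F_def)
    then show "walk C i p j \<and> wdeg p = - u" using p(1) by simp
  qed
  ultimately have wV: "w \<in> Vfull i u" by (simp add: Vfull_def)
  \<comment> \<open>Left multiplication by e_i discards paths with other targets, and paths with a
    source other than j have class 0.\<close>
  have FG: "lamf i w x = F (path_mult (idem i) x)" if "ks x \<subseteq> paths C" for x
  proof -
    have "ks x \<subseteq> paths C \<and> lamf i w x = F (path_mult (idem i) x)"
    proof (rule comb_induct[where x = x and P = "\<lambda>x. ks x \<subseteq> paths C \<and> lamf i w x = F (path_mult (idem i) x)"])
      fix q c assume "q \<in> ks x"
      then have q: "q \<in> paths C" using that by blast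
      obtain t p s where tps: "q = (t, p, s)" by (cases q)
      have "lamf i w (sg q c) = F (path_mult (idem i) (sg q c))"
      proof (cases "t = i")
        case True
        show ?thesis
        proof (cases "s = j")
          case s: True
          have "F (sg q c) = c * w p" using Fscale[OF q, of c] q True s by (simp add: tps w_def paths_def)
          then show ?thesis using True s by (simp add: tps lamf_single ext_def idem_def path_mult_paths)
        next
          case False
          have "cls (sg q c) = cls (path_mult (sg q c) (idem j))" by (rule cls_idem[symmetric])
          also have "path_mult (sg q c) (idem j) = 0" using False by (simp add: tps idem_def path_mult_paths)
          finally have "F (sg q c) = 0" using F0 by (simp add: F_def)
          then show ?thesis using True False by (simp add: tps lamf_single ext_def idem_def path_mult_paths)
        qed
      next
        case False
        then show ?thesis by (simp add: tps lamf_single ext_def idem_def path_mult_paths F0)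
      qed
      then show "ks (sg q c) \<subseteq> paths C \<and> lamf i w (sg q c) = F (path_mult (idem i) (sg q c))" using q by simp
    next
      fix x y assume xy: "ks x \<subseteq> paths C \<and> lamf i w x = F (path_mult (idem i) x)" "ks y \<subseteq> paths C \<and> lamf i w y = F (path_mult (idem i) y)"
      have "F (path_mult (idem i) (x + y)) = F (path_mult (idem i) x) + F (path_mult (idem i) y)"
        unfolding path_mult_add_right
        by (rule Fadd[OF keys_mult_paths[OF keys_idem] keys_mult_paths[OF keys_idem]]) (use xy in simp_all)
      then show "ks (x + y) \<subseteq> paths C \<and> lamf i w (x + y) = F (path_mult (idem i) (x + y))"
        using xy by (simp add: lamf_add keys_add_paths)
    qed (simp add: F0)
    then show ?thesis by simp
  qed
  have "G i w = GPA_idem C \<omega> i \<odot>\<^bsub>Ibar C d \<omega> j\<^esub> \<phi>"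
  proof
    fix m
    show "G i w m = (GPA_idem C \<omega> i \<odot>\<^bsub>Ibar C d \<omega> j\<^esub> \<phi>) m"
    proof (cases "m \<in> carrier (Mq :: (('i, 'k) gpa, _) graded_module)")
      case True
      then obtain x where x: "ks x \<subseteq> paths C" "m = cls x" by (auto simp: Mq_carrier)
      have "G i w m = \<phi> (gc (idem i) \<odot>\<^bsub>Mq\<^esub> m)"
        unfolding x(2) Mq_smult[OF keys_idem x(1)] G_cls[OF wV x(1)] FG[OF x(1)] F_def ..
      then show ?thesis using True unfolding Ibar_smult GPA_op_idem by (simp add: GPA_idem_def)
    next
      case False
      then show ?thesis by (simp add: Ibar_smult G_def)
    qed
  qed
  then show ?thesis using wV by (rule bexI)
qed

lemma act_image_eq: "act_image (GPA_idem C \<omega> i) (Ibar C d \<omega> j) u = G i ` (Vfull i u :: ('i, 'k::field) wfun set)"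
proof
  show "act_image (GPA_idem C \<omega> i) (Ibar C d \<omega> j) u \<subseteq> G i ` (Vfull i u :: ('i, 'k) wfun set)"
  proof
    fix x assume "x \<in> (act_image (GPA_idem C \<omega> i) (Ibar C d \<omega> j) u :: (('i, 'k) gpa set \<Rightarrow> 'k) set)"
    then obtain \<phi> where \<phi>: "\<phi> \<in> graded_module.comp (Ibar C d \<omega> j) u" "x = GPA_idem C \<omega> i \<odot>\<^bsub>Ibar C d \<omega> j\<^esub> \<phi>"
      unfolding act_image_def by (elim imageE)
    from G_onto[OF \<phi>(1), of i] obtain w where "w \<in> Vfull i u" "G i w = x" unfolding \<phi>(2) by (elim bexE)
    then show "x \<in> G i ` (Vfull i u :: ('i, 'k) wfun set)" by (intro image_eqI[of _ _ w]) simp_all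
  qed
  show "G i ` (Vfull i u :: ('i, 'k) wfun set) \<subseteq> act_image (GPA_idem C \<omega> i) (Ibar C d \<omega> j) u"
  proof
    fix x assume "x \<in> G i ` (Vfull i u :: ('i, 'k) wfun set)"
    then obtain w where w: "w \<in> Vfull i u" "x = G i w" by auto
    show "x \<in> act_image (GPA_idem C \<omega> i) (Ibar C d \<omega> j) u"
      unfolding act_image_def w(2) by (rule image_eqI[where x = "G i w"]) (simp_all only: G_act[OF w(1)] G_comp[OF w(1)])
  qed
qed

lemma dim_act_image:
  "int (fs.dim (act_image (GPA_idem C \<omega> i) (Ibar C d \<omega> j) u :: (('i, 'k::field) gpa set \<Rightarrow> 'k) set))
    = gd (V i :: int \<Rightarrow> ('i, 'k) wfun set) u"
  unfolding act_image_eq gd_def Vfull_eq_V[symmetric]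
  by (subst fsp.dim_inj_image[OF linear_G Vfull_subspace]) (use G_inj in auto)

end

section \<open>The quantum Cartan matrix\<close>

lemma fls_powi_mult_nth: "fls_nth (fls_X powi n * f) v = fls_nth (f :: rat fls) (v - n)"
  by (simp add: fls_X_intpow_times_conv_shift)

lemma fls_power_mult_nth: "fls_nth (fls_X ^ n * f) v = fls_nth (f :: rat fls) (v - int n)"
  using fls_powi_mult_nth[of "int n" f v] by (simp only: power_int_of_nat)

text \<open>The expansion [n] = q^(n-1) + q^(n-3) + ... + q^(1-n), obtained by telescoping against q
  - q^-1.\<close>

lemma qint_neg: "qint (- int n) = - (\<Sum>s<n. fls_X powi (int n - 1 - 2 * int s))"
proof -
  let ?X = "fls_X :: rat fls"
  have nz: "?X - inverse ?X \<noteq> 0"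
  proof
    assume "?X - inverse ?X = 0"
    then have "fls_nth (?X - inverse ?X) 1 = 0" by simp
    then show False by (simp add: fls_inverse_X)
  qed
  have "(\<Sum>s<n. ?X powi (m - 1 - 2 * int s)) * (?X - inverse ?X) = ?X powi m - ?X powi (m - 2 * int n)" for m
  proof (induction n)
    case (Suc n)
    have "?X powi (m - 1 - 2 * int n) * (?X - inverse ?X) = ?X powi (m - 2 * int n) - ?X powi (m - 2 * int (Suc n))"
    proof -
      have "?X powi (m - 1 - 2 * int n) * ?X = ?X powi (m - 2 * int n)"
        using power_int_add_1[of ?X "m - 1 - 2 * int n"] by (simp add: algebra_simps del: fls_X_power_int)
      moreover have "?X powi (m - 1 - 2 * int n) * inverse ?X = ?X powi (m - 2 * int (Suc n))"
        using power_int_diff[of ?X "m - 1 - 2 * int n" 1] by (simp add: algebra_simps divide_inverse del: fls_X_power_int)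
      ultimately show ?thesis by (simp add: right_diff_distrib)
    qed
    then show ?case using Suc by (simp add: distrib_right del: fls_X_power_int)
  qed simp
  from this[of "int n"] nz show ?thesis
    unfolding qint_def by (simp add: divide_eq_eq algebra_simps del: fls_X_power_int)
qed

context gpa_dual
begin

text \<open>The coefficients of X: the shift by \<open>d j\<close> is the factor q^(d_j), and the
  \<open>itself\<close> argument fixes the field.\<close>

abbreviation vdim :: "'k::field itself \<Rightarrow> 'i \<Rightarrow> int \<Rightarrow> int" where
  "vdim _ k v \<equiv> gd (V k :: int \<Rightarrow> ('i, 'k) wfun set) (v - d j)"

lemma vdim_bounds: "vdim TYPE('k::field) i v \<noteq> 0 \<Longrightarrow> d i \<le> v \<and> v \<le> rh - d i"
  using degree_bounds[of i "v - d j", where 'k = 'k] by simp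

text \<open>With a = \<open>a i k\<close> one has d_i + sh = d_i (1 + 2 s - a). Either d_i = 1, or a
  = 1 and the factor 1 + 2 s - a is 0.\<close>

lemma sh_sum:
  assumes k: "adj C i k"
  shows "(\<Sum>s<a i k. f (d i + sh i (k, s))) = (\<Sum>s<a i k. f (- (int (a i k) - 1 - 2 * int s)) :: int)"
proof -
  have "d i + sh i (k, s) = - (int (a i k) - 1 - 2 * int s)" if s: "s < a i k" for s
  proof -
    have e: "d i + sh i (k, s) = d i * (1 + 2 * int s - int (a i k))" unfolding sh_def by (simp add: d_a[OF k, symmetric] algebra_simps)
    have "a i k = 1 \<or> d i = 1" using k int_a[OF k] by (cases rule: adj_cases[OF k]) auto
    then show ?thesis unfolding e using s by auto
  qed
  then show ?thesis by (intro sum.cong) simp_all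
qed

lemma vdim_formula:
  "vdim TYPE('k::field) i (v + d i) + vdim TYPE('k) i (v - d i)
     - (\<Sum>k | adj C i k. \<Sum>s<a i k. vdim TYPE('k) k (v - (int (a i k) - 1 - 2 * int s)))
   = (if i = j \<and> v = 0 then 1 else 0) + (if i = star C j \<and> v = rh then 1 else 0)"
proof -
  have "(\<Sum>k | adj C i k. \<Sum>s<a i k. vdim TYPE('k) k (v - (int (a i k) - 1 - 2 * int s)))
      = (\<Sum>k | adj C i k. \<Sum>s<a i k. gd (V k :: int \<Rightarrow> ('i, 'k) wfun set) (v + d i - d j + sh i (k, s)))"
  proof (rule sum.cong[OF refl])
    fix k assume "k \<in> {k. adj C i k}"
    then show "(\<Sum>s<a i k. vdim TYPE('k) k (v - (int (a i k) - 1 - 2 * int s)))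
        = (\<Sum>s<a i k. gd (V k :: int \<Rightarrow> ('i, 'k) wfun set) (v + d i - d j + sh i (k, s)))"
      using sh_sum[of i k "\<lambda>t. vdim TYPE('k) k (v + t)"] by (simp add: algebra_simps)
  qed
  also have "\<dots> = (\<Sum>x\<in>idx i. gd (V (fst x) :: int \<Rightarrow> ('i, 'k) wfun set) (v + d i - d j + sh i x))"
    by (simp add: sum_idx)
  finally have s: "(\<Sum>k | adj C i k. \<Sum>s<a i k. vdim TYPE('k) k (v - (int (a i k) - 1 - 2 * int s))) = \<dots>" .
  have "i = j \<and> v + d i - d j = 0 \<longleftrightarrow> i = j \<and> v = 0" by auto
  moreover have "i = star C j \<and> v + d i - d j = rh \<longleftrightarrow> i = star C j \<and> v = rh" using d_star[of j] by auto
  ultimately show ?thesis using degree_formula[of i "v + d i - d j", where 'k = 'k] unfolding s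
    by (simp add: algebra_simps)
qed

lemma dim_q_nth:
  "fls_nth (dim_q (act_image (GPA_idem C \<omega> i :: ('i, 'k::field) gpa) (Ibar C d \<omega> j))) u
    = of_int (gd (V i :: int \<Rightarrow> ('i, 'k) wfun set) u)"
proof -
  have e: "(of_nat (fs.dim (act_image (GPA_idem C \<omega> i) (Ibar C d \<omega> j) u :: (('i, 'k) gpa set \<Rightarrow> 'k) set)) :: rat)
      = of_int (gd (V i :: int \<Rightarrow> ('i, 'k) wfun set) u)" for u
    unfolding dim_act_image[symmetric] by simp
  have "gd (V i :: int \<Rightarrow> ('i, 'k) wfun set) u = 0" if "u < - d j" for u
    using degree_bounds(1)[of i u, where 'k = 'k] that d_pos[of i] by (cases "gd (V i :: int \<Rightarrow> ('i, 'k) wfun set) u = 0") simp_all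
  then show ?thesis unfolding dim_q_def e by (intro nth_Abs_fls_ex_lower_bound exI[of _ "- d j"]) simp
qed

end

section \<open>Inverting the quantum Cartan matrix\<close>

context connected_cartan
begin

text \<open>Stated for abstract coefficients because \<open>gpa_dual\<close> fixes j, whereas
  inverting the matrix involves all columns at once. N is positive since for N = 0 the bounds would
  leave no nonzero coefficient.\<close>

lemma quantum_cartan_inv_eq:
  fixes x :: "'i \<Rightarrow> 'i \<Rightarrow> int \<Rightarrow> int" and X :: "'i \<Rightarrow> 'i \<Rightarrow> rat fls" and N :: nat
  assumes nth: "\<And>i j v. fls_nth (X i j) v = of_int (x i j v)"
    and formula: "\<And>i j v. x i j (v + d i) + x i j (v - d i)
       - (\<Sum>k | adj C i k. \<Sum>s<nat (- C $ i $ k). x k j (v - (int (nat (- C $ i $ k)) - 1 - 2 * int s)))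
     = (if i = j \<and> v = 0 then 1 else 0) + (if i = star C j \<and> v = int N then 1 else 0)"
    and bounds: "\<And>i j v. x i j v \<noteq> 0 \<Longrightarrow> d i \<le> v \<and> v \<le> int N - d i"
  shows "0 < N" "quantum_cartan_inv C d $ i $ j = (X i j - fls_X ^ N * X i (star C j)) / (1 - fls_X ^ (2 * N))"
proof -
  let ?Q = "quantum_cartan C d"
  show N: "0 < N"
  proof (rule ccontr)
    assume "\<not> ?thesis"
    then have "x k j v = 0" for k v using bounds[of k j v] d_pos[of k] by (cases "x k j v = 0") simp_all
    then show False using formula[of j j 0] by (simp split: if_splits)
  qed
  have QX: "(\<Sum>k\<in>UNIV. ?Q $ i $ k * X k j) = (if i = j then 1 else 0) + (if i = star C j then fls_X ^ N else 0)" for i j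
  proof (rule fls_eqI)
    fix v
    have qk: "fls_nth (?Q $ i $ k * X k j) v
      = (if k = i then of_int (x i j (v + d i) + x i j (v - d i)) else
         if adj C i k then - of_int (\<Sum>s<nat (- C $ i $ k). x k j (v - (int (nat (- C $ i $ k)) - 1 - 2 * int s))) else 0)" for k
    proof (cases "k = i")
      case True
      then show ?thesis by (simp add: quantum_cartan_def distrib_right fls_powi_mult_nth nth del: fls_X_power_int)
    next
      case False
      show ?thesis
      proof (cases "adj C i k")
        case True
        then have "C $ i $ k = - int (nat (- C $ i $ k))" by (simp add: adj_def)
        then have "qint (C $ i $ k) = - (\<Sum>s<nat (- C $ i $ k). fls_X powi (int (nat (- C $ i $ k)) - 1 - 2 * int s))"
          by (metis qint_neg)
        then show ?thesis using False True
          by (simp add: quantum_cartan_def sum_distrib_right fls_nth_sum fls_powi_mult_nth nth del: fls_X_power_int)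
      next
        case nadj: False
        then have "C $ i $ k = 0" using offdiag[of i k] False by (simp add: adj_def)
        then show ?thesis using False nadj by (simp add: quantum_cartan_def qint_def)
      qed
    qed
    have "(\<Sum>k\<in>UNIV. fls_nth (?Q $ i $ k * X k j) v) = fls_nth (?Q $ i $ i * X i j) v + (\<Sum>k\<in>UNIV - {i}. fls_nth (?Q $ i $ k * X k j) v)"
      by (rule sum.remove) simp_all
    also have "(\<Sum>k\<in>UNIV - {i}. fls_nth (?Q $ i $ k * X k j) v)
        = (\<Sum>k | adj C i k. - of_int (\<Sum>s<nat (- C $ i $ k). x k j (v - (int (nat (- C $ i $ k)) - 1 - 2 * int s))))"
      unfolding qk by (rule sum.mono_neutral_cong_right) (auto simp: adj_def)
    finally have "fls_nth (\<Sum>k\<in>UNIV. ?Q $ i $ k * X k j) v = of_int (x i j (v + d i) + x i j (v - d i)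
       - (\<Sum>k | adj C i k. \<Sum>s<nat (- C $ i $ k). x k j (v - (int (nat (- C $ i $ k)) - 1 - 2 * int s))))"
      unfolding qk[of i] fls_nth_sum by (simp add: sum_negf)
    also have "\<dots> = fls_nth ((if i = j then 1 else 0) + (if i = star C j then fls_X ^ N else 0)) v"
      unfolding formula using fls_power_mult_nth[of N 1 v] by simp
    finally show "fls_nth (\<Sum>k\<in>UNIV. ?Q $ i $ k * X k j) v = \<dots>" .
  qed
  define D :: "rat fls" where "D = 1 - fls_X ^ (2 * N)"
  have D: "D \<noteq> 0"
  proof
    assume "D = 0"
    then have "fls_nth D 0 = 0" by simp
    then show False using N fls_power_mult_nth[of "2 * N" 1 0] by (simp add: D_def)
  qed
  \<comment> \<open>The square of the permutation matrix P is 1, whence (1 + q^N P) (1 - q^N P) = 1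
    - q^(2N).\<close>
  define Y :: "rat fls ^ 'i ^ 'i" where "Y = (\<chi> i j. (X i j - fls_X ^ N * X i (star C j)) / D)"
  have "(?Q ** Y) $ i $ j = mat 1 $ i $ j" for i j
  proof -
    have "(?Q ** Y) $ i $ j = ((\<Sum>k\<in>UNIV. ?Q $ i $ k * X k j) - fls_X ^ N * (\<Sum>k\<in>UNIV. ?Q $ i $ k * X k (star C j))) / D"
      unfolding matrix_matrix_mult_def Y_def
      by (simp add: sum_divide_distrib sum_distrib_left sum_subtractf[symmetric] diff_divide_distrib right_diff_distrib mult_ac)
    also have "\<dots> = (if i = j then D else 0) / D"
    proof -
      have "fls_X ^ (2 * N) = fls_X ^ N * (fls_X ^ N :: rat fls)" by (simp add: mult_2 power_add)
      then show ?thesis unfolding QX star_star D_def by (simp add: algebra_simps)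
    qed
    finally show ?thesis using D by (simp add: mat_def)
  qed
  then have QY: "?Q ** Y = mat 1" by (simp add: vec_eq_iff)
  then have YQ: "Y ** ?Q = mat 1" by (simp add: matrix_left_right_inverse)
  have "\<exists>A. ?Q ** A = mat 1 \<and> A ** ?Q = mat 1" using QY YQ by blast
  then have "?Q ** matrix_inv ?Q = mat 1" unfolding matrix_inv_def by (rule someI2_ex) simp
  then have "matrix_inv ?Q = Y" using YQ by (metis matrix_mul_assoc matrix_mul_lid matrix_mul_rid)
  then show "quantum_cartan_inv C d $ i $ j = (X i j - fls_X ^ N * X i (star C j)) / (1 - fls_X ^ (2 * N))"
    by (simp add: quantum_cartan_inv_def Y_def D_def)
qed

text \<open>The coefficients satisfy \<open>c(u) - c(u - 2N) = x(u)\<close> for \<open>u \<le> N\<close>, so a lowest nonzero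
  coefficient of negative degree would not be the lowest one.\<close>

lemma quantum_cartan_inv_nth:
  fixes Y A B :: "rat fls"
  assumes Y: "Y = (A - fls_X ^ N * B) / (1 - fls_X ^ (2 * N))" and N: "0 < N"
    and A: "\<And>v. fls_nth A v \<noteq> 0 \<Longrightarrow> 0 < v" and B: "\<And>v. fls_nth B v \<noteq> 0 \<Longrightarrow> 0 < v"
  shows "u \<le> int N \<Longrightarrow> fls_nth Y u = fls_nth A u"
proof -
  have D: "(1 :: rat fls) - fls_X ^ (2 * N) \<noteq> 0"
  proof
    assume "(1 :: rat fls) - fls_X ^ (2 * N) = 0"
    then have "fls_nth ((1 :: rat fls) - fls_X ^ (2 * N) * 1) 0 = 0" by simp
    then show False using N fls_power_mult_nth[of "2 * N" 1 0] by (simp del: mult_1_right)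
  qed
  then have "Y - fls_X ^ (2 * N) * Y = A - fls_X ^ N * B"
    using Y by (simp add: nonzero_eq_divide_eq algebra_simps)
  then have "fls_nth (Y - fls_X ^ (2 * N) * Y) u = fls_nth (A - fls_X ^ N * B) u" for u by simp
  then have rec: "fls_nth Y u = fls_nth A u - fls_nth B (u - int N) + fls_nth Y (u - 2 * int N)" for u
    unfolding fls_minus_nth fls_power_mult_nth by (simp add: algebra_simps)
  have neg: "fls_nth Y u = 0" if "u < 0" for u
  proof (cases "Y = 0")
    case False
    have "0 \<le> fls_subdegree Y"
    proof (rule ccontr)
      assume s: "\<not> ?thesis"
      have "fls_nth A (fls_subdegree Y) = 0" "fls_nth B (fls_subdegree Y - int N) = 0"
        using A[of "fls_subdegree Y"] B[of "fls_subdegree Y - int N"] s by auto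
      then show False using rec[of "fls_subdegree Y"] False N by simp
    qed
    then show ?thesis using that by simp
  qed simp
  show "fls_nth Y u = fls_nth A u" if "u \<le> int N"
    using rec[of u] neg[of "u - 2 * int N"] B[of "u - int N"] that N by auto
qed

lemma dual_formula:
  assumes signs: "sign_choice C \<omega>"
  shows "dim_q (act_image (GPA_idem C \<omega> i :: ('i, 'k::field) gpa) (Ibar C d \<omega> j)) =
           fls_X powi (- d j) *
           (\<Sum>u = 0..lacing_number C * dual_coxeter_number C.
              fls_const (fls_nth (quantum_cartan_inv C d $ i $ j) (int u)) * fls_X ^ u)
       \<and> quantum_cartan_inv C d $ i $ j =
           fls_X powi d j / (1 - fls_X ^ (2 * lacing_number C * dual_coxeter_number C)) *
           (dim_q (act_image (GPA_idem C \<omega> i :: ('i, 'k) gpa) (Ibar C d \<omega> j)) -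
            fls_X ^ (lacing_number C * dual_coxeter_number C) *
              dim_q (act_image (GPA_idem C \<omega> i :: ('i, 'k) gpa) (Ibar C d \<omega> (star C j))))"
proof -
  have gpa: "gpa_dual C d \<omega>" by unfold_locales (rule signs)
  let ?N = "lacing_number C * dual_coxeter_number C"
  define Dm where "Dm i j = dim_q (act_image (GPA_idem C \<omega> i :: ('i, 'k) gpa) (Ibar C d \<omega> j))" for i j
  define X where "X i j = fls_X powi d j * Dm i j" for i j
  define x where "x i j v = gd (gpa_dual.V C d \<omega> j i :: int \<Rightarrow> ('i, 'k) wfun set) (v - d j)" for i j v
  have nth: "fls_nth (X i j) v = of_int (x i j v)" for i j v
    unfolding X_def Dm_def x_def fls_powi_mult_nth by (rule gpa_dual.dim_q_nth[OF gpa])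
  have formula: "x i j (v + d i) + x i j (v - d i)
       - (\<Sum>k | adj C i k. \<Sum>s<nat (- C $ i $ k). x k j (v - (int (nat (- C $ i $ k)) - 1 - 2 * int s)))
     = (if i = j \<and> v = 0 then 1 else 0) + (if i = star C j \<and> v = int ?N then 1 else 0)" for i j v
    using gpa_dual.vdim_formula[OF gpa, where i = i and j = j and v = v and 'k = 'k] unfolding x_def gpa_dual.a_def[OF gpa] .
  have bounds: "x i j v \<noteq> 0 \<Longrightarrow> d i \<le> v \<and> v \<le> int ?N - d i" for i j v
    unfolding x_def by (rule gpa_dual.vdim_bounds[OF gpa])
  have N: "0 < ?N" by (rule quantum_cartan_inv_eq(1)[OF nth formula bounds])
  have Y: "quantum_cartan_inv C d $ i $ j = (X i j - fls_X ^ ?N * X i (star C j)) / (1 - fls_X ^ (2 * ?N))"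
    by (rule quantum_cartan_inv_eq(2)[OF nth formula bounds])
  have pos: "fls_nth (X i j) v \<noteq> 0 \<Longrightarrow> 0 < v" for j v
    using bounds[of i j v] d_pos[of i] by (simp add: nth)
  have coeff: "u \<le> int ?N \<Longrightarrow> fls_nth (quantum_cartan_inv C d $ i $ j) u = fls_nth (X i j) u" for u
    by (rule quantum_cartan_inv_nth[OF Y N pos pos])
  \<comment> \<open>X vanishes outside the degrees from 0 to N, so cutting the sum at N recovers it
    completely, although the expansion of the inverse continues.\<close>
  have "X i j = (\<Sum>u = 0..?N. fls_const (fls_nth (quantum_cartan_inv C d $ i $ j) (int u)) * fls_X ^ u)"
  proof (rule fls_eqI)
    fix v
    have t: "fls_nth (fls_const c * fls_X ^ u) v = (if v = int u then c else 0)" for c :: rat and u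
      using fls_power_mult_nth[of u "fls_const c" v] by (simp add: mult.commute)
    have "fls_nth (\<Sum>u = 0..?N. fls_const (fls_nth (quantum_cartan_inv C d $ i $ j) (int u)) * fls_X ^ u) v
        = (\<Sum>u = 0..?N. if v = int u then fls_nth (X i j) v else 0)"
      unfolding fls_nth_sum t
    proof (rule sum.cong[OF refl])
      fix u assume "u \<in> {0..?N}"
      then have "int u \<le> int ?N" by (simp only: of_nat_le_iff atLeastAtMost_iff)
      then show "(if v = int u then fls_nth (quantum_cartan_inv C d $ i $ j) (int u) else 0)
          = (if v = int u then fls_nth (X i j) v else 0)" using coeff by simp
    qed
    also have "\<dots> = fls_nth (X i j) v"
    proof (cases "0 \<le> v \<and> v \<le> int ?N")
      case True
      then have "(\<Sum>u = 0..?N. if v = int u then fls_nth (X i j) v else 0) = (\<Sum>u = 0..?N. if u = nat v then fls_nth (X i j) v else 0)"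
        by (intro sum.cong) auto
      moreover have "nat v \<le> ?N" using True by (simp only: nat_le_iff)
      ultimately show ?thesis by simp
    next
      case False
      then have "x i j v = 0" using bounds[of i j v] d_pos[of i] by (cases "x i j v = 0") auto
      then have "fls_nth (X i j) v = 0" by (simp add: nth)
      then show ?thesis by (simp only: if_cancel sum.neutral_const)
    qed
    finally show "fls_nth (X i j) v = fls_nth (\<Sum>u = 0..?N. fls_const (fls_nth (quantum_cartan_inv C d $ i $ j) (int u)) * fls_X ^ u) v" ..
  qed
  moreover have "Dm i j = fls_X powi (- d j) * X i j"
  proof (rule fls_eqI)
    fix v show "fls_nth (Dm i j) v = fls_nth (fls_X powi (- d j) * X i j) v"
      unfolding X_def fls_powi_mult_nth by simp
  qed
  moreover have "X i (star C j) = fls_X powi d j * Dm i (star C j)" by (simp only: X_def d_star)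
  then have "quantum_cartan_inv C d $ i $ j = fls_X powi d j / (1 - fls_X ^ (2 * ?N)) * (Dm i j - fls_X ^ ?N * Dm i (star C j))"
    unfolding Y by (simp add: X_def right_diff_distrib mult_ac del: fls_X_power_int)
  ultimately show ?thesis unfolding Dm_def[symmetric] by (simp add: mult.assoc del: fls_X_power_int)
qed

end

theorem theorem1:
  fixes scale :: "complex \<Rightarrow> 'g::ab_group_add \<Rightarrow> 'g"
    and bracket :: "'g \<Rightarrow> 'g \<Rightarrow> 'g"
    and C :: "int ^ 'i::finite ^ 'i"
    and d :: "'i \<Rightarrow> int"
    and \<omega> :: "'i \<Rightarrow> 'i \<Rightarrow> int"
    and i j :: 'i
  assumes "simple_lie_algebra scale bracket"
    and "complex_lie_algebra.is_cartan_matrix scale bracket C"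
    and "symmetrizer C d"
    and "sign_choice C \<omega>"
  shows "dim_q (act_image (GPA_idem C \<omega> i :: ('i, 'k::field) gpa) (Ibar C d \<omega> j)) =
           fls_X powi (- d j) *
           (\<Sum>u = 0..lacing_number C * dual_coxeter_number C.
              fls_const (fls_nth (quantum_cartan_inv C d $ i $ j) (int u)) * fls_X ^ u)
       \<and> quantum_cartan_inv C d $ i $ j =
           fls_X powi d j / (1 - fls_X ^ (2 * lacing_number C * dual_coxeter_number C)) *
           (dim_q (act_image (GPA_idem C \<omega> i :: ('i, 'k) gpa) (Ibar C d \<omega> j)) -
            fls_X ^ (lacing_number C * dual_coxeter_number C) *
              dim_q (act_image (GPA_idem C \<omega> i :: ('i, 'k) gpa) (Ibar C d \<omega> (star C j))))"
  using assms by (intro connected_cartan.dual_formula connected_cartan_if_simple)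

end
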